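(* Let $V$ be a double-well potential on the circle satisfying the standing assumptions on $V$, let $\xi_0\in\mathbb R$, and let $\mathfrak L_h=(hD_s+\xi_0)^2+V(s)$ on $L^2(\mathbb S^1)$, $h>0$. Let $$\kappa=\sqrt{\frac{V''(0)}{2}} .$$ Then, as soon as $h$ is small enough, there are only two eigenvalues $\lambda_1(h)\le\lambda_2(h)$ (counted with multiplicity) of $\mathfrak L_h$ in the interval $I_h=(-\infty,2\kappa h)$, and they both satisfy $$\lambda_j(h)=\kappa h+o(h)\quad\text{as } h\to0,\qquad j=1,2 .$$ Define $$S_{\mathsf u}=\int_{0}^{\pi}\sqrt{V(\sigma)}\,d\sigma,\qquad S_{\mathsf d}=\int_{-\pi}^{0}\sqrt{V(\sigma)}\,d\sigma,\qquad S=\min\{S_{\mathsf u},S_{\mathsf d}\},$$ $$A_{\mathsf u}=\exp\left(-\int_{0}^{\pi/2}\frac{\partial_\sigma\sqrt V-\kappa}{\sqrt V}\,d\sigma\right),\qquad A_{\mathsf d}=\exp\left(\int_{-\pi/2}^{0}\frac{\partial_\sigma\sqrt V+\kappa}{\sqrt V}\,d\sigma\right).$$ Then, as $h\to0$, $$\lambda_2(h)-\lambda_1(h)=2|w_0(h)|+h^{3/2}\,\mathcal O\big(e^{-S/h}\big),$$ with $$w_0(h)=2h^{1/2}\sqrt{\frac{\kappa}{\pi}}\left(A_{\mathsf u}\sqrt{V\left(\tfrac{\pi}{2}\right)}\,e^{\frac{i\xi_0\pi-S_{\mathsf u}}{h}}+A_{\mathsf d}\sqrt{V\left(-\tfrac{\pi}{2}\right)}\,e^{\frac{-i\xi_0\pi-S_{\mathsf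 d}}{h}}\right).$$
   Context: The circle $\mathbb S^1$ is parametrized by $s\mapsto e^{is}$ and functions on $\mathbb S^1$ are identified with $2\pi$-periodic functions of $s\in\mathbb R$. $D_s=-i\,\frac{d}{ds}$. The operator $\mathfrak L_h=(hD_s+\xi_0)^2+V(s)$ is the self-adjoint operator on $L^2(\mathbb S^1)$ with domain $H^2(\mathbb S^1)$. Standing assumptions on $V$: $V$ is a smooth real-valued function on $\mathbb S^1$ which admits exactly two minima, at $s=0$ and $s=\pi$ (mod $2\pi$); they are non-degenerate, $V(0)=V(\pi)=0$ (so $V>0$ elsewhere), and $V(\pi-s)=V(s)$ for all $s$. *)

theory Defs
  imports "HOL-Analysis.Analysis" "HOL-Library.Landau_Symbols"
begin

section \<open>The complex Hilbert space of square-integrable functions on the circle\<close>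

text \<open>A function on the circle is a \<open>2\<pi>\<close>-periodic function on the real line.\<close>

definition periodic_2pi :: "(real \<Rightarrow> 'a) \<Rightarrow> bool" where
  "periodic_2pi u \<longleftrightarrow> (\<forall>s. u (s + 2 * pi) = u s)"

definition L2_fun :: "(real \<Rightarrow> complex) \<Rightarrow> bool" where
  "L2_fun u \<longleftrightarrow> u \<in> borel_measurable borel \<and> periodic_2pi u \<and>
     set_integrable lborel {0..2 * pi} (\<lambda>s. (cmod (u s))\<^sup>2)"

definition L2_eq :: "(real \<Rightarrow> complex) \<Rightarrow> (real \<Rightarrow> complex) \<Rightarrow> bool" where
  "L2_eq u v \<longleftrightarrow> L2_fun u \<and> L2_fun v \<and> (AE s in lborel. u s = v s)"

lemma L2_fun_zero: "L2_fun (\<lambda>_. 0)"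
  by (simp add: L2_fun_def periodic_2pi_def set_integrable_def)

lemma L2_fun_scale:
  assumes "L2_fun u"
  shows "L2_fun (\<lambda>s. c * u s)"
proof -
  have "set_integrable lborel {0..2 * pi} (\<lambda>s. (cmod c)\<^sup>2 * (cmod (u s))\<^sup>2)"
    using assms unfolding L2_fun_def by (intro set_integrable_mult_right) auto
  then show ?thesis
    using assms by (auto simp: L2_fun_def periodic_2pi_def norm_mult power_mult_distrib)
qed

lemma L2_fun_add:
  assumes "L2_fun u" "L2_fun v"
  shows "L2_fun (\<lambda>s. u s + v s)"
proof -
  have m [measurable]: "u \<in> borel_measurable borel" "v \<in> borel_measurable borel"
    using assms by (auto simp: L2_fun_def)
  have b: "(cmod (x + y))\<^sup>2 \<le> 2 * (cmod x)\<^sup>2 + 2 * (cmod y)\<^sup>2" for x y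
  proof -
    have "(cmod (x + y))\<^sup>2 \<le> (cmod x + cmod y)\<^sup>2"
      by (intro power_mono norm_triangle_ineq) auto
    also have "\<dots> \<le> 2 * (cmod x)\<^sup>2 + 2 * (cmod y)\<^sup>2"
      using sum_squares_bound[of "cmod x" "cmod y"] by (simp add: power2_sum)
    finally show ?thesis .
  qed
  have "set_integrable lborel {0..2 * pi} (\<lambda>s. 2 * (cmod (u s))\<^sup>2 + 2 * (cmod (v s))\<^sup>2)"
    using assms unfolding L2_fun_def
    by (intro set_integral_add set_integrable_mult_right) auto
  then have "set_integrable lborel {0..2 * pi} (\<lambda>s. (cmod (u s + v s))\<^sup>2)"
  proof (rule set_integrable_bound)
    show "set_borel_measurable lborel {0..2 * pi} (\<lambda>s. (cmod (u s + v s))\<^sup>2)"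
      unfolding set_borel_measurable_def by measurable
    show "AE s in lborel. s \<in> {0..2 * pi} \<longrightarrow>
        norm ((cmod (u s + v s))\<^sup>2) \<le> norm (2 * (cmod (u s))\<^sup>2 + 2 * (cmod (v s))\<^sup>2)"
      using b by (intro AE_I2) auto
  qed
  then show ?thesis
    using assms by (auto simp: L2_fun_def periodic_2pi_def)
qed

quotient_type l2_circle = "real \<Rightarrow> complex" / partial: L2_eq
proof (rule part_equivpI)
  show "\<exists>u. L2_eq u u"
    using L2_fun_zero by (auto simp: L2_eq_def intro!: exI[of _ "\<lambda>_. 0"])
  show "symp L2_eq"
    by (rule sympI) (auto simp: L2_eq_def eq_commute)
  show "transp L2_eq"
  proof (rule transpI)
    fix u v w
    assume a: "L2_eq u v" "L2_eq v w"
    then have "AE s in lborel. u s = v s" "AE s in lborel. v s = w s"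
      by (auto simp: L2_eq_def)
    then have "AE s in lborel. u s = w s"
      by eventually_elim simp
    with a show "L2_eq u w"
      by (simp add: L2_eq_def)
  qed
qed

lift_definition l2_scale :: "complex \<Rightarrow> l2_circle \<Rightarrow> l2_circle" is "\<lambda>c u s. c * u s"
  by (auto simp: L2_eq_def L2_fun_scale elim: eventually_mono)

instantiation l2_circle :: ab_group_add
begin

lift_definition zero_l2_circle :: l2_circle is "\<lambda>_. 0"
  by (simp add: L2_eq_def L2_fun_zero)

lift_definition plus_l2_circle :: "l2_circle \<Rightarrow> l2_circle \<Rightarrow> l2_circle" is "\<lambda>u v s. u s + v s"
proof -
  fix u u' v v' assume a: "L2_eq u u'" "L2_eq v v'"
  then have "AE s in lborel. u s = u' s" "AE s in lborel. v s = v' s"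
    by (auto simp: L2_eq_def)
  then have "AE s in lborel. u s + v s = u' s + v' s"
    by eventually_elim simp
  with a show "L2_eq (\<lambda>s. u s + v s) (\<lambda>s. u' s + v' s)"
    by (simp add: L2_eq_def L2_fun_add)
qed

definition uminus_l2_circle :: "l2_circle \<Rightarrow> l2_circle" where
  "uminus_l2_circle u = l2_scale (- 1) u"

definition minus_l2_circle :: "l2_circle \<Rightarrow> l2_circle \<Rightarrow> l2_circle" where
  "minus_l2_circle u v = u + - v"

instance
proof
  fix a b c :: l2_circle
  show "a + b + c = a + (b + c)"
    by transfer (auto simp: L2_eq_def algebra_simps intro!: L2_fun_add)
  show "a + b = b + a"
    by transfer (auto simp: L2_eq_def algebra_simps intro!: L2_fun_add)
  show "0 + a = a"
    by transfer (auto simp: L2_eq_def)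
  show "- a + a = 0"
    unfolding uminus_l2_circle_def by transfer (auto simp: L2_eq_def L2_fun_zero)
  show "a - b = a + - b"
    by (simp add: minus_l2_circle_def)
qed

end

global_interpretation l2_circle: vector_space l2_scale
proof
  fix a b :: complex and x y :: l2_circle
  show "l2_scale a (x + y) = l2_scale a x + l2_scale a y"
    by transfer (auto simp: L2_eq_def algebra_simps intro!: L2_fun_add L2_fun_scale)
  show "l2_scale (a + b) x = l2_scale a x + l2_scale b x"
    by transfer (auto simp: L2_eq_def algebra_simps intro!: L2_fun_add L2_fun_scale)
  show "l2_scale a (l2_scale b x) = l2_scale (a * b) x"
    by transfer (auto simp: L2_eq_def algebra_simps intro!: L2_fun_scale)
  show "l2_scale 1 x = x"
    by transfer (auto simp: L2_eq_def)
qed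

section \<open>Sobolev spaces and the magnetic Schroedinger operator\<close>

definition smooth :: "(real \<Rightarrow> real) \<Rightarrow> bool" where
  "smooth f \<longleftrightarrow> (\<forall>n s. (deriv ^^ n) f differentiable at s)"

text \<open>Neither the pairing with a smooth periodic function nor the product with a continuous
  periodic function depends on the representative picked by \<^const>\<open>rep_l2_circle\<close>.\<close>

definition l2_pairing :: "l2_circle \<Rightarrow> (real \<Rightarrow> real) \<Rightarrow> complex" where
  "l2_pairing u \<phi> = (LINT s:{0..2 * pi}|lborel. rep_l2_circle u s * of_real (\<phi> s))"

definition l2_mult :: "(real \<Rightarrow> real) \<Rightarrow> l2_circle \<Rightarrow> l2_circle" where
  "l2_mult V u = abs_l2_circle (\<lambda>s. of_real (V s) * rep_l2_circle u s)"

definition is_weak_deriv :: "l2_circle \<Rightarrow> l2_circle \<Rightarrow> bool" where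
  "is_weak_deriv u v \<longleftrightarrow>
     (\<forall>\<phi>. smooth \<phi> \<and> periodic_2pi \<phi> \<longrightarrow> l2_pairing u (deriv \<phi>) = - l2_pairing v \<phi>)"

text \<open>Weak derivatives are unique, since the smooth periodic functions are dense.\<close>

definition weak_deriv :: "l2_circle \<Rightarrow> l2_circle" where
  "weak_deriv u = (THE v. is_weak_deriv u v)"

definition H1_circle :: "l2_circle set" where
  "H1_circle = {u. \<exists>v. is_weak_deriv u v}"

definition H2_circle :: "l2_circle set" where
  "H2_circle = {u \<in> H1_circle. weak_deriv u \<in> H1_circle}"

definition D_s :: "l2_circle \<Rightarrow> l2_circle" where
  "D_s u = l2_scale (- \<i>) (weak_deriv u)"

definition magnetic_momentum :: "real \<Rightarrow> real \<Rightarrow> l2_circle \<Rightarrow> l2_circle" where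
  "magnetic_momentum \<xi>\<^sub>0 h u = l2_scale (of_real h) (D_s u) + l2_scale (of_real \<xi>\<^sub>0) u"

text \<open>The operator \<open>(h D\<^sub>s + \<xi>\<^sub>0)\<^sup>2 + V\<close>, meaningful on its domain \<^const>\<open>H2_circle\<close> only.\<close>

definition magnetic_schroedinger ::
    "(real \<Rightarrow> real) \<Rightarrow> real \<Rightarrow> real \<Rightarrow> l2_circle \<Rightarrow> l2_circle" where
  "magnetic_schroedinger V \<xi>\<^sub>0 h u =
     magnetic_momentum \<xi>\<^sub>0 h (magnetic_momentum \<xi>\<^sub>0 h u) + l2_mult V u"

definition eigenspace :: "(real \<Rightarrow> real) \<Rightarrow> real \<Rightarrow> real \<Rightarrow> real \<Rightarrow> l2_circle set" where
  "eigenspace V \<xi>\<^sub>0 h lam =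
     {u \<in> H2_circle. magnetic_schroedinger V \<xi>\<^sub>0 h u = l2_scale (of_real lam) u}"

definition eigenvalue :: "(real \<Rightarrow> real) \<Rightarrow> real \<Rightarrow> real \<Rightarrow> real \<Rightarrow> bool" where
  "eigenvalue V \<xi>\<^sub>0 h lam \<longleftrightarrow> (\<exists>u \<in> eigenspace V \<xi>\<^sub>0 h lam. u \<noteq> 0)"

definition multiplicity_ev :: "(real \<Rightarrow> real) \<Rightarrow> real \<Rightarrow> real \<Rightarrow> real \<Rightarrow> nat" where
  "multiplicity_ev V \<xi>\<^sub>0 h lam = l2_circle.dim (eigenspace V \<xi>\<^sub>0 h lam)"

text \<open>\<open>xs\<close> lists the eigenvalues lying in \<open>I\<close> in non-decreasing order, each repeated according to
  its multiplicity. The dimension of an infinite-dimensional space is \<open>0\<close> by convention, so the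
  last clause also says that each of these eigenvalues has finite multiplicity.\<close>

definition eigenvalue_list ::
    "(real \<Rightarrow> real) \<Rightarrow> real \<Rightarrow> real \<Rightarrow> real set \<Rightarrow> real list \<Rightarrow> bool" where
  "eigenvalue_list V \<xi>\<^sub>0 h I xs \<longleftrightarrow>
     sorted xs \<and> set xs = {lam \<in> I. eigenvalue V \<xi>\<^sub>0 h lam} \<and>
     (\<forall>lam \<in> set xs. count_list xs lam = multiplicity_ev V \<xi>\<^sub>0 h lam)"

section \<open>The double-well potential and the tunnelling constants\<close>

text \<open>The points of the circle \<open>s = 0\<close> and \<open>s = \<pi>\<close> correspond to the integer multiples
  of \<open>\<pi>\<close>.\<close>

definition double_well :: "(real \<Rightarrow> real) \<Rightarrow> bool" where
  "double_well V \<longleftrightarrow>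
     smooth V \<and> periodic_2pi V \<and>
     {s. \<forall>t. V s \<le> V t} = {of_int k * pi | k. True} \<and>
     deriv (deriv V) 0 \<noteq> 0 \<and> deriv (deriv V) pi \<noteq> 0 \<and>
     V 0 = 0 \<and> V pi = 0 \<and>
     (\<forall>s. V (pi - s) = V s)"

definition kappa :: "(real \<Rightarrow> real) \<Rightarrow> real" where
  "kappa V = sqrt (deriv (deriv V) 0 / 2)"

definition S_u :: "(real \<Rightarrow> real) \<Rightarrow> real" where
  "S_u V = integral {0..pi} (\<lambda>\<sigma>. sqrt (V \<sigma>))"

definition S_d :: "(real \<Rightarrow> real) \<Rightarrow> real" where
  "S_d V = integral {- pi..0} (\<lambda>\<sigma>. sqrt (V \<sigma>))"

definition S_min :: "(real \<Rightarrow> real) \<Rightarrow> real" where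
  "S_min V = min (S_u V) (S_d V)"

text \<open>Both integrands below extend continuously to the well \<open>\<sigma> = 0\<close>; the value that the
  formula takes at that single point is irrelevant.\<close>

definition A_u :: "(real \<Rightarrow> real) \<Rightarrow> real" where
  "A_u V = exp (- integral {0..pi / 2}
     (\<lambda>\<sigma>. (deriv (\<lambda>t. sqrt (V t)) \<sigma> - kappa V) / sqrt (V \<sigma>)))"

definition A_d :: "(real \<Rightarrow> real) \<Rightarrow> real" where
  "A_d V = exp (integral {- (pi / 2)..0}
     (\<lambda>\<sigma>. (deriv (\<lambda>t. sqrt (V t)) \<sigma> + kappa V) / sqrt (V \<sigma>)))"

definition w_0 :: "(real \<Rightarrow> real) \<Rightarrow> real \<Rightarrow> real \<Rightarrow> complex" where
  "w_0 V \<xi>\<^sub>0 h =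
     of_real (2 * h powr (1 / 2) * sqrt (kappa V / pi)) *
     (of_real (A_u V * sqrt (V (pi / 2))) *
        exp ((\<i> * of_real (\<xi>\<^sub>0 * pi) - of_real (S_u V)) / of_real h) +
      of_real (A_d V * sqrt (V (- (pi / 2)))) *
        exp ((- \<i> * of_real (\<xi>\<^sub>0 * pi) - of_real (S_d V)) / of_real h))"

end

theory Submission
 imports Defs "HOL-Probability.Distributions"
begin

text \<open>Write the spectral parameter as \<open>\<lambda> = \<kappa> h + h\<^sup>2 e\<close> and put \<open>z = cis (2 \<pi> \<xi>\<^sub>0 / h)\<close>. Multiplication by
\<open>exp (\<i> \<xi>\<^sub>0 s / h)\<close> removes the magnetic term: the eigenfunctions become the solutions of
\<open>h\<^sup>2 x'' = (V - \<lambda>) x\<close> on the line with \<open>x (s + 2 \<pi>) = z x s\<close> (\<open>eigenspace_eq_gauge_floquet\<close>), and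
the theorem becomes a statement about one ordinary differential equation.

The reflections about \<open>\<pi> / 2\<close> and \<open>- \<pi> / 2\<close> cut the circle into four half-wells, of which only the
right one \<open>[0, \<pi> / 2]\<close> and the left one \<open>[- \<pi> / 2, 0]\<close> differ. For each of them, the logarithmic
derivatives at the well of the solutions that are odd and even about the midpoint are \<open>- d\<close> and
\<open>\<delta> - d\<close>. Matching at both wells gives an exact secular equation: with
\<open>R = d\<^sub>r + d\<^sub>l - (\<delta>\<^sub>r + \<delta>\<^sub>l) / 2\<close>, a Floquet solution exists if \<open>2 R = \<plusminus> cmod (\<delta>\<^sub>r + \<delta>\<^sub>l z)\<close>
(\<open>floquet_root\<close>), and two independent ones if both sides vanish (\<open>floquet_double_root\<close>). Here \<open>\<delta>\<close> is
the tunnelling amplitude, exponentially small and nearly constant in \<open>e\<close>, while \<open>d\<^sub>r + d\<^sub>l\<close> is nearly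
affine in \<open>e\<close> with slope \<open>- N\<close>, where \<open>N\<close> is the mass of the approximate ground state on both
half-wells. So there are two roots, at distance \<open>cmod (\<delta>\<^sub>r + \<delta>\<^sub>l z) / N\<close> up to a relative error of the order of
\<open>h\<close> measured against \<open>\<delta>\<^sub>r + \<delta>\<^sub>l\<close> (\<open>secular_roots\<close>); multiplied by \<open>h\<^sup>2\<close> this is \<open>2 cmod w\<^sub>0\<close> to leading order.

The asymptotics come from the factorisation \<open>V = f\<^sup>2\<close>, \<open>f' = \<kappa> - 2 f g\<close> with \<open>f\<close>, \<open>g\<close> regular through
the well (\<open>wkb_data\<close>). The function \<open>\<Psi> = exp (\<integral>g - \<integral>f / h)\<close> solves the equation up to the bounded
potential \<open>h\<^sup>2 (r - e)\<close>, where \<open>r = - (g' + g\<^sup>2)\<close>. Relative to \<open>\<Psi>\<close> the equation is a Volterra equation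
whose kernel gains a factor \<open>h\<close> as soon as \<open>e\<close> is within \<open>O (sqrt h)\<close> of \<open>r 0\<close> (\<open>volterra_bound\<close>).
This yields \<open>\<delta> = 4 f(\<pi>/2) \<Psi>(\<pi>/2)\<^sup>2 / h\<close> with relative error \<open>O h\<close> and \<open>\<Psi>(\<pi>/2)\<^sup>2 = A exp (- S / h)\<close>
(\<open>resp_estimates\<close>, \<open>double_well_pair\<close>). In \<open>N\<close> the corrections of relative order \<open>sqrt h\<close> are
proportional to \<open>g 0\<close>, which has opposite signs on the two sides of the well, so they cancel and
\<open>N = sqrt (\<pi> h / \<kappa>) (1 + O h)\<close> (\<open>N_sum\<close>).

There are no further eigenvalues below \<open>2 \<kappa> h\<close>: among three Floquet solutions a nontrivial combination vanishes at
both wells, and by a Hardy inequality such a function has energy at least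
\<open>2 \<kappa> h\<close> (\<open>hardy_half_well\<close>), because cutting at the bottom of a harmonic well raises the ground energy
to about \<open>3 \<kappa> h\<close>. This forces the three solutions to be dependent (\<open>three_floquet_dependent\<close>).\<close>

section \<open>Linear second-order equations on the line\<close>

lemmas hk_integral_combine = Henstock_Kurzweil_Integration.integral_combine
 and hk_integral_reflect = Henstock_Kurzweil_Integration.integral_reflect_real
 and hk_integral_diff = Henstock_Kurzweil_Integration.integral_diff
 and hk_integral_add = Henstock_Kurzweil_Integration.integral_add

text \<open>The derivative \<open>u'\<close> is carried along as a second function, so that initial data and
one-sided derivatives at end points need no separate treatment.\<close>

definition solves_on :: "real set \<Rightarrow> (real \<Rightarrow> real) \<Rightarrow> (real \<Rightarrow> 'a::real_normed_vector) \<Rightarrow> (real \<Rightarrow> 'a) \<Rightarrow> bool"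
 where "solves_on S q u u' \<longleftrightarrow> (\<forall>s\<in>S. (u has_vector_derivative u' s) (at s within S) \<and>
      (u' has_vector_derivative q s *\<^sub>R u s) (at s within S))"

lemma solves_onD:
 assumes "solves_on S q u u'" "s \<in> S"
 shows "(u has_vector_derivative u' s) (at s within S)"
  and "(u' has_vector_derivative q s *\<^sub>R u s) (at s within S)"
 using assms by (auto simp: solves_on_def)

lemma solves_on_subset: "solves_on S q u u' ==> T \<subseteq> S ==> solves_on T q u u'"
 unfolding solves_on_def by (meson has_vector_derivative_within_subset subsetD)

lemma solves_on_lincomb:
 assumes "solves_on S q u u'" "solves_on S q v v'"
 shows "solves_on S q (\<lambda>s. u s + v s) (\<lambda>s. u' s + v' s)"
  and "solves_on S q (\<lambda>s. u s - v s) (\<lambda>s. u' s - v' s)"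
 using assms unfolding solves_on_def
 by (auto intro!: derivative_eq_intros simp: scaleR_add_right scaleR_diff_right)

lemma solves_on_bounded_linear:
 assumes "bounded_linear L" "solves_on S q u u'"
 shows "solves_on S q (\<lambda>s. L (u s)) (\<lambda>s. L (u' s))"
 using assms bounded_linear.has_vector_derivative[OF assms(1)] linear_simps(5)[OF assms(1)]
 unfolding solves_on_def by metis

lemma solves_on_affine:
 assumes u: "solves_on UNIV q u u'" and c: "c = 1 \<or> c = - 1"
 shows "solves_on UNIV (\<lambda>s. q (a + c * s)) (\<lambda>s. u (a + c * s)) (\<lambda>s. c *\<^sub>R u' (a + c * s))"
proof -
 have d: "((\<lambda>s. a + c * s) has_real_derivative c) (at s)" for s
  by (auto intro!: derivative_eq_intros)
 have 1: "((\<lambda>s. u (a + c * s)) has_vector_derivative c *\<^sub>R u' (a + c * s)) (at s)" for s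
  using vector_diff_chain_at[of "\<lambda>s. a + c * s" c s u "u' (a + c * s)"] u d
  by (auto simp: solves_on_def o_def has_real_derivative_iff_has_vector_derivative)
 have 2: "((\<lambda>s. u' (a + c * s)) has_vector_derivative c *\<^sub>R (q (a + c * s) *\<^sub>R u (a + c * s))) (at s)" for s
  using vector_diff_chain_at[of "\<lambda>s. a + c * s" c s u' "q (a + c * s) *\<^sub>R u (a + c * s)"] u d
  by (auto simp: solves_on_def o_def has_real_derivative_iff_has_vector_derivative)
 have 3: "((\<lambda>s. c *\<^sub>R u' (a + c * s)) has_vector_derivative
   c *\<^sub>R (c *\<^sub>R (q (a + c * s) *\<^sub>R u (a + c * s)))) (at s)" for s
  by (rule bounded_linear.has_vector_derivative[OF bounded_linear_scaleR_right 2])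
 show ?thesis
  using 1 3 c unfolding solves_on_def by auto
qed

text \<open>Gronwall's argument: \<open>E = \<bar>u\<bar>\<^sup>2 + \<bar>u'\<bar>\<^sup>2\<close> satisfies \<open>\<bar>E'\<bar> \<le> (1 + Q) E\<close>, so \<open>E\<close> times an
exponential is monotone on either side of \<open>c\<close>.\<close>

lemma solves_on_unique:
 fixes u u' :: "real \<Rightarrow> 'a::real_inner"
 assumes sol: "solves_on {a..b} q u u'" and q: "\<And>s. s \<in> {a..b} ==> \<bar>q s\<bar> \<le> Q"
  and c: "c \<in> {a..b}" "u c = 0" "u' c = 0" and s: "s \<in> {a..b}"
 shows "u s = 0 \<and> u' s = 0"
proof -
 define E where "E = (\<lambda>t. inner (u t) (u t) + inner (u' t) (u' t))"
 have dE: "(E has_real_derivative 2 * inner (u t) (u' t) * (1 + q t)) (at t within {a..b})"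
  if "t \<in> {a..b}" for t
  using solves_onD[OF sol that] unfolding E_def has_real_derivative_iff_has_vector_derivative
  by (auto intro!: derivative_eq_intros simp: has_vector_derivative_def algebra_simps inner_commute)
 have bound: "\<bar>2 * inner (u t) (u' t) * (1 + q t)\<bar> \<le> (1 + Q) * E t" if "t \<in> {a..b}" for t
 proof -
  have "\<bar>inner (u t) (u' t)\<bar> \<le> norm (u t) * norm (u' t)" by (rule Cauchy_Schwarz_ineq2)
  moreover have "2 * (norm (u t) * norm (u' t)) \<le> E t"
   using sum_squares_bound[of "norm (u t)" "norm (u' t)"]
   by (simp add: E_def power2_norm_eq_inner mult.assoc)
  ultimately have 1: "\<bar>2 * inner (u t) (u' t)\<bar> \<le> E t" by (simp add: abs_mult)
  have "\<bar>1 + q t\<bar> \<le> 1 + Q" using q[OF that] by auto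
  with 1 have "\<bar>2 * inner (u t) (u' t)\<bar> * \<bar>1 + q t\<bar> \<le> E t * (1 + Q)"
   by (intro mult_mono) auto
  then show ?thesis by (simp add: abs_mult mult.commute)
 qed
 have cE: "continuous_on {a..b} E"
  using dE by (intro DERIV_continuous_on) auto
 have E0: "E c = 0" using c by (simp add: E_def)
 have dEo: "(E has_real_derivative 2 * inner (u t) (u' t) * (1 + q t)) (at t)" if "a < t" "t < b" for t
  using dE[of t] that at_within_Icc_at[of a t b] by auto
 have "E s \<le> 0"
 proof (cases "c \<le> s")
  case True
  have "(E s * exp (- (1 + Q) * s)) \<le> (E c * exp (- (1 + Q) * c))"
  proof (rule DERIV_nonpos_imp_decreasing_open[OF True])
   fix t assume t: "c < t" "t < s"
   then have t': "a < t" "t < b" using c s by auto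
   have "((\<lambda>t. E t * exp (- (1 + Q) * t)) has_real_derivative
     (2 * inner (u t) (u' t) * (1 + q t) - (1 + Q) * E t) * exp (- (1 + Q) * t)) (at t)"
    using dEo[OF t'] by (auto intro!: derivative_eq_intros simp: algebra_simps)
   moreover have "(2 * inner (u t) (u' t) * (1 + q t) - (1 + Q) * E t) * exp (- (1 + Q) * t) \<le> 0"
    using bound[of t] t' by (intro mult_nonpos_nonneg) auto
   ultimately show "\<exists>y. ((\<lambda>t. E t * exp (- (1 + Q) * t)) has_real_derivative y) (at t) \<and> y \<le> 0"
    by blast
  next
   show "continuous_on {c..s} (\<lambda>t. E t * exp (- (1 + Q) * t))"
    using c s by (intro continuous_intros continuous_on_subset[OF cE]) auto
  qed
  then show ?thesis using E0 by (simp add: mult_le_0_iff)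
 next
  case False
  then have cs: "s \<le> c" by simp
  have "(E s * exp ((1 + Q) * s)) \<le> (E c * exp ((1 + Q) * c))"
  proof (rule DERIV_nonneg_imp_increasing_open[OF cs])
   fix t assume t: "s < t" "t < c"
   then have t': "a < t" "t < b" using c s by auto
   have "((\<lambda>t. E t * exp ((1 + Q) * t)) has_real_derivative
     (2 * inner (u t) (u' t) * (1 + q t) + (1 + Q) * E t) * exp ((1 + Q) * t)) (at t)"
    using dEo[OF t'] by (auto intro!: derivative_eq_intros simp: algebra_simps)
   moreover have "(2 * inner (u t) (u' t) * (1 + q t) + (1 + Q) * E t) * exp ((1 + Q) * t) \<ge> 0"
    using bound[of t] t' by (intro mult_nonneg_nonneg) auto
   ultimately show "\<exists>y. ((\<lambda>t. E t * exp ((1 + Q) * t)) has_real_derivative y) (at t) \<and> 0 \<le> y"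
    by blast
  next
   show "continuous_on {s..c} (\<lambda>t. E t * exp ((1 + Q) * t))"
    using c s by (intro continuous_intros continuous_on_subset[OF cE]) auto
  qed
  then show ?thesis using E0 by (simp add: mult_le_0_iff)
 qed
 then have "inner (u s) (u s) + inner (u' s) (u' s) \<le> 0" by (simp add: E_def)
 moreover have "inner (u s) (u s) \<ge> 0" "inner (u' s) (u' s) \<ge> 0" by auto
 ultimately have "inner (u s) (u s) = 0" "inner (u' s) (u' s) = 0" by linarith+
 then show ?thesis by simp
qed

lemma solves_UNIV_unique:
 fixes u u' :: "real \<Rightarrow> 'a::real_inner"
 assumes "solves_on UNIV q u u'" "solves_on UNIV q v v'" and q: "\<And>s. \<bar>q s\<bar> \<le> Q"
  and "u c = v c" "u' c = v' c"
 shows "u = v" "u' = v'"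
proof -
 have "u s - v s = 0 \<and> u' s - v' s = 0" for s
 proof (rule solves_on_unique[where a = "min c s" and b = "max c s" and c = c and Q = Q])
  show "solves_on {min c s..max c s} q (\<lambda>s. u s - v s) (\<lambda>s. u' s - v' s)"
   by (rule solves_on_subset[OF solves_on_lincomb(2)[OF assms(1,2)]]) auto
 qed (use assms in auto)
 then show "u = v" "u' = v'" by (auto simp: fun_eq_iff)
qed

lemma antiderivative_exists:
 fixes f :: "real \<Rightarrow> 'a::euclidean_space"
 assumes "continuous_on UNIV f"
 shows "\<exists>F. F c = 0 \<and> (\<forall>x. (F has_vector_derivative f x) (at x))"
proof -
 have "\<exists>F. \<forall>x::real. -\<infinity> < ereal x --> ereal x < \<infinity> --> (F has_vector_derivative f x) (at x)"
  using assms by (intro einterval_antiderivative) (auto simp: continuous_on_eq_continuous_at)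
 then obtain F where "\<And>x. (F has_vector_derivative f x) (at x)" by auto
 then show ?thesis
  by (intro exI[of _ "\<lambda>x. F x - F c"]) (auto intro!: derivative_eq_intros)
qed

text \<open>Integration gains the factor \<open>1 / K\<close> in the norm with weight \<open>exp (- K \<bar>s\<bar>)\<close>; this is what
makes the Picard map below a contraction on the whole line at once.\<close>

lemma antiderivative_exp_bound:
 fixes F f :: "real \<Rightarrow> 'a::euclidean_space"
 assumes F: "F 0 = 0" "\<And>x. (F has_vector_derivative f x) (at x)" and K: "K > 0"
  and f: "\<And>t. norm (f t) \<le> M * exp (K * \<bar>t\<bar>)"
 shows "norm (F s) \<le> M / K * exp (K * \<bar>s\<bar>)"
proof -
 have M: "M \<ge> 0" using order_trans[OF norm_ge_zero f[of 0]] by simp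
 have gen: "norm (G s) \<le> M / K * exp (K * s)"
  if G: "G 0 = 0" "\<And>x. (G has_vector_derivative g x) (at x)"
   and g: "\<And>t. norm (g t) \<le> M * exp (K * \<bar>t\<bar>)" and s: "0 < s" for G g :: "real \<Rightarrow> 'a" and s
 proof -
  have "norm (G s - G 0) \<le> M / K * exp (K * s) - M / K * exp (K * 0)"
  proof (rule differentiable_bound_general[OF s])
   show "continuous_on {0..s} G"
    using G(2) by (meson continuous_at_imp_continuous_on has_vector_derivative_continuous)
   show "continuous_on {0..s} (\<lambda>x. M / K * exp (K * x))" by (intro continuous_intros)
   fix x assume x: "0 < x" "x < s"
   show "(G has_vector_derivative g x) (at x)" by (rule G)
   show "((\<lambda>x. M / K * exp (K * x)) has_vector_derivative M * exp (K * x)) (at x)"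
    unfolding has_real_derivative_iff_has_vector_derivative[symmetric]
    using K by (auto intro!: derivative_eq_intros)
   show "norm (g x) \<le> M * exp (K * x)" using g[of x] x by simp
  qed
  also have "... \<le> M / K * exp (K * s)" using M K by simp
  finally show ?thesis using G by simp
 qed
 consider "s = 0" | "s > 0" | "s < 0" by linarith
 then show ?thesis
 proof cases
  case 1 then show ?thesis using F M K by simp
 next
  case 2 then show ?thesis using gen[OF F f 2] by simp
 next
  case 3
  have d: "((\<lambda>x. F (- x)) has_vector_derivative - f (- x)) (at x)" for x
  proof -
   have "(F \<circ> uminus has_vector_derivative (- 1) *\<^sub>R f (- x)) (at x)"
    by (rule vector_diff_chain_at) (auto intro!: derivative_eq_intros F)
   then show ?thesis by (simp add: o_def)
  qed
  have f': "norm (- f (- t)) \<le> M * exp (K * \<bar>t\<bar>)" for t using f[of "- t"] by simp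
  have "F (- 0) = 0" using F by simp
  from gen[of "\<lambda>x. F (- x)" "\<lambda>x. - f (- x)", OF this d f', of "- s"] 3 show ?thesis by simp
 qed
qed

text \<open>Banach's fixed point theorem on the bounded continuous functions \<open>g\<close>, where the pair
\<open>(u, u')\<close> is represented as \<open>exp (K \<bar>s\<bar>) g\<close> with \<open>K = 2 (1 + Q)\<close>.\<close>

lemma solves_UNIV_exists0:
 fixes a0 b0 :: "'a::euclidean_space"
 assumes q: "continuous_on UNIV q" and Q: "\<And>s. \<bar>q s\<bar> \<le> Q"
 shows "\<exists>u u'. solves_on UNIV q u u' \<and> u 0 = a0 \<and> u' 0 = b0"
proof -
 have Q0: "Q \<ge> 0" using Q[of 0] by linarith
 \<comment> \<open>twice the Lipschitz constant of the right-hand side, so that the contraction factor is \<open>1 / 2\<close>\<close>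
 define K where "K = 2 * (1 + Q)"
 have K: "K > 0" using Q0 by (simp add: K_def)
 define L where "L = (\<lambda>t (w::'a \<times> 'a). (snd w, q t *\<^sub>R fst w))"
 have L_norm: "norm (L t w) \<le> (1 + Q) * norm w" for t w
 proof -
  have "norm (L t w) \<le> norm (snd w) + norm (q t *\<^sub>R fst w)"
   unfolding L_def using norm_Pair_le by blast
  also have "... \<le> norm w + Q * norm w"
   using Q[of t] norm_fst_le[of "fst w" "snd w"] norm_snd_le[of "snd w" "fst w"]
   by (intro add_mono) (auto intro!: mult_mono)
  finally show ?thesis by (simp add: algebra_simps)
 qed
 have L_diff: "L t w - L t v = L t (w - v)" for t w v
  by (simp add: L_def scaleR_diff_right)
 define rhs where "rhs = (\<lambda>(g :: real \<Rightarrow>\<^sub>C ('a \<times> 'a)) t. L t (exp (K * \<bar>t\<bar>) *\<^sub>R apply_bcontfun g t))"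
 have rhs_cont: "continuous_on UNIV (rhs g)" for g
  unfolding rhs_def L_def
  by (intro continuous_intros q continuous_on_apply_bcontfun continuous_on_fst continuous_on_snd)
 define A where "A = (\<lambda>g. SOME F. F 0 = 0 \<and> (\<forall>x. (F has_vector_derivative rhs g x) (at x)))"
 have A: "A g 0 = 0" "(A g has_vector_derivative rhs g x) (at x)" for g x
  using someI_ex[OF antiderivative_exists[OF rhs_cont[of g], of 0]] by (auto simp: A_def)
 have A_cont: "continuous_on UNIV (A g)" for g
  using A(2) by (meson continuous_at_imp_continuous_on has_vector_derivative_continuous)
 have rhs_le: "norm (rhs g t - rhs f t) \<le> (1 + Q) * dist g f * exp (K * \<bar>t\<bar>)" for g f t
 proof -
  have "rhs g t - rhs f t = L t (exp (K * \<bar>t\<bar>) *\<^sub>R (g t - f t))"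
   by (simp add: rhs_def L_diff scaleR_diff_right)
  also have "norm ... \<le> (1 + Q) * (exp (K * \<bar>t\<bar>) * dist g f)"
   using L_norm[of t "exp (K * \<bar>t\<bar>) *\<^sub>R (g t - f t)"] dist_bounded[of g t f] Q0
   by (elim order_trans) (auto intro!: mult_left_mono simp: dist_norm)
  finally show ?thesis by (simp add: mult_ac)
 qed
 have A_le: "norm (A g s - A f s) \<le> 1 / 2 * dist g f * exp (K * \<bar>s\<bar>)" for g f s
 proof -
  have "norm (A g s - A f s) \<le> (1 + Q) * dist g f / K * exp (K * \<bar>s\<bar>)"
   by (rule antiderivative_exp_bound[OF _ _ K rhs_le[of g _ f]])
     (auto intro!: derivative_eq_intros A simp: A)
  also have "(1 + Q) * dist g f / K = (1 + Q) / K * dist g f" by simp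
  also have "(1 + Q) / K = 1 / 2" using K by (simp add: K_def field_simps)
  finally show ?thesis .
 qed
 define w0 where "w0 = (a0, b0)"
 define T where "T = (\<lambda>g. \<lambda>s. exp (- (K * \<bar>s\<bar>)) *\<^sub>R (w0 + A g s))"
 have rhs0: "rhs 0 = (\<lambda>_. 0)" by (auto simp: rhs_def L_def fun_eq_iff zero_prod_def)
 have T_bd: "T g \<in> bcontfun" for g
 proof (rule bcontfun_normI)
  show "continuous_on UNIV (T g)"
   unfolding T_def by (intro continuous_intros A_cont)
  fix s
  have A0: "norm (A 0 s) \<le> 0 / K * exp (K * \<bar>s\<bar>)"
   by (rule antiderivative_exp_bound[OF A K]) (simp add: rhs0)
  have "norm (A g s) \<le> 1 / 2 * dist g 0 * exp (K * \<bar>s\<bar>)" using A_le[of g s 0] A0 by simp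
  then have "norm (w0 + A g s) \<le> norm w0 * exp (K * \<bar>s\<bar>) + 1 / 2 * dist g 0 * exp (K * \<bar>s\<bar>)"
   using mult_left_mono[of 1 "exp (K * \<bar>s\<bar>)" "norm w0"] K norm_triangle_ineq[of w0 "A g s"]
   by simp
  moreover have "norm (T g s) = norm (w0 + A g s) / exp (K * \<bar>s\<bar>)"
   unfolding T_def norm_scaleR by (simp add: exp_minus divide_inverse)
  ultimately show "norm (T g s) \<le> norm w0 + 1 / 2 * dist g 0"
   by (simp add: divide_le_eq algebra_simps)
 qed
 define B where "B = (\<lambda>g. Bcontfun (T g))"
 have B: "apply_bcontfun (B g) = T g" for g
  by (simp add: B_def Bcontfun_inverse T_bd)
 have "\<exists>!g. B g = g"
 proof (rule banach_fix_type[of "1/2"])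
  show "\<forall>x y. dist (B x) (B y) \<le> 1 / 2 * dist x y"
  proof (intro allI dist_bound)
   fix g f :: "real \<Rightarrow>\<^sub>C ('a \<times> 'a)" and s :: real
   have "T g s - T f s = exp (- (K * \<bar>s\<bar>)) *\<^sub>R (A g s - A f s)"
    by (simp add: T_def algebra_simps)
   then have "norm (T g s - T f s) = exp (- (K * \<bar>s\<bar>)) * norm (A g s - A f s)" by simp
   also have "... \<le> exp (- (K * \<bar>s\<bar>)) * (1 / 2 * dist g f * exp (K * \<bar>s\<bar>))"
    by (intro mult_left_mono A_le) auto
   also have "... = 1 / 2 * dist g f" by (simp add: exp_minus field_simps)
   finally show "dist (B g s) (B f s) \<le> 1 / 2 * dist g f"
    by (simp add: B dist_norm)
  qed
 qed auto
 then obtain g where g: "B g = g" by blast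
 define W where "W = (\<lambda>s. w0 + A g s)"
 have gW: "exp (K * \<bar>s\<bar>) *\<^sub>R apply_bcontfun g s = W s" for s
 proof -
  have "apply_bcontfun g s = T g s" using B[of g] g by simp
  also have "... = exp (- (K * \<bar>s\<bar>)) *\<^sub>R W s" by (simp only: T_def W_def)
  finally show ?thesis by (simp add: exp_minus)
 qed
 have "(W has_vector_derivative L s (W s)) (at s)" for s
  unfolding W_def using A(2)[of g s]
  by (auto intro!: derivative_eq_intros simp: rhs_def gW[unfolded W_def])
 then have W: "(W has_vector_derivative (snd (W s), q s *\<^sub>R fst (W s))) (at s)" for s
  by (simp add: L_def)
 have "((\<lambda>s. fst (W s)) has_vector_derivative snd (W s)) (at s)"
    "((\<lambda>s. snd (W s)) has_vector_derivative q s *\<^sub>R fst (W s)) (at s)" for s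
  using bounded_linear.has_vector_derivative[OF bounded_linear_fst W]
   bounded_linear.has_vector_derivative[OF bounded_linear_snd W] by auto
 moreover have "fst (W 0) = a0" "snd (W 0) = b0" using A by (auto simp: W_def w0_def)
 ultimately show ?thesis
  by (intro exI[of _ "\<lambda>s. fst (W s)"] exI[of _ "\<lambda>s. snd (W s)"]) (auto simp: solves_on_def)
qed

lemma solves_UNIV_exists:
 fixes a0 b0 :: "'a::euclidean_space"
 assumes q: "continuous_on UNIV q" and Q: "\<And>s. \<bar>q s\<bar> \<le> Q"
 shows "\<exists>u u'. solves_on UNIV q u u' \<and> u c = a0 \<and> u' c = b0"
proof -
 have "continuous_on UNIV (\<lambda>s. q (c + s))"
  by (rule continuous_on_compose2[OF q]) (auto intro!: continuous_intros)
 from solves_UNIV_exists0[OF this Q] obtain u u' :: "real \<Rightarrow> 'a"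
  where "solves_on UNIV (\<lambda>s. q (c + s)) u u'" "u 0 = a0" "u' 0 = b0" by blast
 from solves_on_affine[OF this(1), of 1 "- c"] this(2,3) show ?thesis
  by (intro exI[of _ "\<lambda>s. u (- c + 1 * s)"] exI[of _ "\<lambda>s. u' (- c + 1 * s)"]) auto
qed

section \<open>Integrable functions orthogonal to smooth periodic functions\<close>

text \<open>Trigonometric polynomials, seen as real polynomial functions on the unit circle: the Stone--Weierstrass
theorem for such functions applies to them, and they are smooth.\<close>

definition trig_poly :: "(real \<Rightarrow> real) \<Rightarrow> bool" where
 "trig_poly f \<longleftrightarrow> (\<exists>p. real_polynomial_function p \<and> f = (\<lambda>s. p (cis s)))"

lemma trig_poly_deriv:
 assumes "trig_poly f"
 shows "\<exists>f'. trig_poly f' \<and> (\<forall>s. (f has_real_derivative f' s) (at s))"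
proof -
 have "\<exists>q. real_polynomial_function q \<and> (\<forall>s. ((\<lambda>s. p (cis s)) has_real_derivative q (cis s)) (at s))"
  if "real_polynomial_function p" for p :: "complex \<Rightarrow> real"
  using that
 proof induction
  case (linear L)
  have "(cis has_vector_derivative \<i> * cis s) (at s)" for s
   unfolding has_vector_derivative_def by (auto intro!: derivative_eq_intros)
  from bounded_linear.has_vector_derivative[OF linear this]
  have "((\<lambda>s. L (cis s)) has_real_derivative L (\<i> * cis s)) (at s)" for s
   by (simp add: has_real_derivative_iff_has_vector_derivative)
  moreover have "bounded_linear (\<lambda>x. L (\<i> * x))"
   using bounded_linear_compose[OF linear bounded_linear_mult_right] .
  ultimately show ?case by blast
 next
  case (const c)
  show ?case by (rule exI[of _ "\<lambda>_. 0"]) auto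
 next
  case (add f g)
  then obtain qf qg where "real_polynomial_function qf" "real_polynomial_function qg"
   "\<And>s. ((\<lambda>s. f (cis s)) has_real_derivative qf (cis s)) (at s)"
   "\<And>s. ((\<lambda>s. g (cis s)) has_real_derivative qg (cis s)) (at s)" by metis
  then show ?case by (intro exI[of _ "\<lambda>x. qf x + qg x"]) (auto intro!: derivative_intros)
 next
  case (mult f g)
  then obtain qf qg where "real_polynomial_function qf" "real_polynomial_function qg"
   "\<And>s. ((\<lambda>s. f (cis s)) has_real_derivative qf (cis s)) (at s)"
   "\<And>s. ((\<lambda>s. g (cis s)) has_real_derivative qg (cis s)) (at s)" by metis
  with mult.hyps show ?case
   by (intro exI[of _ "\<lambda>x. qf x * g x + qg x * f x"]) (auto intro!: derivative_intros DERIV_mult)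
 qed
 moreover obtain p where "real_polynomial_function p" "f = (\<lambda>s. p (cis s))"
  using assms by (auto simp: trig_poly_def)
 ultimately obtain q where "real_polynomial_function q" "\<forall>s. (f has_real_derivative q (cis s)) (at s)"
  by metis
 then show ?thesis by (intro exI[of _ "\<lambda>s. q (cis s)"]) (auto simp: trig_poly_def)
qed

lemma trig_poly_smooth:
 assumes "trig_poly f" shows "smooth f"
proof -
 have "trig_poly ((deriv ^^ n) f)" for n
 proof (induction n)
  case (Suc n)
  then obtain f' where "trig_poly f'" "\<And>s. ((deriv ^^ n) f has_real_derivative f' s) (at s)"
   using trig_poly_deriv by blast
  moreover from this(2) have "deriv ((deriv ^^ n) f) = f'" by (auto intro: DERIV_imp_deriv)
  ultimately show ?case by simp
 qed (use assms in auto)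
 then show ?thesis unfolding smooth_def
  using trig_poly_deriv real_differentiable_def by blast
qed

lemma trig_poly_periodic: "trig_poly f ==> periodic_2pi f"
 by (auto simp: trig_poly_def periodic_2pi_def cis_mult[symmetric])

lemma smooth_deriv: "smooth f ==> smooth (deriv f)"
 unfolding smooth_def by (metis funpow_Suc_right o_apply)

lemma smooth_has_derivative: "smooth f ==> (f has_real_derivative deriv f s) (at s)"
 unfolding smooth_def
 by (metis DERIV_imp_deriv funpow_0 real_differentiable_def)

lemma smooth_continuous: "smooth f ==> continuous_on S f"
 by (meson DERIV_isCont continuous_at_imp_continuous_on smooth_has_derivative)

lemma integrable_mult_bounded:
 fixes F :: "'a \<Rightarrow> complex" and g :: "'a \<Rightarrow> real"
 assumes "integrable M F" "g \<in> borel_measurable M" "AE s in M. \<bar>g s\<bar> \<le> B"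
 shows "integrable M (\<lambda>s. F s * of_real (g s))"
proof (rule Bochner_Integration.integrable_bound)
 show "integrable M (\<lambda>s. F s * of_real B)" using assms by simp
 show "(\<lambda>s. F s * of_real (g s)) \<in> borel_measurable M" using assms by measurable
 show "AE s in M. norm (F s * of_real (g s)) \<le> norm (F s * complex_of_real B)"
  using assms(3) by eventually_elim (auto simp: norm_mult intro!: mult_left_mono)
qed

lemma set_integrable_mult_continuous:
 fixes f :: "real \<Rightarrow> complex" and \<phi> :: "real \<Rightarrow> real"
 assumes f: "set_integrable lborel {a..b} f" and \<phi>: "continuous_on UNIV \<phi>"
 shows "set_integrable lborel {a..b} (\<lambda>s. f s * of_real (\<phi> s))"
proof -
 have [measurable]: "\<phi> \<in> borel_measurable borel" by (rule borel_measurable_continuous_onI[OF \<phi>])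
 have "bounded (\<phi> ` {a..b})"
  by (intro compact_imp_bounded compact_continuous_image continuous_on_subset[OF \<phi>]) auto
 then obtain B where "\<forall>x\<in>\<phi> ` {a..b}. norm x \<le> B" unfolding bounded_iff by blast
 then have B: "\<And>s. s \<in> {a..b} ==> \<bar>\<phi> s\<bar> \<le> B" by auto
 have "integrable lborel (\<lambda>s. (indicat_real {a..b} s *\<^sub>R f s) * of_real (indicat_real {a..b} s * \<phi> s))"
 proof (rule integrable_mult_bounded[where B = "\<bar>B\<bar>" and g = "\<lambda>s. indicat_real {a..b} s * \<phi> s"])
  show "(\<lambda>s. indicat_real {a..b} s * \<phi> s) \<in> borel_measurable lborel" by measurable
  show "AE s in lborel. \<bar>indicat_real {a..b} s * \<phi> s\<bar> \<le> \<bar>B\<bar>"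
   using B by (intro AE_I2) (auto simp: indicator_def dest: order_trans[OF _ abs_ge_self])
 qed (use f in \<open>simp add: set_integrable_def\<close>)
 then show ?thesis unfolding set_integrable_def
  by (rule Bochner_Integration.integrable_cong[THEN iffD1, rotated -1]) (auto simp: indicator_def)
qed

text \<open>By Stone--Weierstrass, \<open>f\<close> annihilates all continuous functions of \<open>cis s\<close>, hence by dominated
convergence the indicators of arcs, hence by Dynkin's theorem all Borel sets; a density with
vanishing integrals over all Borel sets is zero almost everywhere.\<close>

lemma circle_integral_zero:
 fixes f :: "real \<Rightarrow> complex"
 assumes f: "set_integrable lborel {0..2 * pi} f"
  and z: "\<And>\<phi>. smooth \<phi> ==> periodic_2pi \<phi> ==> (LINT s:{0..2 * pi}|lborel. f s * of_real (\<phi> s)) = 0"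
 shows "AE s in lborel. s \<in> {0..2 * pi} --> f s = 0"
proof -
 define F where "F = (\<lambda>s. indicat_real {0..2 * pi} s *\<^sub>R f s)"
 have F: "integrable lborel F" using f by (simp add: F_def set_integrable_def)
 then have [measurable]: "F \<in> borel_measurable borel" by (metis borel_measurable_integrable measurable_lborel2)
 have cis_cont: "continuous_on UNIV cis" by (intro continuous_intros)
 \<comment> \<open>continuous functions on the circle are uniform limits of trigonometric polynomials\<close>
 have cont0: "(\<integral>s. F s * of_real (G (cis s)) \<partial>lborel) = 0"
  if G: "continuous_on UNIV G" for G :: "complex \<Rightarrow> real"
 proof -
  have Gm: "(\<lambda>s. G (cis s)) \<in> borel_measurable borel"
   by (intro borel_measurable_continuous_onI continuous_on_compose2[OF G cis_cont]) auto
  have Gb: "\<exists>B. \<forall>s. \<bar>G (cis s)\<bar> \<le> B"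
  proof -
   have "compact (G ` sphere 0 1)"
    by (intro compact_continuous_image continuous_on_subset[OF G]) auto
   then obtain B where "\<And>x. x \<in> sphere 0 1 ==> norm (G x) \<le> B"
    by (meson bounded_iff compact_imp_bounded imageI)
   then show ?thesis by (intro exI[of _ B]) auto
  qed
  have le: "norm (\<integral>s. F s * of_real (G (cis s)) \<partial>lborel) \<le> e * (\<integral>s. norm (F s) \<partial>lborel)" if e0: "e > 0" for e
  proof -
   obtain p where p: "real_polynomial_function p" "\<And>x. x \<in> sphere 0 1 ==> \<bar>G x - p x\<bar> < e"
    using Stone_Weierstrass_real_polynomial_function[OF compact_sphere continuous_on_subset[OF G subset_UNIV] e0]
    by metis
   have tp: "trig_poly (\<lambda>s. p (cis s))" using p(1) by (auto simp: trig_poly_def)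
   have pm: "(\<lambda>s. p (cis s)) \<in> borel_measurable borel"
    by (intro borel_measurable_continuous_onI smooth_continuous trig_poly_smooth tp)
   obtain B where B: "\<And>s. \<bar>G (cis s)\<bar> \<le> B" using Gb by blast
   have pb: "\<bar>p (cis s)\<bar> \<le> B + e" for s using p(2)[of "cis s"] B[of s] by auto
   have ip: "integrable lborel (\<lambda>s. F s * of_real (p (cis s)))"
    by (rule integrable_mult_bounded[OF F]) (use pm pb in auto)
   have iG: "integrable lborel (\<lambda>s. F s * of_real (G (cis s)))"
    by (rule integrable_mult_bounded[OF F]) (use Gm B in auto)
   have "(\<integral>s. F s * of_real (p (cis s)) \<partial>lborel) = 0"
    using z[OF trig_poly_smooth[OF tp] trig_poly_periodic[OF tp]]
    by (simp add: F_def set_lebesgue_integral_def)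
   then have "(\<integral>s. F s * of_real (G (cis s)) \<partial>lborel)
     = (\<integral>s. F s * of_real (G (cis s)) - F s * of_real (p (cis s)) \<partial>lborel)"
    using Bochner_Integration.integral_diff[OF iG ip] by simp
   also have "norm ... \<le> (\<integral>s. e * norm (F s) \<partial>lborel)"
   proof (rule Bochner_Integration.integral_norm_bound_integral)
    show "integrable lborel (\<lambda>s. F s * of_real (G (cis s)) - F s * of_real (p (cis s)))"
     using iG ip by simp
    show "integrable lborel (\<lambda>s. e * norm (F s))" using F by simp
    fix s
    have "F s * of_real (G (cis s)) - F s * of_real (p (cis s)) = F s * of_real (G (cis s) - p (cis s))"
     by (simp add: algebra_simps)
    then show "norm (F s * of_real (G (cis s)) - F s * of_real (p (cis s))) \<le> e * norm (F s)"
     using p(2)[of "cis s"] by (simp add: norm_mult mult.commute[of "cmod (F s)"] mult_right_mono del: of_real_diff)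
   qed
   finally show ?thesis by simp
  qed
  have "norm (\<integral>s. F s * of_real (G (cis s)) \<partial>lborel) \<le> 0"
  proof (rule field_le_epsilon)
   fix e :: real assume e: "e > 0"
   define A where "A = (\<integral>s. norm (F s) \<partial>lborel)"
   have A: "A \<ge> 0" by (simp add: A_def)
   have "norm (\<integral>s. F s * of_real (G (cis s)) \<partial>lborel) \<le> e / (A + 1) * A"
    using le[folded A_def, of "e / (A + 1)"] e A by simp
   also have "... \<le> e" using e A by (simp add: divide_le_eq algebra_simps)
   finally show "norm (\<integral>s. F s * of_real (G (cis s)) \<partial>lborel) \<le> 0 + e" by simp
  qed
  then show ?thesis by simp
 qed
 \<comment> \<open>the functions \<open>max 0 (1 - n infdist x A)\<close> decrease to the indicator of the arc \<open>A\<close>\<close>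
 have intv: "(LINT s:{a..c}|lborel. F s) = 0" if ac: "0 \<le> a" "a \<le> c" "c \<le> 2 * pi" for a c
 proof -
  define A where "A = cis ` {a..c}"
  have A: "closed A" "A \<noteq> {}"
   using ac compact_imp_closed[OF compact_continuous_image[OF continuous_on_subset[OF cis_cont]], of "{a..c}"]
   by (auto simp: A_def)
  define G where "G = (\<lambda>n x. max 0 (1 - real n * infdist x A))"
  have Gc: "continuous_on UNIV (G n)" for n
   unfolding G_def by (intro continuous_intros)
  have "(\<lambda>n. \<integral>s. F s * of_real (G n (cis s)) \<partial>lborel) \<longlonglongrightarrow> (\<integral>s. F s * of_real (indicator A (cis s)) \<partial>lborel)"
  proof (rule integral_dominated_convergence)
   have [measurable]: "A \<in> sets borel" using A by auto
   have [measurable]: "cis \<in> borel_measurable borel" by (intro borel_measurable_continuous_onI cis_cont)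
   show "(\<lambda>s. F s * of_real (indicator A (cis s))) \<in> borel_measurable lborel" by measurable
   have [measurable]: "(\<lambda>s. G n (cis s)) \<in> borel_measurable borel" for n
    by (intro borel_measurable_continuous_onI continuous_on_compose2[OF Gc cis_cont]) auto
   show "(\<lambda>s. F s * of_real (G n (cis s))) \<in> borel_measurable lborel" for n by measurable
   show "integrable lborel (\<lambda>s. norm (F s))" using F by simp
   show "AE s in lborel. norm (F s * of_real (G n (cis s))) \<le> norm (F s)" for n
   proof (rule AE_I2)
    fix s
    have "\<bar>G n (cis s)\<bar> \<le> 1" using infdist_nonneg[of "cis s" A] by (auto simp: G_def)
    then show "norm (F s * of_real (G n (cis s))) \<le> norm (F s)"
     using mult_left_mono[of "\<bar>G n (cis s)\<bar>" 1 "norm (F s)"] by (simp add: norm_mult)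
   qed
   show "AE s in lborel. (\<lambda>n. F s * of_real (G n (cis s))) \<longlonglongrightarrow> F s * of_real (indicator A (cis s))"
   proof (rule AE_I2)
    fix s
    have "(\<lambda>n. G n (cis s)) \<longlonglongrightarrow> indicator A (cis s)"
    proof (cases "cis s \<in> A")
     case True then show ?thesis by (simp add: G_def)
    next
     case False
     then have d: "infdist (cis s) A > 0"
      using A in_closed_iff_infdist_zero infdist_nonneg by (metis less_eq_real_def)
     have "eventually (\<lambda>n. real n \<ge> 1 / infdist (cis s) A) sequentially"
      using filterlim_real_sequentially by (simp add: filterlim_at_top)
     then have "eventually (\<lambda>n. G n (cis s) = indicator A (cis s)) sequentially"
      by eventually_elim (use d False in \<open>auto simp: G_def divide_le_eq\<close>)
     then show ?thesis by (rule tendsto_eventually)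
    qed
    then show "(\<lambda>n. F s * of_real (G n (cis s))) \<longlonglongrightarrow> F s * of_real (indicator A (cis s))"
     by (intro tendsto_intros)
   qed
  qed
  then have "(\<integral>s. F s * of_real (indicator A (cis s)) \<partial>lborel) = 0"
   using cont0[OF Gc] by (simp add: LIMSEQ_const_iff)
  moreover have "(\<integral>s. F s * of_real (indicator A (cis s)) \<partial>lborel) = (LINT s:{a..c}|lborel. F s)"
   unfolding set_lebesgue_integral_def
  proof (rule Bochner_Integration.integral_cong_AE)
   have [measurable]: "A \<in> sets borel" using A by auto
   have [measurable]: "cis \<in> borel_measurable borel" by (intro borel_measurable_continuous_onI cis_cont)
   show "(\<lambda>s. F s * of_real (indicator A (cis s))) \<in> borel_measurable lborel" by measurable
   show "(\<lambda>s. indicat_real {a..c} s *\<^sub>R F s) \<in> borel_measurable lborel" by measurable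
   show "AE s in lborel. F s * of_real (indicator A (cis s)) = indicat_real {a..c} s *\<^sub>R F s"
    using AE_lborel_singleton[of 0] AE_lborel_singleton[of "2 * pi"]
   proof eventually_elim
    case (elim s)
    show ?case
    proof (cases "0 < s \<and> s < 2 * pi")
     case True
     have "cis s \<in> A \<longleftrightarrow> s \<in> {a..c}"
     proof
      assume "cis s \<in> A"
      then obtain t where t: "t \<in> {a..c}" "cis s = cis t" by (auto simp: A_def)
      then obtain n where n: "s = t + 2 * pi * of_int n"
       using sin_cos_eq_iff[of s t] by (auto simp: complex_eq_iff)
      have "n = 0"
      proof -
       have "\<bar>s - t\<bar> < 2 * pi" using t True ac by (auto simp: abs_if)
       then have "2 * pi * \<bar>real_of_int n\<bar> < 2 * pi * 1" using n by (simp add: abs_mult)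
       then have "\<bar>real_of_int n\<bar> < 1" using pi_gt_zero by (simp only: mult_less_cancel_left_pos)
       then show ?thesis by linarith
      qed
      then show "s \<in> {a..c}" using n t by simp
     qed (auto simp: A_def)
     then show ?thesis by (auto simp: indicator_def)
    next
     case False
     then have "F s = 0" using elim by (auto simp: F_def indicator_def)
     then show ?thesis by simp
    qed
   qed
  qed
  ultimately show ?thesis by simp
 qed
 have tot: "(\<integral>s. F s \<partial>lborel) = 0"
 proof -
  have "indicat_real {0..2 * pi} s *\<^sub>R F s = F s" for s by (auto simp: F_def indicator_def)
  then show ?thesis using intv[of 0 "2 * pi"] by (simp add: set_lebesgue_integral_def)
 qed
 have Fs: "set_integrable lborel B F" if "B \<in> sets borel" for B
  using F that unfolding set_integrable_def
  by (intro integrable_mult_indicator) auto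
 \<comment> \<open>intervals form an intersection-stable generator of the Borel sets\<close>
 have all: "(LINT s:B|lborel. F s) = 0" if "B \<in> sets borel" for B
 proof -
  have B: "B \<in> sigma_sets UNIV (range (\<lambda>(a,b). {a..b::real}))"
   using that by (subst (asm) borel_eq_atLeastAtMost) simp
  have I: "Int_stable (range (\<lambda>(a,b). {a..b::real}))"
   by (auto simp: Int_stable_def)
  have P: "range (\<lambda>(a,b). {a..b::real}) \<subseteq> Pow UNIV" by simp
  from I P B show ?thesis
  proof (induction rule: sigma_sets_induct_disjoint)
   case (basic A)
   then obtain a b where A: "A = {a..b}" by auto
   have "(LINT s:A|lborel. F s) = (LINT s:{max a 0..min b (2 * pi)}|lborel. F s)"
    unfolding A set_lebesgue_integral_def
    by (intro Bochner_Integration.integral_cong) (auto simp: F_def indicator_def)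
   also have "... = 0"
   proof (cases "max a 0 \<le> min b (2 * pi)")
    case True then show ?thesis by (intro intv) auto
   next
    case False
    then have "{max a 0..min b (2 * pi)} = {}" by auto
    then show ?thesis by (simp add: set_lebesgue_integral_def)
   qed
   finally show ?case .
  next
   case empty show ?case by (simp add: set_lebesgue_integral_def)
  next
   case (compl A)
   have A: "A \<in> sets borel" using compl(1) by (subst borel_eq_atLeastAtMost) simp
   have "(LINT s:(UNIV - A)|lborel. F s) = (\<integral>s. F s - indicat_real A s *\<^sub>R F s \<partial>lborel)"
    unfolding set_lebesgue_integral_def
    by (intro Bochner_Integration.integral_cong) (auto simp: indicator_def)
   also have "... = 0"
    using Bochner_Integration.integral_diff[OF F Fs[OF A, unfolded set_integrable_def]] tot compl(2)
    by (simp add: set_lebesgue_integral_def)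
   finally show ?case .
  next
   case (union A)
   have A: "A i \<in> sets borel" for i using union(2) by (subst borel_eq_atLeastAtMost) auto
   have "(LINT s:(\<Union>i. A i)|lborel. F s) = (\<Sum>i. (LINT s:(A i)|lborel. F s))"
    using union(1) A
    by (intro lebesgue_integral_countable_add Fs) (auto simp: disjoint_family_on_def)
   then show ?case using union(3) by simp
  qed
 qed
 have "AE s in lborel. F s = 0"
  by (rule sigma_finite_measure.density_zero[OF lborel.sigma_finite_measure_axioms F]) (use all in auto)
 then show ?thesis by eventually_elim (auto simp: F_def)
qed

section \<open>Weak derivatives and primitives\<close>

lemma lborel_pair_integrable_mult:
 fixes g k :: "real \<Rightarrow> complex"
 assumes "integrable lborel g" "integrable lborel k"
 shows "integrable (lborel \<Otimes>\<^sub>M lborel) (\<lambda>(x, y). g x * k y)"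
proof -
 have [measurable]: "g \<in> borel_measurable borel" "k \<in> borel_measurable borel"
  using assms by (metis borel_measurable_integrable measurable_lborel2)+
 have m: "(\<lambda>(x, y). g x * k y) \<in> borel_measurable (lborel \<Otimes>\<^sub>M lborel)" by measurable
 show ?thesis
 proof (rule lborel_pair.Fubini_integrable[OF m])
  have "(\<lambda>x. \<integral>y. norm (case (x, y) of (x, y) \<Rightarrow> g x * k y) \<partial>lborel) = (\<lambda>x. norm (g x) * (\<integral>y. norm (k y) \<partial>lborel))"
   by (simp add: norm_mult)
  then show "integrable lborel (\<lambda>x. \<integral>y. norm (case (x, y) of (x, y) \<Rightarrow> g x * k y) \<partial>lborel)"
   using assms by simp
  show "AE x in lborel. integrable lborel (\<lambda>y. case (x, y) of (x, y) \<Rightarrow> g x * k y)"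
   using assms by simp
 qed
qed

text \<open>Fubini's theorem on the triangle \<open>t \<le> s\<close>; the primitive of an integrable function need not be
differentiable everywhere, so the classical formula does not apply.\<close>

lemma primitive_integral_by_parts:
 fixes v :: "real \<Rightarrow> complex" and \<phi> \<psi> :: "real \<Rightarrow> real"
 assumes v: "set_integrable lborel {0..T} v" and T: "0 \<le> T"
  and \<phi>: "\<And>s. (\<phi> has_real_derivative \<psi> s) (at s)" and \<psi>: "continuous_on UNIV \<psi>"
 shows "(LINT s:{0..T}|lborel. (LINT t:{0..s}|lborel. v t) * of_real (\<psi> s))
    = (LINT t:{0..T}|lborel. v t * of_real (\<phi> T - \<phi> t))"
  and "set_integrable lborel {0..T} (\<lambda>s. LINT t:{0..s}|lborel. v t)"
proof -
 define g where "g = (\<lambda>t. indicat_real {0..T} t *\<^sub>R v t)"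
 define k where "k = (\<lambda>s. complex_of_real (indicat_real {0..T} s * \<psi> s))"
 have g: "integrable lborel g" using v by (simp add: g_def set_integrable_def)
 have one: "integrable lborel (\<lambda>s. complex_of_real (indicat_real {0..T} s))"
  using borel_integrable_atLeastAtMost'[of 0 T "\<lambda>_. 1::complex"]
  by (simp add: set_integrable_def scaleR_conv_of_real)
 have k: "integrable lborel k"
  using borel_integrable_atLeastAtMost'[of 0 T "\<lambda>s. complex_of_real (\<psi> s)"]
   continuous_on_subset[OF \<psi>, of "{0..T}"]
  by (auto simp: k_def set_integrable_def scaleR_conv_of_real intro!: continuous_intros)
 have [measurable]: "g \<in> borel_measurable borel" "k \<in> borel_measurable borel"
  using g k by (metis borel_measurable_integrable measurable_lborel2)+
 define f where "f = (\<lambda>k t s. if t \<le> s then g t * k s else (0::complex))"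
 have f_int: "integrable (lborel \<Otimes>\<^sub>M lborel) (case_prod (f k))"
  if k: "integrable lborel k" for k :: "real \<Rightarrow> complex"
 proof (rule Bochner_Integration.integrable_bound[OF lborel_pair_integrable_mult[OF g k]])
  have [measurable]: "k \<in> borel_measurable borel"
   using k by (metis borel_measurable_integrable measurable_lborel2)
  have "case_prod (f k) = (\<lambda>p. if fst p \<le> snd p then g (fst p) * k (snd p) else 0)"
   by (auto simp: f_def)
  also have "... \<in> borel_measurable (lborel \<Otimes>\<^sub>M lborel)" by measurable
  finally show "case_prod (f k) \<in> borel_measurable (lborel \<Otimes>\<^sub>M lborel)" .
  show "AE p in lborel \<Otimes>\<^sub>M lborel. norm (case_prod (f k) p) \<le> norm (case p of (x, y) \<Rightarrow> g x * k y)"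
   by (rule AE_I2) (auto simp: f_def)
 qed
 have inner: "(\<integral>t. f k t s \<partial>lborel) = indicat_real {0..T} s *\<^sub>R ((LINT t:{0..s}|lborel. v t) * x)"
  if k: "k s = indicat_real {0..T} s *\<^sub>R x" for s k x
 proof -
  have "(\<integral>t. f k t s \<partial>lborel) = (\<integral>t. (indicat_real {0..s} t *\<^sub>R v t) * (indicat_real {0..T} s *\<^sub>R x) \<partial>lborel)"
   by (intro Bochner_Integration.integral_cong) (auto simp: f_def g_def k indicator_def)
  also have "... = (\<integral>t. indicat_real {0..s} t *\<^sub>R v t \<partial>lborel) * (indicat_real {0..T} s *\<^sub>R x)"
  proof (cases "s \<in> {0..T}")
   case True
   then have "integrable lborel (\<lambda>t. indicat_real {0..s} t *\<^sub>R v t)"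
    using set_integrable_subset[OF v, of "{0..s}"] by (auto simp: set_integrable_def)
   then show ?thesis by (intro Bochner_Integration.integral_mult_left)
  qed simp
  finally show ?thesis by (simp add: set_lebesgue_integral_def)
 qed
 have outer: "(\<integral>s. f k t s \<partial>lborel) = indicat_real {0..T} t *\<^sub>R (v t * of_real (\<phi> T - \<phi> t))" for t
 proof (cases "t \<in> {0..T}")
  case True
  have "(\<integral>s. f k t s \<partial>lborel) = (\<integral>s. v t * complex_of_real (indicat_real {t..T} s * \<psi> s) \<partial>lborel)"
   using True
   by (intro Bochner_Integration.integral_cong) (auto simp: f_def g_def k_def indicator_def)
  also have "... = v t * (\<integral>s. complex_of_real (indicat_real {t..T} s * \<psi> s) \<partial>lborel)"
   by (rule integral_mult_right_zero)
  also have "... = v t * complex_of_real (\<integral>s. indicat_real {t..T} s * \<psi> s \<partial>lborel)"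
   by (simp only: integral_complex_of_real)
  also have "(\<integral>s. indicat_real {t..T} s * \<psi> s \<partial>lborel) = \<phi> T - \<phi> t"
  proof -
   have "((\<lambda>s. \<psi> s) has_integral \<phi> T - \<phi> t) {t..T}"
    using True \<phi> by (intro fundamental_theorem_of_calculus)
     (auto simp: has_real_derivative_iff_has_vector_derivative intro: has_vector_derivative_at_within)
   moreover have "set_integrable lborel {t..T} \<psi>"
    by (intro borel_integrable_atLeastAtMost' continuous_on_subset[OF \<psi>]) auto
   ultimately show ?thesis
    using set_borel_integral_eq_integral(2)[of "{t..T}" \<psi>]
    by (simp add: set_lebesgue_integral_def integral_unique)
  qed
  finally show ?thesis using True by simp
 next
  case False
  then have "f k t = (\<lambda>_. 0)" by (auto simp: f_def g_def fun_eq_iff)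
  then show ?thesis using False by simp
 qed
 have "(\<integral>s. (\<integral>t. f k t s \<partial>lborel) \<partial>lborel) = (\<integral>t. (\<integral>s. f k t s \<partial>lborel) \<partial>lborel)"
  by (rule lborel_pair.Fubini_integral[OF f_int[OF k]])
 moreover have "(\<integral>t. f k t s \<partial>lborel) = indicat_real {0..T} s *\<^sub>R ((LINT t:{0..s}|lborel. v t) * of_real (\<psi> s))" for s
  by (rule inner) (simp add: k_def scaleR_conv_of_real)
 ultimately show "(LINT s:{0..T}|lborel. (LINT t:{0..s}|lborel. v t) * of_real (\<psi> s))
    = (LINT t:{0..T}|lborel. v t * of_real (\<phi> T - \<phi> t))"
  by (simp add: outer set_lebesgue_integral_def)
 have "integrable lborel (\<lambda>s. \<integral>t. f (\<lambda>s. complex_of_real (indicat_real {0..T} s)) t s \<partial>lborel)"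
  using lborel_pair.integrable_snd[OF f_int[OF one]] .
 moreover have "(\<integral>t. f (\<lambda>s. complex_of_real (indicat_real {0..T} s)) t s \<partial>lborel)
   = indicat_real {0..T} s *\<^sub>R ((LINT t:{0..s}|lborel. v t) * 1)" for s
  by (rule inner) (simp add: scaleR_conv_of_real)
 ultimately show "set_integrable lborel {0..T} (\<lambda>s. LINT t:{0..s}|lborel. v t)"
  by (simp add: set_integrable_def)
qed

lemma smooth_const: "smooth (\<lambda>_. c)"
 by (rule trig_poly_smooth) (auto simp: trig_poly_def intro!: exI[of _ "\<lambda>_. c"])

text \<open>Testing with the constant function gives the vanishing mean. By parts, \<open>u\<close> minus the primitive
of \<open>v\<close> annihilates every \<open>\<phi>'\<close>; its difference to its mean therefore annihilates all test functions,
since a smooth periodic function differs from its mean by such a \<open>\<phi>'\<close>.\<close>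

lemma circle_weak_primitive:
 fixes u v :: "real \<Rightarrow> complex"
 assumes u: "set_integrable lborel {0..2 * pi} u" and v: "set_integrable lborel {0..2 * pi} v"
  and weak: "\<And>\<phi>. smooth \<phi> ==> periodic_2pi \<phi> ==>
    (LINT s:{0..2 * pi}|lborel. u s * of_real (deriv \<phi> s)) = - (LINT s:{0..2 * pi}|lborel. v s * of_real (\<phi> s))"
 shows "(LINT s:{0..2 * pi}|lborel. v s) = 0"
  and "\<exists>c. AE s in lborel. s \<in> {0..2 * pi} --> u s = c + (LINT t:{0..s}|lborel. v t)"
proof -
 show v0: "(LINT s:{0..2 * pi}|lborel. v s) = 0"
  using weak[of "\<lambda>_. 1"] smooth_const[of 1] by (simp add: periodic_2pi_def set_lebesgue_integral_def)
 define W where "W = (\<lambda>s. LINT t:{0..s}|lborel. v t)"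
 have W: "set_integrable lborel {0..2 * pi} W"
  unfolding W_def by (rule primitive_integral_by_parts(2)[where \<phi> = "\<lambda>_. 0" and \<psi> = "\<lambda>_. 0"]) (use v in auto)
 note vm = set_integrable_mult_continuous
 define hh where "hh = (\<lambda>s. u s - W s)"
 have h: "set_integrable lborel {0..2 * pi} hh"
  unfolding hh_def by (intro set_integral_diff u W)
 have h0: "(LINT s:{0..2 * pi}|lborel. hh s * of_real (deriv \<phi> s)) = 0"
  if \<phi>: "smooth \<phi>" "periodic_2pi \<phi>" for \<phi>
 proof -
  have dc: "continuous_on UNIV (deriv \<phi>)" "continuous_on UNIV \<phi>"
   using smooth_continuous smooth_deriv \<phi>(1) by blast+
  have "(LINT s:{0..2 * pi}|lborel. W s * of_real (deriv \<phi> s))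
    = (LINT t:{0..2 * pi}|lborel. v t * of_real (\<phi> (2 * pi) - \<phi> t))"
   unfolding W_def by (rule primitive_integral_by_parts(1)) (use v dc smooth_has_derivative[OF \<phi>(1)] in auto)
  also have "... = (LINT t:{0..2 * pi}|lborel. v t * of_real (\<phi> (2 * pi)) - v t * of_real (\<phi> t))"
   by (simp add: algebra_simps)
  also have "... = (LINT t:{0..2 * pi}|lborel. v t * of_real (\<phi> (2 * pi))) - (LINT t:{0..2 * pi}|lborel. v t * of_real (\<phi> t))"
   by (intro set_integral_diff(2) vm v dc) auto
  also have "... = - (LINT t:{0..2 * pi}|lborel. v t * of_real (\<phi> t))"
   using v0 by simp
  finally have "(LINT s:{0..2 * pi}|lborel. W s * of_real (deriv \<phi> s)) = (LINT s:{0..2 * pi}|lborel. u s * of_real (deriv \<phi> s))"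
   using weak[OF \<phi>] by simp
  moreover have "(LINT s:{0..2 * pi}|lborel. hh s * of_real (deriv \<phi> s))
    = (LINT s:{0..2 * pi}|lborel. u s * of_real (deriv \<phi> s)) - (LINT s:{0..2 * pi}|lborel. W s * of_real (deriv \<phi> s))"
   unfolding hh_def left_diff_distrib by (intro set_integral_diff(2) vm u W dc)
  ultimately show ?thesis by simp
 qed
 define c where "c = (LINT s:{0..2 * pi}|lborel. hh s) / of_real (2 * pi)"
 have cint: "set_integrable lborel {0..2 * pi} (\<lambda>_. c)"
  by (rule borel_integrable_atLeastAtMost') auto
 have cval: "(LINT s:{0..2 * pi}|lborel. c) = (LINT s:{0..2 * pi}|lborel. hh s)"
  using set_borel_integral_eq_integral(2)[OF cint] by (simp add: c_def scaleR_conv_of_real)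
 have "AE s in lborel. s \<in> {0..2 * pi} --> hh s - c = 0"
 proof (rule circle_integral_zero)
  show hc: "set_integrable lborel {0..2 * pi} (\<lambda>s. hh s - c)" by (intro set_integral_diff h cint)
  fix \<psi> :: "real \<Rightarrow> real" assume \<psi>: "smooth \<psi>" "periodic_2pi \<psi>"
  define m where "m = integral {0..2 * pi} \<psi> / (2 * pi)"
  have \<psi>c: "continuous_on S \<psi>" for S by (rule smooth_continuous[OF \<psi>(1)])
  obtain \<phi> where \<phi>: "\<And>x. (\<phi> has_vector_derivative \<psi> x - m) (at x)"
   using antiderivative_exists[OF continuous_on_diff[OF \<psi>c continuous_on_const], of m] by blast
  then have \<phi>': "(\<phi> has_real_derivative \<psi> x - m) (at x)" for x
   by (simp add: has_real_derivative_iff_has_vector_derivative)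
  have d\<phi>: "deriv \<phi> = (\<lambda>x. \<psi> x - m)" using \<phi>' by (auto intro: DERIV_imp_deriv)
  have "smooth \<phi>" unfolding smooth_def
  proof (intro allI)
   fix n s
   show "(deriv ^^ n) \<phi> differentiable at s"
   proof (cases n)
    case 0 then show ?thesis using \<phi>' real_differentiable_def by auto
   next
    case (Suc k)
    have "(deriv ^^ k) (\<lambda>x. \<psi> x - m) = (\<lambda>x. (deriv ^^ k) \<psi> x - (if k = 0 then m else 0))"
    proof (induction k)
     case (Suc k)
     have "((\<lambda>x. (deriv ^^ k) \<psi> x - (if k = 0 then m else 0)) has_real_derivative deriv ((deriv ^^ k) \<psi>) x) (at x)" for x
     proof -
      have "((deriv ^^ k) \<psi> has_real_derivative deriv ((deriv ^^ k) \<psi>) x) (at x)"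
       using \<psi>(1) unfolding smooth_def by (simp only: DERIV_deriv_iff_real_differentiable)
      from DERIV_diff[OF this DERIV_const] show ?thesis by simp
     qed
     then have "deriv (\<lambda>x. (deriv ^^ k) \<psi> x - (if k = 0 then m else 0)) = deriv ((deriv ^^ k) \<psi>)"
      by (intro ext DERIV_imp_deriv)
     then show ?case using Suc by simp
    qed simp
    then have "(deriv ^^ n) \<phi> = (\<lambda>x. (deriv ^^ k) \<psi> x - (if k = 0 then m else 0))"
     using Suc d\<phi> by (simp add: funpow_Suc_right del: funpow.simps)
    then show ?thesis using \<psi>(1) unfolding smooth_def by (auto intro!: derivative_intros)
   qed
  qed
  moreover have "periodic_2pi \<phi>"
  proof -
   have D: "((\<lambda>x. \<phi> (x + 2 * pi) - \<phi> x) has_real_derivative 0) (at x)" for x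
   proof -
    have "((\<lambda>x. \<phi> (x + 2 * pi)) has_real_derivative (\<psi> (x + 2 * pi) - m)) (at x)"
     using \<phi>'[of "x + 2 * pi"] DERIV_shift by blast
    then show ?thesis using \<phi>'[of x] \<psi>(2)
     by (auto intro!: derivative_eq_intros simp: periodic_2pi_def)
   qed
   have "\<phi> (x + 2 * pi) - \<phi> x = \<phi> (0 + 2 * pi) - \<phi> 0" for x
    using DERIV_isconst_all[of "\<lambda>x. \<phi> (x + 2 * pi) - \<phi> x"] D by blast
   moreover have i1: "((\<lambda>x. \<psi> x - m) has_integral \<phi> (2 * pi) - \<phi> 0) {0..2 * pi}"
    by (intro fundamental_theorem_of_calculus) (auto intro: has_vector_derivative_at_within \<phi>)
   have i2: "((\<lambda>x. \<psi> x - m) has_integral (integral {0..2 * pi} \<psi> - 2 * pi * m)) {0..2 * pi}"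
    using has_integral_diff[OF integrable_integral[OF integrable_continuous_real[OF \<psi>c]] has_integral_const_real[of m 0 "2 * pi"]]
    by simp
   ultimately have "\<phi> (x + 2 * pi) - \<phi> x = integral {0..2 * pi} \<psi> - 2 * pi * m" for x
    using has_integral_unique[OF i1 i2] by simp
   then show ?thesis by (simp add: periodic_2pi_def m_def)
  qed
  ultimately have z: "(LINT s:{0..2 * pi}|lborel. hh s * of_real (\<psi> s - m)) = 0"
   using h0[of \<phi>] by (simp add: d\<phi>)
  have i1: "set_integrable lborel {0..2 * pi} (\<lambda>s. hh s * of_real (\<psi> s - m))"
   by (intro vm h continuous_intros \<psi>c)
  have i2: "set_integrable lborel {0..2 * pi} (\<lambda>s. c * of_real (\<psi> s - m))"
   by (intro vm cint continuous_intros \<psi>c)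
  have "(LINT s:{0..2 * pi}|lborel. c * of_real (\<psi> s - m)) = integral {0..2 * pi} (\<lambda>s. c * of_real (\<psi> s - m))"
   by (rule set_borel_integral_eq_integral(2)[OF i2])
  also have "... = 0"
  proof -
   have "((\<lambda>x. \<psi> x - m) has_integral (integral {0..2 * pi} \<psi> - 2 * pi * m)) {0..2 * pi}"
    using has_integral_diff[OF integrable_integral[OF integrable_continuous_real[OF \<psi>c]] has_integral_const_real[of m 0 "2 * pi"]]
    by simp
   then have "((\<lambda>x. \<psi> x - m) has_integral 0) {0..2 * pi}" by (simp add: m_def)
   from integral_unique[OF has_integral_mult_right[OF has_integral_of_real[OF this, where 'b = complex], of c]]
   show ?thesis by (simp only: of_real_0 mult_zero_right)
  qed
  finally have z2: "(LINT s:{0..2 * pi}|lborel. c * of_real (\<psi> s - m)) = 0" .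
  have i3: "set_integrable lborel {0..2 * pi} (\<lambda>s. (hh s - c) * of_real (\<psi> s - m))"
   by (intro vm hc continuous_intros \<psi>c)
  have z3: "(LINT s:{0..2 * pi}|lborel. (hh s - c) * of_real (\<psi> s - m)) = 0"
   using set_integral_diff(2)[OF i1 i2] z z2 by (simp add: left_diff_distrib)
  have "(LINT s:{0..2 * pi}|lborel. (hh s - c) * of_real (\<psi> s))
    = (LINT s:{0..2 * pi}|lborel. (hh s - c) * of_real (\<psi> s - m) + (hh s - c) * of_real m)"
   by (simp add: algebra_simps)
  also have "... = (LINT s:{0..2 * pi}|lborel. (hh s - c) * of_real (\<psi> s - m)) + (LINT s:{0..2 * pi}|lborel. (hh s - c) * of_real m)"
   by (intro set_integral_add(2) i3 vm hc) auto
  also have "... = 0" using z3 set_integral_diff(2)[OF h cint] cval by simp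
  finally show "(LINT s:{0..2 * pi}|lborel. (hh s - c) * of_real (\<psi> s)) = 0" .
 qed
 then have "AE s in lborel. s \<in> {0..2 * pi} --> u s = c + (LINT t:{0..s}|lborel. v t)"
  by eventually_elim (auto simp: hh_def W_def algebra_simps)
 then show "\<exists>c. AE s in lborel. s \<in> {0..2 * pi} --> u s = c + (LINT t:{0..s}|lborel. v t)" by blast
qed

section \<open>Representatives and weak derivatives of square-integrable classes\<close>

text \<open>A representative picked by the quotient agrees with a given one almost everywhere only, so all
computations with classes below hold almost everywhere.\<close>

lemma rep_abs_l2:
 assumes "L2_fun f"
 shows "L2_fun (rep_l2_circle (abs_l2_circle f))" "AE s in lborel. rep_l2_circle (abs_l2_circle f) s = f s"
proof -
 have "L2_eq f f" using assms by (simp add: L2_eq_def)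
 then have "L2_eq (rep_l2_circle (abs_l2_circle f)) f"
  using Quotient3_l2_circle by (metis Quotient3_rep_abs)
 then show "L2_fun (rep_l2_circle (abs_l2_circle f))" "AE s in lborel. rep_l2_circle (abs_l2_circle f) s = f s"
  by (auto simp: L2_eq_def)
qed

lemma L2_fun_rep: "L2_fun (rep_l2_circle u)"
 using Quotient3_rep_reflp[OF Quotient3_l2_circle, of u] by (simp add: L2_eq_def)

lemma abs_rep_l2 [simp]: "abs_l2_circle (rep_l2_circle u) = u"
 using Quotient3_abs_rep[OF Quotient3_l2_circle] by simp

lemma abs_l2_eq_iff:
 assumes "L2_fun f" "L2_fun g"
 shows "abs_l2_circle f = abs_l2_circle g \<longleftrightarrow> (AE s in lborel. f s = g s)"
proof -
 have "L2_eq f f" "L2_eq g g" using assms by (auto simp: L2_eq_def)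
 then show ?thesis using Quotient3_rel[OF Quotient3_l2_circle, of f g] assms
  by (auto simp: L2_eq_def)
qed

lemma l2_eqI: "AE s in lborel. rep_l2_circle u s = rep_l2_circle v s ==> u = v"
 using abs_l2_eq_iff[OF L2_fun_rep L2_fun_rep, of u v] by simp

lemma rep_add: "AE s in lborel. rep_l2_circle (u + v) s = rep_l2_circle u s + rep_l2_circle v s"
proof -
 have "u + v = abs_l2_circle (\<lambda>s. rep_l2_circle u s + rep_l2_circle v s)"
  using plus_l2_circle.abs_eq[of "rep_l2_circle u" "rep_l2_circle v"] L2_fun_rep
  by (simp add: eq_onp_def L2_eq_def)
 then show ?thesis using rep_abs_l2[OF L2_fun_add[OF L2_fun_rep L2_fun_rep]] by simp
qed

lemma rep_scale: "AE s in lborel. rep_l2_circle (l2_scale c u) s = c * rep_l2_circle u s"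
proof -
 have "l2_scale c u = abs_l2_circle (\<lambda>s. c * rep_l2_circle u s)"
  using l2_scale.abs_eq[of "rep_l2_circle u" c] L2_fun_rep
  by (simp add: eq_onp_def L2_eq_def)
 then show ?thesis using rep_abs_l2[OF L2_fun_scale[OF L2_fun_rep]] by simp
qed

lemma L2_fun_integrable: "L2_fun f ==> set_integrable lborel {0..2 * pi} f"
proof -
 assume f: "L2_fun f"
 then have [measurable]: "f \<in> borel_measurable borel" by (simp add: L2_fun_def)
 have "set_integrable lborel {0..2 * pi} (\<lambda>s. 1 + (cmod (f s))\<^sup>2)"
  using f unfolding L2_fun_def
  by (intro set_integral_add(1)[OF borel_integrable_atLeastAtMost']) auto
 then show ?thesis
 proof (rule set_integrable_bound)
  show "set_borel_measurable lborel {0..2 * pi} f" unfolding set_borel_measurable_def by measurable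
  have "x \<le> 1 + x\<^sup>2" for x :: real using zero_le_power2[of "x - 1 / 2"] by (simp add: power2_eq_square algebra_simps)
  then show "AE s in lborel. s \<in> {0..2 * pi} --> norm (f s) \<le> norm (1 + (cmod (f s))\<^sup>2)"
   by (intro AE_I2) (smt (verit) real_norm_def)
 qed
qed

lemma L2_fun_continuous:
 assumes "continuous_on UNIV f" "periodic_2pi f" shows "L2_fun f"
 unfolding L2_fun_def using assms
 by (auto intro!: borel_measurable_continuous_onI borel_integrable_atLeastAtMost' continuous_intros
   intro: continuous_on_subset)

lemma L2_fun_mult_bounded:
 assumes f: "L2_fun f" and V: "continuous_on UNIV V" "periodic_2pi V"
 shows "L2_fun (\<lambda>s. of_real (V s) * f s)"
proof -
 have [measurable]: "f \<in> borel_measurable borel" "V \<in> borel_measurable borel"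
  using f V by (auto simp: L2_fun_def intro: borel_measurable_continuous_onI)
 have "bounded (V ` {0..2 * pi})"
  by (intro compact_imp_bounded compact_continuous_image continuous_on_subset[OF V(1)]) auto
 then obtain B where "\<forall>x\<in>V ` {0..2 * pi}. norm x \<le> B" unfolding bounded_iff by blast
 then have B: "\<bar>V s\<bar> \<le> B" if "s \<in> {0..2 * pi}" for s using that by auto
 have "set_integrable lborel {0..2 * pi} (\<lambda>s. B\<^sup>2 * (cmod (f s))\<^sup>2)"
  using f unfolding L2_fun_def by (intro set_integrable_mult_right) auto
 then have "set_integrable lborel {0..2 * pi} (\<lambda>s. (cmod (of_real (V s) * f s))\<^sup>2)"
 proof (rule set_integrable_bound)
  show "set_borel_measurable lborel {0..2 * pi} (\<lambda>s. (cmod (of_real (V s) * f s))\<^sup>2)"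
   unfolding set_borel_measurable_def by measurable
  have "(V s)\<^sup>2 * (cmod (f s))\<^sup>2 \<le> B\<^sup>2 * (cmod (f s))\<^sup>2" if "s \<in> {0..2 * pi}" for s
   using power_mono[OF B[OF that], of 2] by (intro mult_right_mono) auto
  then show "AE s in lborel. s \<in> {0..2 * pi} -->
    norm ((cmod (of_real (V s) * f s))\<^sup>2) \<le> norm (B\<^sup>2 * (cmod (f s))\<^sup>2)"
   by (intro AE_I2) (auto simp: norm_mult power_mult_distrib)
 qed
 then show ?thesis using f V(2) by (auto simp: L2_fun_def periodic_2pi_def)
qed

lemma rep_l2_mult:
 assumes V: "continuous_on UNIV V" "periodic_2pi V"
 shows "AE s in lborel. rep_l2_circle (l2_mult V u) s = of_real (V s) * rep_l2_circle u s"
 unfolding l2_mult_def using rep_abs_l2 L2_fun_mult_bounded[OF L2_fun_rep V] by blast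

lemma L2_measurable: "rep_l2_circle u \<in> borel_measurable borel"
 using L2_fun_rep by (auto simp: L2_fun_def)

lemma pairing_cong:
 assumes "f \<in> borel_measurable borel" "continuous_on UNIV \<phi>" "AE s in lborel. rep_l2_circle u s = f s"
 shows "l2_pairing u \<phi> = (LINT s:{0..2 * pi}|lborel. f s * of_real (\<phi> s))"
proof -
 have [measurable]: "\<phi> \<in> borel_measurable borel" "rep_l2_circle u \<in> borel_measurable borel" "f \<in> borel_measurable borel"
  using assms L2_measurable by (auto intro: borel_measurable_continuous_onI)
 show ?thesis unfolding l2_pairing_def
  by (rule set_lebesgue_integral_cong_AE) (use assms(3) in \<open>auto elim: eventually_mono\<close>)
qed

lemma pairing_integrable:
 assumes "L2_fun f" "continuous_on UNIV \<phi>"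
 shows "set_integrable lborel {0..2 * pi} (\<lambda>s. f s * of_real (\<phi> s))"
 by (rule set_integrable_mult_continuous[OF L2_fun_integrable[OF assms(1)] assms(2)])

lemma pairing_add:
 assumes "continuous_on UNIV \<phi>" shows "l2_pairing (u + v) \<phi> = l2_pairing u \<phi> + l2_pairing v \<phi>"
proof -
 have "l2_pairing (u + v) \<phi> = (LINT s:{0..2 * pi}|lborel. (rep_l2_circle u s + rep_l2_circle v s) * of_real (\<phi> s))"
  by (rule pairing_cong) (use assms rep_add L2_measurable in \<open>auto intro: borel_measurable_add\<close>)
 also have "... = l2_pairing u \<phi> + l2_pairing v \<phi>"
  unfolding l2_pairing_def distrib_right
  by (intro set_integral_add(2) pairing_integrable L2_fun_rep assms)
 finally show ?thesis .
qed

lemma pairing_scale: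
 assumes "continuous_on UNIV \<phi>" shows "l2_pairing (l2_scale c u) \<phi> = c * l2_pairing u \<phi>"
proof -
 have "l2_pairing (l2_scale c u) \<phi> = (LINT s:{0..2 * pi}|lborel. (c * rep_l2_circle u s) * of_real (\<phi> s))"
  by (rule pairing_cong) (use assms rep_scale L2_measurable in auto)
 also have "... = c * l2_pairing u \<phi>"
  unfolding l2_pairing_def by (simp add: mult.assoc)
 finally show ?thesis .
qed

text \<open>The exceptional set is a countable union of translates of a null set.\<close>

lemma AE_periodic:
 fixes f g :: "real \<Rightarrow> complex"
 assumes [measurable]: "f \<in> borel_measurable borel" "g \<in> borel_measurable borel"
  and per: "periodic_2pi f" "periodic_2pi g"
  and ae: "AE s in lborel. s \<in> {0..2 * pi} --> f s = g s"
 shows "AE s in lborel. f s = g s"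
proof -
 have shift: "h (s + 2 * pi * of_int k) = h s" if h: "periodic_2pi h" for h :: "real \<Rightarrow> complex" and s k
 proof (induction k rule: int_induct[of _ 0])
  case (step1 i)
  then show ?case using h[unfolded periodic_2pi_def, rule_format, of "s + 2 * pi * of_int i"]
   by (simp add: algebra_simps)
 next
  case (step2 i)
  then show ?case using h[unfolded periodic_2pi_def, rule_format, of "s + 2 * pi * of_int (i - 1)"]
   by (simp add: algebra_simps)
 qed simp
 have [measurable]: "Measurable.pred borel (\<lambda>s. s \<in> {0..2 * pi} --> f s = g s)" by measurable
 have "AE s in lborel. \<forall>k::int. (2 * pi * of_int k + 1 * s) \<in> {0..2 * pi} -->
   f (2 * pi * of_int k + 1 * s) = g (2 * pi * of_int k + 1 * s)"
  unfolding AE_all_countable by (intro allI AE_borel_affine ae) auto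
 then show ?thesis
 proof eventually_elim
  case (elim s)
  define k where "k = - \<lfloor>s / (2 * pi)\<rfloor>"
  have "0 \<le> s + 2 * pi * of_int k" "s + 2 * pi * of_int k \<le> 2 * pi"
   using floor_divide_lower[of "2 * pi" s] floor_divide_upper[of "2 * pi" s]
   by (auto simp: k_def algebra_simps)
  with elim[rule_format, of k] have "f (s + 2 * pi * of_int k) = g (s + 2 * pi * of_int k)"
   by (simp add: add.commute)
  then show ?case using shift[OF per(1), of s k] shift[OF per(2), of s k] by simp
 qed
qed

lemma is_weak_deriv_unique:
 assumes "is_weak_deriv u v" "is_weak_deriv u w" shows "v = w"
proof (rule l2_eqI, rule AE_periodic)
 let ?d = "\<lambda>s. rep_l2_circle v s - rep_l2_circle w s"
 have "AE s in lborel. s \<in> {0..2 * pi} --> ?d s = 0"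
 proof (rule circle_integral_zero)
  show "set_integrable lborel {0..2 * pi} ?d"
   by (intro set_integral_diff L2_fun_integrable L2_fun_rep)
  fix \<phi> :: "real \<Rightarrow> real" assume \<phi>: "smooth \<phi>" "periodic_2pi \<phi>"
  have c: "continuous_on UNIV \<phi>" by (rule smooth_continuous[OF \<phi>(1)])
  have "(LINT s:{0..2 * pi}|lborel. ?d s * of_real (\<phi> s)) = l2_pairing v \<phi> - l2_pairing w \<phi>"
   unfolding l2_pairing_def left_diff_distrib
   by (intro set_integral_diff(2) pairing_integrable L2_fun_rep c)
  also have "... = 0" using assms \<phi> unfolding is_weak_deriv_def by (metis add_diff_cancel diff_minus_eq_add minus_minus cancel_comm_monoid_add_class.diff_cancel)
  finally show "(LINT s:{0..2 * pi}|lborel. ?d s * of_real (\<phi> s)) = 0" .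
 qed
 then show "AE s in lborel. s \<in> {0..2 * pi} --> rep_l2_circle v s = rep_l2_circle w s"
  by eventually_elim auto
qed (use L2_fun_rep in \<open>auto simp: L2_fun_def\<close>)

lemma weak_deriv_eq: "is_weak_deriv u v ==> weak_deriv u = v"
 unfolding weak_deriv_def using is_weak_deriv_unique by blast

lemma is_weak_deriv_add: "is_weak_deriv u v ==> is_weak_deriv u' v' ==> is_weak_deriv (u + u') (v + v')"
 unfolding is_weak_deriv_def
 by (auto simp: pairing_add smooth_continuous smooth_deriv)

lemma is_weak_deriv_scale: "is_weak_deriv u v ==> is_weak_deriv (l2_scale c u) (l2_scale c v)"
 unfolding is_weak_deriv_def
 by (auto simp: pairing_scale smooth_continuous smooth_deriv)

lemma periodic_deriv:
 assumes "periodic_2pi f" "\<And>s. (f has_vector_derivative f' s) (at s)" shows "periodic_2pi f'"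
proof -
 have "(f has_vector_derivative f' (s + 2 * pi)) (at s)" for s
 proof -
  have "(f \<circ> (\<lambda>s. s + 2 * pi) has_vector_derivative 1 *\<^sub>R f' (s + 2 * pi)) (at s)"
   by (rule vector_diff_chain_at) (auto intro!: derivative_eq_intros assms)
  moreover have "f \<circ> (\<lambda>s. s + 2 * pi) = f" using assms(1) by (auto simp: periodic_2pi_def)
  ultimately show ?thesis by simp
 qed
 then show ?thesis using assms(2) vector_derivative_unique_at unfolding periodic_2pi_def by blast
qed

lemma is_weak_deriv_classical:
 assumes f: "\<And>s. (f has_vector_derivative f' s) (at s)" "continuous_on UNIV f'" "periodic_2pi f"
 shows "is_weak_deriv (abs_l2_circle f) (abs_l2_circle f')"
 unfolding is_weak_deriv_def
proof (intro allI impI, elim conjE)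
 fix \<phi> assume \<phi>: "smooth \<phi>" "periodic_2pi \<phi>"
 have fc: "continuous_on S f" for S
  using f(1) by (meson continuous_at_imp_continuous_on has_vector_derivative_continuous)
 have f'c: "continuous_on S f'" for S using continuous_on_subset[OF f(2)] by auto
 have \<phi>c: "continuous_on S \<phi>" "continuous_on S (deriv \<phi>)" for S
  using \<phi> smooth_continuous smooth_deriv by blast+
 have L: "L2_fun f" "L2_fun f'"
  using L2_fun_continuous fc f'c f periodic_deriv[OF f(3,1)] by auto
 have m: "f \<in> borel_measurable borel" "f' \<in> borel_measurable borel" using L by (auto simp: L2_fun_def)
 have "((\<lambda>s. f s * of_real (deriv \<phi> s) + f' s * of_real (\<phi> s)) has_integral
   f (2 * pi) * of_real (\<phi> (2 * pi)) - f 0 * of_real (\<phi> 0)) {0..2 * pi}"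
 proof (rule fundamental_theorem_of_calculus)
  fix s
  have "(\<phi> has_vector_derivative deriv \<phi> s) (at s)"
   using smooth_has_derivative[OF \<phi>(1)] by (simp add: has_real_derivative_iff_has_vector_derivative)
  then have "((\<lambda>s. complex_of_real (\<phi> s)) has_vector_derivative of_real (deriv \<phi> s)) (at s)"
   by (rule bounded_linear.has_vector_derivative[OF bounded_linear_of_real])
  from has_vector_derivative_mult[OF f(1) this]
  show "((\<lambda>s. f s * of_real (\<phi> s)) has_vector_derivative f s * of_real (deriv \<phi> s) + f' s * of_real (\<phi> s)) (at s within {0..2 * pi})"
   by (rule has_vector_derivative_at_within)
 qed simp
 moreover have "f (2 * pi) * of_real (\<phi> (2 * pi)) - f 0 * of_real (\<phi> 0) = 0"
  using f(3) \<phi>(2) unfolding periodic_2pi_def by (metis add_0 cancel_comm_monoid_add_class.diff_cancel)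
 moreover have "set_integrable lborel {0..2 * pi} (\<lambda>s. f s * of_real (deriv \<phi> s) + f' s * of_real (\<phi> s))"
  by (intro borel_integrable_atLeastAtMost' continuous_intros fc f'c \<phi>c)
 ultimately have "(LINT s:{0..2 * pi}|lborel. f s * of_real (deriv \<phi> s) + f' s * of_real (\<phi> s)) = 0"
  using set_borel_integral_eq_integral(2) by (metis integral_unique)
 moreover have "(LINT s:{0..2 * pi}|lborel. f s * of_real (deriv \<phi> s) + f' s * of_real (\<phi> s))
   = (LINT s:{0..2 * pi}|lborel. f s * of_real (deriv \<phi> s)) + (LINT s:{0..2 * pi}|lborel. f' s * of_real (\<phi> s))"
  by (intro set_integral_add(2) borel_integrable_atLeastAtMost' continuous_intros fc f'c \<phi>c)
 ultimately show "l2_pairing (abs_l2_circle f) (deriv \<phi>) = - l2_pairing (abs_l2_circle f') \<phi>"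
  using pairing_cong[OF m(1) \<phi>c(2) rep_abs_l2(2)[OF L(1)]] pairing_cong[OF m(2) \<phi>c(1) rep_abs_l2(2)[OF L(2)]]
  by (simp add: eq_neg_iff_add_eq_0)
qed

section \<open>Floquet solutions of a symmetric equation\<close>

definition floquet :: "(real \<Rightarrow> real) \<Rightarrow> complex \<Rightarrow> (real \<Rightarrow> complex) set" where
 "floquet q z = {x. (\<exists>x'. solves_on UNIV q x x') \<and> (\<forall>s. x (s + 2 * pi) = z * x s)}"

lemma solves_on_of_real:
 fixes u u' :: "real \<Rightarrow> real"
 assumes "solves_on S q u u'"
 shows "solves_on S q (\<lambda>s. c * complex_of_real (u s)) (\<lambda>s. c * complex_of_real (u' s))"
 using solves_on_bounded_linear[OF bounded_linear_compose[OF bounded_linear_mult_right bounded_linear_of_real] assms, of c] .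

lemma floquetI:
 assumes sol: "solves_on UNIV q x x'" and q: "\<And>s. \<bar>q s\<bar> \<le> Q" "periodic_2pi q"
  and "x pi = z * x (- pi)" "x' pi = z * x' (- pi)"
 shows "x \<in> floquet q z"
proof -
 have "solves_on UNIV q (\<lambda>s. x (2 * pi + 1 * s)) (\<lambda>s. 1 *\<^sub>R x' (2 * pi + 1 * s))"
 proof -
  have "(\<lambda>s. q (2 * pi + 1 * s)) = q" using q(2) by (auto simp: periodic_2pi_def add.commute)
  then show ?thesis using solves_on_affine[OF sol, of 1 "2 * pi"] by simp
 qed
 then have "(\<lambda>s. x (2 * pi + 1 * s)) = (\<lambda>s. z * x s)"
  by (rule solves_UNIV_unique(1)[OF _ solves_on_bounded_linear[OF bounded_linear_mult_right sol] q(1), of _ _ "- pi"])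
    (use assms in auto)
 then have "x (s + 2 * pi) = z * x s" for s by (metis add.commute mult_1)
 then show ?thesis using sol by (auto simp: floquet_def)
qed

text \<open>\<open>N\<close> and \<open>D\<close> have Neumann and Dirichlet data at the midpoint; they are the even and the
odd solution if \<open>q\<close> is symmetric about it. Their logarithmic derivatives at \<open>0\<close> are \<open>\<delta> - d\<close> and
\<open>- d\<close>; since the Wronskian is constant, \<open>\<delta> = - 1 / (N 0 * D 0)\<close>.\<close>

definition half_response :: "(real \<Rightarrow> real) \<Rightarrow> real \<Rightarrow> real \<Rightarrow> bool" where
 "half_response q d \<delta> \<longleftrightarrow> (\<exists>N N' D D'. solves_on UNIV q N N' \<and> solves_on UNIV q D D' \<and>
   N (pi / 2) = 1 \<and> N' (pi / 2) = 0 \<and> D (pi / 2) = 0 \<and> D' (pi / 2) = (1::real) \<and>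
   N 0 \<noteq> 0 \<and> D 0 \<noteq> 0 \<and> D' 0 = - d * D 0 \<and> N' 0 = (\<delta> - d) * N 0)"

text \<open>The two sides solve the same equation with the same data at the midpoint \<open>\<pi> / 2\<close>.\<close>

lemma reflected_solutions:
 fixes u u' :: "real \<Rightarrow> real"
 assumes u: "solves_on UNIV q u u'" and q: "\<And>s. \<bar>q s\<bar> \<le> Q" "\<And>s. q (pi - s) = q s"
  and c: "c = 1 \<or> c = - 1" "u (pi / 2) = c * u (pi / 2)" "- u' (pi / 2) = c * u' (pi / 2)"
 shows "u (pi - s) = c * u s" "u' (pi - s) = - c * u' s"
proof -
 have "(\<lambda>s. q (pi + - 1 * s)) = q" using q by auto
 then have r: "solves_on UNIV q (\<lambda>s. u (pi + - 1 * s)) (\<lambda>s. (- 1) *\<^sub>R u' (pi + - 1 * s))"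
  using solves_on_affine[OF u, of "- 1" pi] by simp
 have l: "solves_on UNIV q (\<lambda>s. c * u s) (\<lambda>s. c * u' s)"
  by (rule solves_on_bounded_linear[OF bounded_linear_mult_right u])
 have "(\<lambda>s. u (pi + - 1 * s)) = (\<lambda>s. c * u s)" "(\<lambda>s. (- 1) *\<^sub>R u' (pi + - 1 * s)) = (\<lambda>s. c * u' s)"
  using solves_UNIV_unique[OF r l q(1), of "pi / 2"] c by auto
 then show "u (pi - s) = c * u s" "u' (pi - s) = - c * u' s"
  by (auto simp: fun_eq_iff) (metis minus_minus)
qed

text \<open>On the left half-circle take \<open>G\<close> times the even and \<open>G'\<close> times the odd solution about \<open>- \<pi> / 2\<close>,
normalised at \<open>0\<close>, and continue across the right half-circle with the corresponding combination there.
Reflection about the midpoints turns continuity of \<open>x\<close> and \<open>x'\<close> at \<open>\<pi>\<close>, up to the factor \<open>z\<close>, into the two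
linear equations in the hypotheses.\<close>

lemma floquet_from_amplitudes:
 fixes z G G' :: complex
 assumes q: "\<And>s. \<bar>q s\<bar> \<le> Q" "periodic_2pi q" "\<And>s. q (pi - s) = q s"
  and r: "half_response q dr \<delta>r" and l: "half_response (\<lambda>s. q (- s)) dl \<delta>l"
  and e1: "(1 - z) * (\<delta>l - dl - dr) * G = (1 + z) * (dr + dl) * G'"
  and e2: "(1 + z) * (\<delta>r - dr + \<delta>l - dl) * G = (1 - z) * (dl - (\<delta>r - dr)) * G'"
 shows "\<exists>x x'. x \<in> floquet q z \<and> solves_on UNIV q x x' \<and> x 0 = G + G' \<and> x' 0 = dl * G' - (\<delta>l - dl) * G"
proof -
 obtain N N' D D' where N: "solves_on UNIV q N N'" and D: "solves_on UNIV q D D'" and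
   ND: "N (pi / 2) = 1" "N' (pi / 2) = 0" "D (pi / 2) = 0" "D' (pi / 2) = (1::real)"
   "N 0 \<noteq> 0" "D 0 \<noteq> 0" "D' 0 = - dr * D 0" "N' 0 = (\<delta>r - dr) * N 0"
  using r unfolding half_response_def by blast
 obtain M M' C C' where M: "solves_on UNIV (\<lambda>s. q (- s)) M M'" and C: "solves_on UNIV (\<lambda>s. q (- s)) C C'" and
   MC: "M (pi / 2) = 1" "M' (pi / 2) = 0" "C (pi / 2) = 0" "C' (pi / 2) = (1::real)"
   "M 0 \<noteq> 0" "C 0 \<noteq> 0" "C' 0 = - dl * C 0" "M' 0 = (\<delta>l - dl) * M 0"
  using l unfolding half_response_def by blast
 have qm: "q (- (pi - s)) = q (- s)" for s
  using q(3)[of "2 * pi - s"] q(2)[unfolded periodic_2pi_def, rule_format, of "- s"] by (simp add: algebra_simps)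
 have qmb: "\<bar>q (- s)\<bar> \<le> Q" for s using q by auto
 have Npi: "N pi = N 0" "N' pi = - N' 0" "D pi = - D 0" "D' pi = D' 0"
  using reflected_solutions[OF N q(1,3), of 1 0] reflected_solutions[OF D q(1,3), of "- 1" 0] ND by auto
 have Mpi: "M pi = M 0" "M' pi = - M' 0" "C pi = - C 0" "C' pi = C' 0"
  using reflected_solutions[OF M qmb qm, of 1 0] reflected_solutions[OF C qmb qm, of "- 1" 0] MC by auto
 define A where "A = ((1 + z) * G + (1 - z) * G') / 2"
 define A' where "A' = ((1 - z) * G + (1 + z) * G') / 2"
 define X where "X = (\<lambda>s. (A / N 0) * complex_of_real (N s) + (A' / D 0) * complex_of_real (D s))"
 define X' where "X' = (\<lambda>s. (A / N 0) * complex_of_real (N' s) + (A' / D 0) * complex_of_real (D' s))"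
 have X: "solves_on UNIV q X X'"
  unfolding X_def X'_def by (intro solves_on_lincomb(1) solves_on_of_real N D)
 define Y where "Y = (\<lambda>s. (G / M 0) * complex_of_real (M s) + (G' / C 0) * complex_of_real (C s))"
 define Y' where "Y' = (\<lambda>s. (G / M 0) * complex_of_real (M' s) + (G' / C 0) * complex_of_real (C' s))"
 have "solves_on UNIV (\<lambda>s. q (- s)) Y Y'"
  unfolding Y_def Y'_def by (intro solves_on_lincomb(1) solves_on_of_real M C)
 from solves_on_affine[OF this, of "- 1" 0]
 have Y: "solves_on UNIV q (\<lambda>s. Y (- s)) (\<lambda>s. - Y' (- s))" by simp
 have X0: "X 0 = A + A'" "X' 0 = (\<delta>r - dr) * A - dr * A'" using ND by (auto simp: X_def X'_def)
 have Y0: "Y 0 = G + G'" "Y' 0 = (\<delta>l - dl) * G - dl * G'" using MC by (auto simp: Y_def Y'_def)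
 have Xpi: "X pi = A - A'" "X' pi = - (\<delta>r - dr) * A - dr * A'" unfolding X_def X'_def Npi ND(7,8) using ND(5,6) by (simp_all add: field_simps)
 have Ypi: "Y pi = G - G'" "Y' pi = - (\<delta>l - dl) * G - dl * G'" unfolding Y_def Y'_def Mpi MC(7,8) using MC(5,6) by (simp_all add: field_simps)
 have AA: "A + A' = G + G'" "A - A' = z * (G - G')" by (auto simp: A_def A'_def field_simps)
 have A2: "2 * A = (1 + z) * G + (1 - z) * G'" "2 * A' = (1 - z) * G + (1 + z) * G'"
  by (simp_all add: A_def A'_def)
 have s1: "- 2 * dr * A' = (z - 1) * (\<delta>l - dl) * G + (z + 1) * dl * G'"
 proof -
  have "- 2 * dr * A' = - dr * (2 * A')" by simp
  also have "... = (z - 1) * (\<delta>l - dl) * G + (z + 1) * dl * G'"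
   unfolding A2 using e1 by (simp add: algebra_simps)
  finally show ?thesis .
 qed
 have s2: "2 * (\<delta>r - dr) * A = - (1 + z) * (\<delta>l - dl) * G + (1 - z) * dl * G'"
 proof -
  have "2 * (\<delta>r - dr) * A = (\<delta>r - dr) * (2 * A)" by simp
  also have "... = - (1 + z) * (\<delta>l - dl) * G + (1 - z) * dl * G'"
   unfolding A2 using e2 by (simp add: algebra_simps)
  finally show ?thesis .
 qed
 have k1: "2 * X' 0 = 2 * (dl * G' - (\<delta>l - dl) * G)"
 proof -
  have "2 * X' 0 = 2 * (\<delta>r - dr) * A + - 2 * dr * A'" by (simp add: X0 algebra_simps)
  also have "... = 2 * (dl * G' - (\<delta>l - dl) * G)" unfolding s1 s2 by (simp add: algebra_simps)
  finally show ?thesis .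
 qed
 have k2: "2 * X' pi = 2 * (z * (- Y' pi))"
 proof -
  have "2 * X' pi = - (2 * (\<delta>r - dr) * A) + - 2 * dr * A'" by (simp add: Xpi algebra_simps)
  also have "... = 2 * (z * (- Y' pi))" unfolding s1 s2 Ypi by (simp add: algebra_simps)
  finally show ?thesis .
 qed
 have k1': "X' 0 = dl * G' - (\<delta>l - dl) * G" and k2': "X' pi = z * (- Y' pi)"
  using k1 k2 by (metis mult_left_cancel zero_neq_numeral)+
 have "X 0 = Y (- 0)" "X' 0 = - Y' (- 0)" using X0(1) Y0 AA k1' by auto
 then have XY: "X = (\<lambda>s. Y (- s))" "X' = (\<lambda>s. - Y' (- s))"
  using solves_UNIV_unique[OF X Y q(1), of 0] by auto
 have "X \<in> floquet q z"
 proof (rule floquetI[OF X q(1,2)])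
  have "X (- pi) = Y pi" "X' (- pi) = - Y' pi" by (simp_all add: XY)
  then show "X pi = z * X (- pi)" "X' pi = z * X' (- pi)"
   using k2' Xpi(1) Ypi(1) AA by auto
 qed
 then show ?thesis using X k1' X0(1) AA by (intro exI[of _ X] exI[of _ X']) auto
qed

lemma kernel_2x2:
 fixes a b c d :: complex
 assumes "a * d = b * c"
 shows "\<exists>G G'. (G \<noteq> 0 \<or> G' \<noteq> 0) \<and> a * G = b * G' \<and> c * G = d * G'"
proof (cases "a = 0 \<and> b = 0")
 case True
 show ?thesis
 proof (cases "c = 0 \<and> d = 0")
  case True
  with \<open>a = 0 \<and> b = 0\<close> show ?thesis by (intro exI[of _ 1]) auto
 next
  case False
  with \<open>a = 0 \<and> b = 0\<close> show ?thesis by (intro exI[of _ d] exI[of _ c]) auto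
 qed
next
 case False
 then show ?thesis using assms by (intro exI[of _ b] exI[of _ a]) (auto simp: mult.commute)
qed

text \<open>On the unit circle \<open>(1 - z)\<^sup>2\<close> and \<open>(1 + z)\<^sup>2\<close> are real multiples of \<open>z\<close>; the secular determinant is
therefore \<open>z\<close> times a real number.\<close>

lemma unit_circle_squares:
 fixes z :: complex
 assumes "cmod z = 1"
 shows "(1 - z)\<^sup>2 = - z * of_real (2 - 2 * Re z)" "(1 + z)\<^sup>2 = z * of_real (2 + 2 * Re z)"
  "(cmod (of_real a + of_real b * z))\<^sup>2 = a\<^sup>2 + b\<^sup>2 + 2 * a * b * Re z"
proof -
 have 1: "z * cnj z = 1" using complex_norm_square[of z] assms by simp
 have 2: "complex_of_real (2 * Re z) = z + cnj z" by (simp add: complex_add_cnj)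
 have "(1 - z)\<^sup>2 = 1 - 2 * z + z * z" by (simp add: power2_eq_square algebra_simps)
 also have "... = - z * (2 - (z + cnj z))" using 1 by (simp add: algebra_simps)
 finally show "(1 - z)\<^sup>2 = - z * of_real (2 - 2 * Re z)" using 2 by simp
 have "(1 + z)\<^sup>2 = 1 + 2 * z + z * z" by (simp add: power2_eq_square algebra_simps)
 also have "... = z * (2 + (z + cnj z))" using 1 by (simp add: algebra_simps)
 finally show "(1 + z)\<^sup>2 = z * of_real (2 + 2 * Re z)" using 2 by simp
 have "(Re z)\<^sup>2 + (Im z)\<^sup>2 = 1" using assms by (metis cmod_power2 one_power2)
 then have "b\<^sup>2 * ((Re z)\<^sup>2 + (Im z)\<^sup>2) = b\<^sup>2" by simp
 then show "(cmod (of_real a + of_real b * z))\<^sup>2 = a\<^sup>2 + b\<^sup>2 + 2 * a * b * Re z"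
  unfolding cmod_power2 by (simp add: power2_eq_square algebra_simps)
qed

text \<open>The hypothesis \<open>root\<close> is the vanishing of the determinant of the system in
\<open>floquet_from_amplitudes\<close>, after division by \<open>z\<close>.\<close>

lemma floquet_root:
 fixes z :: complex
 assumes q: "\<And>s. \<bar>q s\<bar> \<le> Q" "periodic_2pi q" "\<And>s. q (pi - s) = q s"
  and r: "half_response q dr \<delta>r" and l: "half_response (\<lambda>s. q (- s)) dl \<delta>l"
  and z: "cmod z = 1" and \<delta>l: "\<delta>l \<noteq> 0"
  and root: "4 * (dr + dl - (\<delta>r + \<delta>l) / 2)\<^sup>2 = (cmod (of_real \<delta>r + of_real \<delta>l * z))\<^sup>2"
 shows "\<exists>x \<in> floquet q z. x \<noteq> (\<lambda>_. 0)"
proof -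
 let ?a = "(1 - z) * (\<delta>l - dl - dr)" and ?b = "(1 + z) * (dr + dl)"
 let ?c = "(1 + z) * (\<delta>r - dr + \<delta>l - dl)" and ?d = "(1 - z) * (dl - (\<delta>r - dr))"
 have real: "- (2 - 2 * Re z) * ((\<delta>l - dl - dr) * (dl - (\<delta>r - dr))) = (2 + 2 * Re z) * ((dr + dl) * (\<delta>r - dr + \<delta>l - dl))"
  using root unfolding unit_circle_squares(3)[OF z] by (simp add: power2_eq_square field_simps)
 have "?a * ?d = (1 - z)\<^sup>2 * of_real ((\<delta>l - dl - dr) * (dl - (\<delta>r - dr)))"
  by (simp add: power2_eq_square mult_ac)
 also have "... = z * of_real (- (2 - 2 * Re z) * ((\<delta>l - dl - dr) * (dl - (\<delta>r - dr))))"
  unfolding unit_circle_squares(1)[OF z] by (simp only: of_real_mult of_real_minus mult_minus_left mult_minus_right mult.assoc)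
 also have "... = (1 + z)\<^sup>2 * of_real ((dr + dl) * (\<delta>r - dr + \<delta>l - dl))"
  unfolding real unit_circle_squares(2)[OF z] by (simp only: of_real_mult mult.assoc)
 also have "... = ?b * ?c" by (simp add: power2_eq_square mult_ac)
 finally obtain G G' where G: "G \<noteq> 0 \<or> G' \<noteq> 0" "?a * G = ?b * G'" "?c * G = ?d * G'"
  using kernel_2x2 by blast
 then obtain x x' where x: "x \<in> floquet q z" "solves_on UNIV q x x'" "x 0 = G + G'" "x' 0 = dl * G' - (\<delta>l - dl) * G"
  using floquet_from_amplitudes[OF q r l, of z G G'] by auto
 have "x \<noteq> (\<lambda>_. 0)"
 proof
  assume x0: "x = (\<lambda>_. 0)"
  have "solves_on UNIV q (\<lambda>_. 0) (\<lambda>_. 0::complex)" by (simp add: solves_on_def)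
  moreover have "x' 0 = 0"
   using x(2) x0 vector_derivative_unique_at[of "\<lambda>_. 0" "x' 0" 0 0] by (auto simp: solves_on_def)
  ultimately have "G' = - G" "dl * G' = (\<delta>l - dl) * G" using x x0 by (auto simp: add_eq_0_iff)
  then have "\<delta>l * G = 0" by (simp add: algebra_simps)
  with \<delta>l G(1) \<open>G' = - G\<close> show False by auto
 qed
 then show ?thesis using x by blast
qed

text \<open>Here \<open>z = - 1\<close> and \<open>\<delta>r = \<delta>l = dr + dl\<close>: all four coefficients of the amplitude equations vanish,
and every pair of amplitudes gives a solution.\<close>

lemma floquet_double_root:
 fixes z :: complex
 assumes q: "\<And>s. \<bar>q s\<bar> \<le> Q" "periodic_2pi q" "\<And>s. q (pi - s) = q s"
  and r: "half_response q dr \<delta>r" and l: "half_response (\<lambda>s. q (- s)) dl \<delta>l"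
  and z: "cmod z = 1" and \<delta>: "\<delta>l > 0" "\<delta>r > 0"
  and root: "dr + dl = (\<delta>r + \<delta>l) / 2" "of_real \<delta>r + of_real \<delta>l * z = 0"
 shows "\<exists>x \<in> floquet q z. \<exists>y \<in> floquet q z. \<forall>a b. (\<forall>s. a * x s + b * y s = 0) --> a = 0 \<and> b = 0"
proof -
 have "of_real \<delta>l * z = - of_real \<delta>r" using root(2) by (simp add: add_eq_0_iff)
 then have "cmod (of_real \<delta>l * z) = cmod (- of_real \<delta>r)" by simp
 then have eq: "\<delta>l = \<delta>r" using z \<delta> by (simp add: norm_mult)
 then have zz: "z = - 1" using \<open>of_real \<delta>l * z = - of_real \<delta>r\<close> \<delta> by (metis mult_cancel_left mult_minus1_right of_real_eq_0_iff less_irrefl)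
 have d: "\<delta>l = dr + dl" "\<delta>r = dr + dl" using root eq by auto
 obtain x x' where x: "x \<in> floquet q z" "solves_on UNIV q x x'" "x 0 = 1" "x' 0 = - dr"
  using floquet_from_amplitudes[OF q r l, of z 1 0] by (auto simp: zz d)
 obtain y y' where y: "y \<in> floquet q z" "solves_on UNIV q y y'" "y 0 = 1" "y' 0 = dl"
  using floquet_from_amplitudes[OF q r l, of z 0 1] by (auto simp: zz d)
 have "a = 0 \<and> b = 0" if ab: "\<forall>s. a * x s + b * y s = 0" for a b
 proof -
  have "((\<lambda>s. a * x s + b * y s) has_vector_derivative a * x' 0 + b * y' 0) (at 0)"
   using x(2) y(2) by (auto simp: solves_on_def intro!: derivative_intros)
  then have "((\<lambda>s. 0) has_vector_derivative a * x' 0 + b * y' 0) (at (0::real))" using ab by simp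
  then have "a * x' 0 + b * y' 0 = 0"
   using vector_derivative_unique_at[of "\<lambda>_. 0" _ 0 0] by auto
  moreover have ab0: "b = - a" using ab[rule_format, of 0] x y by (simp add: add_eq_0_iff)
  ultimately have "- (a * of_real (dr + dl)) = 0" unfolding x(4) y(4) ab0 by (simp add: algebra_simps)
  moreover have "complex_of_real (dr + dl) \<noteq> 0" using d \<delta> by (simp only: of_real_eq_0_iff)
  ultimately show ?thesis using ab0 by (simp del: of_real_add)
 qed
 then show ?thesis using x y by blast
qed

section \<open>Eigenfunctions are gauged Floquet solutions\<close>

text \<open>The phase is periodic up to the factor that a Floquet solution with multiplier
\<open>cis (2 \<pi> \<xi> / h)\<close> compensates.\<close>

definition mag_gauge :: "real \<Rightarrow> real \<Rightarrow> (real \<Rightarrow> complex) \<Rightarrow> l2_circle" where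
 "mag_gauge \<xi> h x = abs_l2_circle (\<lambda>s. cis (- (\<xi> * s / h)) * x s)"

lemma scale_abs: "L2_fun f ==> l2_scale c (abs_l2_circle f) = abs_l2_circle (\<lambda>s. c * f s)"
 using l2_scale.abs_eq[of f c] by (simp add: eq_onp_def L2_eq_def)

lemma add_abs: "L2_fun f ==> L2_fun g ==> abs_l2_circle f + abs_l2_circle g = abs_l2_circle (\<lambda>s. f s + g s)"
 using plus_l2_circle.abs_eq[of f g] by (simp add: eq_onp_def L2_eq_def)

lemma mult_abs:
 assumes "L2_fun f" "continuous_on UNIV V" "periodic_2pi V"
 shows "l2_mult V (abs_l2_circle f) = abs_l2_circle (\<lambda>s. of_real (V s) * f s)"
proof -
 have "AE s in lborel. of_real (V s) * rep_l2_circle (abs_l2_circle f) s = of_real (V s) * f s"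
  using rep_abs_l2(2)[OF assms(1)] by eventually_elim simp
 then show ?thesis unfolding l2_mult_def
  by (simp only: abs_l2_eq_iff[OF L2_fun_mult_bounded[OF L2_fun_rep assms(2,3)] L2_fun_mult_bounded[OF assms]])
qed

lemma periodic_shift:
 assumes "periodic_2pi f"
 shows "f (s + 2 * pi * of_int k) = f s"
proof (induction k rule: int_induct[of _ 0])
 case (step1 i)
 then show ?case using assms[unfolded periodic_2pi_def, rule_format, of "s + 2 * pi * of_int i"]
  by (simp add: algebra_simps)
next
 case (step2 i)
 then show ?case using assms[unfolded periodic_2pi_def, rule_format, of "s + 2 * pi * of_int (i - 1)"]
  by (simp add: algebra_simps)
qed simp

lemma periodic_bounded:
 fixes f :: "real \<Rightarrow> real"
 assumes "continuous_on UNIV f" "periodic_2pi f"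
 shows "\<exists>B. \<forall>s. \<bar>f s\<bar> \<le> B"
proof -
 have "bounded (f ` {0..2 * pi})"
  by (intro compact_imp_bounded compact_continuous_image continuous_on_subset[OF assms(1)]) auto
 then obtain B where "\<forall>x\<in>f ` {0..2 * pi}. norm x \<le> B" unfolding bounded_iff by blast
 then have B: "\<And>s. s \<in> {0..2 * pi} ==> \<bar>f s\<bar> \<le> B" by auto
 have "\<bar>f s\<bar> \<le> B" for s
 proof -
  define k where "k = - \<lfloor>s / (2 * pi)\<rfloor>"
  have "0 \<le> s + 2 * pi * of_int k" "s + 2 * pi * of_int k \<le> 2 * pi"
   using floor_divide_lower[of "2 * pi" s] floor_divide_upper[of "2 * pi" s]
   by (auto simp: k_def algebra_simps)
  then show ?thesis using B[of "s + 2 * pi * of_int k"] periodic_shift[OF assms(2), of s k] by simp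
 qed
 then show ?thesis by blast
qed

lemma cis_gauge_deriv: "((\<lambda>s. cis (a * s)) has_vector_derivative \<i> * of_real a * cis (a * s)) (at s within S)"
 unfolding has_vector_derivative_def
 by (auto intro!: derivative_eq_intros simp: scaleR_conv_of_real)

text \<open>The gauge conjugates \<open>h D + \<xi>\<close> into \<open>h D\<close>.\<close>

lemma gauge_momentum:
 assumes h: "h > 0" and x: "\<And>s. (x has_vector_derivative x' s) (at s)" "continuous_on UNIV x'"
  and per: "\<And>s. x (s + 2 * pi) = cis (2 * pi * \<xi> / h) * x s"
 shows "mag_gauge \<xi> h x \<in> H1_circle"
  and "magnetic_momentum \<xi> h (mag_gauge \<xi> h x) = mag_gauge \<xi> h (\<lambda>s. - \<i> * of_real h * x' s)"
  and "weak_deriv (mag_gauge \<xi> h x) = mag_gauge \<xi> h (\<lambda>s. x' s - \<i> * of_real (\<xi> / h) * x s)"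
  and "\<And>s. x' (s + 2 * pi) = cis (2 * pi * \<xi> / h) * x' s"
  and "L2_fun (\<lambda>s. cis (- (\<xi> * s / h)) * x s)"
proof -
 define u where "u = (\<lambda>s. cis (- (\<xi> * s / h)) * x s)"
 define u' where "u' = (\<lambda>s. cis (- (\<xi> * s / h)) * (x' s - \<i> * of_real (\<xi> / h) * x s))"
 have xc: "continuous_on UNIV x"
  using x(1) by (meson continuous_at_imp_continuous_on has_vector_derivative_continuous)
 have "(u has_vector_derivative u' s) (at s)" for s
  unfolding u_def
  using has_vector_derivative_mult[OF cis_gauge_deriv[of "- (\<xi> / h)" s UNIV] x(1)[of s]]
  by (simp add: u'_def algebra_simps)
 moreover have c': "continuous_on UNIV u'" unfolding u'_def by (intro continuous_intros x xc) (use h in auto)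
 moreover have "periodic_2pi u"
  unfolding periodic_2pi_def
 proof
  fix s
  have "u (s + 2 * pi) = (cis (- (\<xi> * (s + 2 * pi) / h)) * cis (2 * pi * \<xi> / h)) * x s"
   by (simp add: u_def per)
  also have "cis (- (\<xi> * (s + 2 * pi) / h)) * cis (2 * pi * \<xi> / h) = cis (- (\<xi> * s / h))"
   using h by (simp add: cis_mult field_simps)
  finally show "u (s + 2 * pi) = u s" by (simp add: u_def)
 qed
 ultimately have wd: "is_weak_deriv (abs_l2_circle u) (abs_l2_circle u')"
  and p': "periodic_2pi u'" and p: "periodic_2pi u"
  using is_weak_deriv_classical periodic_deriv by blast+
 have uc: "continuous_on UNIV u" unfolding u_def by (intro continuous_intros xc) (use h in auto)
 have L: "L2_fun u" "L2_fun u'" using L2_fun_continuous uc c' p p' by auto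
 show "L2_fun (\<lambda>s. cis (- (\<xi> * s / h)) * x s)" using L by (simp add: u_def)
 have g: "mag_gauge \<xi> h x = abs_l2_circle u" by (simp add: mag_gauge_def u_def)
 show "mag_gauge \<xi> h x \<in> H1_circle" using wd by (auto simp: g H1_circle_def)
 show w: "weak_deriv (mag_gauge \<xi> h x) = mag_gauge \<xi> h (\<lambda>s. x' s - \<i> * of_real (\<xi> / h) * x s)"
  unfolding g weak_deriv_eq[OF wd] by (simp add: mag_gauge_def u'_def)
 have "magnetic_momentum \<xi> h (mag_gauge \<xi> h x) = l2_scale (of_real h) (l2_scale (- \<i>) (abs_l2_circle u')) + l2_scale (of_real \<xi>) (abs_l2_circle u)"
  unfolding magnetic_momentum_def D_s_def g weak_deriv_eq[OF wd] ..
 also have "... = abs_l2_circle (\<lambda>s. of_real h * (- \<i> * u' s) + of_real \<xi> * u s)"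
  using L by (simp only: scale_abs add_abs L2_fun_scale)
 also have "(\<lambda>s. of_real h * (- \<i> * u' s) + of_real \<xi> * u s) = (\<lambda>s. cis (- (\<xi> * s / h)) * (- \<i> * of_real h * x' s))"
  using h by (auto simp: u_def u'_def fun_eq_iff field_simps)
 finally show "magnetic_momentum \<xi> h (mag_gauge \<xi> h x) = mag_gauge \<xi> h (\<lambda>s. - \<i> * of_real h * x' s)"
  by (simp add: mag_gauge_def)
 show "x' (s + 2 * pi) = cis (2 * pi * \<xi> / h) * x' s" for s
 proof -
  have "(x \<circ> (\<lambda>s. s + 2 * pi) has_vector_derivative 1 *\<^sub>R x' (s + 2 * pi)) (at s)"
   by (rule vector_diff_chain_at) (auto intro!: derivative_eq_intros x)
  moreover have "x \<circ> (\<lambda>s. s + 2 * pi) = (\<lambda>s. cis (2 * pi * \<xi> / h) * x s)"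
   using per by (simp add: o_def)
  ultimately have 1: "((\<lambda>s. cis (2 * pi * \<xi> / h) * x s) has_vector_derivative x' (s + 2 * pi)) (at s)" by simp
  have 2: "((\<lambda>s. cis (2 * pi * \<xi> / h) * x s) has_vector_derivative cis (2 * pi * \<xi> / h) * x' s) (at s)"
   by (rule has_vector_derivative_mult_right[OF x(1)])
  show ?thesis by (rule vector_derivative_unique_at[OF 1 2])
 qed
qed

lemma gauge_floquet_eigen:
 assumes h: "h > 0" and V: "continuous_on UNIV V" "periodic_2pi V"
  and x: "x \<in> floquet (\<lambda>s. (V s - lam) / h\<^sup>2) (cis (2 * pi * \<xi> / h))"
 shows "mag_gauge \<xi> h x \<in> eigenspace V \<xi> h lam"
proof -
 obtain x' where sol: "solves_on UNIV (\<lambda>s. (V s - lam) / h\<^sup>2) x x'" and per: "\<And>s. x (s + 2 * pi) = cis (2 * pi * \<xi> / h) * x s"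
  using x by (auto simp: floquet_def)
 define x'' where "x'' = (\<lambda>s. ((V s - lam) / h\<^sup>2) *\<^sub>R x s)"
 have d1: "(x has_vector_derivative x' s) (at s)" and d2: "(x' has_vector_derivative x'' s) (at s)" for s
  using sol by (auto simp: solves_on_def x''_def)
 have c: "continuous_on UNIV x" "continuous_on UNIV x'"
  using d1 d2 by (meson continuous_at_imp_continuous_on has_vector_derivative_continuous)+
 have c2: "continuous_on UNIV x''" unfolding x''_def by (intro continuous_intros V c) (use h in auto)
 note G1 = gauge_momentum[OF h d1 c(2) per]
 define y where "y = (\<lambda>s. x' s - \<i> * of_real (\<xi> / h) * x s)"
 define m where "m = (\<lambda>s. - \<i> * of_real h * x' s)"
 have dy: "(y has_vector_derivative x'' s - \<i> * of_real (\<xi> / h) * x' s) (at s)" for s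
  unfolding y_def by (intro derivative_intros d1 d2)
 have cy: "continuous_on UNIV (\<lambda>s. x'' s - \<i> * of_real (\<xi> / h) * x' s)" by (intro continuous_intros c c2)
 have py: "y (s + 2 * pi) = cis (2 * pi * \<xi> / h) * y s" for s
  unfolding y_def G1(4)[of s] per by (simp add: algebra_simps)
 note G2 = gauge_momentum[OF h dy cy py]
 have dm: "(m has_vector_derivative - \<i> * of_real h * x'' s) (at s)" for s
  unfolding m_def by (intro derivative_intros d1 d2)
 have cm: "continuous_on UNIV (\<lambda>s. - \<i> * of_real h * x'' s)" by (intro continuous_intros c2)
 have pm: "m (s + 2 * pi) = cis (2 * pi * \<xi> / h) * m s" for s
  unfolding m_def G1(4)[of s] by (simp add: algebra_simps)
 note G3 = gauge_momentum[OF h dm cm pm]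
 have H2: "mag_gauge \<xi> h x \<in> H2_circle"
  using G1(1,3) G2(1) by (simp add: H2_circle_def y_def)
 have mm: "magnetic_momentum \<xi> h (magnetic_momentum \<xi> h (mag_gauge \<xi> h x)) = mag_gauge \<xi> h (\<lambda>s. - of_real (h\<^sup>2) * x'' s)"
 proof -
  have "- \<i> * of_real h * (- \<i> * of_real h * y) = - of_real (h\<^sup>2) * y" for y
   by (simp add: power2_eq_square complex_eq_iff algebra_simps)
  then show ?thesis using G1(2) G3(2) unfolding m_def by simp
 qed
 have L: "L2_fun (\<lambda>s. cis (- (\<xi> * s / h)) * x s)" by (rule G1(5))
 have hx: "of_real (h\<^sup>2) * x'' s = of_real (V s - lam) * x s" for s
  using h by (simp add: x''_def scaleR_conv_of_real)
 have "L2_fun (\<lambda>s. of_real (V s) * (cis (- (\<xi> * s / h)) * x s) + - of_real lam * (cis (- (\<xi> * s / h)) * x s))"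
  by (intro L2_fun_add L2_fun_mult_bounded L2_fun_scale L V)
 then have "L2_fun (\<lambda>s. - 1 * (of_real (V s) * (cis (- (\<xi> * s / h)) * x s) + - of_real lam * (cis (- (\<xi> * s / h)) * x s)))"
  by (rule L2_fun_scale)
 moreover have "(\<lambda>s. - 1 * (of_real (V s) * (cis (- (\<xi> * s / h)) * x s) + - of_real lam * (cis (- (\<xi> * s / h)) * x s)))
   = (\<lambda>s. cis (- (\<xi> * s / h)) * (- of_real (h\<^sup>2) * x'' s))"
  by (simp only: mult_minus_left hx) (simp add: algebra_simps)
 ultimately have L2: "L2_fun (\<lambda>s. cis (- (\<xi> * s / h)) * (- of_real (h\<^sup>2) * x'' s))" by simp
 have "magnetic_schroedinger V \<xi> h (mag_gauge \<xi> h x) = abs_l2_circle (\<lambda>s. cis (- (\<xi> * s / h)) * (- of_real (h\<^sup>2) * x'' s)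
    + of_real (V s) * (cis (- (\<xi> * s / h)) * x s))"
  unfolding magnetic_schroedinger_def mm unfolding mag_gauge_def mult_abs[OF L V]
  by (rule add_abs[OF L2 L2_fun_mult_bounded[OF L V]])
 also have "(\<lambda>s. cis (- (\<xi> * s / h)) * (- of_real (h\<^sup>2) * x'' s) + of_real (V s) * (cis (- (\<xi> * s / h)) * x s))
   = (\<lambda>s. of_real lam * (cis (- (\<xi> * s / h)) * x s))"
  by (simp only: mult_minus_left hx) (simp add: algebra_simps)
 also have "abs_l2_circle ... = l2_scale (of_real lam) (mag_gauge \<xi> h x)"
  unfolding mag_gauge_def by (rule scale_abs[OF L, symmetric])
 finally show ?thesis using H2 by (simp add: eigenspace_def)
qed

lemma weak_deriv_primitive:
 assumes "is_weak_deriv u v"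
 shows "(LINT s:{0..2 * pi}|lborel. rep_l2_circle v s) = 0"
  and "\<exists>c. AE s in lborel. s \<in> {0..2 * pi} --> rep_l2_circle u s = c + (LINT t:{0..s}|lborel. rep_l2_circle v t)"
proof -
 have *: "(LINT s:{0..2 * pi}|lborel. rep_l2_circle u s * of_real (deriv \<phi> s)) =
   - (LINT s:{0..2 * pi}|lborel. rep_l2_circle v s * of_real (\<phi> s))" if "smooth \<phi>" "periodic_2pi \<phi>" for \<phi>
  using assms that unfolding is_weak_deriv_def l2_pairing_def by blast
 note int = L2_fun_integrable[OF L2_fun_rep]
 show "(LINT s:{0..2 * pi}|lborel. rep_l2_circle v s) = 0"
  by (rule circle_weak_primitive(1)[OF int int *])
 show "\<exists>c. AE s in lborel. s \<in> {0..2 * pi} --> rep_l2_circle u s = c + (LINT t:{0..s}|lborel. rep_l2_circle v t)"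
  by (rule circle_weak_primitive(2)[OF int int *])
qed

text \<open>The passage from the Lebesgue integral of a representative to the gauge integral of a continuous
function, to which the fundamental theorem of calculus applies.\<close>

lemma set_lint_continuous_cong:
 fixes f g :: "real \<Rightarrow> complex"
 assumes f: "set_integrable lborel {a..b} f" and g: "continuous_on {a..b} g"
  and ae: "AE s in lborel. s \<in> {a..b} --> f s = g s"
 shows "(LINT s:{a..b}|lborel. f s) = integral {a..b} g"
proof -
 have gi: "set_integrable lborel {a..b} g" by (rule borel_integrable_atLeastAtMost'[OF g])
 have "(LINT s:{a..b}|lborel. f s) = (LINT s:{a..b}|lborel. g s)"
  unfolding set_lebesgue_integral_def
 proof (rule Bochner_Integration.integral_cong_AE)
  show "AE s in lborel. indicat_real {a..b} s *\<^sub>R f s = indicat_real {a..b} s *\<^sub>R g s"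
   using ae by eventually_elim (auto simp: indicator_def)
 qed (use f gi in \<open>simp_all add: set_integrable_def borel_measurable_integrable\<close>)
 then show ?thesis using set_borel_integral_eq_integral(2)[OF gi] by simp
qed

lemma set_lint_primitive_continuous:
 fixes f :: "real \<Rightarrow> complex"
 assumes f: "set_integrable lborel {a..b} f"
 shows "continuous_on {a..b} (\<lambda>s. LINT t:{a..s}|lborel. f t)"
proof -
 have "(LINT t:{a..s}|lborel. f t) = integral {a..s} f" if "s \<in> {a..b}" for s
  by (rule set_borel_integral_eq_integral(2)[OF set_integrable_subset[OF f]]) (use that in auto)
 then have "continuous_on {a..b} (\<lambda>s. LINT t:{a..s}|lborel. f t) \<longleftrightarrow> continuous_on {a..b} (\<lambda>s. integral {a..s} f)"
  by (intro continuous_on_cong) auto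
 then show ?thesis
  using indefinite_integral_continuous_1[OF set_borel_integral_eq_integral(1)[OF f]] by simp
qed

text \<open>Regularity: \<open>u\<close>, its weak derivative \<open>v\<close> and the weak derivative \<open>w\<close> of \<open>v\<close> have primitives as
representatives. The eigenvalue equation expresses \<open>w\<close> by continuous functions almost everywhere,
so \<open>v\<close> and then \<open>u\<close> have continuously differentiable representatives and the equation holds
classically on one period. The solution of the equation on the line that agrees with it there is a
Floquet solution by uniqueness.\<close>

lemma eigen_imp_gauge_floquet:
 assumes h: "h > 0" and V: "continuous_on UNIV V" "periodic_2pi V"
  and u: "u \<in> eigenspace V \<xi> h lam"
 shows "\<exists>x \<in> floquet (\<lambda>s. (V s - lam) / h\<^sup>2) (cis (2 * pi * \<xi> / h)). u = mag_gauge \<xi> h x"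
proof -
 let ?R = rep_l2_circle
 have "u \<in> H1_circle" "weak_deriv u \<in> H1_circle" and eq: "magnetic_schroedinger V \<xi> h u = l2_scale (of_real lam) u"
  using u by (auto simp: eigenspace_def H2_circle_def)
 then obtain v w where v: "is_weak_deriv u v" and w: "is_weak_deriv v w"
  using weak_deriv_eq by (auto simp: H1_circle_def)
 have m1: "magnetic_momentum \<xi> h u = l2_scale (of_real h) (l2_scale (- \<i>) v) + l2_scale (of_real \<xi>) u"
  by (simp add: magnetic_momentum_def D_s_def weak_deriv_eq[OF v])
 have "is_weak_deriv (magnetic_momentum \<xi> h u) (l2_scale (of_real h) (l2_scale (- \<i>) w) + l2_scale (of_real \<xi>) v)"
  unfolding m1 by (intro is_weak_deriv_add is_weak_deriv_scale v w)
 then have m2: "magnetic_momentum \<xi> h (magnetic_momentum \<xi> h u) =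
   l2_scale (of_real h) (l2_scale (- \<i>) (l2_scale (of_real h) (l2_scale (- \<i>) w) + l2_scale (of_real \<xi>) v))
   + l2_scale (of_real \<xi>) (magnetic_momentum \<xi> h u)"
  by (simp add: magnetic_momentum_def[of \<xi> h "magnetic_momentum \<xi> h u"] D_s_def weak_deriv_eq)
 have simp_eq: "l2_scale (- of_real (h\<^sup>2)) w + l2_scale (- 2 * \<i> * of_real (h * \<xi>)) v + l2_scale (of_real (\<xi>\<^sup>2)) u + l2_mult V u = l2_scale (of_real lam) u"
 proof -
  have "l2_scale (of_real h) (l2_scale (- \<i>) (l2_scale (of_real h) (l2_scale (- \<i>) w) + l2_scale (of_real \<xi>) v))
   + l2_scale (of_real \<xi>) (l2_scale (of_real h) (l2_scale (- \<i>) v) + l2_scale (of_real \<xi>) u)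
   = l2_scale (- of_real (h\<^sup>2)) w + (l2_scale (- \<i> * of_real (h * \<xi>)) v + l2_scale (- \<i> * of_real (h * \<xi>)) v) + l2_scale (of_real (\<xi>\<^sup>2)) u"
   by (simp add: l2_circle.scale_right_distrib power2_eq_square algebra_simps)
  also have "l2_scale (- \<i> * of_real (h * \<xi>)) v + l2_scale (- \<i> * of_real (h * \<xi>)) v = l2_scale (- 2 * \<i> * of_real (h * \<xi>)) v"
   by (simp add: l2_circle.scale_left_distrib[symmetric] algebra_simps)
  finally show ?thesis using eq m1 m2 by (simp add: magnetic_schroedinger_def)
 qed
 obtain c1 where c1: "AE s in lborel. s \<in> {0..2 * pi} --> ?R u s = c1 + (LINT t:{0..s}|lborel. ?R v t)"
  using weak_deriv_primitive(2)[OF v] by blast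
 obtain c2 where c2: "AE s in lborel. s \<in> {0..2 * pi} --> ?R v s = c2 + (LINT t:{0..s}|lborel. ?R w t)"
  using weak_deriv_primitive(2)[OF w] by blast
 define V1 where "V1 = (\<lambda>s. c2 + (LINT t:{0..s}|lborel. ?R w t))"
 define U1 where "U1 = (\<lambda>s. c1 + (LINT t:{0..s}|lborel. ?R v t))"
 define W1 where "W1 = (\<lambda>s. (of_real (\<xi>\<^sup>2 + V s - lam) * U1 s - 2 * \<i> * of_real (h * \<xi>) * V1 s) / of_real (h\<^sup>2))"
 have int: "set_integrable lborel {0..2 * pi} (?R v)" "set_integrable lborel {0..2 * pi} (?R w)" for v w
  by (intro L2_fun_integrable L2_fun_rep)+
 have cV1: "continuous_on {0..2 * pi} V1" and cU1: "continuous_on {0..2 * pi} U1"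
  unfolding V1_def U1_def by (intro continuous_intros set_lint_primitive_continuous int)+
 have cW1: "continuous_on {0..2 * pi} W1"
  unfolding W1_def by (intro continuous_intros cV1 cU1 continuous_on_subset[OF V(1)]) (use h in auto)
 have aeW: "AE s in lborel. s \<in> {0..2 * pi} --> ?R w s = W1 s"
  using c1 c2 rep_scale[of "- of_real (h\<^sup>2)" w] rep_scale[of "- 2 * \<i> * of_real (h * \<xi>)" v]
   rep_scale[of "of_real (\<xi>\<^sup>2)" u] rep_scale[of "of_real lam" u] rep_l2_mult[OF V, of u]
   rep_add[of "l2_scale (- of_real (h\<^sup>2)) w" "l2_scale (- 2 * \<i> * of_real (h * \<xi>)) v"]
   rep_add[of "l2_scale (- of_real (h\<^sup>2)) w + l2_scale (- 2 * \<i> * of_real (h * \<xi>)) v" "l2_scale (of_real (\<xi>\<^sup>2)) u"]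
   rep_add[of "l2_scale (- of_real (h\<^sup>2)) w + l2_scale (- 2 * \<i> * of_real (h * \<xi>)) v + l2_scale (of_real (\<xi>\<^sup>2)) u" "l2_mult V u"]
 proof eventually_elim
  case (elim s)
  have e: "- of_real (h\<^sup>2) * ?R w s + - 2 * \<i> * of_real (h * \<xi>) * ?R v s + of_real (\<xi>\<^sup>2) * ?R u s + of_real (V s) * ?R u s = of_real lam * ?R u s"
   using elim(3-10) arg_cong[OF simp_eq, of "\<lambda>x. ?R x s"] by (simp only:)
  show ?case
  proof
   assume "s \<in> {0..2 * pi}"
   then have "?R u s = U1 s" "?R v s = V1 s" using elim(1,2) by (auto simp: U1_def V1_def)
   with e have "of_real (h\<^sup>2) * ?R w s = of_real (\<xi>\<^sup>2 + V s - lam) * U1 s - 2 * \<i> * of_real (h * \<xi>) * V1 s"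
    by (simp add: algebra_simps add_eq_0_iff2)
   then show "?R w s = W1 s" unfolding W1_def using h by (simp add: eq_divide_eq mult.commute)
  qed
 qed
 have U1_eq: "U1 s = c1 + integral {0..s} V1" if s: "s \<in> {0..2 * pi}" for s
 proof -
  have "(LINT t:{0..s}|lborel. ?R v t) = integral {0..s} V1"
  proof (rule set_lint_continuous_cong)
   show "set_integrable lborel {0..s} (?R v)" by (rule set_integrable_subset[OF int(1)[of v]]) (use s in auto)
   show "continuous_on {0..s} V1" by (rule continuous_on_subset[OF cV1]) (use s in auto)
   show "AE t in lborel. t \<in> {0..s} --> ?R v t = V1 t"
    using c2 by eventually_elim (use s in \<open>auto simp: V1_def\<close>)
  qed
  then show ?thesis by (simp add: U1_def)
 qed
 have V1_eq: "V1 s = c2 + integral {0..s} W1" if s: "s \<in> {0..2 * pi}" for s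
 proof -
  have "(LINT t:{0..s}|lborel. ?R w t) = integral {0..s} W1"
  proof (rule set_lint_continuous_cong)
   show "set_integrable lborel {0..s} (?R w)" by (rule set_integrable_subset[OF int(1)[of w]]) (use s in auto)
   show "continuous_on {0..s} W1" by (rule continuous_on_subset[OF cW1]) (use s in auto)
   show "AE t in lborel. t \<in> {0..s} --> ?R w t = W1 t"
    using aeW by eventually_elim (use s in auto)
  qed
  then show ?thesis by (simp add: V1_def)
 qed
 have dU: "(U1 has_vector_derivative V1 s) (at s within {0..2 * pi})" if s: "s \<in> {0..2 * pi}" for s
 proof -
  have "((\<lambda>s. c1 + integral {0..s} V1) has_vector_derivative 0 + V1 s) (at s within {0..2 * pi})"
   by (intro has_vector_derivative_add has_vector_derivative_const integral_has_vector_derivative cV1 s)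
  then show ?thesis using has_vector_derivative_transform[OF s U1_eq] by simp
 qed
 have dV: "(V1 has_vector_derivative W1 s) (at s within {0..2 * pi})" if s: "s \<in> {0..2 * pi}" for s
 proof -
  have "((\<lambda>s. c2 + integral {0..s} W1) has_vector_derivative 0 + W1 s) (at s within {0..2 * pi})"
   by (intro has_vector_derivative_add has_vector_derivative_const integral_has_vector_derivative cW1 s)
  then show ?thesis using has_vector_derivative_transform[OF s V1_eq] by simp
 qed
 have ends: "U1 (2 * pi) = U1 0" "V1 (2 * pi) = V1 0"
  using weak_deriv_primitive(1)[OF v] weak_deriv_primitive(1)[OF w] U1_eq[of 0] V1_eq[of 0]
  by (auto simp: U1_def V1_def)
 define E where "E = (\<lambda>s. cis (\<xi> / h * s))"
 define x where "x = (\<lambda>s. E s * U1 s)"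
 define x' where "x' = (\<lambda>s. E s * (V1 s + \<i> * of_real (\<xi> / h) * U1 s))"
 define q where "q = (\<lambda>s. (V s - lam) / h\<^sup>2)"
 have dE: "(E has_vector_derivative \<i> * of_real (\<xi> / h) * E s) (at s within S)" for s S
  unfolding E_def by (rule cis_gauge_deriv)
 have sol: "solves_on {0..2 * pi} q x x'"
  unfolding solves_on_def
 proof (intro ballI conjI)
  fix s assume s: "s \<in> {0..2 * pi}"
  show "(x has_vector_derivative x' s) (at s within {0..2 * pi})"
   unfolding x_def using has_vector_derivative_mult[OF dE dU[OF s]]
   by (simp add: x'_def algebra_simps)
  have "((\<lambda>s. V1 s + \<i> * of_real (\<xi> / h) * U1 s) has_vector_derivative W1 s + \<i> * of_real (\<xi> / h) * V1 s) (at s within {0..2 * pi})"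
   by (intro has_vector_derivative_add dV s has_vector_derivative_mult_right dU)
  from has_vector_derivative_mult[OF dE this]
  have "(x' has_vector_derivative E s * (W1 s + \<i> * of_real (\<xi> / h) * V1 s) + \<i> * of_real (\<xi> / h) * E s * (V1 s + \<i> * of_real (\<xi> / h) * U1 s)) (at s within {0..2 * pi})"
   by (simp add: x'_def)
  also have "E s * (W1 s + \<i> * of_real (\<xi> / h) * V1 s) + \<i> * of_real (\<xi> / h) * E s * (V1 s + \<i> * of_real (\<xi> / h) * U1 s) = q s *\<^sub>R x s"
   using h by (simp add: W1_def q_def x_def scaleR_conv_of_real field_simps power2_eq_square)
  finally show "(x' has_vector_derivative q s *\<^sub>R x s) (at s within {0..2 * pi})" .
 qed
 obtain B where B: "\<And>s. \<bar>q s\<bar> \<le> B"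
 proof -
  have "continuous_on UNIV q" "periodic_2pi q"
   using V h by (auto simp: q_def periodic_2pi_def intro!: continuous_intros)
  then show ?thesis using periodic_bounded that by blast
 qed
 have qc: "continuous_on UNIV q" unfolding q_def by (intro continuous_intros V) (use h in auto)
 obtain y y' where y: "solves_on UNIV q y y'" "y 0 = x 0" "y' 0 = x' 0"
  using solves_UNIV_exists[OF qc B] by blast
 have yx: "y s = x s \<and> y' s = x' s" if "s \<in> {0..2 * pi}" for s
 proof -
  have "y s - x s = 0 \<and> y' s - x' s = 0"
   by (rule solves_on_unique[OF solves_on_lincomb(2)[OF solves_on_subset[OF y(1)] sol] B, of 0]) (use that y in auto)
  then show ?thesis by simp
 qed
 define z where "z = cis (2 * pi * \<xi> / h)"
 have E2: "E (2 * pi) = z * E 0" by (simp add: E_def z_def mult_ac)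
 have "y (2 * pi) = z * y 0" "y' (2 * pi) = z * y' 0"
  using yx[of "2 * pi"] yx[of 0] ends E2 by (auto simp: x_def x'_def E_def)
 moreover have "solves_on UNIV q (\<lambda>s. y (2 * pi + 1 * s)) (\<lambda>s. 1 *\<^sub>R y' (2 * pi + 1 * s))"
 proof -
  have "(\<lambda>s. q (2 * pi + 1 * s)) = q" using V(2) by (auto simp: q_def periodic_2pi_def add.commute)
  then show ?thesis using solves_on_affine[OF y(1), of 1 "2 * pi"] by simp
 qed
 ultimately have "(\<lambda>s. y (2 * pi + 1 * s)) = (\<lambda>s. z * y s)"
  using solves_UNIV_unique(1)[OF _ solves_on_bounded_linear[OF bounded_linear_mult_right y(1)] B, of "\<lambda>s. y (2 * pi + 1 * s)" "\<lambda>s. 1 *\<^sub>R y' (2 * pi + 1 * s)" 0 z]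
  by simp
 then have yper: "y (s + 2 * pi) = z * y s" for s by (metis add.commute mult_1)
 then have yF: "y \<in> floquet (\<lambda>s. (V s - lam) / h\<^sup>2) (cis (2 * pi * \<xi> / h))"
  using y(1) by (auto simp: floquet_def z_def q_def)
 have dy: "(y has_vector_derivative y' s) (at s)" and dy': "(y' has_vector_derivative q s *\<^sub>R y s) (at s)" for s
  using y(1) by (auto simp: solves_on_def)
 have Ly: "L2_fun (\<lambda>s. cis (- (\<xi> * s / h)) * y s)"
  by (rule gauge_momentum(5)[OF h dy _ yper[unfolded z_def]])
    (use dy' in \<open>meson continuous_at_imp_continuous_on has_vector_derivative_continuous\<close>)
 have "AE s in lborel. ?R u s = cis (- (\<xi> * s / h)) * y s"
 proof (rule AE_periodic)
  show "AE s in lborel. s \<in> {0..2 * pi} --> ?R u s = cis (- (\<xi> * s / h)) * y s"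
   using c1
  proof eventually_elim
   case (elim s)
   show ?case
   proof
    assume s: "s \<in> {0..2 * pi}"
    have "cis (- (\<xi> * s / h)) * y s = (cis (- (\<xi> * s / h)) * cis (\<xi> / h * s)) * U1 s"
     using yx[OF s] by (simp add: x_def E_def mult.assoc)
    also have "cis (- (\<xi> * s / h)) * cis (\<xi> / h * s) = 1" by (simp add: cis_mult)
    finally show "?R u s = cis (- (\<xi> * s / h)) * y s" using elim s by (simp add: U1_def)
   qed
  qed
 qed (use Ly L2_fun_rep in \<open>auto simp: L2_fun_def\<close>)
 then have "u = mag_gauge \<xi> h y"
  unfolding mag_gauge_def using abs_l2_eq_iff[OF L2_fun_rep Ly] by simp
 then show ?thesis using yF by blast
qed

theorem eigenspace_eq_gauge_floquet:
 assumes "h > 0" "continuous_on UNIV V" "periodic_2pi V"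
 shows "eigenspace V \<xi> h lam = mag_gauge \<xi> h ` floquet (\<lambda>s. (V s - lam) / h\<^sup>2) (cis (2 * pi * \<xi> / h))"
proof (intro equalityI subsetI)
 fix u assume "u \<in> eigenspace V \<xi> h lam"
 then obtain x where "x \<in> floquet (\<lambda>s. (V s - lam) / h\<^sup>2) (cis (2 * pi * \<xi> / h))" "u = mag_gauge \<xi> h x"
  using eigen_imp_gauge_floquet[OF assms] by metis
 then show "u \<in> mag_gauge \<xi> h ` floquet (\<lambda>s. (V s - lam) / h\<^sup>2) (cis (2 * pi * \<xi> / h))"
  by (simp only: imageI)
next
 fix u assume "u \<in> mag_gauge \<xi> h ` floquet (\<lambda>s. (V s - lam) / h\<^sup>2) (cis (2 * pi * \<xi> / h))"
 then obtain x where "x \<in> floquet (\<lambda>s. (V s - lam) / h\<^sup>2) (cis (2 * pi * \<xi> / h))" "u = mag_gauge \<xi> h x"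
  by (elim imageE)
 then show "u \<in> eigenspace V \<xi> h lam" by (simp only: gauge_floquet_eigen[OF assms])
qed

section \<open>At most two independent Floquet solutions of low energy\<close>

lemma floquet_data:
 assumes "x \<in> floquet q z"
 obtains x' where "solves_on UNIV q x x'" "\<And>s. (x has_vector_derivative x' s) (at s)"
  "\<And>s. (x' has_vector_derivative q s *\<^sub>R x s) (at s)"
  "\<And>s. x (s + 2 * pi) = z * x s" "\<And>s. x' (s + 2 * pi) = z * x' s"
  "\<And>S. continuous_on S x" "\<And>S. continuous_on S x'"
proof -
 obtain x' where x: "solves_on UNIV q x x'" and per: "\<And>s. x (s + 2 * pi) = z * x s"
  using assms by (auto simp: floquet_def)
 have d: "(x has_vector_derivative x' s) (at s)" "(x' has_vector_derivative q s *\<^sub>R x s) (at s)" for s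
  using x by (auto simp: solves_on_def)
 have "x' (s + 2 * pi) = z * x' s" for s
 proof -
  have "(x \<circ> (\<lambda>s. s + 2 * pi) has_vector_derivative 1 *\<^sub>R x' (s + 2 * pi)) (at s)"
   by (rule vector_diff_chain_at) (auto intro!: derivative_eq_intros d)
  moreover have "x \<circ> (\<lambda>s. s + 2 * pi) = (\<lambda>s. z * x s)"
   using per by (simp add: o_def)
  ultimately have 1: "((\<lambda>s. z * x s) has_vector_derivative x' (s + 2 * pi)) (at s)" by simp
  have 2: "((\<lambda>s. z * x s) has_vector_derivative z * x' s) (at s)"
   by (rule has_vector_derivative_mult_right[OF d(1)])
  show ?thesis by (rule vector_derivative_unique_at[OF 1 2])
 qed
 moreover have "continuous_on S x" "continuous_on S x'" for S
  using d by (meson continuous_at_imp_continuous_on has_vector_derivative_continuous)+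
 ultimately show ?thesis using that x d per by blast
qed

text \<open>Integration by parts over a period; the boundary terms cancel because \<open>z * cnj z = 1\<close>.\<close>

lemma floquet_green:
 assumes x: "\<And>s. (x has_vector_derivative x' s) (at s)" "\<And>s. (x' has_vector_derivative ((V s - l) / h\<^sup>2) *\<^sub>R x s) (at s)"
   "\<And>s. x' (s + 2 * pi) = z * x' s" "\<And>S. continuous_on S x" "\<And>S. continuous_on S x'"
  and y: "\<And>s. (y has_vector_derivative y' s) (at s)" "\<And>s. y (s + 2 * pi) = z * y s"
   "\<And>S. continuous_on S y" "\<And>S. continuous_on S y'"
  and z: "cmod z = 1" and h: "h > 0" and V: "continuous_on UNIV V"
 shows "integral {- pi..pi} (\<lambda>s. of_real (h\<^sup>2) * (x' s * cnj (y' s)) + of_real (V s - L) * (x s * cnj (y s)))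
    = of_real (l - L) * integral {- pi..pi} (\<lambda>s. x s * cnj (y s))"
proof -
 have Vc: "continuous_on S V" for S using continuous_on_subset[OF V] by auto
 note cont = continuous_intros x(4,5) y(3,4) Vc
 have "((\<lambda>s. x' s * cnj (y' s) + (((V s - l) / h\<^sup>2) *\<^sub>R x s) * cnj (y s)) has_integral
   x' pi * cnj (y pi) - x' (- pi) * cnj (y (- pi))) {- pi..pi}"
 proof (rule fundamental_theorem_of_calculus)
  fix s
  have "((\<lambda>s. cnj (y s)) has_vector_derivative cnj (y' s)) (at s)"
   by (rule bounded_linear.has_vector_derivative[OF bounded_linear_cnj y(1)])
  from has_vector_derivative_mult[OF x(2) this]
  show "((\<lambda>s. x' s * cnj (y s)) has_vector_derivative x' s * cnj (y' s) + (((V s - l) / h\<^sup>2) *\<^sub>R x s) * cnj (y s)) (at s within {- pi..pi})"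
   by (rule has_vector_derivative_at_within)
 qed simp
 moreover have "x' pi * cnj (y pi) - x' (- pi) * cnj (y (- pi)) = 0"
 proof -
  have "x' pi * cnj (y pi) = (z * cnj z) * (x' (- pi) * cnj (y (- pi)))"
   using x(3)[of "- pi"] y(2)[of "- pi"] by simp
  moreover have "z * cnj z = 1" using complex_norm_square[of z] z by simp
  ultimately show ?thesis by simp
 qed
 ultimately have 0: "((\<lambda>s. of_real (h\<^sup>2) * (x' s * cnj (y' s) + (((V s - l) / h\<^sup>2) *\<^sub>R x s) * cnj (y s))) has_integral 0) {- pi..pi}"
  using has_integral_mult_right[of _ 0 "{- pi..pi}" "complex_of_real (h\<^sup>2)"] by simp
 have i: "((\<lambda>s. of_real (l - L) * (x s * cnj (y s))) has_integral of_real (l - L) * integral {- pi..pi} (\<lambda>s. x s * cnj (y s))) {- pi..pi}"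
  by (intro has_integral_mult_right integrable_integral integrable_continuous_real cont)
 have "((\<lambda>s. of_real (h\<^sup>2) * (x' s * cnj (y' s)) + of_real (V s - L) * (x s * cnj (y s))) has_integral
    0 + of_real (l - L) * integral {- pi..pi} (\<lambda>s. x s * cnj (y s))) {- pi..pi}"
  by (rule has_integral_eq[OF _ has_integral_add[OF 0 i]])
    (use h in \<open>auto simp: scaleR_conv_of_real field_simps\<close>)
 then show ?thesis by (simp add: integral_unique)
qed

text \<open>For any \<open>\<rho>\<close> one has \<open>\<integral>\<bar>w' - \<rho> w\<bar>\<^sup>2 \<ge> 0\<close>, which after integration by parts is
\<open>\<integral>\<bar>w'\<bar>\<^sup>2 \<ge> - \<integral>(\<rho>' + \<rho>\<^sup>2) \<bar>w\<bar>\<^sup>2\<close> up to a boundary term. For the odd ground state \<open>s exp (- a s\<^sup>2 / 2h)\<close>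
of the harmonic well the optimal choice is \<open>\<rho> = 1 / s - a s / h\<close>; the cut-off \<open>1 - s / b0\<close> makes
the boundary term at \<open>b0\<close> nonnegative, and the hypothesis \<open>near\<close> is what is left over.\<close>

lemma hardy_half_well:
 fixes w w' :: "real \<Rightarrow> complex" and U :: "real \<Rightarrow> real"
 assumes w: "\<And>s. (w has_vector_derivative w' s) (at s)" "continuous_on {0..b} w'" "w 0 = 0"
  and U: "continuous_on {0..b} U" and b0: "0 < b0" "b0 \<le> b" and h: "h > 0"
  and near: "\<And>s. 0 < s ==> s \<le> b0 ==> L \<le> 3 * a * h - 4 * a * h * s / b0 - a\<^sup>2 * s\<^sup>2 * (1 - s / b0)\<^sup>2 + U s"
  and far: "\<And>s. b0 \<le> s ==> s \<le> b ==> L \<le> U s"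
 shows "0 \<le> integral {0..b} (\<lambda>s. h\<^sup>2 * (cmod (w' s))\<^sup>2 + (U s - L) * (cmod (w s))\<^sup>2)"
proof -
 have wc: "continuous_on S w" for S
  using w(1) by (meson continuous_at_imp_continuous_on has_vector_derivative_continuous)
 define f where "f = (\<lambda>s. h\<^sup>2 * (cmod (w' s))\<^sup>2 + (U s - L) * (cmod (w s))\<^sup>2)"
 have fc: "continuous_on {0..b} f" unfolding f_def by (intro continuous_intros w U wc)
 \<comment> \<open>\<open>1 / s\<close> is admissible because \<open>w\<close> vanishes at \<open>0\<close>: the boundary term \<open>\<rho> \<bar>w\<bar>\<^sup>2\<close> tends to \<open>0\<close>\<close>
 define \<rho> where "\<rho> = (\<lambda>s. 1 / s - (a / h) * s * (1 - s / b0))"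
 define \<rho>' where "\<rho>' = (\<lambda>s. - 1 / s\<^sup>2 - (a / h) * (1 - 2 * s / b0))"
 define W where "W = (\<lambda>s. w s \<bullet> w s)"
 have Wn: "W s = (cmod (w s))\<^sup>2" for s by (simp add: W_def power2_norm_eq_inner)
 have dW: "(W has_vector_derivative 2 * (w s \<bullet> w' s)) (at s)" for s
  unfolding W_def using w(1)[of s]
  by (auto intro!: derivative_eq_intros simp: has_vector_derivative_def algebra_simps inner_commute)
 have P_int: "((\<lambda>s. \<rho>' s * W s + \<rho> s * (2 * (w s \<bullet> w' s))) has_integral \<rho> b0 * W b0 - \<rho> 0 * W 0) {0..b0}"
 proof (rule fundamental_theorem_of_calculus_interior)
  show "((\<lambda>s. \<rho> s * W s) has_vector_derivative \<rho>' s * W s + \<rho> s * (2 * (w s \<bullet> w' s))) (at s)" if "s \<in> {0<..<b0}" for s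
  proof -
   have "(\<rho> has_real_derivative \<rho>' s) (at s)"
    unfolding \<rho>_def \<rho>'_def using that h b0
    by (auto intro!: derivative_eq_intros simp: field_simps power2_eq_square)
   from has_vector_derivative_mult[OF this[unfolded has_real_derivative_iff_has_vector_derivative] dW[of s]]
   show ?thesis by (simp add: algebra_simps)
  qed
  show "continuous_on {0..b0} (\<lambda>s. \<rho> s * W s)"
   unfolding continuous_on_eq_continuous_within
  proof
   fix s assume s: "s \<in> {0..b0}"
   show "continuous (at s within {0..b0}) (\<lambda>s. \<rho> s * W s)"
   proof (cases "s = 0")
    case False
    have "isCont (\<lambda>s. \<rho> s * W s) s"
     unfolding \<rho>_def W_def using False b0 wc[of UNIV]
     by (intro continuous_intros) (auto simp: continuous_on_eq_continuous_at)
    then show ?thesis by (rule continuous_at_imp_continuous_at_within)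
   next
    case True
    have "(W has_real_derivative 0) (at 0)"
     using dW[of 0] w(3) by (simp add: has_real_derivative_iff_has_vector_derivative)
    then have 1: "((\<lambda>s. W s / s) \<longlongrightarrow> 0) (at 0)"
     using w(3) unfolding has_field_derivative_iff by (simp add: W_def)
    have 2: "(W \<longlongrightarrow> 0) (at 0)"
    proof -
     have "isCont W 0" by (rule has_vector_derivative_continuous[OF dW])
     then show ?thesis using w(3) by (simp add: isCont_def W_def)
    qed
    have 3: "((\<lambda>s. W s / s - (a / h) * s * (1 - s / b0) * W s) \<longlongrightarrow> 0 - (a / h) * 0 * (1 - 0 / b0) * 0) (at 0)"
     by (intro tendsto_intros 1 2) (use b0 in auto)
    have "((\<lambda>s. \<rho> s * W s) \<longlongrightarrow> 0) (at 0)"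
     by (rule Lim_transform_eventually[OF 3[simplified]])
       (auto simp: \<rho>_def algebra_simps eventually_at_filter)
    then have "((\<lambda>s. \<rho> s * W s) \<longlongrightarrow> 0) (at 0 within {0..b0})" by (rule tendsto_within_subset) simp
    then show ?thesis unfolding continuous_within True by (simp add: W_def w(3))
   qed
  qed
 qed (use b0 in auto)
 have pt: "h\<^sup>2 * (\<rho>' s * W s + \<rho> s * (2 * (w s \<bullet> w' s))) \<le> f s" if s: "s \<in> {0..b0}" for s
 proof (cases "s = 0")
  case True
  then show ?thesis by (simp add: W_def w(3) f_def)
 next
  case False
  then have s0: "0 < s" "s \<le> b0" using s by auto
  have "0 \<le> (w' s - \<rho> s *\<^sub>R w s) \<bullet> (w' s - \<rho> s *\<^sub>R w s)" by simp
  moreover have n: "(cmod (w' s))\<^sup>2 = w' s \<bullet> w' s" by (simp add: power2_norm_eq_inner)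
  ultimately have 1: "2 * \<rho> s * (w s \<bullet> w' s) \<le> (cmod (w' s))\<^sup>2 + (\<rho> s)\<^sup>2 * W s"
   unfolding n by (simp add: W_def inner_diff_left inner_diff_right inner_commute power2_eq_square algebra_simps)
  have "h\<^sup>2 * (\<rho>' s * W s + \<rho> s * (2 * (w s \<bullet> w' s))) \<le> h\<^sup>2 * (\<rho>' s * W s + ((cmod (w' s))\<^sup>2 + (\<rho> s)\<^sup>2 * W s))"
   using 1 h by (intro mult_left_mono add_left_mono) (auto simp: algebra_simps)
  also have "... = h\<^sup>2 * (cmod (w' s))\<^sup>2 + h\<^sup>2 * (\<rho>' s + (\<rho> s)\<^sup>2) * W s"
   by (simp add: algebra_simps)
  also have "h\<^sup>2 * (\<rho>' s + (\<rho> s)\<^sup>2) = - (3 * a * h - 4 * a * h * s / b0 - a\<^sup>2 * s\<^sup>2 * (1 - s / b0)\<^sup>2)"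
   using s0 h b0 unfolding \<rho>_def \<rho>'_def by (simp add: field_simps power2_eq_square)
  also have "h\<^sup>2 * (cmod (w' s))\<^sup>2 + - (3 * a * h - 4 * a * h * s / b0 - a\<^sup>2 * s\<^sup>2 * (1 - s / b0)\<^sup>2) * W s
    \<le> h\<^sup>2 * (cmod (w' s))\<^sup>2 + (U s - L) * W s"
   using near[OF s0] by (intro add_left_mono mult_right_mono) (auto simp: W_def)
  finally show ?thesis by (simp add: f_def Wn)
 qed
 have fi: "f integrable_on {0..b0}" "f integrable_on {b0..b}" "f integrable_on {0..b}"
  using b0 by (auto intro!: integrable_continuous_real continuous_on_subset[OF fc])
 have "h\<^sup>2 * (\<rho> b0 * W b0 - \<rho> 0 * W 0) \<le> integral {0..b0} f"
  by (rule has_integral_le[OF has_integral_mult_right[OF P_int] integrable_integral[OF fi(1)]]) (rule pt)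
 moreover have "\<rho> b0 * W b0 - \<rho> 0 * W 0 \<ge> 0"
  using b0 by (simp add: \<rho>_def W_def w(3))
 ultimately have 1: "0 \<le> integral {0..b0} f" using h by (meson order_trans zero_le_mult_iff zero_le_power2)
 have 2: "0 \<le> integral {b0..b} f"
  by (rule integral_nonneg[OF fi(2)]) (use far in \<open>auto simp: f_def intro!: add_nonneg_nonneg mult_nonneg_nonneg\<close>)
 have "integral {0..b} f = integral {0..b0} f + integral {b0..b} f"
  using hk_integral_combine[OF _ b0(2) fi(3)] b0 by simp
 then show ?thesis using 1 2 by (simp add: f_def)
qed

lemma integral_quarters:
 fixes f :: "real \<Rightarrow> real"
 assumes f: "continuous_on UNIV f"
 shows "integral {- pi..pi} f = integral {0..pi / 2} f + integral {0..pi / 2} (\<lambda>s. f (pi - s))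
   + integral {0..pi / 2} (\<lambda>s. f (- s)) + integral {0..pi / 2} (\<lambda>s. f (s - pi))"
proof -
 have fi: "f integrable_on {a..b}" for a b by (intro integrable_continuous_real continuous_on_subset[OF f]) auto
 have c: "continuous_on S (\<lambda>s. f (- s))" for S by (rule continuous_on_compose2[OF f]) (auto intro!: continuous_intros)
 have 1: "integral {- pi..pi} f = integral {- pi..- pi / 2} f + integral {- pi / 2..0} f + integral {0..pi / 2} f + integral {pi / 2..pi} f"
  using hk_integral_combine[OF _ _ fi, of "- pi" "- pi / 2" 0]
   hk_integral_combine[OF _ _ fi, of "- pi" 0 "pi / 2"]
   hk_integral_combine[OF _ _ fi, of "- pi" "pi / 2" pi] by simp
 have 2: "integral {- pi / 2..0} f = integral {0..pi / 2} (\<lambda>s. f (- s))"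
  using hk_integral_reflect[of "pi / 2" 0 "\<lambda>s. f (- s)"] by simp
 have 3: "integral {- pi..- pi / 2} f = integral {0..pi / 2} (\<lambda>s. f (s - pi))"
  using integral_shift[of 0 "- pi" "pi / 2" f] continuous_on_subset[OF f] by (simp add: o_def)
 have 4: "integral {pi / 2..pi} f = integral {0..pi / 2} (\<lambda>s. f (pi - s))"
 proof -
  have "integral {pi / 2..pi} f = integral {- pi..- pi / 2} (\<lambda>s. f (- s))"
   using hk_integral_reflect[of pi "pi / 2" f] by simp
  also have "... = integral {0..pi / 2} (\<lambda>s. f (pi - s))"
   using integral_shift[of 0 "- pi" "pi / 2" "\<lambda>s. f (- s)"] c by (simp add: o_def)
  finally show ?thesis .
 qed
 show ?thesis unfolding 1 2 3 4 by simp
qed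

text \<open>The Hardy inequality on each of the four half-wells, transported to \<open>[0, \<pi> / 2]\<close>.\<close>

lemma energy_lower_bound:
 fixes v v' :: "real \<Rightarrow> complex"
 assumes v: "\<And>s. (v has_vector_derivative v' s) (at s)" "continuous_on UNIV v'" "v 0 = 0" "v pi = 0" "v (- pi) = 0"
  and V: "continuous_on UNIV V" "periodic_2pi V" "\<And>s. V (pi - s) = V s"
  and b0: "0 < b0" "b0 \<le> pi / 2" and h: "h > 0"
  and near: "\<And>s U. U = V s \<or> U = V (- s) ==> 0 < s ==> s \<le> b0 ==> L \<le> 3 * a * h - 4 * a * h * s / b0 - a\<^sup>2 * s\<^sup>2 * (1 - s / b0)\<^sup>2 + U"
  and far: "\<And>s U. U = V s \<or> U = V (- s) ==> b0 \<le> s ==> s \<le> pi / 2 ==> L \<le> U"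
 shows "0 \<le> integral {- pi..pi} (\<lambda>s. h\<^sup>2 * (cmod (v' s))\<^sup>2 + (V s - L) * (cmod (v s))\<^sup>2)"
proof -
 let ?f = "\<lambda>s. h\<^sup>2 * (cmod (v' s))\<^sup>2 + (V s - L) * (cmod (v s))\<^sup>2"
 have vc: "continuous_on S v" for S
  using v(1) by (meson continuous_at_imp_continuous_on has_vector_derivative_continuous)
 have fc: "continuous_on UNIV ?f" by (intro continuous_intros v V vc)
 have q: "0 \<le> integral {0..pi / 2} (\<lambda>s. ?f (c * s + t))"
  if c: "c = 1 \<or> c = - 1" and t: "v t = 0" and VV: "\<And>s. V (c * s + t) = V s \<or> V (c * s + t) = V (- s)" for c t
 proof -
  have aff: "continuous_on UNIV (\<lambda>s. g (c * s + t))" if "continuous_on UNIV g" for g :: "real \<Rightarrow> 'a::topological_space"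
   by (rule continuous_on_compose2[OF that]) (auto intro!: continuous_intros)
  have d: "((\<lambda>s. v (c * s + t)) has_vector_derivative c *\<^sub>R v' (c * s + t)) (at s)" for s
  proof -
   have "(v \<circ> (\<lambda>s. c * s + t) has_vector_derivative c *\<^sub>R v' (c * s + t)) (at s)"
    by (rule vector_diff_chain_at) (auto intro!: derivative_eq_intros v)
   then show ?thesis by (simp add: o_def)
  qed
  have "0 \<le> integral {0..pi / 2} (\<lambda>s. h\<^sup>2 * (cmod (c *\<^sub>R v' (c * s + t)))\<^sup>2 + (V (c * s + t) - L) * (cmod (v (c * s + t)))\<^sup>2)"
  proof (rule hardy_half_well[OF d _ _ _ b0 h])
   show "continuous_on {0..pi / 2} (\<lambda>s. c *\<^sub>R v' (c * s + t))" "continuous_on {0..pi / 2} (\<lambda>s. V (c * s + t))"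
    using continuous_on_subset[OF aff[OF v(2)]] continuous_on_subset[OF aff[OF V(1)]]
    by (auto intro!: continuous_intros)
   show "L \<le> 3 * a * h - 4 * a * h * s / b0 - a\<^sup>2 * s\<^sup>2 * (1 - s / b0)\<^sup>2 + V (c * s + t)" if "0 < s" "s \<le> b0" for s
    using near[OF VV that] .
   show "L \<le> V (c * s + t)" if "b0 \<le> s" "s \<le> pi / 2" for s using far[OF VV that] .
  qed (use t in simp)
  then show ?thesis using c by auto
 qed
 have p1: "V (s - pi) = V (- s)" for s
  using V(3)[of "s - pi"] V(2)[unfolded periodic_2pi_def, rule_format, of "- s"] by (simp add: algebra_simps)
 show ?thesis unfolding integral_quarters[OF fc]
  using q[of 1 0] q[of "- 1" pi] q[of "- 1" 0] q[of 1 "- pi"] v V(3) p1 by simp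
qed

lemma kernel_2x3:
 fixes p r :: "nat \<Rightarrow> complex"
 shows "\<exists>a. (\<exists>i<3. a i \<noteq> 0) \<and> (\<Sum>i<3. a i * p i) = 0 \<and> (\<Sum>i<3. a i * r i) = 0"
proof -
 have S: "(\<Sum>i<3. f i) = f 0 + f 1 + f 2" for f :: "nat \<Rightarrow> complex"
  by (simp add: numeral_3_eq_3 numeral_2_eq_2)
 have E: "(\<exists>i<3. a i \<noteq> 0) \<longleftrightarrow> a 0 \<noteq> 0 \<or> a 1 \<noteq> 0 \<or> a 2 \<noteq> 0" for a :: "nat \<Rightarrow> complex"
  by (auto simp: numeral_3_eq_3 numeral_2_eq_2 less_Suc_eq)
 have ex: "\<exists>a. (\<exists>i<3. a i \<noteq> 0) \<and> (\<Sum>i<3. a i * p i) = 0 \<and> (\<Sum>i<3. a i * r i) = 0"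
  if "x \<noteq> 0 \<or> y \<noteq> 0 \<or> w \<noteq> 0" "x * p 0 + y * p 1 + w * p 2 = 0" "x * r 0 + y * r 1 + w * r 2 = 0" for x y w
  by (rule exI[of _ "\<lambda>i. if i = 0 then x else if i = 1 then y else w"]) (use that in \<open>simp add: S E\<close>)
 let ?x = "p 1 * r 2 - p 2 * r 1" and ?y = "p 2 * r 0 - p 0 * r 2" and ?w = "p 0 * r 1 - p 1 * r 0"
 show ?thesis
 proof (cases "?x = 0 \<and> ?y = 0 \<and> ?w = 0")
  case False
  show ?thesis by (rule ex[of ?x ?y ?w]) (use False in \<open>auto simp: algebra_simps\<close>)
 next
  case True
  consider "p 0 \<noteq> 0 \<or> p 1 \<noteq> 0" | "p 0 = 0" "p 1 = 0" "r 0 \<noteq> 0 \<or> r 1 \<noteq> 0" | "p 0 = 0" "p 1 = 0" "r 0 = 0" "r 1 = 0"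
   by blast
  then show ?thesis
  proof cases
   case 1 show ?thesis by (rule ex[of "p 1" "- p 0" 0]) (use 1 True in \<open>auto simp: algebra_simps\<close>)
  next
   case 2 show ?thesis by (rule ex[of "r 1" "- r 0" 0]) (use 2 in \<open>auto simp: algebra_simps\<close>)
  next
   case 3 show ?thesis by (rule ex[of 1 0 0]) (use 3 in auto)
  qed
 qed
qed

text \<open>Choose a nontrivial combination \<open>v\<close> of the three solutions that vanishes at \<open>0\<close> and \<open>\<pi>\<close>. Its energy
relative to \<open>L\<close> is nonnegative. But solutions for different \<open>l i\<close> are orthogonal, and by Green's formula
the energy equals minus the squared norm of the combination in which the \<open>i\<close>-th coefficient is multiplied by
\<open>sqrt (L - l i)\<close>. So that combination is zero.\<close>

lemma three_floquet_dependent: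
 fixes X :: "nat \<Rightarrow> real \<Rightarrow> complex" and l :: "nat \<Rightarrow> real"
 assumes V: "continuous_on UNIV V" "periodic_2pi V" "\<And>s. V (pi - s) = V s"
  and z: "cmod z = 1" and h: "h > 0"
  and X: "\<And>i. i < 3 ==> X i \<in> floquet (\<lambda>s. (V s - l i) / h\<^sup>2) z" and l: "\<And>i. i < 3 ==> l i < L"
  and energy: "\<And>v v'. (\<And>s. (v has_vector_derivative v' s) (at s)) ==> continuous_on UNIV v' ==>
    v 0 = 0 ==> v pi = 0 ==> v (- pi) = 0 ==>
    0 \<le> integral {- pi..pi} (\<lambda>s. h\<^sup>2 * (cmod (v' s))\<^sup>2 + (V s - L) * (cmod (v s))\<^sup>2)"
 shows "\<exists>c. (\<exists>i<3. c i \<noteq> 0) \<and> (\<forall>s. (\<Sum>i<3. c i * X i s) = 0)"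
proof -
 let ?I = "{- pi..pi}"
 have "\<forall>i\<in>{..<3}. \<exists>x'. (\<forall>s. (X i has_vector_derivative x' s) (at s)) \<and>
   (\<forall>s. (x' has_vector_derivative ((V s - l i) / h\<^sup>2) *\<^sub>R X i s) (at s)) \<and>
   (\<forall>s. X i (s + 2 * pi) = z * X i s) \<and> (\<forall>s. x' (s + 2 * pi) = z * x' s) \<and>
   (\<forall>S. continuous_on S (X i)) \<and> (\<forall>S. continuous_on S x')"
 proof
  fix i :: nat assume "i \<in> {..<3}"
  then have "X i \<in> floquet (\<lambda>s. (V s - l i) / h\<^sup>2) z" using X by simp
  then show "\<exists>x'. (\<forall>s. (X i has_vector_derivative x' s) (at s)) \<and>
   (\<forall>s. (x' has_vector_derivative ((V s - l i) / h\<^sup>2) *\<^sub>R X i s) (at s)) \<and>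
   (\<forall>s. X i (s + 2 * pi) = z * X i s) \<and> (\<forall>s. x' (s + 2 * pi) = z * x' s) \<and>
   (\<forall>S. continuous_on S (X i)) \<and> (\<forall>S. continuous_on S x')"
   by (rule floquet_data) (rule exI, intro conjI allI, assumption+)
 qed
 from bchoice[OF this] obtain X' where XX: "\<forall>i\<in>{..<3}. (\<forall>s. (X i has_vector_derivative X' i s) (at s)) \<and>
   (\<forall>s. (X' i has_vector_derivative ((V s - l i) / h\<^sup>2) *\<^sub>R X i s) (at s)) \<and>
   (\<forall>s. X i (s + 2 * pi) = z * X i s) \<and> (\<forall>s. X' i (s + 2 * pi) = z * X' i s) \<and>
   (\<forall>S. continuous_on S (X i)) \<and> (\<forall>S. continuous_on S (X' i))" ..
 have X': "\<And>i s. i < 3 ==> (X i has_vector_derivative X' i s) (at s)"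
   "\<And>i s. i < 3 ==> (X' i has_vector_derivative ((V s - l i) / h\<^sup>2) *\<^sub>R X i s) (at s)"
   "\<And>i s. i < 3 ==> X i (s + 2 * pi) = z * X i s" "\<And>i s. i < 3 ==> X' i (s + 2 * pi) = z * X' i s"
   "\<And>i S. i < 3 ==> continuous_on S (X i)" "\<And>i S. i < 3 ==> continuous_on S (X' i)"
  using XX by (simp_all only: lessThan_iff Ball_def)
 have Vc: "continuous_on S V" for S using continuous_on_subset[OF V(1)] by auto
 obtain a where a: "\<exists>i<3. a i \<noteq> 0" "(\<Sum>i<3. a i * X i 0) = 0" "(\<Sum>i<3. a i * X i pi) = 0"
  using kernel_2x3[of "\<lambda>i. X i 0" "\<lambda>i. X i pi"] by blast
 define v where "v = (\<lambda>s. \<Sum>i<3. a i * X i s)"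
 define v' where "v' = (\<lambda>s. \<Sum>i<3. a i * X' i s)"
 have dv: "(v has_vector_derivative v' s) (at s)" for s
  unfolding v_def v'_def
  by (intro has_vector_derivative_sum has_vector_derivative_mult_right X') auto
 have cv: "continuous_on S v" "continuous_on S v'" for S
  unfolding v_def v'_def by (intro continuous_intros X'; simp)+
 have vper: "v (s + 2 * pi) = z * v s" for s
  unfolding v_def sum_distrib_left by (intro sum.cong refl) (simp add: X'(3) mult.left_commute[of z] mult.assoc)
 have "v (- pi) = 0" using vper[of "- pi"] a(3) z by (auto simp: v_def)
 then have e0: "0 \<le> integral ?I (\<lambda>s. h\<^sup>2 * (cmod (v' s))\<^sup>2 + (V s - L) * (cmod (v s))\<^sup>2)"
  using a by (intro energy dv cv) (auto simp: v_def)
 define ip where "ip = (\<lambda>i j. integral ?I (\<lambda>s. X i s * cnj (X j s)))"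
 define E where "E = (\<lambda>i j s. of_real (h\<^sup>2) * (X' i s * cnj (X' j s)) + of_real (V s - L) * (X i s * cnj (X j s)))"
 have green: "integral ?I (E i j) = of_real (l i - L) * ip i j" if "i < 3" "j < 3" for i j
  unfolding E_def ip_def
  by (rule floquet_green[OF X'(1,2,4-6) X'(1,3,5,6) z h V(1)]) (use that in auto)
 have Ei: "E i j integrable_on ?I" "(\<lambda>s. X i s * cnj (X j s)) integrable_on ?I" if "i < 3" "j < 3" for i j
  unfolding E_def using that by (auto intro!: integrable_continuous_real continuous_intros X' Vc)
 define m where "m = (\<lambda>i. sqrt (L - l i))"
 have m: "m i > 0" if "i < 3" for i using l[OF that] by (simp add: m_def)
 have mm: "of_real (L - l i) * ip i j = of_real (m i * m j) * ip i j" if ij: "i < 3" "j < 3" for i j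
 proof (cases "l i = l j")
  case True
  then show ?thesis using l[OF ij(1)] by (simp add: m_def)
 next
  case False
  have "integral ?I (E i j) = cnj (integral ?I (E j i))"
   unfolding integral_cnj E_def by (simp add: mult.commute)
  moreover have "cnj (ip j i) = ip i j" unfolding ip_def integral_cnj by (simp add: mult.commute)
  ultimately have "of_real (l i - L) * ip i j = of_real (l j - L) * ip i j"
   using green ij by simp
  then have "complex_of_real (l i - l j) * ip i j = 0" by (simp add: algebra_simps)
  then have "ip i j = 0" using False by (simp del: of_real_diff)
  then show ?thesis by simp
 qed
 define w where "w = (\<lambda>s. \<Sum>i<3. a i * of_real (m i) * X i s)"
 have cw: "continuous_on S w" for S unfolding w_def by (intro continuous_intros X') auto
 have wsum: "complex_of_real ((cmod (w s))\<^sup>2) = (\<Sum>i<3. \<Sum>j<3. a i * cnj (a j) * of_real (m i * m j) * (X i s * cnj (X j s)))" for s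
  unfolding complex_norm_square w_def cnj_sum sum_product by (intro sum.cong refl) (simp add: mult_ac)
 have vsum: "complex_of_real (h\<^sup>2 * (cmod (v' s))\<^sup>2 + (V s - L) * (cmod (v s))\<^sup>2) = (\<Sum>i<3. \<Sum>j<3. a i * cnj (a j) * E i j s)" for s
 proof -
  have "complex_of_real (h\<^sup>2 * (cmod (v' s))\<^sup>2 + (V s - L) * (cmod (v s))\<^sup>2)
   = of_real (h\<^sup>2) * (v' s * cnj (v' s)) + of_real (V s - L) * (v s * cnj (v s))"
   by (simp only: of_real_add of_real_mult complex_norm_square)
  also have "v s * cnj (v s) = (\<Sum>i<3. \<Sum>j<3. a i * cnj (a j) * (X i s * cnj (X j s)))"
   unfolding v_def cnj_sum sum_product by (intro sum.cong refl) (simp add: mult_ac)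
  also have "v' s * cnj (v' s) = (\<Sum>i<3. \<Sum>j<3. a i * cnj (a j) * (X' i s * cnj (X' j s)))"
   unfolding v'_def cnj_sum sum_product by (intro sum.cong refl) (simp add: mult_ac)
  also have "of_real (h\<^sup>2) * (\<Sum>i<3. \<Sum>j<3. a i * cnj (a j) * (X' i s * cnj (X' j s)))
    + of_real (V s - L) * (\<Sum>i<3. \<Sum>j<3. a i * cnj (a j) * (X i s * cnj (X j s)))
    = (\<Sum>i<3. \<Sum>j<3. a i * cnj (a j) * E i j s)"
   unfolding sum_distrib_left sum.distrib[symmetric] E_def
   by (intro sum.cong refl) (simp add: algebra_simps)
  finally show ?thesis .
 qed
 have iw: "((\<lambda>s. complex_of_real ((cmod (w s))\<^sup>2)) has_integral (\<Sum>i<3. \<Sum>j<3. a i * cnj (a j) * of_real (m i * m j) * ip i j)) ?I"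
  unfolding wsum ip_def
  by (intro has_integral_sum finite_lessThan has_integral_mult_right integrable_integral Ei) auto
 have iv: "((\<lambda>s. complex_of_real (h\<^sup>2 * (cmod (v' s))\<^sup>2 + (V s - L) * (cmod (v s))\<^sup>2)) has_integral (\<Sum>i<3. \<Sum>j<3. a i * cnj (a j) * (of_real (l i - L) * ip i j))) ?I"
  unfolding vsum
 proof (intro has_integral_sum finite_lessThan has_integral_mult_right)
  fix i j :: nat assume "i \<in> {..<3}" "j \<in> {..<3}"
  then show "(E i j has_integral of_real (l i - L) * ip i j) ?I"
   using integrable_integral[OF Ei(1), of i j] green[of i j] by simp
 qed
 have iz: "(\<Sum>i<3. \<Sum>j<3. a i * cnj (a j) * of_real (m i * m j) * ip i j) + (\<Sum>i<3. \<Sum>j<3. a i * cnj (a j) * (of_real (l i - L) * ip i j)) = 0"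
  unfolding sum.distrib[symmetric]
 proof (intro sum.neutral ballI)
  fix i j :: nat assume ij: "i \<in> {..<3}" "j \<in> {..<3}"
  have z0: "of_real (m i * m j) * ip i j - of_real (L - l i) * ip i j = 0"
   using mm[of i j] ij by (simp only: lessThan_iff diff_self)
  have "a i * cnj (a j) * of_real (m i * m j) * ip i j + a i * cnj (a j) * (of_real (l i - L) * ip i j)
    = a i * cnj (a j) * (of_real (m i * m j) * ip i j - of_real (L - l i) * ip i j)"
   by (simp add: algebra_simps)
  then show "a i * cnj (a j) * of_real (m i * m j) * ip i j + a i * cnj (a j) * (of_real (l i - L) * ip i j) = 0"
   unfolding z0 by (simp only: mult_zero_right)
 qed
 have "((\<lambda>s. complex_of_real ((cmod (w s))\<^sup>2) + complex_of_real (h\<^sup>2 * (cmod (v' s))\<^sup>2 + (V s - L) * (cmod (v s))\<^sup>2)) has_integral 0) ?I"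
  using has_integral_add[OF iw iv] unfolding iz .
 then have "((\<lambda>s. Re (complex_of_real ((cmod (w s))\<^sup>2) + complex_of_real (h\<^sup>2 * (cmod (v' s))\<^sup>2 + (V s - L) * (cmod (v s))\<^sup>2))) has_integral Re 0) ?I"
  by (rule has_integral_Re)
 then have s0: "((\<lambda>s. (cmod (w s))\<^sup>2 + (h\<^sup>2 * (cmod (v' s))\<^sup>2 + (V s - L) * (cmod (v s))\<^sup>2)) has_integral 0) ?I"
  by simp
 have i1: "(\<lambda>s. (cmod (w s))\<^sup>2) integrable_on ?I" "(\<lambda>s. h\<^sup>2 * (cmod (v' s))\<^sup>2 + (V s - L) * (cmod (v s))\<^sup>2) integrable_on ?I"
  by (intro integrable_continuous_real continuous_intros cw cv Vc)+
 have "integral ?I (\<lambda>s. (cmod (w s))\<^sup>2) + integral ?I (\<lambda>s. h\<^sup>2 * (cmod (v' s))\<^sup>2 + (V s - L) * (cmod (v s))\<^sup>2) = 0"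
  using integral_unique[OF s0] hk_integral_add[OF i1] by simp
 moreover have "0 \<le> integral ?I (\<lambda>s. (cmod (w s))\<^sup>2)" by (rule integral_nonneg[OF i1(1)]) simp
 ultimately have "integral ?I (\<lambda>s. (cmod (w s))\<^sup>2) = 0" using e0 by linarith
 then have "\<forall>s\<in>?I. (cmod (w s))\<^sup>2 = 0"
  by (subst (asm) integral_eq_0_iff) (auto intro!: continuous_intros cw)
 then have w0: "\<And>s. s \<in> ?I ==> w s = 0" by simp
 have wper: "w (s + 2 * pi) = z * w s" for s
  unfolding w_def sum_distrib_left by (intro sum.cong refl) (simp add: X'(3) mult.left_commute[of z] mult.assoc)
 have "periodic_2pi (\<lambda>s. cmod (w s))" by (simp add: periodic_2pi_def wper norm_mult z)
 then have "cmod (w s) = 0" for s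
 proof -
  define k where "k = - \<lfloor>(s + pi) / (2 * pi)\<rfloor>"
  have "- pi \<le> s + 2 * pi * of_int k" "s + 2 * pi * of_int k \<le> pi"
   using floor_divide_lower[of "2 * pi" "s + pi"] floor_divide_upper[of "2 * pi" "s + pi"]
   by (auto simp: k_def algebra_simps)
  then have "cmod (w (s + 2 * pi * of_int k)) = 0" using w0 by simp
  then show ?thesis using periodic_shift[OF \<open>periodic_2pi (\<lambda>s. cmod (w s))\<close>, of s k] by simp
 qed
 then have "\<forall>s. (\<Sum>i<3. (a i * of_real (m i)) * X i s) = 0" by (simp add: w_def)
 moreover have "\<exists>i<3. a i * of_real (m i) \<noteq> 0" using a(1) m by fastforce
 ultimately show ?thesis by (intro exI[of _ "\<lambda>i. a i * of_real (m i)"]) simp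
qed

section \<open>The list of low eigenvalues\<close>

lemma floquet_gauge_L2:
 assumes "x \<in> floquet q (cis (2 * pi * \<xi> / h))" "h > 0"
 shows "L2_fun (\<lambda>s. cis (- (\<xi> * s / h)) * x s)" "continuous_on UNIV x"
proof -
 obtain x' where x: "\<And>s. (x has_vector_derivative x' s) (at s)" "\<And>s. x (s + 2 * pi) = cis (2 * pi * \<xi> / h) * x s"
  "\<And>S. continuous_on S x" "\<And>S. continuous_on S x'"
  by (rule floquet_data[OF assms(1)]) blast
 show "L2_fun (\<lambda>s. cis (- (\<xi> * s / h)) * x s)" by (rule gauge_momentum(5)[OF assms(2) x(1,4,2)])
 show "continuous_on UNIV x" by (rule x)
qed

lemma mag_gauge_lincomb:
 assumes x: "x \<in> floquet q (cis (2 * pi * \<xi> / h))" and y: "y \<in> floquet r (cis (2 * pi * \<xi> / h))" and h: "h > 0"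
 shows "mag_gauge \<xi> h (\<lambda>s. a * x s + b * y s) = l2_scale a (mag_gauge \<xi> h x) + l2_scale b (mag_gauge \<xi> h y)"
  and "mag_gauge \<xi> h (\<lambda>s. a * x s) = l2_scale a (mag_gauge \<xi> h x)"
proof -
 note L = floquet_gauge_L2(1)[OF x h] floquet_gauge_L2(1)[OF y h]
 show "mag_gauge \<xi> h (\<lambda>s. a * x s + b * y s) = l2_scale a (mag_gauge \<xi> h x) + l2_scale b (mag_gauge \<xi> h y)"
  unfolding mag_gauge_def scale_abs[OF L(1)] scale_abs[OF L(2)] add_abs[OF L2_fun_scale[OF L(1)] L2_fun_scale[OF L(2)]]
  by (simp add: algebra_simps)
 show "mag_gauge \<xi> h (\<lambda>s. a * x s) = l2_scale a (mag_gauge \<xi> h x)"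
  unfolding mag_gauge_def scale_abs[OF L(1)] by (simp add: algebra_simps)
qed

lemma mag_gauge_eq_0:
 assumes x: "continuous_on UNIV x" "L2_fun (\<lambda>s. cis (- (\<xi> * s / h)) * x s)" and 0: "mag_gauge \<xi> h x = 0"
 shows "x = (\<lambda>_. 0)"
proof -
 have "abs_l2_circle (\<lambda>_. 0) = 0" by (simp add: zero_l2_circle_def)
 then have "AE s in lborel. cis (- (\<xi> * s / h)) * x s = 0"
  using 0 abs_l2_eq_iff[OF x(2) L2_fun_zero] by (simp add: mag_gauge_def)
 then have "AE s in lborel. s \<in> {s. x s = 0}" by eventually_elim simp
 then have ae: "AE s in lebesgue. s \<in> {s. x s = 0}" by (rule AE_completion)
 have "closed {s. x s = 0}" by (intro closed_Collect_eq x(1) continuous_on_const)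
 then have "s \<in> {s. x s = 0}" for s using mem_closed_if_AE_lebesgue ae by blast
 then show ?thesis by auto
qed

lemma mag_gauge_zero [simp]: "mag_gauge \<xi> h (\<lambda>_. 0) = 0"
 by (simp add: mag_gauge_def zero_l2_circle_def)

text \<open>A vanishing combination may be differentiated twice; the equations then multiply each
summand by its own spectral parameter.\<close>

lemma floquet_lincomb_zero:
 fixes X :: "nat \<Rightarrow> real \<Rightarrow> complex" and l :: "nat \<Rightarrow> real"
 assumes X: "\<And>i. i < n ==> X i \<in> floquet (\<lambda>s. (V s - l i) / h\<^sup>2) z" and h: "h > 0"
  and 0: "\<And>s. (\<Sum>i<n. c i * X i s) = 0"
 shows "(\<Sum>i<n. c i * of_real (l i) * X i s) = 0"
proof -
 have "\<forall>i\<in>{..<n}. \<exists>x'. solves_on UNIV (\<lambda>s. (V s - l i) / h\<^sup>2) (X i) x'"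
  using X by (auto simp: floquet_def)
 from bchoice[OF this] obtain X' where X': "\<forall>i\<in>{..<n}. solves_on UNIV (\<lambda>s. (V s - l i) / h\<^sup>2) (X i) (X' i)" ..
 have "((\<lambda>s. \<Sum>i<n. c i * X i s) has_vector_derivative (\<Sum>i<n. c i * X' i s)) (at s)" for s
  by (intro has_vector_derivative_sum has_vector_derivative_mult_right) (use X' in \<open>auto simp: solves_on_def\<close>)
 then have "((\<lambda>s. 0) has_vector_derivative (\<Sum>i<n. c i * X' i s)) (at s)" for s by (simp add: 0)
 then have 1: "(\<Sum>i<n. c i * X' i s) = 0" for s
  using vector_derivative_unique_at[OF _ has_vector_derivative_const] by blast
 have "((\<lambda>s. \<Sum>i<n. c i * X' i s) has_vector_derivative (\<Sum>i<n. c i * ((V s - l i) / h\<^sup>2) *\<^sub>R X i s)) (at s)" for s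
  by (intro has_vector_derivative_sum has_vector_derivative_mult_right) (use X' in \<open>auto simp: solves_on_def\<close>)
 then have "((\<lambda>s. 0) has_vector_derivative (\<Sum>i<n. c i * ((V s - l i) / h\<^sup>2) *\<^sub>R X i s)) (at s)" for s by (simp add: 1)
 then have 2: "(\<Sum>i<n. c i * ((V s - l i) / h\<^sup>2) *\<^sub>R X i s) = 0" for s
  using vector_derivative_unique_at[OF _ has_vector_derivative_const] by blast
 have "(\<Sum>i<n. c i * of_real (l i) * X i s) = of_real (V s) * (\<Sum>i<n. c i * X i s) - of_real (h\<^sup>2) * (\<Sum>i<n. c i * ((V s - l i) / h\<^sup>2) *\<^sub>R X i s)"
  unfolding sum_distrib_left sum_subtractf[symmetric]
  by (intro sum.cong refl) (use h in \<open>simp add: scaleR_conv_of_real field_simps\<close>)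
 then show ?thesis using 0 2 by simp
qed

lemma sum3: "(\<Sum>i<(3::nat). f i) = f 0 + f 1 + (f 2 :: complex)"
 by (simp add: numeral_3_eq_3 numeral_2_eq_2)

text \<open>With at most two independent Floquet solutions below \<open>L\<close>, the ones that are exhibited exhaust the
eigenspaces. A third one for another parameter would be proportional to a given one, and comparing the
two equations makes it zero.\<close>

lemma eigenvalue_list_of_floquet:
 fixes l1 l2 L h \<xi> :: real and V :: "real \<Rightarrow> real"
 defines "FL \<equiv> \<lambda>l. floquet (\<lambda>s. (V s - l) / h\<^sup>2) (cis (2 * pi * \<xi> / h))"
 assumes h: "h > 0" and V: "continuous_on UNIV V" "periodic_2pi V"
  and dep: "\<And>X l. (\<And>i. i < 3 ==> X i \<in> FL (l i)) ==> (\<And>i. i < 3 ==> l i < L) ==>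
    \<exists>c. (\<exists>i<3::nat. c i \<noteq> 0) \<and> (\<forall>s. (\<Sum>i<3. c i * X i s) = (0::complex))"
  and l: "l1 \<le> l2" "l2 < L"
  and ex: "(l1 < l2 \<and> (\<exists>x\<in>FL l1. x \<noteq> (\<lambda>_. 0)) \<and> (\<exists>x\<in>FL l2. x \<noteq> (\<lambda>_. 0))) \<or>
    (l1 = l2 \<and> (\<exists>x\<in>FL l1. \<exists>y\<in>FL l1. \<forall>a b. (\<forall>s. a * x s + b * y s = 0) --> a = 0 \<and> b = 0))"
 shows "eigenvalue_list V \<xi> h {..<L} [l1, l2]"
proof -
 have E: "eigenspace V \<xi> h l = mag_gauge \<xi> h ` FL l" for l
  unfolding FL_def by (rule eigenspace_eq_gauge_floquet[OF h V])
 have inj: "x = (\<lambda>_. 0)" if "x \<in> FL l" "mag_gauge \<xi> h x = 0" for x l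
  using mag_gauge_eq_0[OF _ _ that(2)] floquet_gauge_L2 that(1) h unfolding FL_def by blast
 have eig: "eigenvalue V \<xi> h l \<longleftrightarrow> (\<exists>x\<in>FL l. x \<noteq> (\<lambda>_. 0))" for l
 proof
  assume "eigenvalue V \<xi> h l"
  then obtain x where x: "x \<in> FL l" "mag_gauge \<xi> h x \<noteq> 0" unfolding eigenvalue_def E by auto
  then have "x \<noteq> (\<lambda>_. 0)" by auto
  with x(1) show "\<exists>x\<in>FL l. x \<noteq> (\<lambda>_. 0)" by blast
 next
  assume "\<exists>x\<in>FL l. x \<noteq> (\<lambda>_. 0)"
  then obtain x where x: "x \<in> FL l" "x \<noteq> (\<lambda>_. 0)" by auto
  then have "mag_gauge \<xi> h x \<noteq> 0" using inj by blast
  with x(1) show "eigenvalue V \<xi> h l" unfolding eigenvalue_def E by auto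
 qed
 have scale: "mag_gauge \<xi> h (\<lambda>s. a * x s) = l2_scale a (mag_gauge \<xi> h x)" if "x \<in> FL l" for a x l
  using mag_gauge_lincomb(2) that h unfolding FL_def by blast
 have comb: "mag_gauge \<xi> h (\<lambda>s. a * x s + b * y s) = l2_scale a (mag_gauge \<xi> h x) + l2_scale b (mag_gauge \<xi> h y)"
  if "x \<in> FL l" "y \<in> FL l" for a b x y l
  using mag_gauge_lincomb(1) that h unfolding FL_def by blast
 have FL_comb: "(\<lambda>s. a * x s + b * y s) \<in> FL l" if xy: "x \<in> FL l" "y \<in> FL l" for a b x y l
 proof -
  obtain x' y' where "solves_on UNIV (\<lambda>s. (V s - l) / h\<^sup>2) x x'" "solves_on UNIV (\<lambda>s. (V s - l) / h\<^sup>2) y y'"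
   "\<And>s. x (s + 2 * pi) = cis (2 * pi * \<xi> / h) * x s" "\<And>s. y (s + 2 * pi) = cis (2 * pi * \<xi> / h) * y s"
   using xy by (auto simp: FL_def floquet_def)
  then have "solves_on UNIV (\<lambda>s. (V s - l) / h\<^sup>2) (\<lambda>s. a * x s + b * y s) (\<lambda>s. a * x' s + b * y' s)"
   "\<And>s. a * x (s + 2 * pi) + b * y (s + 2 * pi) = cis (2 * pi * \<xi> / h) * (a * x s + b * y s)"
   by (auto intro!: solves_on_lincomb(1) solves_on_bounded_linear[OF bounded_linear_mult_right] simp: algebra_simps)
  then show ?thesis by (auto simp: FL_def floquet_def)
 qed
 have indep1: "l2_circle.dim (range (\<lambda>c. l2_scale c v)) = 1" if "v \<noteq> 0" for v
  using l2_circle.dim_span_eq_card_independent[of "{v}"] that by (simp add: l2_circle.span_singleton)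
 have dep3: "\<exists>c0 c1 c2. (c0 \<noteq> 0 \<or> c1 \<noteq> 0 \<or> c2 \<noteq> 0) \<and> (\<forall>s. c0 * u s + c1 * x s + c2 * y s = 0) \<and>
   (\<forall>s. c0 * of_real l * u s + c1 * of_real m1 * x s + c2 * of_real m2 * y s = 0)"
  if "u \<in> FL l" "x \<in> FL m1" "y \<in> FL m2" "l < L" "m1 < L" "m2 < L" for u x y l m1 m2
 proof -
  define X where "X = (\<lambda>i::nat. if i = 0 then u else if i = 1 then x else y)"
  define k where "k = (\<lambda>i::nat. if i = 0 then l else if i = 1 then m1 else m2)"
  have X: "X i \<in> FL (k i)" "k i < L" for i using that by (auto simp: X_def k_def)
  obtain c where c: "\<exists>i<3. c i \<noteq> 0" "\<And>s. (\<Sum>i<3. c i * X i s) = 0" using dep[of X k] X by blast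
  have "(\<Sum>i<3. c i * of_real (k i) * X i s) = 0" for s
   by (rule floquet_lincomb_zero[OF _ h c(2)]) (use X in \<open>auto simp: FL_def\<close>)
  moreover have "c 0 \<noteq> 0 \<or> c 1 \<noteq> 0 \<or> c 2 \<noteq> 0"
   using c(1) by (auto simp: numeral_3_eq_3 numeral_2_eq_2 less_Suc_eq)
  ultimately show ?thesis using c(2) unfolding sum3
   by (intro exI[of _ "c 0"] exI[of _ "c 1"] exI[of _ "c 2"]) (simp add: X_def k_def)
 qed
 show ?thesis
  using ex
 proof (elim disjE conjE bexE)
  fix x y assume lt: "l1 < l2" and x: "x \<in> FL l1" "x \<noteq> (\<lambda>_. 0)" and y: "y \<in> FL l2" "y \<noteq> (\<lambda>_. 0)"
  have main: "(\<exists>a. u = (\<lambda>s. a * x s)) \<and> l = l1 \<or> (\<exists>a. u = (\<lambda>s. a * y s)) \<and> l = l2 \<or> u = (\<lambda>_. 0)"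
   if u: "u \<in> FL l" "l < L" for u l
  proof -
   obtain c0 c1 c2 where c: "c0 \<noteq> 0 \<or> c1 \<noteq> 0 \<or> c2 \<noteq> 0" and e1: "\<And>s. c0 * u s + c1 * x s + c2 * y s = 0"
    and e2: "\<And>s. c0 * of_real l * u s + c1 * of_real l1 * x s + c2 * of_real l2 * y s = 0"
    using dep3[OF u(1) x(1) y(1) u(2)] l lt by auto
   have f1: "c0 * of_real (l - l1) * u s + c2 * of_real (l2 - l1) * y s = 0" for s
   proof -
    have "c0 * of_real (l - l1) * u s + c2 * of_real (l2 - l1) * y s
     = (c0 * of_real l * u s + c1 * of_real l1 * x s + c2 * of_real l2 * y s) - of_real l1 * (c0 * u s + c1 * x s + c2 * y s)"
     by (simp add: algebra_simps)
    then show ?thesis using e1 e2 by simp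
   qed
   have f2: "c0 * of_real (l - l2) * u s + c1 * of_real (l1 - l2) * x s = 0" for s
   proof -
    have "c0 * of_real (l - l2) * u s + c1 * of_real (l1 - l2) * x s
     = (c0 * of_real l * u s + c1 * of_real l1 * x s + c2 * of_real l2 * y s) - of_real l2 * (c0 * u s + c1 * x s + c2 * y s)"
     by (simp add: algebra_simps)
    then show ?thesis using e1 e2 by simp
   qed
   have n: "complex_of_real (l2 - l1) \<noteq> 0" "complex_of_real (l1 - l2) \<noteq> 0" using lt by (simp_all del: of_real_diff)
   obtain sx sy where sx: "x sx \<noteq> 0" and sy: "y sy \<noteq> 0" using x(2) y(2) by (auto simp: fun_eq_iff)
   have c0: "c0 \<noteq> 0"
   proof
    assume "c0 = 0"
    then have "c2 = 0" "c1 = 0" using f1[of sy] f2[of sx] n sx sy by (auto simp del: of_real_diff)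
    with c \<open>c0 = 0\<close> show False by simp
   qed
   consider "l = l1" | "l = l2" | "l \<noteq> l1" "l \<noteq> l2" by blast
   then show ?thesis
   proof cases
    case 1
    then have "c2 = 0" using f1[of sy] n sy by (simp del: of_real_diff)
    then have "u s = - (c1 / c0) * x s" for s using e1[of s] c0 by (simp add: field_simps add_eq_0_iff)
    then show ?thesis using 1 by blast
   next
    case 2
    then have "c1 = 0" using f2[of sx] n sx by (simp del: of_real_diff)
    then have "u s = - (c2 / c0) * y s" for s using e1[of s] c0 by (simp add: field_simps add_eq_0_iff)
    then show ?thesis using 2 by blast
   next
    \<comment> \<open>a new parameter would make \<open>u\<close> proportional to \<open>y\<close> with two different spectral parameters\<close>
    case 3
    define b where "b = - (c2 * of_real (l2 - l1)) / (c0 * of_real (l - l1))"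
    have nz: "c0 * complex_of_real (l - l1) \<noteq> 0" using 3 c0 by (simp del: of_real_diff)
    have ub: "u s = b * y s" for s
    proof -
     have "c0 * of_real (l - l1) * u s = - (c2 * of_real (l2 - l1)) * y s"
      using f1[of s] by (simp only: mult_minus_left eq_neg_iff_add_eq_0)
     then show ?thesis using nz unfolding b_def times_divide_eq_left
      by (simp only: nonzero_eq_divide_eq[OF nz] mult.commute)
    qed
    define X where "X = (\<lambda>i::nat. if i = 0 then u else y)"
    define k where "k = (\<lambda>i::nat. if i = 0 then l else l2)"
    define c where "c = (\<lambda>i::nat. if i = 0 then 1 else - b)"
    have "(\<Sum>i<2. c i * of_real (k i) * X i s) = 0" for s
    proof (rule floquet_lincomb_zero[OF _ h])
     show "X i \<in> floquet (\<lambda>s. (V s - k i) / h\<^sup>2) (cis (2 * pi * \<xi> / h))" for i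
      using u(1) y(1) by (simp add: X_def k_def FL_def)
     show "(\<Sum>i<2. c i * X i s) = 0" for s
      by (simp add: numeral_2_eq_2 X_def c_def ub)
    qed
    then have sum0: "(\<Sum>i<2. c i * of_real (k i) * X i s) = 0" for s .
    have "of_real l * u s - b * of_real l2 * y s = 0" for s
     using sum0[of s] by (simp add: numeral_2_eq_2 X_def k_def c_def)
    then have "of_real (l - l2) * u s = 0" for s using ub by (simp add: algebra_simps)
    then have "u s = 0" for s using 3 by (simp del: of_real_diff)
    then show ?thesis by auto
   qed
  qed
  have l1: "l1 < L" using l lt by simp
  have F1: "FL l1 = range (\<lambda>c s. c * x s)"
  proof (intro equalityI subsetI)
   fix u assume "u \<in> FL l1"
   from main[OF this l1] lt consider a where "u = (\<lambda>s. a * x s)" | "u = (\<lambda>s. 0 * x s)" by auto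
   then show "u \<in> range (\<lambda>c s. c * x s)" by cases blast+
  next
   fix u assume "u \<in> range (\<lambda>c s. c * x s)"
   then obtain c where "u = (\<lambda>s. c * x s + 0 * x s)" by auto
   then show "u \<in> FL l1" using FL_comb[OF x(1) x(1), of c 0] by simp
  qed
  have F2: "FL l2 = range (\<lambda>c s. c * y s)"
  proof (intro equalityI subsetI)
   fix u assume "u \<in> FL l2"
   from main[OF this l(2)] lt consider a where "u = (\<lambda>s. a * y s)" | "u = (\<lambda>s. 0 * y s)" by auto
   then show "u \<in> range (\<lambda>c s. c * y s)" by cases blast+
  next
   fix u assume "u \<in> range (\<lambda>c s. c * y s)"
   then obtain c where "u = (\<lambda>s. c * y s + 0 * y s)" by auto
   then show "u \<in> FL l2" using FL_comb[OF y(1) y(1), of c 0] by simp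
  qed
  have "eigenspace V \<xi> h l1 = range (\<lambda>c. l2_scale c (mag_gauge \<xi> h x))"
   unfolding E F1 image_image using scale[OF x(1)] by simp
  then have d1: "multiplicity_ev V \<xi> h l1 = 1"
   unfolding multiplicity_ev_def using indep1 inj[OF x(1)] x(2) by metis
  have "eigenspace V \<xi> h l2 = range (\<lambda>c. l2_scale c (mag_gauge \<xi> h y))"
   unfolding E F2 image_image using scale[OF y(1)] by simp
  then have d2: "multiplicity_ev V \<xi> h l2 = 1"
   unfolding multiplicity_ev_def using indep1 inj[OF y(1)] y(2) by metis
  have "{lam \<in> {..<L}. eigenvalue V \<xi> h lam} = {l1, l2}"
   unfolding eig using main x y l l1 by blast
  then show ?thesis using lt d1 d2 unfolding eigenvalue_list_def by auto
 next
  fix x y assume eq: "l1 = l2" and x: "x \<in> FL l1" and y: "y \<in> FL l1"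
   and ind: "\<forall>a b. (\<forall>s. a * x s + b * y s = 0) --> a = 0 \<and> b = 0"
  have main: "(\<exists>a b. u = (\<lambda>s. a * x s + b * y s)) \<and> l = l1 \<or> u = (\<lambda>_. 0)"
   if u: "u \<in> FL l" "l < L" for u l
  proof -
   obtain c0 c1 c2 where c: "c0 \<noteq> 0 \<or> c1 \<noteq> 0 \<or> c2 \<noteq> 0" and e1: "\<And>s. c0 * u s + c1 * x s + c2 * y s = 0"
    and e2: "\<And>s. c0 * of_real l * u s + c1 * of_real l1 * x s + c2 * of_real l1 * y s = 0"
    using dep3[OF u(1) x y u(2)] l eq by auto
   have c0: "c0 \<noteq> 0"
   proof
    assume 0: "c0 = 0"
    then have "\<forall>s. c1 * x s + c2 * y s = 0" using e1 by simp
    then have "c1 = 0 \<and> c2 = 0" using ind by blast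
    then show False using c 0 by simp
   qed
   have "c0 * of_real (l - l1) * u s = 0" for s
   proof -
    have "c0 * of_real (l - l1) * u s
     = (c0 * of_real l * u s + c1 * of_real l1 * x s + c2 * of_real l1 * y s) - of_real l1 * (c0 * u s + c1 * x s + c2 * y s)"
     by (simp add: algebra_simps)
    then show ?thesis using e1 e2 by simp
   qed
   moreover have us: "u s = - (c1 / c0) * x s + - (c2 / c0) * y s" for s
   proof -
    have "- (c1 / c0) * x s + - (c2 / c0) * y s = - (c1 * x s + c2 * y s) / c0"
     by (simp add: add_divide_distrib diff_divide_distrib)
    also have "- (c1 * x s + c2 * y s) = c0 * u s"
     using e1[of s] by (simp add: add_eq_0_iff add.assoc)
    finally show ?thesis using c0 by simp
   qed
   moreover have "u = (\<lambda>s. - (c1 / c0) * x s + - (c2 / c0) * y s)" using us by (intro ext)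
   then have "\<exists>a b. u = (\<lambda>s. a * x s + b * y s)" by blast
   ultimately show ?thesis using c0 by (cases "l = l1") (auto simp del: of_real_diff)
  qed
  have l1: "l1 < L" using l eq by simp
  let ?C = "{(\<lambda>s. a * x s + b * y s) | a b. True}"
  have F1: "FL l1 = ?C"
  proof (intro equalityI subsetI)
   fix u assume "u \<in> FL l1"
   from main[OF this l1] show "u \<in> ?C"
   proof
    assume "u = (\<lambda>_. 0)"
    then have "u = (\<lambda>s. 0 * x s + 0 * y s)" by simp
    then show ?thesis by blast
   qed blast
  qed (use FL_comb[OF x y] in blast)
  let ?gx = "mag_gauge \<xi> h x" and ?gy = "mag_gauge \<xi> h y"
  let ?S = "{l2_scale a ?gx + l2_scale b ?gy | a b. True}"
  have ES: "eigenspace V \<xi> h l1 = l2_circle.span {?gx, ?gy}"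
  proof -
   have "eigenspace V \<xi> h l1 = ?S"
    unfolding E F1
   proof (intro equalityI subsetI)
    fix w assume "w \<in> mag_gauge \<xi> h ` ?C"
    then obtain a b where "w = mag_gauge \<xi> h (\<lambda>s. a * x s + b * y s)" by auto
    then show "w \<in> ?S"
     using comb[OF x y] by auto
   next
    fix w assume "w \<in> ?S"
    then obtain a b where "w = mag_gauge \<xi> h (\<lambda>s. a * x s + b * y s)" using comb[OF x y] by auto
    then show "w \<in> mag_gauge \<xi> h ` ?C" by blast
   qed
   also have "... = l2_circle.span {?gx, ?gy}"
    unfolding l2_circle.span_insert[of "?gx"] l2_circle.span_singleton
   proof (intro equalityI subsetI)
    fix w assume "w \<in> ?S"
    then obtain a b where "w = l2_scale a ?gx + l2_scale b ?gy" by auto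
    then have "w - l2_scale a ?gx = l2_scale b ?gy" by simp
    then show "w \<in> {w. \<exists>k. w - l2_scale k ?gx \<in> range (\<lambda>k. l2_scale k ?gy)}" by blast
   next
    fix w assume "w \<in> {w. \<exists>k. w - l2_scale k ?gx \<in> range (\<lambda>k. l2_scale k ?gy)}"
    then obtain a b where "w - l2_scale a ?gx = l2_scale b ?gy" by auto
    then have "w = l2_scale a ?gx + l2_scale b ?gy" by (simp add: diff_eq_eq add.commute)
    then show "w \<in> ?S" by blast
   qed
   finally show ?thesis .
  qed
  have key: "a = 0 \<and> b = 0" if "l2_scale a ?gx + l2_scale b ?gy = 0" for a b
   using inj[OF FL_comb[OF x y]] comb[OF x y] that ind by metis
  have gy: "?gy \<noteq> 0" using key[of 0 1] by auto
  have gx: "?gx \<notin> range (\<lambda>k. l2_scale k ?gy)"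
  proof
   assume "?gx \<in> range (\<lambda>k. l2_scale k ?gy)"
   then obtain k where "?gx = l2_scale k ?gy" by auto
   then have "l2_scale 1 ?gx + l2_scale (- k) ?gy = 0" by simp
   then show False using key by fastforce
  qed
  then have ne: "?gx \<noteq> ?gy" by (metis l2_circle.scale_one rangeI)
  have "l2_circle.independent {?gx, ?gy}"
   using gx gy ne by (simp add: l2_circle.independent_insert l2_circle.span_singleton)
  from l2_circle.dim_span_eq_card_independent[OF this]
  have d: "multiplicity_ev V \<xi> h l1 = 2"
   unfolding multiplicity_ev_def ES using ne by (simp only: card_2_iff) blast
  have "x \<noteq> (\<lambda>_. 0)" using ind[rule_format, of 1 0] by auto
  then have "{lam \<in> {..<L}. eigenvalue V \<xi> h lam} = {l1}"
   unfolding eig using main x l1 by blast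
  then show ?thesis using eq d unfolding eigenvalue_list_def by auto
 qed
qed

section \<open>The signed square root of the potential at a well\<close>

text \<open>On open sets this is continuous differentiability of order \<open>n\<close>. Smoothness is used to finite order only, and the
order drops by one with each division by \<open>s\<close>.\<close>

primrec Ck :: "nat \<Rightarrow> real set \<Rightarrow> (real \<Rightarrow> real) \<Rightarrow> bool" where
 "Ck 0 S f = continuous_on S f"
| "Ck (Suc n) S f = (\<exists>f'. (\<forall>x\<in>S. (f has_real_derivative f' x) (at x)) \<and> Ck n S f')"

lemma Ck_SucI: "(\<And>x. x \<in> S ==> (f has_real_derivative f' x) (at x)) ==> Ck n S f' ==> Ck (Suc n) S f"
 by auto

lemma Ck_SucE:
 assumes "Ck (Suc n) S f"
 obtains f' where "\<And>x. x \<in> S ==> (f has_real_derivative f' x) (at x)" "Ck n S f'"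
 using assms unfolding Ck.simps(2) by blast

lemma Ck_continuous: "Ck n S f ==> continuous_on S f"
proof (cases n)
 case (Suc m)
 assume "Ck n S f"
 with Suc obtain f' where f': "\<And>x. x \<in> S ==> (f has_real_derivative f' x) (at x)" by (metis Ck_SucE)
 show ?thesis by (rule continuous_at_imp_continuous_on) (use f' DERIV_isCont in blast)
qed simp

lemma Ck_Suc_imp: "Ck (Suc n) S f ==> Ck n S f"
proof (induction n arbitrary: f)
 case 0 then show ?case using Ck_continuous[of "Suc 0" S f] by simp
next
 case (Suc n)
 then obtain f' where "\<forall>x\<in>S. (f has_real_derivative f' x) (at x)" "Ck (Suc n) S f'" by (auto simp del: Ck.simps(1))
 then show ?case using Suc.IH[of f'] by (intro Ck_SucI) auto
qed

lemma Ck_mono: "Ck n S f ==> m \<le> n ==> Ck m S f"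
 by (induction n) (auto simp del: Ck.simps simp: le_Suc_eq dest: Ck_Suc_imp)

lemma Ck_const: "Ck n S (\<lambda>_. c)"
proof (induction n arbitrary: c)
 case (Suc n) then show ?case by (intro Ck_SucI[of _ _ "\<lambda>_. 0"]) auto
qed simp

lemma Ck_add: "Ck n S f ==> Ck n S g ==> Ck n S (\<lambda>x. f x + g x)"
proof (induction n arbitrary: f g)
 case (Suc n)
 then obtain f' g' where "\<forall>x\<in>S. (f has_real_derivative f' x) (at x)" "Ck n S f'"
  "\<forall>x\<in>S. (g has_real_derivative g' x) (at x)" "Ck n S g'" by auto
 with Suc.IH show ?case by (intro Ck_SucI[of _ _ "\<lambda>x. f' x + g' x"]) (auto intro!: derivative_intros)
qed (auto intro: continuous_intros)

lemma Ck_mult: "Ck n S f ==> Ck n S g ==> Ck n S (\<lambda>x. f x * g x)"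
proof (induction n arbitrary: f g)
 case (Suc n)
 then obtain f' g' where *: "\<forall>x\<in>S. (f has_real_derivative f' x) (at x)" "Ck n S f'"
  "\<forall>x\<in>S. (g has_real_derivative g' x) (at x)" "Ck n S g'" by auto
 have "Ck n S f" "Ck n S g" using Suc.prems Ck_Suc_imp by blast+
 then have "Ck n S (\<lambda>x. f' x * g x + g' x * f x)" using * Suc.IH by (intro Ck_add) auto
 moreover have "((\<lambda>x. f x * g x) has_real_derivative f' x * g x + g' x * f x) (at x)" if "x \<in> S" for x
  by (rule DERIV_mult) (use * that in auto)
 ultimately show ?case by (rule Ck_SucI[rotated])
qed (auto intro: continuous_intros)

lemma Ck_minus: "Ck n S f ==> Ck n S (\<lambda>x. - f x)"
 using Ck_mult[OF Ck_const[of n S "- 1"], of f] by simp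

lemma Ck_inverse:
 assumes "Ck n S f" "\<And>x. x \<in> S ==> f x \<noteq> 0" shows "Ck n S (\<lambda>x. inverse (f x))"
 using assms(1)
proof (induction n)
 case 0 then show ?case using assms by (auto intro: continuous_intros)
next
 case (Suc n)
 then obtain f' where f': "\<forall>x\<in>S. (f has_real_derivative f' x) (at x)" "Ck n S f'" by auto
 have i: "Ck n S (\<lambda>x. inverse (f x))" using Suc.IH Ck_Suc_imp[OF Suc.prems] by blast
 have "Ck n S (\<lambda>x. - f' x * (inverse (f x) * inverse (f x)))" by (intro Ck_mult Ck_minus f' i)
 moreover have "((\<lambda>x. inverse (f x)) has_real_derivative - f' x * (inverse (f x) * inverse (f x))) (at x)" if "x \<in> S" for x
  using f'(1) assms(2) that by (auto intro!: derivative_eq_intros simp: algebra_simps)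
 ultimately show ?case by (rule Ck_SucI[rotated])
qed

lemma Ck_sqrt:
 assumes "Ck n S f" "\<And>x. x \<in> S ==> f x > 0" shows "Ck n S (\<lambda>x. sqrt (f x))"
 using assms(1)
proof (induction n)
 case 0 then show ?case by (auto intro: continuous_intros)
next
 case (Suc n)
 then obtain f' where f': "\<forall>x\<in>S. (f has_real_derivative f' x) (at x)" "Ck n S f'" by auto
 have i: "Ck n S (\<lambda>x. sqrt (f x))" using Suc.IH Ck_Suc_imp[OF Suc.prems] by blast
 have "Ck n S (\<lambda>x. f' x * ((1 / 2) * inverse (sqrt (f x))))"
  by (intro Ck_mult Ck_const f' Ck_inverse i) (use assms(2) in force)
 moreover have "((\<lambda>x. sqrt (f x)) has_real_derivative f' x * ((1 / 2) * inverse (sqrt (f x)))) (at x)" if "x \<in> S" for x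
  using f'(1) assms(2)[OF that] that by (auto intro!: derivative_eq_intros simp: field_simps)
 ultimately show ?case by (rule Ck_SucI[rotated])
qed

text \<open>Differentiation under the integral sign; the power \<open>t ^ m\<close> makes the induction close.\<close>

lemma star_shaped_integral_Ck:
 fixes H :: "real \<Rightarrow> real"
 assumes "Ck n {- a<..<a} H"
 shows "Ck n {- a<..<a} (\<lambda>s. integral {0..1} (\<lambda>t. t ^ m * H (t * s)))"
 using assms
proof (induction n arbitrary: H m)
 have star: "t * s \<in> {- a<..<a}" if "s \<in> {- a<..<a}" "t \<in> {0..1}" for s t
 proof -
  have "\<bar>t * s\<bar> \<le> 1 * \<bar>s\<bar>" unfolding abs_mult using that by (intro mult_right_mono) auto
  then show ?thesis using that by auto
 qed
 have cont: "continuous_on ({- a<..<a} \<times> {0..1}) (\<lambda>(s, t). t ^ m * H (t * s))"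
  if "continuous_on {- a<..<a} H" for H :: "real \<Rightarrow> real" and m
  unfolding split_beta
  by (intro continuous_intros continuous_on_compose2[OF that]) (use star in force)
 { case 0
  then show ?case using integral_continuous_on_param[of "{- a<..<a}" 0 1 "\<lambda>s t. t ^ m * H (t * s)"] cont[of H m]
   by simp
 next
  case (Suc n)
  then obtain H' where H': "\<And>x. x \<in> {- a<..<a} ==> (H has_real_derivative H' x) (at x)" "Ck n {- a<..<a} H'"
   using Ck_SucE[OF Suc.prems] by blast
  have Hc: "continuous_on {- a<..<a} H" "continuous_on {- a<..<a} H'"
   using Ck_continuous Suc.prems H'(2) by blast+
  show ?case
  proof (rule Ck_SucI[OF _ Suc.IH[OF H'(2), of "Suc m"]])
   fix s assume s: "s \<in> {- a<..<a}"
   have "((\<lambda>s. integral (cbox 0 1) (\<lambda>t. t ^ m * H (t * s))) has_real_derivative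
     integral (cbox 0 1) (\<lambda>t. t ^ Suc m * H' (t * s))) (at s within {- a<..<a})"
   proof (rule leibniz_rule_field_derivative[where fx = "\<lambda>s t. t ^ Suc m * H' (t * s)"])
    fix x t assume xt: "x \<in> {- a<..<a}" "t \<in> cbox 0 (1::real)"
    have "(H has_real_derivative H' (t * x)) (at (t * x))" using H'(1) star xt by simp
    from DERIV_chain2[of H "H' (t * x)" "\<lambda>x. t * x" x t UNIV, OF this DERIV_cmult_Id]
    have "((\<lambda>x. H (t * x)) has_real_derivative H' (t * x) * t) (at x)" .
    from DERIV_cmult[OF this, of "t ^ m"]
    have "((\<lambda>x. t ^ m * H (t * x)) has_real_derivative t ^ Suc m * H' (t * x)) (at x)" by (simp add: mult_ac)
    then show "((\<lambda>x. t ^ m * H (t * x)) has_real_derivative t ^ Suc m * H' (t * x)) (at x within {- a<..<a})"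
     by (rule has_field_derivative_at_within)
   next
    fix x assume "x \<in> {- a<..<a}"
    then show "(\<lambda>t. t ^ m * H (t * x)) integrable_on cbox 0 1"
     by (intro integrable_continuous continuous_intros continuous_on_compose2[OF Hc(1)]) (use star in force)
   qed (use cont[OF Hc(2), of "Suc m"] s in auto)
   then show "((\<lambda>s. integral {0..1} (\<lambda>t. t ^ m * H (t * s))) has_real_derivative
     integral {0..1} (\<lambda>t. t ^ Suc m * H' (t * s))) (at s)"
    using s by (simp add: at_within_open[OF s] del: power_Suc)
  qed
 }
qed

text \<open>\<open>F s = s \<integral>\<^sub>0\<^sup>1 F' (t s) dt\<close>.\<close>

lemma hadamard_quotient:
 assumes F: "Ck (Suc n) {- a<..<a} F" "F 0 = 0" and a: "a > 0"
 shows "\<exists>G. Ck n {- a<..<a} G \<and> (\<forall>s\<in>{- a<..<a}. F s = s * G s)"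
proof -
 obtain H where H: "\<And>x. x \<in> {- a<..<a} ==> (F has_real_derivative H x) (at x)" "Ck n {- a<..<a} H"
  using Ck_SucE[OF F(1)] by blast
 have "F s = s * integral {0..1} (\<lambda>t. t ^ 0 * H (t * s))" if s: "s \<in> {- a<..<a}" for s
 proof -
  have "((\<lambda>t. s * H (t * s)) has_integral F (1 * s) - F (0 * s)) {0..1}"
  proof (rule fundamental_theorem_of_calculus)
   fix t :: real assume t: "t \<in> {0..1}"
   have "\<bar>t * s\<bar> \<le> 1 * \<bar>s\<bar>" unfolding abs_mult using t by (intro mult_right_mono) auto
   then have "t * s \<in> {- a<..<a}" using s by auto
   moreover have "((\<lambda>t. t * s) has_real_derivative s) (at t)" by (auto intro!: derivative_eq_intros)
   ultimately have "((\<lambda>t. F (t * s)) has_real_derivative H (t * s) * s) (at t)"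
    using DERIV_chain2[of F "H (t * s)" "\<lambda>t. t * s" t s UNIV] H(1) by blast
   then have "((\<lambda>t. F (t * s)) has_vector_derivative s * H (t * s)) (at t)"
    by (simp add: has_real_derivative_iff_has_vector_derivative mult.commute)
   then show "((\<lambda>t. F (t * s)) has_vector_derivative s * H (t * s)) (at t within {0..1})"
    by (rule has_vector_derivative_at_within)
  qed simp
  from integral_unique[OF this] show ?thesis using F(2) by simp
 qed
 then show ?thesis using star_shaped_integral_Ck[OF H(2), of 0] by blast
qed

lemma smooth_imp_Ck: "smooth f ==> Ck n S f"
proof -
 assume f: "smooth f"
 have "Ck n S ((deriv ^^ m) f)" for m
 proof (induction n arbitrary: m)
  case 0
  have "isCont ((deriv ^^ m) f) s" for s
   using f unfolding smooth_def by (metis DERIV_isCont real_differentiable_def)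
  then show ?case by (simp add: continuous_at_imp_continuous_on)
 next
  case (Suc n)
  show ?case
  proof (rule Ck_SucI[OF _ Suc.IH[of "Suc m"]])
   show "((deriv ^^ m) f has_real_derivative (deriv ^^ Suc m) f x) (at x)" for x
    using f unfolding smooth_def by (simp add: DERIV_deriv_iff_real_differentiable)
  qed
 qed
 from this[of 0] show ?thesis by simp
qed

lemma Ck_deriv_bound:
 assumes "Ck 1 {- a<..<a} r" "b < a" "0 \<le> b"
 shows "\<exists>L. \<forall>s\<in>{- b..b}. \<bar>r s - r 0\<bar> \<le> L * \<bar>s\<bar>"
proof -
 obtain r' where r': "\<And>x. x \<in> {- a<..<a} ==> (r has_real_derivative r' x) (at x)" "continuous_on {- a<..<a} r'"
  using assms(1) unfolding One_nat_def by (metis Ck_SucE Ck.simps(1))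
 have "bounded (r' ` {- b..b})"
  using assms by (intro compact_imp_bounded compact_continuous_image continuous_on_subset[OF r'(2)]) auto
 then obtain L where "\<forall>x\<in>r' ` {- b..b}. norm x \<le> L" unfolding bounded_iff by blast
 then have L: "\<And>x. x \<in> {- b..b} ==> norm (r' x) \<le> L" by auto
 have "norm (r s - r 0) \<le> L * norm (s - 0)" if "s \<in> {- b..b}" for s
 proof (rule field_differentiable_bound[of "{- b..b}"])
  show "(r has_field_derivative r' z) (at z within {- b..b})" if "z \<in> {- b..b}" for z
   using r'(1)[of z] that assms by (auto intro: has_field_derivative_at_within)
 qed (use L that assms in auto)
 then show ?thesis by (intro exI[of _ L]) auto
qed

text \<open>Dividing by \<open>s\<close> twice, \<open>V s = s\<^sup>2 Q s\<close> with \<open>Q > 0\<close>, and \<open>f s = s sqrt (Q s)\<close>. The quotient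
\<open>g = (\<kappa> - f') / (2 f)\<close> is regular at \<open>0\<close> because its numerator vanishes there, and by one more division it is
continuously differentiable with \<open>g' + g\<^sup>2\<close> Lipschitz at \<open>0\<close>.\<close>

lemma wkb_data:
 fixes V :: "real \<Rightarrow> real"
 assumes V: "smooth V" "V 0 = 0" "\<forall>s\<in>{- pi<..<pi} - {0}. V s > 0" "deriv (deriv V) 0 \<noteq> 0"
 defines "\<kappa> \<equiv> sqrt (deriv (deriv V) 0 / 2)"
 shows "\<kappa> > 0 \<and> (\<exists>f g g' c L. c > 0 \<and>
   (\<forall>s\<in>{- pi<..<pi}. V s = (f s)\<^sup>2 \<and> (f has_real_derivative \<kappa> - 2 * f s * g s) (at s) \<and>
    (g has_real_derivative g' s) (at s)) \<and> continuous_on {- pi<..<pi} g' \<and> f 0 = 0 \<and>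
   (\<forall>s\<in>{- (pi / 2)..pi / 2}. c * s\<^sup>2 \<le> s * f s \<and> \<bar>(g' s + (g s)\<^sup>2) - (g' 0 + (g 0)\<^sup>2)\<bar> \<le> L * \<bar>s\<bar>) \<and>
   (\<forall>s\<in>{0<..<pi}. f s > 0) \<and> (\<forall>s\<in>{- pi<..<0}. f s < 0))"
proof -
 let ?S = "{- pi<..<pi}"
 have S: "open ?S" "0 \<in> ?S" by auto
 have dV: "(V has_real_derivative deriv V s) (at s)" and ddV: "(deriv V has_real_derivative deriv (deriv V) s) (at s)" for s
  using V(1) unfolding smooth_def
  by (metis DERIV_deriv_iff_real_differentiable funpow_0, metis DERIV_deriv_iff_real_differentiable One_nat_def funpow_0 funpow_simps_right(2) o_apply)
 have V'0: "deriv V 0 = 0"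
 proof (rule DERIV_local_min[OF dV[of 0] pi_gt_zero], intro allI impI)
  fix y :: real assume "\<bar>0 - y\<bar> < pi"
  then have "y \<in> {- pi<..<pi}" by (auto simp: abs_if split: if_splits)
  then show "V 0 \<le> V y" using V(2) less_imp_le[OF V(3)[rule_format, of y]] by (cases "y = 0") auto
 qed
 have four: "4 = Suc 3" and three: "3 = Suc 2" and two: "2 = Suc 1" by auto
 obtain V1 where V1: "Ck 4 ?S V1" "\<And>s. s \<in> ?S ==> V s = s * V1 s"
  using hadamard_quotient[OF smooth_imp_Ck[OF V(1)] V(2) pi_gt_zero, of 4] by blast
 have "(V has_real_derivative V1 0) (at 0)"
 proof -
  obtain V1' where "\<And>s. s \<in> ?S ==> (V1 has_real_derivative V1' s) (at s)"
   by (rule Ck_SucE[OF V1(1)[unfolded four]], rule that)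
  from DERIV_mult[OF DERIV_ident this[OF S(2)]] have "((\<lambda>s. s * V1 s) has_real_derivative V1 0) (at 0)" by simp
  then show ?thesis by (rule has_field_derivative_transform_within_open[OF _ S]) (simp add: V1(2))
 qed
 then have V10: "V1 0 = 0" using DERIV_unique dV[of 0] V'0 by metis
 obtain Q where Q: "Ck 3 ?S Q" "\<And>s. s \<in> ?S ==> V1 s = s * Q s"
  using hadamard_quotient[OF V1(1)[unfolded four] V10 pi_gt_zero] by (elim exE conjE) (rule that, auto)
 obtain Q' where Q': "\<And>s. s \<in> ?S ==> (Q has_real_derivative Q' s) (at s)" "Ck 2 ?S Q'"
  by (rule Ck_SucE[OF Q(1)[unfolded three]], rule that)
 obtain Q'' where Q'': "\<And>s. s \<in> ?S ==> (Q' has_real_derivative Q'' s) (at s)"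
  by (rule Ck_SucE[OF Q'(2)[unfolded two]], rule that)
 have VQ: "V s = s\<^sup>2 * Q s" if "s \<in> ?S" for s using V1(2) Q(2) that by (simp add: power2_eq_square)
 have d1: "deriv V s = 2 * s * Q s + s\<^sup>2 * Q' s" if s: "s \<in> ?S" for s
 proof -
  have "((\<lambda>s. s\<^sup>2 * Q s) has_real_derivative 2 * s * Q s + s\<^sup>2 * Q' s) (at s)"
   using Q'(1)[OF s] by (auto intro!: derivative_eq_intros)
  then have "(V has_real_derivative 2 * s * Q s + s\<^sup>2 * Q' s) (at s)"
   by (rule has_field_derivative_transform_within_open[OF _ S(1) s]) (simp add: VQ)
  then show ?thesis by (rule DERIV_imp_deriv)
 qed
 have Q0: "deriv (deriv V) 0 = 2 * Q 0"
 proof -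
  have "((\<lambda>s. 2 * s * Q s + s\<^sup>2 * Q' s) has_real_derivative 2 * Q 0) (at 0)"
   using Q'(1)[OF S(2)] Q''[OF S(2)] by (auto intro!: derivative_eq_intros)
  then have "(deriv V has_real_derivative 2 * Q 0) (at 0)"
   by (rule has_field_derivative_transform_within_open[OF _ S]) (simp add: d1)
  then show ?thesis by (rule DERIV_imp_deriv)
 qed
 have Qpos': "Q s > 0" if "s \<in> ?S" "s \<noteq> 0" for s
  using V(3)[rule_format, of s] that VQ[OF that(1)] that(2) by (simp add: zero_less_mult_iff)
 have "Q 0 \<ge> 0"
 proof (rule tendsto_lowerbound)
  show "(Q \<longlongrightarrow> Q 0) (at 0)" using DERIV_isCont[OF Q'(1)[OF S(2)]] by (simp add: isCont_def)
  show "\<forall>\<^sub>F x in at 0. 0 \<le> Q x"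
   using eventually_at_in_open'[OF S(1) S(2)] eventually_neq_at_within[of 0 0 UNIV]
   by eventually_elim (use Qpos' in \<open>auto intro: less_imp_le\<close>)
 qed simp
 then have "Q 0 > 0" using V(4) Q0 by simp
 then have Qpos: "Q s > 0" if "s \<in> ?S" for s using Qpos' that by (cases "s = 0") auto
 define q where "q = (\<lambda>s. sqrt (Q s))"
 have q: "Ck 3 ?S q" unfolding q_def by (rule Ck_sqrt[OF Q(1) Qpos])
 have qpos: "q s > 0" if "s \<in> ?S" for s using Qpos[OF that] by (simp add: q_def)
 have q0: "q 0 = \<kappa>" by (simp add: q_def \<kappa>_def Q0)
 then have \<kappa>: "\<kappa> > 0" using qpos[OF S(2)] by simp
 obtain q' where q': "\<And>s. s \<in> ?S ==> (q has_real_derivative q' s) (at s)" "Ck 2 ?S q'"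
  by (rule Ck_SucE[OF q[unfolded three]], rule that)
 have "Ck (Suc 2) ?S (\<lambda>s. q s + (- \<kappa>))" using Ck_add[OF q Ck_const] unfolding three .
 from hadamard_quotient[OF this] obtain k where k: "Ck 2 ?S k" "\<And>s. s \<in> ?S ==> q s + (- \<kappa>) = s * k s"
  by (auto simp: q0)
 define g where "g = (\<lambda>s. - ((k s + q' s) * ((1 / 2) * inverse (q s))))"
 have "Ck 2 ?S q" using Ck_mono[OF q] by simp
 moreover have "\<And>s. s \<in> ?S ==> q s \<noteq> 0" using qpos by (metis less_irrefl)
 ultimately have g: "Ck 2 ?S g" unfolding g_def
  by (intro Ck_minus Ck_mult Ck_add Ck_const Ck_inverse k q')
 obtain g' where g': "\<And>s. s \<in> ?S ==> (g has_real_derivative g' s) (at s)" "Ck 1 ?S g'"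
  by (rule Ck_SucE[OF g[unfolded two]], rule that)
 have "Ck 1 ?S (\<lambda>s. g' s + g s * g s)" by (intro Ck_add Ck_mult g' Ck_mono[OF g]) auto
 from Ck_deriv_bound[OF this, of "pi / 2"]
 have "\<exists>L. \<forall>s\<in>{- (pi / 2)..pi / 2}. \<bar>(g' s + (g s)\<^sup>2) - (g' 0 + (g 0)\<^sup>2)\<bar> \<le> L * \<bar>s\<bar>"
  by (simp add: power2_eq_square)
 then obtain L where
  L: "\<And>s. s \<in> {- (pi / 2)..pi / 2} ==> \<bar>(g' s + (g s)\<^sup>2) - (g' 0 + (g 0)\<^sup>2)\<bar> \<le> L * \<bar>s\<bar>"
  by blast
 define f where "f = (\<lambda>s. s * q s)"
 have Vf: "V s = (f s)\<^sup>2" if "s \<in> ?S" for s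
  using VQ[OF that] Qpos[OF that] by (simp add: f_def q_def power_mult_distrib)
 have df: "(f has_real_derivative \<kappa> - 2 * f s * g s) (at s)" if s: "s \<in> ?S" for s
 proof -
  have "(f has_real_derivative q s + s * q' s) (at s)"
   unfolding f_def using q'(1)[OF s] by (auto intro!: derivative_eq_intros)
  also have "q s + s * q' s = \<kappa> - 2 * f s * g s"
   using k(2)[OF s] qpos[OF s] by (simp add: f_def g_def field_simps)
  finally show ?thesis .
 qed
 have in_S: "s \<in> ?S" if "s \<in> {- (pi / 2)..pi / 2}" for s
  using that pi_gt_zero by (simp only: atLeastAtMost_iff greaterThanLessThan_iff) linarith
 have "\<exists>x\<in>{- (pi / 2)..pi / 2}. \<forall>y\<in>{- (pi / 2)..pi / 2}. q x \<le> q y"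
 proof (rule continuous_attains_inf)
  show "continuous_on {- (pi / 2)..pi / 2} q"
   by (rule continuous_on_subset[OF Ck_continuous[OF q]]) (use in_S in blast)
 qed auto
 then obtain x where x: "x \<in> {- (pi / 2)..pi / 2}" "\<And>y. y \<in> {- (pi / 2)..pi / 2} ==> q x \<le> q y" by blast
 have "q x * s\<^sup>2 \<le> s * f s" if "s \<in> {- (pi / 2)..pi / 2}" for s
  using mult_right_mono[OF x(2)[OF that], of "s\<^sup>2"] by (simp add: f_def power2_eq_square mult_ac)
 moreover have "q x > 0" by (rule qpos[OF in_S[OF x(1)]])
 moreover have "f s > 0" if "s \<in> {0<..<pi}" for s using qpos[of s] that by (simp add: f_def)
 moreover have "f s < 0" if "s \<in> {- pi<..<0}" for s using qpos[of s] that by (simp add: f_def mult_neg_pos)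
 moreover have "f 0 = 0" by (simp add: f_def)
 moreover have "continuous_on ?S g'" using g'(2) Ck_continuous by blast
 ultimately have "q x > 0 \<and>
   (\<forall>s\<in>?S. V s = (f s)\<^sup>2 \<and> (f has_real_derivative \<kappa> - 2 * f s * g s) (at s) \<and>
    (g has_real_derivative g' s) (at s)) \<and> continuous_on ?S g' \<and> f 0 = 0 \<and>
   (\<forall>s\<in>{- (pi / 2)..pi / 2}. q x * s\<^sup>2 \<le> s * f s \<and> \<bar>(g' s + (g s)\<^sup>2) - (g' 0 + (g 0)\<^sup>2)\<bar> \<le> L * \<bar>s\<bar>) \<and>
   (\<forall>s\<in>{0<..<pi}. f s > 0) \<and> (\<forall>s\<in>{- pi<..<0}. f s < 0)"
  using Vf df g'(1) L by blast
 then show ?thesis using \<kappa> by blast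
qed

section \<open>A half-well in the gauge of the approximate ground state\<close>

lemma deriv_compare:
 fixes f \<phi> :: "real \<Rightarrow> real"
 assumes "a \<le> b" "continuous_on {a..b} f" "continuous_on {a..b} \<phi>"
  "\<And>x. a < x ==> x < b ==> (f has_real_derivative f' x) (at x)"
  "\<And>x. a < x ==> x < b ==> (\<phi> has_real_derivative \<phi>' x) (at x)"
  "\<And>x. a < x ==> x < b ==> \<bar>f' x\<bar> \<le> \<phi>' x"
 shows "\<bar>f b - f a\<bar> \<le> \<phi> b - \<phi> a"
proof (cases "a = b")
 case False
 then have "norm (f b - f a) \<le> \<phi> b - \<phi> a"
  using assms by (intro differentiable_bound_general[where f' = f' and \<phi>' = \<phi>'])
   (auto simp: has_real_derivative_iff_has_vector_derivative)
 then show ?thesis by simp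
qed simp

lemma within_Icc_interior:
 fixes f :: "real \<Rightarrow> real"
 shows "(f has_real_derivative D) (at x within {a..b}) ==> a < x ==> x < b ==> (f has_real_derivative D) (at x)"
 by (simp add: at_within_Icc_at)

text \<open>The data of one half-well, with \<open>0\<close> the bottom and \<open>b\<close> the midpoint of the barrier: the signed
square root \<open>f\<close> of the potential, the transport coefficient \<open>g\<close>, and the Lipschitz bound that
makes \<open>\<kappa> h + h\<^sup>2 (- g' 0 - (g 0)\<^sup>2)\<close> a good approximation to the energy near the bottom.\<close>

locale half_well =
 fixes b \<kappa> c L :: real and f g g' :: "real \<Rightarrow> real"
 assumes pos: "b > 0" "\<kappa> > 0" "c > 0"
  and df: "\<And>s. s \<in> {0..b} ==> (f has_real_derivative \<kappa> - 2 * f s * g s) (at s within {0..b})"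
  and dg: "\<And>s. s \<in> {0..b} ==> (g has_real_derivative g' s) (at s within {0..b})"
  and cg': "continuous_on {0..b} g'"
  and f0: "f 0 = 0" and fc: "\<And>s. s \<in> {0..b} ==> c * s \<le> f s"
  and Lip: "\<And>s. s \<in> {0..b} ==> \<bar>(g' s + (g s)\<^sup>2) - (g' 0 + (g 0)\<^sup>2)\<bar> \<le> L * s"
begin

text \<open>\<open>p\<close> is the square of the approximate ground state \<open>exp (G - F / h)\<close>, and \<open>h\<^sup>2 r\<close> is the local energy by which
that state fails to be exact at the energy \<open>\<kappa> h\<close>.\<close>

definition r :: "real \<Rightarrow> real" where "r s = - (g' s + (g s)\<^sup>2)"
definition F :: "real \<Rightarrow> real" where "F s = integral {0..s} f"
definition G :: "real \<Rightarrow> real" where "G s = integral {0..s} g"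
definition p :: "real \<Rightarrow> real \<Rightarrow> real" where "p h s = exp (2 * G s - 2 * F s / h)"

lemma cont_f: "continuous_on {0..b} f" and cont_g: "continuous_on {0..b} g"
 by (rule DERIV_continuous_on[OF df] DERIV_continuous_on[OF dg]; assumption)+

lemma cont_r: "continuous_on {0..b} r"
 unfolding r_def[abs_def] by (intro continuous_intros cont_g cg')

lemma dF: "s \<in> {0..b} ==> (F has_real_derivative f s) (at s within {0..b})"
 unfolding F_def has_real_derivative_iff_has_vector_derivative
 by (rule integral_has_vector_derivative[OF cont_f])

lemma dG: "s \<in> {0..b} ==> (G has_real_derivative g s) (at s within {0..b})"
 unfolding G_def has_real_derivative_iff_has_vector_derivative
 by (rule integral_has_vector_derivative[OF cont_g])

lemma cont_F: "continuous_on {0..b} F" and cont_G: "continuous_on {0..b} G"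
 by (rule DERIV_continuous_on[OF dF] DERIV_continuous_on[OF dG]; assumption)+

lemma F0 [simp]: "F 0 = 0" and G0 [simp]: "G 0 = 0" by (auto simp: F_def G_def)

lemma p_pos: "p h s > 0" by (simp add: p_def)

lemma p_nz [simp]: "p h s \<noteq> 0" by (simp add: p_def)

lemma p_0 [simp]: "p h 0 = 1" by (simp add: p_def)

lemma dp: "s \<in> {0..b} ==> h > 0 ==> (p h has_real_derivative (2 * g s - 2 * f s / h) * p h s) (at s within {0..b})"
 unfolding p_def[abs_def] by (auto intro!: derivative_eq_intros dF dG)

lemma cont_p: "continuous_on {0..b} (p h)"
 unfolding p_def[abs_def] by (cases "h = 0") (auto intro!: continuous_intros cont_F cont_G)

lemma L_nonneg: "L \<ge> 0"
proof -
 have "0 \<le> L * b" using Lip[of b] pos by auto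
 then show ?thesis using pos by (simp add: zero_le_mult_iff)
qed

lemma F_growth:
 assumes "0 \<le> \<sigma>" "\<sigma> \<le> s" "s \<le> b"
 shows "c / 2 * (s\<^sup>2 - \<sigma>\<^sup>2) \<le> F s - F \<sigma>"
proof -
 have "F \<sigma> - c / 2 * \<sigma>\<^sup>2 \<le> F s - c / 2 * s\<^sup>2"
 proof (rule DERIV_nonneg_imp_increasing_open[OF assms(2)])
  fix x assume x: "\<sigma> < x" "x < s"
  have "(F has_real_derivative f x) (at x)" by (rule within_Icc_interior[OF dF]) (use x assms in auto)
  then have "((\<lambda>x. F x - c / 2 * x\<^sup>2) has_real_derivative f x - c * x) (at x)"
   by (auto intro!: derivative_eq_intros)
  moreover have "0 \<le> f x - c * x" using fc[of x] x assms by simp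
  ultimately show "\<exists>y. ((\<lambda>x. F x - c / 2 * x\<^sup>2) has_real_derivative y) (at x) \<and> 0 \<le> y" by blast
 next
  show "continuous_on {\<sigma>..s} (\<lambda>x. F x - c / 2 * x\<^sup>2)"
   using assms by (intro continuous_intros continuous_on_subset[OF cont_F]) auto
 qed
 then show ?thesis by (simp add: algebra_simps)
qed

text \<open>\<open>\<Gamma>\<close> bounds the amplitude part \<open>G\<close>, so that \<open>K\<close> compares \<open>p\<close> with its exponential part.\<close>

definition \<Gamma> :: real where "\<Gamma> = (SOME B. \<forall>s\<in>{0..b}. \<bar>G s\<bar> \<le> B)"

lemma \<Gamma>: "s \<in> {0..b} ==> \<bar>G s\<bar> \<le> \<Gamma>"
proof -
 have "bounded (G ` {0..b})" by (intro compact_imp_bounded compact_continuous_image cont_G) auto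
 then obtain B where "\<forall>x\<in>G ` {0..b}. norm x \<le> B" unfolding bounded_iff by blast
 then have "\<exists>B. \<forall>s\<in>{0..b}. \<bar>G s\<bar> \<le> B" by (intro exI[of _ B]) auto
 from someI_ex[OF this] show "s \<in> {0..b} ==> \<bar>G s\<bar> \<le> \<Gamma>" unfolding \<Gamma>_def by blast
qed

definition K :: real where "K = exp (4 * \<Gamma>)"

lemma K_ge1: "K \<ge> 1" using \<Gamma>[of 0] pos by (simp add: K_def)

lemma p_decay:
 assumes "0 \<le> \<sigma>" "\<sigma> \<le> s" "s \<le> b" "h > 0"
 shows "p h s \<le> K * p h \<sigma> * exp (- c * (s\<^sup>2 - \<sigma>\<^sup>2) / h)"
proof -
 have "2 * G s - 2 * F s / h \<le> 4 * \<Gamma> + (2 * G \<sigma> - 2 * F \<sigma> / h) + - c * (s\<^sup>2 - \<sigma>\<^sup>2) / h"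
 proof -
  have "2 * (c / 2 * (s\<^sup>2 - \<sigma>\<^sup>2)) / h \<le> 2 * (F s - F \<sigma>) / h"
   using F_growth[OF assms(1-3)] assms(4) by (intro divide_right_mono mult_left_mono) auto
  moreover have "2 * G s - 2 * G \<sigma> \<le> 4 * \<Gamma>"
   using \<Gamma>[of s] \<Gamma>[of \<sigma>] assms by (auto simp: abs_le_iff)
  ultimately show ?thesis by (simp add: diff_divide_distrib algebra_simps)
 qed
 then have "p h s \<le> exp (4 * \<Gamma> + (2 * G \<sigma> - 2 * F \<sigma> / h) + - c * (s\<^sup>2 - \<sigma>\<^sup>2) / h)"
  unfolding p_def by simp
 then show ?thesis by (simp only: exp_add K_def p_def)
qed

lemma p_quasi_antimono:
 assumes "0 \<le> \<sigma>" "\<sigma> \<le> s" "s \<le> b" "h > 0"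
 shows "p h s \<le> K * p h \<sigma>"
proof -
 have "exp (- c * (s\<^sup>2 - \<sigma>\<^sup>2) / h) \<le> 1"
  using assms pos power_mono[OF assms(2,1), of 2] by (simp add: divide_nonpos_pos mult_nonneg_nonneg)
 moreover have "0 \<le> K * p h \<sigma>" using K_ge1 p_pos[of h \<sigma>] by simp
 ultimately have "K * p h \<sigma> * exp (- c * (s\<^sup>2 - \<sigma>\<^sup>2) / h) \<le> K * p h \<sigma> * 1" by (rule mult_left_mono)
 with p_decay[OF assms] show ?thesis by linarith
qed

definition K1 :: real where "K1 = K * (1 / c + 6)"

lemma K1_pos: "K1 > 0" using K_ge1 pos by (simp add: K1_def add_pos_pos)

text \<open>The basic estimate. Integrating \<open>p Z\<close> from the barrier \<open>b\<close> down to \<open>s\<close> costs only \<open>O h * p s\<close> if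
\<open>Z = O (sqrt h + s)\<close>: for \<open>s\<close> beyond \<open>sqrt h\<close> the decay rate \<open>s / h\<close> of \<open>p\<close> absorbs the factor \<open>s\<close>, and
below \<open>sqrt h\<close> the interval is short. The weight \<open>\<nu>\<close> lets the same estimate serve for solutions that decrease towards \<open>b\<close>.\<close>

lemma volterra_bound:
 assumes h: "h > 0"
  and W: "\<And>s. s \<in> {0..b} ==> (W has_real_derivative Y s / p h s) (at s within {0..b})"
  and Y: "\<And>s. s \<in> {0..b} ==> (Y has_real_derivative - (p h s * Z s)) (at s within {0..b})"
  and Z: "\<And>s. s \<in> {0..b} ==> \<bar>Z s\<bar> \<le> M * (sqrt h + s) * \<nu> s"
  and M: "M \<ge> 0" and \<nu>: "\<And>s t. 0 \<le> s ==> s \<le> t ==> t \<le> b ==> \<nu> t \<le> \<nu> s" "\<And>s. s \<in> {0..b} ==> 0 \<le> \<nu> s"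
  and 0: "W b = 0" "Y b = 0" and s: "s \<in> {0..b}"
 shows "\<bar>Y s\<bar> \<le> K1 * h * M * \<nu> s * p h s" "\<bar>W s\<bar> \<le> K1 * h * b * M * \<nu> s"
proof -
 have Yb: "\<bar>Y s\<bar> \<le> K1 * h * M * \<nu> s * p h s" if s: "s \<in> {0..b}" for s
 proof -
  define A where "A = M * \<nu> s * (K * p h s)"
  have A: "A \<ge> 0" using M \<nu>(2)[OF s] K_ge1 p_pos[of h s] by (simp add: A_def)
  let ?E = "\<lambda>t. exp (- c * (t\<^sup>2 - s\<^sup>2) / h)"
  \<comment> \<open>\<open>- A \<Phi>\<close> is an explicit majorant of \<open>Y\<close>: the first summand handles \<open>t\<close> and the second one, which is at least \<open>2 h\<close> up to \<open>t = sqrt h\<close>, handles \<open>sqrt h\<close>\<close>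
  define \<Phi> where "\<Phi> = (\<lambda>t. h / c * ?E t + 2 * h * exp (1 - t / sqrt h))"
  define \<phi> where "\<phi> = (\<lambda>t. 2 * t * ?E t + 2 * sqrt h * exp (1 - t / sqrt h))"
  have d\<Phi>: "((\<lambda>t. - A * \<Phi> t) has_real_derivative A * \<phi> t) (at t)" for t
  proof -
   have "(\<Phi> has_real_derivative h / c * (?E t * (- c * (2 * t) / h)) + 2 * h * (exp (1 - t / sqrt h) * (- (1 / sqrt h)))) (at t)"
   proof -
    have "((\<lambda>t. ?E t) has_real_derivative ?E t * (- c * (2 * t) / h)) (at t)"
     by (rule DERIV_fun_exp) (use h in \<open>auto intro!: derivative_eq_intros\<close>)
    moreover have "((\<lambda>t. 1 - t / sqrt h) has_real_derivative 0 - 1 / sqrt h) (at t)"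
     by (intro DERIV_diff DERIV_const DERIV_cdivide DERIV_ident)
    then have "((\<lambda>t. exp (1 - t / sqrt h)) has_real_derivative exp (1 - t / sqrt h) * (- (1 / sqrt h))) (at t)"
     by (intro DERIV_fun_exp) simp
    ultimately show ?thesis unfolding \<Phi>_def by (intro DERIV_add DERIV_cmult)
   qed
   also have "h / c * (?E t * (- c * (2 * t) / h)) + 2 * h * (exp (1 - t / sqrt h) * (- (1 / sqrt h))) = - \<phi> t"
   proof -
    have "h / sqrt h = sqrt h" using h by (intro real_div_sqrt) auto
    then have "h * (1 / sqrt h) = sqrt h" by (simp only: times_divide_eq_right mult_1_right)
    then have "2 * h * (exp (1 - t / sqrt h) * (- (1 / sqrt h))) = - (2 * sqrt h * exp (1 - t / sqrt h))"
    proof -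
     assume k: "h * (1 / sqrt h) = sqrt h"
     have "2 * h * (exp (1 - t / sqrt h) * (- (1 / sqrt h))) = - (2 * (h * (1 / sqrt h)) * exp (1 - t / sqrt h))"
      by (simp only: mult_ac mult_minus_right)
     then show ?thesis unfolding k .
    qed
    moreover have "h / c * (?E t * (- c * (2 * t) / h)) = - (2 * t * ?E t)"
     using h pos by simp
    ultimately show ?thesis by (simp add: \<phi>_def)
   qed
   finally show ?thesis using DERIV_cmult[of \<Phi> "- \<phi> t" t UNIV "- A"] by simp
  qed
  have "\<bar>Y b - Y s\<bar> \<le> (- A * \<Phi> b) - (- A * \<Phi> s)"
  proof (rule deriv_compare)
   show "s \<le> b" using s by simp
   show "continuous_on {s..b} Y"
    using s by (intro continuous_on_subset[OF DERIV_continuous_on[OF Y]]) auto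
   show "continuous_on {s..b} (\<lambda>t. - A * \<Phi> t)"
    using d\<Phi> by (meson DERIV_continuous_on has_field_derivative_at_within)
   fix t assume t: "s < t" "t < b"
   then have t': "t \<in> {0..b}" "0 < t" using s by auto
   show "(Y has_real_derivative - (p h t * Z t)) (at t)" by (rule within_Icc_interior[OF Y[OF t'(1)] t'(2) t(2)])
   show "((\<lambda>t. - A * \<Phi> t) has_real_derivative A * \<phi> t) (at t)" by (rule d\<Phi>)
   have sq: "sqrt h + t \<le> 2 * t + 2 * sqrt h * exp (1 - t / sqrt h)"
   proof (cases "t \<le> sqrt h")
    case True
    then have "exp (1 - t / sqrt h) \<ge> 1" using h by simp
    then have "2 * sqrt h * exp (1 - t / sqrt h) \<ge> 2 * sqrt h" using h by simp
    then show ?thesis using True t' by linarith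
   next
    case False
    then show ?thesis using h by (simp add: add_increasing2)
   qed
   have e1: "?E t \<le> 1"
    using h pos s t power_mono[of s t 2] by (simp add: divide_nonpos_pos mult_nonneg_nonneg)
   have step: "(sqrt h + t) * ?E t \<le> \<phi> t"
   proof -
    have "(sqrt h + t) * ?E t \<le> (2 * t + 2 * sqrt h * exp (1 - t / sqrt h)) * ?E t"
     using sq by (intro mult_right_mono) auto
    also have "... \<le> \<phi> t"
     using mult_left_mono[OF e1, of "2 * sqrt h * exp (1 - t / sqrt h)"] h
     by (simp add: \<phi>_def algebra_simps)
    finally show ?thesis .
   qed
   have "\<bar>- (p h t * Z t)\<bar> = p h t * \<bar>Z t\<bar>" using p_pos[of h t] by (simp add: abs_mult)
   also have "... \<le> (K * p h s * ?E t) * (M * (sqrt h + t) * \<nu> s)"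
   proof (rule mult_mono)
    show "p h t \<le> K * p h s * ?E t" using p_decay[of s t h] s t h by auto
    have "M * (sqrt h + t) * \<nu> t \<le> M * (sqrt h + t) * \<nu> s"
     using \<nu>(1)[of s t] s t M h t' by (intro mult_left_mono) auto
    then show "\<bar>Z t\<bar> \<le> M * (sqrt h + t) * \<nu> s" using Z[OF t'(1)] by linarith
   qed (use K_ge1 p_pos[of h s] in auto)
   also have "... = A * ((sqrt h + t) * ?E t)" by (simp add: A_def mult_ac)
   also have "... \<le> A * \<phi> t" by (rule mult_left_mono[OF step A])
   finally show "\<bar>- (p h t * Z t)\<bar> \<le> A * \<phi> t" .
  qed
  also have "... \<le> A * \<Phi> s"
   using A h pos by (simp add: \<Phi>_def add_nonneg_nonneg)
  also have "... \<le> A * ((1 / c + 6) * h)"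
  proof (rule mult_left_mono[OF _ A])
   have "exp (1 - s / sqrt h) \<le> exp 1" using s h by simp
   also have "exp (1::real) \<le> 3" by (rule exp_le)
   finally have "2 * h * exp (1 - s / sqrt h) \<le> 2 * h * 3" using h by (intro mult_left_mono) auto
   then show "\<Phi> s \<le> (1 / c + 6) * h" by (simp add: \<Phi>_def algebra_simps)
  qed
  also have "... = K1 * h * M * \<nu> s * p h s" by (simp add: A_def K1_def mult_ac)
  finally show ?thesis using 0 by simp
 qed
 then show "\<bar>Y s\<bar> \<le> K1 * h * M * \<nu> s * p h s" using s by blast
 have "\<bar>W b - W s\<bar> \<le> K1 * h * M * \<nu> s * b - K1 * h * M * \<nu> s * s"
 proof (rule deriv_compare)
  show "s \<le> b" using s by simp
  show "continuous_on {s..b} W" using s by (intro continuous_on_subset[OF DERIV_continuous_on[OF W]]) auto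
  show "continuous_on {s..b} (\<lambda>t. K1 * h * M * \<nu> s * t)" by (intro continuous_intros)
  fix t assume t: "s < t" "t < b"
  then have t': "t \<in> {0..b}" "0 < t" using s by auto
  show "(W has_real_derivative Y t / p h t) (at t)" by (rule within_Icc_interior[OF W[OF t'(1)] t'(2) t(2)])
  show "((\<lambda>t. K1 * h * M * \<nu> s * t) has_real_derivative K1 * h * M * \<nu> s) (at t)"
   by (auto intro!: derivative_eq_intros)
  have "\<bar>Y t / p h t\<bar> \<le> K1 * h * M * \<nu> t"
   using Yb[OF t'(1)] p_pos[of h t] by (simp add: divide_le_eq)
  also have "... \<le> K1 * h * M * \<nu> s"
   using \<nu>(1)[of s t] s t M h K1_pos by (intro mult_left_mono) auto
  finally show "\<bar>Y t / p h t\<bar> \<le> K1 * h * M * \<nu> s" .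
 qed
 also have "... \<le> K1 * h * b * M * \<nu> s"
 proof -
  have "0 \<le> K1 * h * M * \<nu> s * s" using K1_pos h M \<nu>(2)[OF s] s by simp
  then show ?thesis by (simp add: mult_ac)
 qed
 finally show "\<bar>W s\<bar> \<le> K1 * h * b * M * \<nu> s" using 0 by simp
qed

text \<open>The equation \<open>h\<^sup>2 u'' = (V - \<kappa> h - h\<^sup>2 e) u\<close> for \<open>w = u / \<Psi>\<close> with the flux \<open>y = p w'\<close>.\<close>

definition sol :: "real \<Rightarrow> real \<Rightarrow> (real \<Rightarrow> real) \<Rightarrow> (real \<Rightarrow> real) \<Rightarrow> bool" where
 "sol h e w y \<longleftrightarrow> (\<forall>s\<in>{0..b}. (w has_real_derivative y s / p h s) (at s within {0..b}) \<and>
   (y has_real_derivative - (p h s * ((e - r s) * w s))) (at s within {0..b}))"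

lemma sol_cont: "sol h e w y ==> continuous_on {0..b} w" "sol h e w y ==> continuous_on {0..b} y"
 unfolding sol_def by (rule DERIV_continuous_on, blast)+

text \<open>\<open>A h\<close> and \<open>1\<close> span the solutions of \<open>(p w')' = 0\<close>, the equation without its energy term.\<close>

definition A :: "real \<Rightarrow> real \<Rightarrow> real" where "A h s = integral {s..b} (\<lambda>t. 1 / p h t)"
definition J :: "real \<Rightarrow> real" where "J h = A h 0"

lemma inv_p_cont: "continuous_on {0..b} (\<lambda>t. 1 / p h t)"
 by (intro continuous_intros cont_p) (use p_pos in \<open>metis less_irrefl\<close>)

lemma dA: "s \<in> {0..b} ==> (A h has_real_derivative - (1 / p h s)) (at s within {0..b})"
proof -
 assume s: "s \<in> {0..b}"
 have i: "(\<lambda>t. 1 / p h t) integrable_on {0..b}" by (rule integrable_continuous_real[OF inv_p_cont])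
 have eq: "A h t = J h - integral {0..t} (\<lambda>t. 1 / p h t)" if "t \<in> {0..b}" for t
  using hk_integral_combine[OF _ _ i, of t] that by (simp add: A_def J_def)
 have "((\<lambda>t. J h - integral {0..t} (\<lambda>t. 1 / p h t)) has_real_derivative 0 - 1 / p h s) (at s within {0..b})"
  by (intro derivative_intros)
    (simp add: has_real_derivative_iff_has_vector_derivative integral_has_vector_derivative[OF inv_p_cont s])
 then show ?thesis
  using has_field_derivative_transform_within[of _ _ s "{0..b}" 1 "A h"] s eq by simp
qed

lemma A_b [simp]: "A h b = 0" by (simp add: A_def)

lemma A_antimono: "0 \<le> s ==> s \<le> t ==> t \<le> b ==> A h t \<le> A h s"
 unfolding A_def using p_pos
 by (intro integral_subset_le integrable_continuous_real continuous_on_subset[OF inv_p_cont])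
   (auto intro: less_imp_le)

lemma A_nonneg: "s \<in> {0..b} ==> 0 \<le> A h s"
 using A_antimono[of s b h] by simp

lemma A_pos: "0 \<le> s ==> s < b ==> A h s > 0"
proof (rule ccontr)
 assume s: "0 \<le> s" "s < b" and "\<not> A h s > 0"
 have i: "(\<lambda>t. 1 / p h t) integrable_on {s..b}"
  using s by (intro integrable_continuous_real continuous_on_subset[OF inv_p_cont]) auto
 have "continuous_on {s..b} (\<lambda>t. 1 / p h t)" using s by (intro continuous_on_subset[OF inv_p_cont]) auto
 then have "A h s = 0 \<longleftrightarrow> (\<forall>x\<in>{s..b}. 1 / p h x = 0)"
  unfolding A_def using s p_pos by (intro integral_eq_0_iff) (auto intro: less_imp_le)
 moreover have "1 / p h s \<noteq> 0" using p_pos[of h s] by simp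
 ultimately have "A h s \<noteq> 0" using s by auto
 then show False using \<open>\<not> A h s > 0\<close> A_nonneg[of s h] s by simp
qed

lemma J_pos: "J h > 0" using A_pos[of 0 h] pos by (simp add: J_def)

text \<open>The flux at \<open>b\<close> of the solution that is even about the midpoint, where \<open>u' = 0\<close> and \<open>w = 1\<close>.\<close>

definition \<beta> :: "real \<Rightarrow> real" where "\<beta> h = p h b * (f b / h - g b)"

definition \<epsilon> :: "real \<Rightarrow> real \<Rightarrow> real" where "\<epsilon> C1 h = K1 * h * b * C1"

text \<open>First \<open>w\<close> is bounded by some multiple of \<open>A h\<close>; the Volterra estimate with weight \<open>A h\<close> improves any such
multiple by the factor \<open>\<epsilon>\<close>, up to the main term.\<close>

lemma dirichlet_estimate:
 assumes h: "h > 0" and s: "sol h e w y" "w b = 0" "y b = - 1"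
  and e: "\<And>s. s \<in> {0..b} ==> \<bar>e - r s\<bar> \<le> C1 * (sqrt h + s)" and C1: "C1 \<ge> 0" and \<epsilon>: "\<epsilon> C1 h \<le> 1 / 2"
  and t: "t \<in> {0..b}"
 shows "\<bar>w t - A h t\<bar> \<le> 2 * \<epsilon> C1 h * A h t"
proof -
 have step: "\<bar>w t - A h t\<bar> \<le> \<epsilon> C1 h * M * A h t"
  if M: "M \<ge> 0" "\<And>s. s \<in> {0..b} ==> \<bar>w s\<bar> \<le> M * A h s" and t: "t \<in> {0..b}" for M t
 proof -
  have "\<bar>w t - A h t\<bar> \<le> K1 * h * b * (C1 * M) * A h t"
  proof (rule volterra_bound(2)[where W = "\<lambda>s. w s - A h s" and Y = "\<lambda>s. y s + 1" and Z = "\<lambda>s. (e - r s) * w s"])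
   show "((\<lambda>s. w s - A h s) has_real_derivative (y s + 1) / p h s) (at s within {0..b})" if "s \<in> {0..b}" for s
    using s(1) that dA[OF that, of h] by (auto simp: sol_def add_divide_distrib intro!: derivative_eq_intros)
   show "((\<lambda>s. y s + 1) has_real_derivative - (p h s * ((e - r s) * w s))) (at s within {0..b})" if "s \<in> {0..b}" for s
    using s(1) that by (auto simp: sol_def intro!: derivative_eq_intros)
   show "\<bar>(e - r s) * w s\<bar> \<le> C1 * M * (sqrt h + s) * A h s" if "s \<in> {0..b}" for s
   proof -
    have "\<bar>(e - r s) * w s\<bar> \<le> (C1 * (sqrt h + s)) * (M * A h s)"
     unfolding abs_mult using e[OF that] M(2)[OF that] C1 h that by (intro mult_mono) auto
    then show ?thesis by (simp add: mult_ac)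
   qed
  qed (use h C1 M t A_antimono A_nonneg s in auto)
  then show ?thesis by (simp add: \<epsilon>_def mult_ac)
 qed
 have "bounded (y ` {0..b})" by (intro compact_imp_bounded compact_continuous_image sol_cont(2)[OF s(1)]) auto
 then obtain Y0 where "\<forall>x\<in>y ` {0..b}. norm x \<le> Y0" unfolding bounded_iff by blast
 then have Y0: "\<And>s. s \<in> {0..b} ==> \<bar>y s\<bar> \<le> Y0" by auto
 have Y0p: "Y0 \<ge> 0" using Y0[of 0] pos by auto
 have w0: "\<bar>w s\<bar> \<le> Y0 * A h s" if s': "s \<in> {0..b}" for s
 proof -
  have "\<bar>w b - w s\<bar> \<le> - Y0 * A h b - (- Y0 * A h s)"
  proof (rule deriv_compare)
   show "s \<le> b" using s' by simp
   show "continuous_on {s..b} w" using s' by (intro continuous_on_subset[OF sol_cont(1)[OF s(1)]]) auto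
   show "continuous_on {s..b} (\<lambda>t. - Y0 * A h t)"
    using s' by (intro continuous_intros continuous_on_subset[OF DERIV_continuous_on[OF dA]]) auto
   fix t assume t: "s < t" "t < b"
   then have t': "t \<in> {0..b}" "0 < t" using s' by auto
   show "(w has_real_derivative y t / p h t) (at t)"
    by (rule within_Icc_interior[OF _ t'(2) t(2)]) (use s(1) t' in \<open>auto simp: sol_def\<close>)
   have "(A h has_real_derivative - (1 / p h t)) (at t)" by (rule within_Icc_interior[OF dA[OF t'(1)] t'(2) t(2)])
   from DERIV_cmult[OF this, of "- Y0"]
   show "((\<lambda>t. - Y0 * A h t) has_real_derivative Y0 / p h t) (at t)" by simp
   show "\<bar>y t / p h t\<bar> \<le> Y0 / p h t" using Y0[OF t'(1)] p_pos[of h t] by (simp add: divide_right_mono)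
  qed
  then show ?thesis using s by simp
 qed
 define R where "R = (\<lambda>s. \<bar>w s\<bar> / A h s) ` {0..<b}"
 have bdd: "bdd_above R"
  unfolding R_def using w0 A_pos by (intro bdd_aboveI[of _ Y0]) (auto simp: divide_le_eq)
 have ne: "R \<noteq> {}" using pos by (auto simp: R_def)
 define M where "M = Sup R"
 have wM: "\<bar>w s\<bar> \<le> M * A h s" if "s \<in> {0..b}" for s
 proof (cases "s = b")
  case True then show ?thesis using s by simp
 next
  case False
  then have "\<bar>w s\<bar> / A h s \<le> M" unfolding M_def using that by (intro cSup_upper bdd) (auto simp: R_def)
  then show ?thesis using A_pos[of s h] that False by (simp add: divide_le_eq)
 qed
 have M0: "M \<ge> 0"
 proof -
  have "\<bar>w 0\<bar> / A h 0 \<le> M" unfolding M_def using pos by (intro cSup_upper bdd) (auto simp: R_def)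
  moreover have "0 \<le> \<bar>w 0\<bar> / A h 0" using A_nonneg[of 0 h] pos by simp
  ultimately show ?thesis by linarith
 qed
 have "M \<le> 1 + \<epsilon> C1 h * M"
  unfolding M_def
 proof (rule cSup_least[OF ne])
  fix x assume "x \<in> R"
  then obtain s where s': "0 \<le> s" "s < b" "x = \<bar>w s\<bar> / A h s" by (auto simp: R_def)
  have "\<bar>w s\<bar> \<le> A h s + \<bar>w s - A h s\<bar>" using A_nonneg[of s h] s' by auto
  also have "... \<le> (1 + \<epsilon> C1 h * M) * A h s" using step[OF M0 wM, of s] s' by (simp add: algebra_simps)
  finally show "x \<le> 1 + \<epsilon> C1 h * Sup R" using A_pos[of s h] s' by (simp add: divide_le_eq M_def)
 qed
 moreover have "\<epsilon> C1 h * M \<le> 1 / 2 * M" using \<epsilon> M0 by (intro mult_right_mono) auto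
 ultimately have M2: "M \<le> 2" by linarith
 have \<epsilon>0: "\<epsilon> C1 h \<ge> 0" using h C1 pos K1_pos by (simp add: \<epsilon>_def)
 have "\<bar>w t - A h t\<bar> \<le> \<epsilon> C1 h * M * A h t" by (rule step[OF M0 wM t])
 also have "... \<le> \<epsilon> C1 h * 2 * A h t" using M2 \<epsilon>0 A_nonneg[OF t] by (intro mult_right_mono mult_left_mono) auto
 finally show ?thesis by (simp add: mult_ac)
qed

text \<open>The same argument with weight \<open>1\<close>, started from the maximum of \<open>\<bar>w\<bar>\<close>.\<close>

lemma neumann_estimate:
 assumes h: "h > 0" and s: "sol h e w y" "w b = 1" "y b = \<beta> h" and \<beta>: "0 \<le> \<beta> h" "\<beta> h * J h \<le> 1"
  and e: "\<And>s. s \<in> {0..b} ==> \<bar>e - r s\<bar> \<le> C1 * (sqrt h + s)" and C1: "C1 \<ge> 0" and \<epsilon>: "\<epsilon> C1 h \<le> 1 / 2"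
  and t: "t \<in> {0..b}"
 shows "\<bar>w t - (1 - \<beta> h * A h t)\<bar> \<le> 2 * \<epsilon> C1 h" "\<bar>w t\<bar> \<le> 2"
proof -
 have "\<exists>x\<in>{0..b}. \<forall>y\<in>{0..b}. \<bar>w y\<bar> \<le> \<bar>w x\<bar>"
  using pos by (intro continuous_attains_sup continuous_intros sol_cont(1)[OF s(1)]) auto
 then obtain t0 where t0: "t0 \<in> {0..b}" "\<And>s. s \<in> {0..b} ==> \<bar>w s\<bar> \<le> \<bar>w t0\<bar>" by blast
 define M where "M = \<bar>w t0\<bar>"
 have step: "\<bar>w t - (1 - \<beta> h * A h t)\<bar> \<le> \<epsilon> C1 h * M" if t: "t \<in> {0..b}" for t
 proof -
  have "\<bar>w t - (1 - \<beta> h * A h t)\<bar> \<le> K1 * h * b * (C1 * M) * 1"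
  proof (rule volterra_bound(2)[where W = "\<lambda>s. w s - (1 - \<beta> h * A h s)" and Y = "\<lambda>s. y s - \<beta> h"
     and Z = "\<lambda>s. (e - r s) * w s" and \<nu> = "\<lambda>_. 1"])
   show "((\<lambda>s. w s - (1 - \<beta> h * A h s)) has_real_derivative (y s - \<beta> h) / p h s) (at s within {0..b})" if "s \<in> {0..b}" for s
    using s(1) that dA[OF that, of h] by (auto simp: sol_def diff_divide_distrib intro!: derivative_eq_intros)
   show "((\<lambda>s. y s - \<beta> h) has_real_derivative - (p h s * ((e - r s) * w s))) (at s within {0..b})" if "s \<in> {0..b}" for s
    using s(1) that by (auto simp: sol_def intro!: derivative_eq_intros)
   show "\<bar>(e - r s) * w s\<bar> \<le> C1 * M * (sqrt h + s) * 1" if "s \<in> {0..b}" for s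
   proof -
    have "\<bar>(e - r s) * w s\<bar> \<le> (C1 * (sqrt h + s)) * M"
     unfolding abs_mult M_def using e[OF that] t0(2)[OF that] C1 h that by (intro mult_mono) auto
    then show ?thesis by (simp add: mult_ac)
   qed
  qed (use h C1 t s in \<open>auto simp: M_def\<close>)
  then show ?thesis by (simp add: \<epsilon>_def mult_ac)
 qed
 have base: "\<bar>1 - \<beta> h * A h t\<bar> \<le> 1" if "t \<in> {0..b}" for t
 proof -
  have "\<beta> h * A h t \<le> \<beta> h * J h" unfolding J_def using \<beta> A_antimono[of 0 t h] that by (intro mult_left_mono) auto
  moreover have "0 \<le> \<beta> h * A h t" using \<beta> A_nonneg[OF that] by simp
  ultimately show ?thesis using \<beta> by (auto simp: abs_le_iff)
 qed
 have M0: "M \<ge> 0" by (simp add: M_def)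
 have "M \<le> 1 + \<epsilon> C1 h * M" using step[OF t0(1)] base[OF t0(1)] unfolding M_def by linarith
 moreover have "\<epsilon> C1 h * M \<le> 1 / 2 * M" using \<epsilon> M0 by (intro mult_right_mono) auto
 ultimately have M2: "M \<le> 2" by linarith
 have \<epsilon>0: "\<epsilon> C1 h \<ge> 0" using h C1 pos K1_pos by (simp add: \<epsilon>_def)
 have "\<epsilon> C1 h * M \<le> \<epsilon> C1 h * 2" using M2 \<epsilon>0 by (intro mult_left_mono) auto
 then show "\<bar>w t - (1 - \<beta> h * A h t)\<bar> \<le> 2 * \<epsilon> C1 h" using step[OF t] by simp
 show "\<bar>w t\<bar> \<le> 2" using t0(2)[OF t] M2 by (simp add: M_def)
qed

text \<open>The difference of two solutions solves the equation with source \<open>(e1 - e2) w2\<close>. A source without the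
factor \<open>sqrt h + s\<close> is written as \<open>1 / sqrt h\<close> times one with it, so the gain is only \<open>sqrt h\<close>; for \<open>h \<le> 1\<close> this suffices.\<close>

lemma energy_lipschitz:
 assumes h: "h > 0" "h \<le> 1" and s: "sol h e1 w1 y1" "sol h e2 w2 y2" "w1 b = w2 b" "y1 b = y2 b"
  and e: "\<And>s. s \<in> {0..b} ==> \<bar>e1 - r s\<bar> \<le> C1 * (sqrt h + s)" and C1: "C1 \<ge> 0" and \<epsilon>: "\<epsilon> C1 h \<le> 1 / 2"
  and \<nu>: "\<And>s t. 0 \<le> s ==> s \<le> t ==> t \<le> b ==> \<nu> t \<le> \<nu> s" "\<And>s. s \<in> {0..b} ==> 0 \<le> \<nu> s" "\<And>s. 0 \<le> s ==> s < b ==> 0 < \<nu> s"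
  and w: "\<And>s. s \<in> {0..b} ==> \<bar>w1 s\<bar> \<le> 2 * \<nu> s" "\<And>s. s \<in> {0..b} ==> \<bar>w2 s\<bar> \<le> 2 * \<nu> s"
 shows "\<bar>w1 0 - w2 0\<bar> \<le> 4 * K1 * b * \<bar>e1 - e2\<bar> * \<nu> 0"
proof -
 define m where "m = \<bar>e1 - e2\<bar> * 2 / sqrt h"
 have m: "m \<ge> 0" using h by (simp add: m_def)
 have step: "\<bar>w1 t - w2 t\<bar> \<le> K1 * h * b * (C1 * M + m) * \<nu> t"
  if M: "M \<ge> 0" "\<And>s. s \<in> {0..b} ==> \<bar>w1 s - w2 s\<bar> \<le> M * \<nu> s" and t: "t \<in> {0..b}" for M t
 proof (rule volterra_bound(2)[where W = "\<lambda>s. w1 s - w2 s" and Y = "\<lambda>s. y1 s - y2 s"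
    and Z = "\<lambda>s. (e1 - r s) * (w1 s - w2 s) + (e1 - e2) * w2 s"])
  show "((\<lambda>s. w1 s - w2 s) has_real_derivative (y1 s - y2 s) / p h s) (at s within {0..b})" if "s \<in> {0..b}" for s
   using s(1,2) that by (auto simp: sol_def diff_divide_distrib intro!: derivative_eq_intros)
  show "((\<lambda>s. y1 s - y2 s) has_real_derivative - (p h s * ((e1 - r s) * (w1 s - w2 s) + (e1 - e2) * w2 s))) (at s within {0..b})"
   if "s \<in> {0..b}" for s
  proof -
   have "((\<lambda>s. y1 s - y2 s) has_real_derivative - (p h s * ((e1 - r s) * w1 s)) - - (p h s * ((e2 - r s) * w2 s))) (at s within {0..b})"
    using s(1,2) that by (intro derivative_intros) (auto simp: sol_def)
   then show ?thesis by (simp add: algebra_simps)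
  qed
  show "\<bar>(e1 - r s) * (w1 s - w2 s) + (e1 - e2) * w2 s\<bar> \<le> (C1 * M + m) * (sqrt h + s) * \<nu> s" if s': "s \<in> {0..b}" for s
  proof -
   have "\<bar>(e1 - r s) * (w1 s - w2 s)\<bar> \<le> (C1 * (sqrt h + s)) * (M * \<nu> s)"
    unfolding abs_mult using e[OF s'] M(2)[OF s'] C1 h s' by (intro mult_mono) auto
   moreover have "\<bar>(e1 - e2) * w2 s\<bar> \<le> \<bar>e1 - e2\<bar> * (2 * \<nu> s)"
    unfolding abs_mult using w(2)[OF s'] by (intro mult_left_mono) auto
   moreover have "\<bar>e1 - e2\<bar> * (2 * \<nu> s) \<le> m * (sqrt h + s) * \<nu> s"
   proof -
    have "\<bar>e1 - e2\<bar> * 2 = m * sqrt h" using h by (simp add: m_def)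
    also have "... \<le> m * (sqrt h + s)" using m s' by (intro mult_left_mono) auto
    finally have "\<bar>e1 - e2\<bar> * 2 * \<nu> s \<le> m * (sqrt h + s) * \<nu> s" using \<nu>(2)[OF s'] by (intro mult_right_mono)
    then show ?thesis by simp
   qed
   moreover have "(C1 * (sqrt h + s)) * (M * \<nu> s) + m * (sqrt h + s) * \<nu> s = (C1 * M + m) * (sqrt h + s) * \<nu> s"
    by (simp add: algebra_simps)
   ultimately show ?thesis by linarith
  qed
 qed (use h C1 M m t \<nu> s in auto)
 define R where "R = (\<lambda>s. \<bar>w1 s - w2 s\<bar> / \<nu> s) ` {0..<b}"
 have bdd: "bdd_above R"
 proof (rule bdd_aboveI[of _ 4])
  fix x assume "x \<in> R"
  then obtain s where s': "0 \<le> s" "s < b" "x = \<bar>w1 s - w2 s\<bar> / \<nu> s" by (auto simp: R_def)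
  have "\<bar>w1 s - w2 s\<bar> \<le> 4 * \<nu> s" using w(1)[of s] w(2)[of s] s' by auto
  then show "x \<le> 4" using \<nu>(3)[of s] s' by (simp add: divide_le_eq)
 qed
 have ne: "R \<noteq> {}" using pos by (auto simp: R_def)
 define M where "M = Sup R"
 have wM: "\<bar>w1 s - w2 s\<bar> \<le> M * \<nu> s" if "0 \<le> s" "s < b" for s
 proof -
  have "\<bar>w1 s - w2 s\<bar> / \<nu> s \<le> M" unfolding M_def using that by (intro cSup_upper bdd) (auto simp: R_def)
  then show ?thesis using \<nu>(3)[of s] that by (simp add: divide_le_eq)
 qed
 have M0: "M \<ge> 0"
 proof -
  have "0 \<le> M * \<nu> 0" using wM[of 0] pos abs_ge_zero[of "w1 0 - w2 0"] by linarith
  then show ?thesis using \<nu>(3)[of 0] pos by (simp add: zero_le_mult_iff)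
 qed
 have wM': "\<bar>w1 s - w2 s\<bar> \<le> M * \<nu> s" if "s \<in> {0..b}" for s
 proof (cases "s = b")
  case True then show ?thesis using s(3) M0 \<nu>(2)[OF that] by simp
 next
  case False then show ?thesis using wM[of s] that by simp
 qed
 have "M \<le> K1 * h * b * (C1 * M + m)"
  unfolding M_def
 proof (rule cSup_least[OF ne])
  fix x assume "x \<in> R"
  then obtain s where s': "0 \<le> s" "s < b" "x = \<bar>w1 s - w2 s\<bar> / \<nu> s" by (auto simp: R_def)
  then show "x \<le> K1 * h * b * (C1 * Sup R + m)"
   using step[OF M0 wM', of s] \<nu>(3)[of s] by (simp add: divide_le_eq M_def)
 qed
 also have "... = \<epsilon> C1 h * M + K1 * h * b * m" by (simp add: \<epsilon>_def algebra_simps)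
 also have "\<epsilon> C1 h * M \<le> 1 / 2 * M" using \<epsilon> M0 by (intro mult_right_mono) auto
 finally have "M \<le> 2 * (K1 * h * b * m)" by linarith
 also have "2 * (K1 * h * b * m) = 4 * K1 * b * \<bar>e1 - e2\<bar> * (h / sqrt h)" by (simp add: m_def)
 also have "h / sqrt h = sqrt h" using h by (simp add: real_div_sqrt)
 also have "4 * K1 * b * \<bar>e1 - e2\<bar> * sqrt h \<le> 4 * K1 * b * \<bar>e1 - e2\<bar> * 1"
  using K1_pos pos h by (intro mult_left_mono) auto
 finally have "M * \<nu> 0 \<le> 4 * K1 * b * \<bar>e1 - e2\<bar> * \<nu> 0" using \<nu>(2)[of 0] pos by (intro mult_right_mono) auto
 then show ?thesis using wM[of 0] pos by linarith
qed

end

section \<open>Mass and barrier integrals of a half-well\<close>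

text \<open>Exponentially small quantities only ever need to be \<open>O (h\<^sup>3)\<close>.\<close>

lemma exp_small:
 fixes a h :: real
 assumes "a > 0" "h > 0" shows "exp (- a / h) \<le> (3 * h / a) ^ 3"
proof -
 have "(a / (3 * h)) ^ 3 \<le> (1 + a / (3 * h)) ^ 3" using assms by (intro power_mono) auto
 also have "... \<le> exp (a / (3 * h)) ^ 3" using assms by (intro power_mono) auto
 also have "... = exp (a / h)" using assms by (simp add: exp_of_nat_mult[symmetric])
 finally have "inverse (exp (a / h)) \<le> inverse ((a / (3 * h)) ^ 3)"
  using assms by (intro le_imp_inverse_le) auto
 then show ?thesis using assms by (simp add: exp_minus power_divide field_simps)
qed

context half_well
begin

lemma b_in: "b \<in> {0..b}" "0 \<in> {0..b}" using pos by auto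

lemma fb_pos: "f b > 0" using fc[OF b_in(1)] mult_pos_pos[OF pos(3,1)] by linarith

lemma pb_small: "h > 0 ==> p h b \<le> K * (3 * h / (c * b\<^sup>2)) ^ 3"
proof -
 assume h: "h > 0"
 have "p h b \<le> K * exp (- (c * b\<^sup>2) / h)" using p_decay[of 0 b h] pos h by simp
 also have "... \<le> K * (3 * h / (c * b\<^sup>2)) ^ 3"
  using exp_small[of "c * b\<^sup>2" h] pos h K_ge1 by (intro mult_left_mono) auto
 finally show ?thesis .
qed

text \<open>Laplace's method at the end point: \<open>1 / p\<close> is a logarithmic derivative up to small terms,
\<open>(h / (2 f p))' = 1 / p\<close> with relative error \<open>O h\<close> on \<open>[b / 2, b]\<close>, and the rest of the interval is negligible.\<close>

lemma J_asymptotic: "\<exists>C h0. C \<ge> 0 \<and> h0 > 0 \<and> (\<forall>h. 0 < h \<and> h < h0 --> \<bar>p h b * J h - h / (2 * f b)\<bar> \<le> C * h\<^sup>2)"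
proof -
 define m where "m = c * b / 2"
 have m: "m > 0" using pos by (simp add: m_def)
 define \<eta> where "\<eta> = \<kappa> / (2 * m\<^sup>2)"
 have \<eta>: "\<eta> > 0" using m pos by (simp add: \<eta>_def)
 define a where "a = 3 / 4 * c * b\<^sup>2"
 have a: "a > 0" using pos by (simp add: a_def)
 define CE where "CE = K * (3 / a) ^ 3"
 have CE: "CE \<ge> 0" using K_ge1 a by (simp add: CE_def)
 define C where "C = b / 2 * CE + \<eta> / f b + CE / (2 * m)"
 have "\<bar>p h b * J h - h / (2 * f b)\<bar> \<le> C * h\<^sup>2" if h: "0 < h" "h < min 1 (1 / (2 * \<eta>))" for h
 proof -
  have h1: "h \<le> 1" "h * \<eta> \<le> 1 / 2" using h \<eta> by (auto simp: field_simps)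
  have bh: "b / 2 \<in> {0..b}" using pos by auto
  have early: "p h b / p h s \<le> CE * h\<^sup>2" if s: "0 \<le> s" "s \<le> b / 2" for s
  proof -
   have "s\<^sup>2 \<le> (b / 2)\<^sup>2" using s by (intro power_mono) auto
   then have "c * (3 / 4 * b\<^sup>2) \<le> c * (b\<^sup>2 - s\<^sup>2)" using pos by (intro mult_left_mono) (auto simp: power_divide)
   then have "- c * (b\<^sup>2 - s\<^sup>2) / h \<le> - a / h" using h by (intro divide_right_mono) (auto simp: a_def)
   then have "exp (- c * (b\<^sup>2 - s\<^sup>2) / h) \<le> exp (- a / h)" by simp
   also have "... \<le> (3 * h / a) ^ 3" by (rule exp_small[OF a h(1)])
   finally have e: "exp (- c * (b\<^sup>2 - s\<^sup>2) / h) \<le> (3 * h / a) ^ 3" .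
   have "p h b \<le> K * p h s * exp (- c * (b\<^sup>2 - s\<^sup>2) / h)" using p_decay[of s b h] s h pos by auto
   then have "p h b / p h s \<le> K * exp (- c * (b\<^sup>2 - s\<^sup>2) / h)" using p_pos[of h s] by (simp add: divide_le_eq mult_ac)
   also have "... \<le> K * (3 * h / a) ^ 3" using e K_ge1 by (intro mult_left_mono) auto
   also have "... = CE * h\<^sup>2 * h" by (simp add: CE_def power_mult_distrib power_divide power2_eq_square power3_eq_cube)
   also have "... \<le> CE * h\<^sup>2 * 1" using h1 CE h by (intro mult_left_mono) auto
   finally show ?thesis by simp
  qed
  define X where "X = (\<lambda>t. h / (2 * f t * p h t))"
  have fm: "f t \<ge> m" if "t \<in> {b / 2..b}" for t
  proof -
   have "c * (b / 2) \<le> c * t" using that pos by (intro mult_left_mono) auto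
   also have "c * t \<le> f t" using fc[of t] that pos by auto
   finally show ?thesis by (simp add: m_def)
  qed
  have sub: "{b / 2..b} \<subseteq> {0..b}" using pos by auto
  have cX: "continuous_on {b / 2..b} X" unfolding X_def
   using fm m p_pos[of h] by (intro continuous_intros continuous_on_subset[OF cont_f sub] continuous_on_subset[OF cont_p sub])
    (metis less_le_trans less_irrefl mult_eq_0_iff zero_neq_numeral)
  have cA: "continuous_on {b / 2..b} (A h)" by (intro continuous_on_subset[OF DERIV_continuous_on[OF dA] sub])
  have "\<bar>(- A h b - X b) - (- A h (b / 2) - X (b / 2))\<bar> \<le> (- (h * \<eta>) * A h b) - (- (h * \<eta>) * A h (b / 2))"
  proof (rule deriv_compare)
   show "continuous_on {b / 2..b} (\<lambda>t. - A h t - X t)" "continuous_on {b / 2..b} (\<lambda>t. - (h * \<eta>) * A h t)"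
    by (intro continuous_intros cX cA)+
   fix t assume t: "b / 2 < t" "t < b"
   then have t': "t \<in> {0..b}" "0 < t" "t \<in> {b / 2..b}" using pos by auto
   have dAt: "(A h has_real_derivative - (1 / p h t)) (at t)" by (rule within_Icc_interior[OF dA[OF t'(1)] t'(2) t(2)])
   have ft: "f t > 0" using fm[OF t'(3)] m by linarith
   have dft: "(f has_real_derivative \<kappa> - 2 * f t * g t) (at t)" by (rule within_Icc_interior[OF df[OF t'(1)] t'(2) t(2)])
   have dpt: "(p h has_real_derivative (2 * g t - 2 * f t / h) * p h t) (at t)" by (rule within_Icc_interior[OF dp[OF t'(1) h(1)] t'(2) t(2)])
   have nz: "2 * f t * p h t \<noteq> 0" using ft p_pos[of h t] by simp
   have "(X has_real_derivative - (h * (2 * ((\<kappa> - 2 * f t * g t) * p h t + (2 * g t - 2 * f t / h) * p h t * f t))) / (2 * f t * p h t)\<^sup>2) (at t)"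
    unfolding X_def using dft dpt nz
    by (auto intro!: derivative_eq_intros simp: power2_eq_square)
   also have "- (h * (2 * ((\<kappa> - 2 * f t * g t) * p h t + (2 * g t - 2 * f t / h) * p h t * f t))) / (2 * f t * p h t)\<^sup>2
     = (1 - h * \<kappa> / (2 * (f t)\<^sup>2)) / p h t"
    using ft p_pos[of h t] h by (simp add: field_simps power2_eq_square)
   finally have dX: "(X has_real_derivative (1 - h * \<kappa> / (2 * (f t)\<^sup>2)) / p h t) (at t)" .
   show "((\<lambda>t. - A h t - X t) has_real_derivative (h * \<kappa> / (2 * (f t)\<^sup>2)) / p h t) (at t)"
    using DERIV_diff[OF DERIV_minus[OF dAt] dX] by (simp add: diff_divide_distrib)
   show "((\<lambda>t. - (h * \<eta>) * A h t) has_real_derivative (h * \<eta>) / p h t) (at t)"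
    using DERIV_cmult[OF dAt, of "- (h * \<eta>)"] by simp
   have "\<kappa> / (2 * (f t)\<^sup>2) \<le> \<eta>"
    unfolding \<eta>_def using fm[OF t'(3)] m pos by (intro divide_left_mono mult_left_mono power_mono) auto
   then have "h * \<kappa> / (2 * (f t)\<^sup>2) \<le> h * \<eta>" using h by (metis mult_le_cancel_left_pos times_divide_eq_right)
   then have "h * \<kappa> / (2 * (f t)\<^sup>2) / p h t \<le> h * \<eta> / p h t"
    using p_pos[of h t] by (intro divide_right_mono) auto
   moreover have "0 \<le> h * \<kappa> / (2 * (f t)\<^sup>2) / p h t" using p_pos[of h t] h pos by simp
   ultimately show "\<bar>h * \<kappa> / (2 * (f t)\<^sup>2) / p h t\<bar> \<le> h * \<eta> / p h t"
    by (simp only: abs_of_nonneg)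
  qed (use pos in auto)
  then have main: "\<bar>A h (b / 2) - (X b - X (b / 2))\<bar> \<le> h * \<eta> * A h (b / 2)" by (simp add: abs_minus_commute algebra_simps)
  have X0: "X (b / 2) \<ge> 0" unfolding X_def using fm[of "b / 2"] m pos h p_pos[of h "b / 2"] by simp
  have Ab: "A h (b / 2) \<ge> 0" by (rule A_nonneg[OF bh])
  have "h * \<eta> * A h (b / 2) \<le> 1 / 2 * A h (b / 2)" using h1 Ab by (intro mult_right_mono) auto
  then have A2: "A h (b / 2) \<le> 2 * X b" using main X0 by linarith
  have pX: "p h b * X b = h / (2 * f b)" using fb_pos p_pos[of h b] by (simp add: X_def)
  have pA: "p h b * A h (b / 2) \<le> h / f b"
   using mult_left_mono[OF A2, of "p h b"] p_pos[of h b] pX by (simp add: mult.left_commute)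
  have pX2: "p h b * X (b / 2) \<le> CE / (2 * m) * h\<^sup>2"
  proof -
   have "p h b * X (b / 2) = (p h b / p h (b / 2)) * (h / (2 * f (b / 2)))" by (simp add: X_def)
   also have "... \<le> (CE * h\<^sup>2) * (1 / (2 * m))"
    using early[of "b / 2"] fm[of "b / 2"] m pos h h1 CE by (intro mult_mono frac_le) auto
   finally show ?thesis by simp
  qed
  have i: "(\<lambda>t. 1 / p h t) integrable_on {0..b}" by (rule integrable_continuous_real[OF inv_p_cont])
  have Jsplit: "J h = integral {0..b / 2} (\<lambda>t. 1 / p h t) + A h (b / 2)"
   using hk_integral_combine[OF _ _ i, of "b / 2"] pos by (simp add: A_def J_def)
  have i2: "(\<lambda>t. 1 / p h t) integrable_on {0..b / 2}"
   by (intro integrable_continuous_real continuous_on_subset[OF inv_p_cont]) (use pos in auto)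
  have e0: "0 \<le> p h b * integral {0..b / 2} (\<lambda>t. 1 / p h t)"
   using p_pos by (intro mult_nonneg_nonneg integral_nonneg i2) (auto intro: less_imp_le)
  have e1: "p h b * integral {0..b / 2} (\<lambda>t. 1 / p h t) \<le> b / 2 * CE * h\<^sup>2"
  proof -
   have "p h b * integral {0..b / 2} (\<lambda>t. 1 / p h t) = integral {0..b / 2} (\<lambda>t. p h b * (1 / p h t))" by (rule integral_mult_right[symmetric])
   also have "... \<le> integral {0..b / 2} (\<lambda>t. CE * h\<^sup>2)"
    by (intro integral_le integrable_on_mult_right i2) (use early in auto)
   also have "... = b / 2 * CE * h\<^sup>2" using pos by simp
   finally show ?thesis .
  qed
  have "\<bar>p h b * A h (b / 2) - p h b * (X b - X (b / 2))\<bar> \<le> h * \<eta> * (p h b * A h (b / 2))"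
  proof -
   have "\<bar>p h b * A h (b / 2) - p h b * (X b - X (b / 2))\<bar> = p h b * \<bar>A h (b / 2) - (X b - X (b / 2))\<bar>"
    unfolding right_diff_distrib[symmetric] abs_mult using p_pos[of h b] by simp
   also have "... \<le> p h b * (h * \<eta> * A h (b / 2))" using main p_pos[of h b] by (intro mult_left_mono) auto
   finally show ?thesis by (simp add: mult_ac)
  qed
  also have "... \<le> h * \<eta> * (h / f b)" using pA h \<eta> by (intro mult_left_mono) auto
  finally have m1: "\<bar>p h b * A h (b / 2) - p h b * (X b - X (b / 2))\<bar> \<le> h * \<eta> * (h / f b)" .
  have eq1: "p h b * (X b - X (b / 2)) = h / (2 * f b) - p h b * X (b / 2)" by (simp only: right_diff_distrib pX)
  have eq2: "h * \<eta> * (h / f b) = \<eta> / f b * h\<^sup>2" by (simp add: power2_eq_square)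
  have m2: "\<bar>p h b * A h (b / 2) - (h / (2 * f b) - p h b * X (b / 2))\<bar> \<le> \<eta> / f b * h\<^sup>2"
   using m1 unfolding eq1 eq2 .
  have "p h b * X (b / 2) \<ge> 0" using X0 p_pos[of h b] by simp
  then show ?thesis using m2 pX2 e0 e1 by (simp add: Jsplit C_def distrib_left distrib_right abs_le_iff)
 qed
 moreover have "C \<ge> 0" using CE \<eta> fb_pos m pos by (simp add: C_def)
 ultimately show ?thesis using \<eta> by (intro exI[of _ C] exI[of _ "min 1 (1 / (2 * \<eta>))"]) auto
qed

text \<open>\<open>N\<close> is the mass of the approximate ground state. \<open>Dinf\<close> is the leading term of the tunnelling amplitude
\<open>\<delta>\<close>.\<close>

definition N :: "real \<Rightarrow> real" where "N h = integral {0..b} (p h)"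
definition Dinf :: "real \<Rightarrow> real" where "Dinf h = 4 * f b * p h b / h"

lemma p_integrable: "p h integrable_on {0..b}" by (rule integrable_continuous_real[OF cont_p])

lemma f_upper: "\<exists>B. B > 0 \<and> (\<forall>s\<in>{0..b}. f s \<le> B * s)"
proof -
 have "continuous_on {0..b} (\<lambda>s. \<kappa> - 2 * f s * g s)" by (intro continuous_intros cont_f cont_g)
 then have "bounded ((\<lambda>s. \<kappa> - 2 * f s * g s) ` {0..b})" by (intro compact_imp_bounded compact_continuous_image) auto
 then obtain B where "\<forall>x\<in>(\<lambda>s. \<kappa> - 2 * f s * g s) ` {0..b}. norm x \<le> B" unfolding bounded_iff by blast
 then have B: "\<And>s. s \<in> {0..b} ==> \<bar>\<kappa> - 2 * f s * g s\<bar> \<le> B" by auto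
 have "f s \<le> (\<bar>B\<bar> + 1) * s" if s: "s \<in> {0..b}" for s
 proof -
  have "\<bar>f s - f 0\<bar> \<le> (\<bar>B\<bar> + 1) * s - (\<bar>B\<bar> + 1) * 0"
  proof (rule deriv_compare[where f' = "\<lambda>s. \<kappa> - 2 * f s * g s" and \<phi>' = "\<lambda>_. \<bar>B\<bar> + 1"])
   fix x assume x: "0 < x" "x < s"
   show "(f has_real_derivative \<kappa> - 2 * f x * g x) (at x)" by (rule within_Icc_interior[OF df]) (use x s in auto)
   show "\<bar>\<kappa> - 2 * f x * g x\<bar> \<le> \<bar>B\<bar> + 1" using B[of x] x s by auto
  qed (use s in \<open>auto intro!: continuous_intros derivative_eq_intros intro: continuous_on_subset[OF cont_f]\<close>)
  then show ?thesis using f0 by simp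
 qed
 then show ?thesis by (intro exI[of _ "\<bar>B\<bar> + 1"]) auto
qed

lemma N_lower: "\<exists>n0. n0 > 0 \<and> (\<forall>h. 0 < h \<and> h \<le> b\<^sup>2 --> n0 * sqrt h \<le> N h)"
proof -
 obtain B where B: "B > 0" "\<And>s. s \<in> {0..b} ==> f s \<le> B * s" using f_upper by blast
 have FB: "F s \<le> B / 2 * s\<^sup>2" if s: "s \<in> {0..b}" for s
 proof -
  have "F s - B / 2 * s\<^sup>2 \<le> F 0 - B / 2 * 0\<^sup>2"
  proof (rule DERIV_nonpos_imp_decreasing_open[of 0 s "\<lambda>x. F x - B / 2 * x\<^sup>2"])
   fix x assume x: "0 < x" "x < s"
   have "(F has_real_derivative f x) (at x)" by (rule within_Icc_interior[OF dF]) (use x s in auto)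
   then have "((\<lambda>x. F x - B / 2 * x\<^sup>2) has_real_derivative f x - B * x) (at x)" by (auto intro!: derivative_eq_intros)
   moreover have "f x - B * x \<le> 0" using B(2)[of x] x s by simp
   ultimately show "\<exists>y. ((\<lambda>x. F x - B / 2 * x\<^sup>2) has_real_derivative y) (at x) \<and> y \<le> 0" by blast
  qed (use s in \<open>auto intro!: continuous_intros intro: continuous_on_subset[OF cont_F]\<close>)
  then show ?thesis by simp
 qed
 define n0 where "n0 = exp (- 2 * \<Gamma> - B)"
 have "n0 * sqrt h \<le> N h" if h: "0 < h" "h \<le> b\<^sup>2" for h
 proof -
  have sb: "sqrt h \<le> b" using h pos by (simp add: real_le_lsqrt)
  have low: "n0 \<le> p h s" if s: "0 \<le> s" "s \<le> sqrt h" for s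
  proof -
   have "s\<^sup>2 \<le> h" using s h power_mono[of s "sqrt h" 2] by simp
   then have "B / 2 * s\<^sup>2 \<le> B / 2 * h" using B by (intro mult_left_mono) auto
   then have "F s \<le> B / 2 * h" using FB[of s] s sb by auto
   then have "2 * F s / h \<le> B" using h by (simp add: divide_le_eq)
   moreover have "- \<Gamma> \<le> G s" using \<Gamma>[of s] s sb by auto
   ultimately show ?thesis by (simp add: n0_def p_def)
  qed
  have "n0 * sqrt h = integral {0..sqrt h} (\<lambda>_. n0)" using h by simp
  also have "... \<le> integral {0..sqrt h} (p h)"
   by (intro integral_le integrable_continuous_real continuous_on_subset[OF cont_p]) (use low sb in auto)
  also have "... \<le> N h" unfolding N_def
   by (intro integral_subset_le integrable_continuous_real continuous_on_subset[OF cont_p])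
     (use sb p_pos in \<open>auto intro: less_imp_le\<close>)
  finally show ?thesis .
 qed
 then show ?thesis by (intro exI[of _ n0]) (auto simp: n0_def)
qed

lemma kernel_integral:
 assumes h: "h > 0"
 shows "integral {0..b} (\<lambda>s. (sqrt h + s) * p h s) \<le> K1 * h"
proof -
 define Y where "Y = (\<lambda>s. integral {0..b} (\<lambda>s. (sqrt h + s) * p h s) - integral {0..s} (\<lambda>s. (sqrt h + s) * p h s))"
 have cg: "continuous_on {0..b} (\<lambda>s. (sqrt h + s) * p h s)" by (intro continuous_intros cont_p)
 have dY: "(Y has_real_derivative - (p h s * (sqrt h + s))) (at s within {0..b})" if s: "s \<in> {0..b}" for s
 proof -
  have "((\<lambda>s. integral {0..s} (\<lambda>s. (sqrt h + s) * p h s)) has_real_derivative (sqrt h + s) * p h s) (at s within {0..b})"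
   by (simp add: has_real_derivative_iff_has_vector_derivative integral_has_vector_derivative[OF cg s])
  from DERIV_diff[OF DERIV_const this] show ?thesis unfolding Y_def by (simp add: mult.commute)
 qed
 have cYp: "continuous_on {0..b} (\<lambda>s. Y s / p h s)"
  by (intro continuous_intros DERIV_continuous_on[OF dY] cont_p) (use p_pos in \<open>auto simp: less_imp_neq[symmetric]\<close>)
 define W where "W = (\<lambda>s. integral {0..s} (\<lambda>s. Y s / p h s) - integral {0..b} (\<lambda>s. Y s / p h s))"
 have dW: "(W has_real_derivative Y s / p h s) (at s within {0..b})" if s: "s \<in> {0..b}" for s
 proof -
  have "((\<lambda>s. integral {0..s} (\<lambda>s. Y s / p h s)) has_real_derivative Y s / p h s) (at s within {0..b})"
   by (simp add: has_real_derivative_iff_has_vector_derivative integral_has_vector_derivative[OF cYp s])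
  from DERIV_diff[OF this DERIV_const] show ?thesis unfolding W_def by simp
 qed
 have "\<bar>Y 0\<bar> \<le> K1 * h * 1 * 1 * p h 0"
  by (rule volterra_bound(1)[OF h dW dY, where \<nu> = "\<lambda>_. 1" and M = 1]) (use h pos in \<open>auto simp: W_def Y_def\<close>)
 then show ?thesis by (simp add: Y_def)
qed

text \<open>\<open>A h / J h\<close> is close to \<open>1\<close> where \<open>p\<close> is not small, because \<open>p (J - A)\<close> is bounded.\<close>

lemma pA_lower:
 assumes h: "h > 0"
 shows "N h - K * b\<^sup>2 / J h \<le> integral {0..b} (\<lambda>s. p h s * (A h s / J h))"
  and "N h - 2 * K * b\<^sup>2 / J h \<le> integral {0..b} (\<lambda>s. p h s * (A h s / J h)\<^sup>2)"
proof -
 have cA: "continuous_on {0..b} (A h)" by (rule DERIV_continuous_on[OF dA])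
 have a: "p h s * (1 - A h s / J h) \<le> K * b / J h" and a1: "0 \<le> 1 - A h s / J h" if s: "s \<in> {0..b}" for s
 proof -
  have "\<bar>(- A h s) - (- A h 0)\<bar> \<le> K / p h s * s - K / p h s * 0"
  proof (rule deriv_compare[where f' = "\<lambda>t. 1 / p h t" and \<phi>' = "\<lambda>_. K / p h s"])
   show "continuous_on {0..s} (\<lambda>t. - A h t)" using s by (intro continuous_intros continuous_on_subset[OF cA]) auto
   fix t assume t: "0 < t" "t < s"
   have "(A h has_real_derivative - (1 / p h t)) (at t)" by (rule within_Icc_interior[OF dA]) (use t s in auto)
   from DERIV_minus[OF this] show "((\<lambda>t. - A h t) has_real_derivative 1 / p h t) (at t)" by simp
   have "p h s \<le> K * p h t" using p_quasi_antimono[of t s h] t s h by auto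
   then show "\<bar>1 / p h t\<bar> \<le> K / p h s" using p_pos[of h t] p_pos[of h s] by (simp add: field_simps)
  qed (use s in \<open>auto intro!: continuous_intros derivative_eq_intros\<close>)
  then have "J h - A h s \<le> K * s / p h s" by (simp add: J_def abs_le_iff)
  also have "... \<le> K * b / p h s" using s K_ge1 p_pos[of h s] by (intro divide_right_mono mult_left_mono) auto
  finally have "p h s * (J h - A h s) \<le> K * b" using p_pos[of h s] by (simp add: le_divide_eq mult.commute)
  then have "p h s * (J h - A h s) / J h \<le> K * b / J h" using J_pos[of h] by (intro divide_right_mono) auto
  then show "p h s * (1 - A h s / J h) \<le> K * b / J h" using J_pos[of h] by (simp add: diff_divide_distrib right_diff_distrib)
  show "0 \<le> 1 - A h s / J h" using A_antimono[of 0 s h] s J_pos[of h] by (simp add: J_def divide_le_eq)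
 qed
 have cAJ: "continuous_on {0..b} (\<lambda>s. A h s / J h)" using J_pos[of h] by (intro continuous_intros cA) auto
 have "N h - K * b\<^sup>2 / J h = integral {0..b} (\<lambda>s. p h s - K * b / J h)"
  unfolding N_def using pos by (subst hk_integral_diff[OF p_integrable]) (auto simp: power2_eq_square)
 also have "... \<le> integral {0..b} (\<lambda>s. p h s * (A h s / J h))"
 proof (intro integral_le integrable_continuous_real continuous_on_mult continuous_on_diff continuous_on_power continuous_on_const cont_p cAJ)
  fix s assume "s \<in> {0..b}"
  from a[OF this] show "p h s - K * b / J h \<le> p h s * (A h s / J h)" by (simp add: right_diff_distrib)
 qed
 finally show "N h - K * b\<^sup>2 / J h \<le> integral {0..b} (\<lambda>s. p h s * (A h s / J h))" .
 have "N h - 2 * K * b\<^sup>2 / J h = integral {0..b} (\<lambda>s. p h s - 2 * (K * b / J h))"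
  unfolding N_def using pos by (subst hk_integral_diff[OF p_integrable]) (auto simp: power2_eq_square)
 also have "... \<le> integral {0..b} (\<lambda>s. p h s * (A h s / J h)\<^sup>2)"
 proof (intro integral_le integrable_continuous_real continuous_on_mult continuous_on_diff continuous_on_power continuous_on_const cont_p cAJ)
  fix s assume s: "s \<in> {0..b}"
  define x where "x = 1 - A h s / J h"
  have xx: "(A h s / J h)\<^sup>2 = 1 - 2 * x + x\<^sup>2" by (simp add: x_def power2_eq_square algebra_simps)
  have "p h s * (A h s / J h)\<^sup>2 = p h s - 2 * (p h s * x) + p h s * x\<^sup>2"
   unfolding xx by (simp add: algebra_simps)
  moreover have "p h s * x \<le> K * b / J h" using a[OF s] by (simp add: x_def)
  moreover have "p h s * x\<^sup>2 \<ge> 0" using p_pos[of h s] by simp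
  ultimately show "p h s - 2 * (K * b / J h) \<le> p h s * (A h s / J h)\<^sup>2" by linarith
 qed
 finally show "N h - 2 * K * b\<^sup>2 / J h \<le> integral {0..b} (\<lambda>s. p h s * (A h s / J h)\<^sup>2)" .
qed

lemma wronskian_energy:
 assumes "sol h e1 w1 y1" "sol h e2 w2 y2" "w1 b = 0" "w2 b = 0"
 shows "w2 0 * y1 0 - w1 0 * y2 0 = (e1 - e2) * integral {0..b} (\<lambda>s. p h s * (w1 s * w2 s))"
proof -
 have "((\<lambda>s. - (e1 - e2) * (p h s * (w1 s * w2 s))) has_integral
   (w2 b * y1 b - w1 b * y2 b) - (w2 0 * y1 0 - w1 0 * y2 0)) {0..b}"
 proof (rule fundamental_theorem_of_calculus)
  fix s assume s: "s \<in> {0..b}"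
  have d: "(w1 has_real_derivative y1 s / p h s) (at s within {0..b})" "(w2 has_real_derivative y2 s / p h s) (at s within {0..b})"
   "(y1 has_real_derivative - (p h s * ((e1 - r s) * w1 s))) (at s within {0..b})"
   "(y2 has_real_derivative - (p h s * ((e2 - r s) * w2 s))) (at s within {0..b})"
   using assms(1,2) s by (auto simp: sol_def)
  have "((\<lambda>s. w2 s * y1 s - w1 s * y2 s) has_real_derivative
    (y2 s / p h s * y1 s + - (p h s * ((e1 - r s) * w1 s)) * w2 s) - (y1 s / p h s * y2 s + - (p h s * ((e2 - r s) * w2 s)) * w1 s)) (at s within {0..b})"
   by (intro DERIV_diff DERIV_mult d)
  also have "(y2 s / p h s * y1 s + - (p h s * ((e1 - r s) * w1 s)) * w2 s) - (y1 s / p h s * y2 s + - (p h s * ((e2 - r s) * w2 s)) * w1 s)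
   = - (e1 - e2) * (p h s * (w1 s * w2 s))" by (simp add: algebra_simps)
  finally show "((\<lambda>s. w2 s * y1 s - w1 s * y2 s) has_vector_derivative - (e1 - e2) * (p h s * (w1 s * w2 s))) (at s within {0..b})"
   by (simp add: has_real_derivative_iff_has_vector_derivative)
 qed (use pos in simp)
 from integral_unique[OF this]
 have "- (e1 - e2) * integral {0..b} (\<lambda>s. p h s * (w1 s * w2 s)) = (w2 b * y1 b - w1 b * y2 b) - (w2 0 * y1 0 - w1 0 * y2 0)"
  by (simp only: integral_mult_right)
 then have "(e1 - e2) * integral {0..b} (\<lambda>s. p h s * (w1 s * w2 s)) = - ((w2 b * y1 b - w1 b * y2 b) - (w2 0 * y1 0 - w1 0 * y2 0))"
  by (simp only: mult_minus_left minus_equation_iff)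
 then show ?thesis using assms(3,4) by simp
qed

lemma y_at_0:
 assumes "sol h e w y"
 shows "y 0 = y b + integral {0..b} (\<lambda>s. p h s * ((e - r s) * w s))"
proof -
 have "((\<lambda>s. - (p h s * ((e - r s) * w s))) has_integral y b - y 0) {0..b}"
  by (rule fundamental_theorem_of_calculus)
    (use assms pos in \<open>auto simp: sol_def has_real_derivative_iff_has_vector_derivative\<close>)
 from integral_unique[OF this] show ?thesis by simp
qed

end

section \<open>The response of a half-well at the well bottom\<close>

context half_well
begin

text \<open>In terms of \<open>w\<close> and \<open>y\<close>, the logarithmic derivative of the odd solution at the well is \<open>- d\<close> up to the
shift by \<open>g 0\<close>, and the Wronskian gives \<open>\<delta>\<close>.\<close>

definition resp :: "real \<Rightarrow> real \<Rightarrow> real \<Rightarrow> real \<Rightarrow> bool" where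
 "resp h e d \<delta> \<longleftrightarrow> (\<exists>wD yD wN yN. sol h e wD yD \<and> wD b = 0 \<and> yD b = - 1 \<and>
   sol h e wN yN \<and> wN b = 1 \<and> yN b = \<beta> h \<and> d = - yD 0 / wD 0 \<and> \<delta> = 1 / (wN 0 * wD 0))"

text \<open>These follow from \<open>p b * J = h / (2 f b) + O (h\<^sup>2)\<close> and the smallness of \<open>p b\<close>. As \<open>\<beta> * J\<close> is close
to \<open>1 / 2\<close>, the quotient of the even solution by \<open>\<Psi>\<close> halves between \<open>b\<close> and \<open>0\<close>.\<close>

lemma scale_facts:
 "\<exists>C h0. C \<ge> 1 \<and> h0 > 0 \<and> (\<forall>h. 0 < h \<and> h < h0 --> 0 \<le> \<beta> h \<and> \<beta> h * J h \<le> 1 \<and>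
   \<bar>\<beta> h * J h - 1 / 2\<bar> \<le> C * h \<and> \<bar>J h * Dinf h / 2 - 1\<bar> \<le> C * h \<and> 1 / J h \<le> C * h\<^sup>2 \<and> Dinf h \<le> C * h\<^sup>2 \<and> 1 / J h \<le> Dinf h)"
proof -
 obtain C h0 where C: "C \<ge> 0" and h0: "h0 > 0"
  and J: "\<And>h. 0 < h ==> h < h0 ==> \<bar>p h b * J h - h / (2 * f b)\<bar> \<le> C * h\<^sup>2"
  using J_asymptotic by blast
 define C1 where "C1 = f b * C + \<bar>g b\<bar> / (2 * f b) + \<bar>g b\<bar> * C"
 define C2 where "C2 = 2 * f b * C"
 define C3 where "C3 = 4 * f b * (K * (3 / (c * b\<^sup>2)) ^ 3)"
 define C' where "C' = 1 + C1 + C2 + C3"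
 have nn: "C1 \<ge> 0" "C2 \<ge> 0" "C3 \<ge> 0" using C fb_pos pos K_ge1 by (auto simp: C1_def C2_def C3_def)
 define h1 where "h1 = min (min h0 1) (min (1 / (2 * C')) (f b / (\<bar>g b\<bar> + 1)))"
 have C'1: "C' \<ge> 1" using nn by (simp add: C'_def)
 have h1: "h1 > 0" using h0 C'1 fb_pos by (simp add: h1_def)
 have "0 \<le> \<beta> h \<and> \<beta> h * J h \<le> 1 \<and>
   \<bar>\<beta> h * J h - 1 / 2\<bar> \<le> C' * h \<and> \<bar>J h * Dinf h / 2 - 1\<bar> \<le> C' * h \<and> 1 / J h \<le> C' * h\<^sup>2 \<and> Dinf h \<le> C' * h\<^sup>2 \<and> 1 / J h \<le> Dinf h"
  if h: "0 < h" "h < h1" for h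
 proof -
  have hh: "h < h0" "h \<le> 1" "h * C' \<le> 1 / 2" "h * (\<bar>g b\<bar> + 1) \<le> f b"
   using h C'1 by (auto simp: h1_def field_simps)
  define x where "x = p h b * J h - h / (2 * f b)"
  have x: "\<bar>x\<bar> \<le> C * h\<^sup>2" using J[OF h(1) hh(1)] by (simp add: x_def)
  have x1: "\<bar>x\<bar> \<le> C * h"
  proof -
   have "C * (h * h) \<le> C * (h * 1)" using hh C h by (intro mult_left_mono) auto
   then show ?thesis using x by (simp add: power2_eq_square)
  qed
  have pJ: "p h b * J h = h / (2 * f b) + x" by (simp add: x_def)
  have "g b \<le> \<bar>g b\<bar> + 1" by linarith
  from mult_left_mono[OF this, of h] have "h * g b \<le> f b" using hh(4) h(1) by linarith
  then have "g b \<le> f b / h" using h by (simp add: le_divide_eq mult.commute)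
  then have \<beta>0: "0 \<le> \<beta> h" using p_pos[of h b] by (simp add: \<beta>_def)
  have "\<beta> h * J h = (f b / h - g b) * (p h b * J h)" by (simp add: \<beta>_def)
  also have "... = 1 / 2 + f b / h * x - g b * (h / (2 * f b)) - g b * x"
   unfolding pJ using fb_pos h by (simp add: field_simps)
  finally have e: "\<beta> h * J h - 1 / 2 = f b / h * x - g b * (h / (2 * f b)) - g b * x" by simp
  have t1: "\<bar>f b / h * x\<bar> \<le> f b * C * h"
  proof -
   have "\<bar>f b / h * x\<bar> = f b / h * \<bar>x\<bar>" using fb_pos h by (simp add: abs_mult)
   also have "... \<le> f b / h * (C * h\<^sup>2)" using x fb_pos h by (intro mult_left_mono) auto
   finally show ?thesis using h by (simp add: power2_eq_square)
  qed
  have t2: "\<bar>g b * (h / (2 * f b))\<bar> \<le> \<bar>g b\<bar> / (2 * f b) * h" using fb_pos h by (simp add: abs_mult)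
  have t3: "\<bar>g b * x\<bar> \<le> \<bar>g b\<bar> * C * h" unfolding abs_mult using x1 by (simp add: mult.assoc mult_left_mono)
  have "\<bar>\<beta> h * J h - 1 / 2\<bar> \<le> f b * C * h + \<bar>g b\<bar> / (2 * f b) * h + \<bar>g b\<bar> * C * h"
   unfolding e using t1 t2 t3 by linarith
  also have "... = C1 * h" by (simp add: C1_def algebra_simps)
  also have "... \<le> C' * h" using nn h by (intro mult_right_mono) (auto simp: C'_def)
  finally have r1: "\<bar>\<beta> h * J h - 1 / 2\<bar> \<le> C' * h" .
  have r2: "\<beta> h * J h \<le> 1" using r1 hh(3) by (simp add: mult.commute abs_le_iff)
  have "J h * Dinf h / 2 = (2 * f b / h) * (p h b * J h)" by (simp add: Dinf_def)
  also have "... = 1 + 2 * f b / h * x" unfolding pJ using fb_pos h by (simp add: field_simps)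
  finally have e2': "J h * Dinf h / 2 = 1 + 2 * f b / h * x" .
  have "2 * f b / h * x = 2 * (f b / h * x)" by simp
  with e2' have e2: "J h * Dinf h / 2 - 1 = 2 * (f b / h * x)" by linarith
  have "\<bar>J h * Dinf h / 2 - 1\<bar> \<le> 2 * (f b * C * h)" unfolding e2 using t1 by (simp add: abs_mult)
  also have "... = C2 * h" by (simp add: C2_def)
  also have "... \<le> C' * h" using nn h by (intro mult_right_mono) (auto simp: C'_def)
  finally have r3: "\<bar>J h * Dinf h / 2 - 1\<bar> \<le> C' * h" .
  have r4: "1 / J h \<le> Dinf h"
  proof -
   have "J h * Dinf h \<ge> 1" using r3 hh(3) by (simp add: mult.commute abs_le_iff)
   then show ?thesis using J_pos[of h] by (simp add: divide_le_eq mult.commute)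
  qed
  have "Dinf h \<le> 4 * f b * (K * (3 * h / (c * b\<^sup>2)) ^ 3) / h"
   unfolding Dinf_def using pb_small[OF h(1)] fb_pos h by (intro divide_right_mono mult_left_mono) auto
  also have "... = C3 * h\<^sup>2" using h by (simp add: C3_def power2_eq_square power3_eq_cube field_simps)
  also have "... \<le> C' * h\<^sup>2" using nn by (intro mult_right_mono) (auto simp: C'_def)
  finally have r5: "Dinf h \<le> C' * h\<^sup>2" .
  show ?thesis using \<beta>0 r1 r2 r3 r4 r5 by auto
 qed
 then show ?thesis using C'1 h1 by blast
qed

lemma product_near_one:
 fixes a x y t :: real
 assumes "\<bar>a - 1\<bar> \<le> t" "\<bar>x - 1\<bar> \<le> t" "\<bar>y - 1\<bar> \<le> t" "t \<le> 1 / 14"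
 shows "a * x * y > 0" "\<bar>1 / (a * x * y) - 1\<bar> \<le> 14 * t"
proof -
 define u where "u = a - 1"
 define v where "v = x - 1"
 define w where "w = y - 1"
 have uvw: "\<bar>u\<bar> \<le> t" "\<bar>v\<bar> \<le> t" "\<bar>w\<bar> \<le> t" using assms by (auto simp: u_def v_def w_def)
 have t0: "0 \<le> t" using assms by linarith
 have uv: "\<bar>u * v\<bar> \<le> t" "\<bar>v * w\<bar> \<le> t" "\<bar>u * w\<bar> \<le> t" "\<bar>u * v * w\<bar> \<le> t"
 proof -
  have k: "\<bar>m * n\<bar> \<le> t" if "\<bar>m\<bar> \<le> t" "\<bar>n\<bar> \<le> t" for m n :: real
  proof -
   have "\<bar>m * n\<bar> \<le> t * 1" unfolding abs_mult using that assms(4) t0 by (intro mult_mono) auto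
   then show ?thesis by simp
  qed
  show 1: "\<bar>u * v\<bar> \<le> t" by (rule k[OF uvw(1,2)])
  show "\<bar>v * w\<bar> \<le> t" by (rule k[OF uvw(2,3)])
  show "\<bar>u * w\<bar> \<le> t" by (rule k[OF uvw(1,3)])
  show "\<bar>u * v * w\<bar> \<le> t" by (rule k[OF 1 uvw(3)])
 qed
 have "a * x * y - 1 = u + v + w + u * v + v * w + u * w + u * v * w"
  by (simp add: u_def v_def w_def algebra_simps)
 then have X: "\<bar>a * x * y - 1\<bar> \<le> 7 * t"
  using uv[unfolded abs_le_iff] uvw[unfolded abs_le_iff] by (intro abs_leI) linarith+
 then have X2: "a * x * y \<ge> 1 / 2" using assms(4) by linarith
 then show "a * x * y > 0" by linarith
 have "\<bar>1 / (a * x * y) - 1\<bar> = \<bar>a * x * y - 1\<bar> / (a * x * y)"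
 proof -
  have nz: "a * x * y \<noteq> 0" using X2 by linarith
  have "1 / (a * x * y) - 1 = (1 - a * x * y) / (a * x * y)"
   by (simp only: diff_divide_distrib divide_self[OF nz])
  then show ?thesis using X2 by (simp add: abs_divide abs_minus_commute)
 qed
 also have "... \<le> 7 * t / (1 / 2)" using X X2 t0 by (intro frac_le) auto
 finally show "\<bar>1 / (a * x * y) - 1\<bar> \<le> 14 * t" by simp
qed

text \<open>Energies within \<open>O (sqrt h)\<close> of \<open>r 0\<close> are those for which the Volterra estimate gains a factor \<open>h\<close>.\<close>

lemma window:
 assumes "h > 0" "C0 \<ge> 0" "\<bar>e - r 0\<bar> \<le> C0 * sqrt h" "s \<in> {0..b}"
 shows "\<bar>e - r s\<bar> \<le> (C0 + L) * (sqrt h + s)"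
proof -
 have "\<bar>r s - r 0\<bar> \<le> L * s" using Lip[OF assms(4)] by (simp add: r_def abs_minus_commute)
 then have "\<bar>e - r s\<bar> \<le> C0 * sqrt h + L * s" using assms(3) by linarith
 also have "... \<le> (C0 + L) * (sqrt h + s)" using assms L_nonneg by (simp add: algebra_simps)
 finally show ?thesis .
qed

definition response_bound where
 "response_bound C C0 h e d \<delta> \<longleftrightarrow> \<delta> > 0 \<and> \<bar>\<delta> - Dinf h\<bar> \<le> C * h * Dinf h \<and> Dinf h \<le> C * h\<^sup>2 \<and>
   (\<forall>e' d' \<delta>'. \<bar>e' - r 0\<bar> \<le> C0 * sqrt h \<and> resp h e' d' \<delta>' -->
    \<bar>\<delta> - \<delta>'\<bar> \<le> C * \<bar>e - e'\<bar> * Dinf h \<and> \<bar>d - d' + (e - e') * N h\<bar> \<le> C * h * N h * \<bar>e - e'\<bar>)"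

text \<open>\<open>\<delta> = 1 / (w\<^sub>N 0 * w\<^sub>D 0)\<close> with \<open>w\<^sub>N 0\<close> near \<open>1 / 2\<close> and \<open>w\<^sub>D 0\<close> near \<open>J\<close>, while
\<open>d - d'\<close> is by the Wronskian identity \<open>e' - e\<close> times the \<open>p\<close>-weighted integral of the product of the two Dirichlet solutions, normalised at \<open>0\<close>; since \<open>w\<^sub>D / w\<^sub>D 0\<close> is close to \<open>1\<close> where \<open>p\<close> lives, that integral is close to \<open>N\<close>.\<close>

lemma resp_estimates:
 assumes C0: "C0 \<ge> 0"
 shows "\<exists>C h0. C \<ge> 0 \<and> h0 > 0 \<and> (\<forall>h e d \<delta>. 0 < h \<and> h < h0 \<and> \<bar>e - r 0\<bar> \<le> C0 * sqrt h \<and> resp h e d \<delta> -->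
   response_bound C C0 h e d \<delta>)"
proof -
 obtain Cs hs where Cs: "Cs \<ge> 1" "hs > 0" and S: "\<And>h. 0 < h ==> h < hs ==> 0 \<le> \<beta> h \<and> \<beta> h * J h \<le> 1 \<and>
   \<bar>\<beta> h * J h - 1 / 2\<bar> \<le> Cs * h \<and> \<bar>J h * Dinf h / 2 - 1\<bar> \<le> Cs * h \<and> 1 / J h \<le> Cs * h\<^sup>2 \<and> Dinf h \<le> Cs * h\<^sup>2 \<and> 1 / J h \<le> Dinf h"
  using scale_facts by blast
 obtain n0 where n0: "n0 > 0" "\<And>h. 0 < h ==> h \<le> b\<^sup>2 ==> n0 * sqrt h \<le> N h" using N_lower by blast
 define C1 where "C1 = C0 + L"
 have C1: "C1 \<ge> 0" using C0 L_nonneg by (simp add: C1_def)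
 define k where "k = K1 * b * C1"
 have k: "k \<ge> 0" using K1_pos pos C1 by (simp add: k_def)
 have \<epsilon>k: "\<epsilon> C1 h = k * h" for h by (simp add: \<epsilon>_def k_def)
 define t0 where "t0 = 4 * k + 2 * Cs"
 have t0: "t0 > 0" using k Cs by (simp add: t0_def add_nonneg_pos)
 define q where "q = 4 * K1 * b"
 have q: "q > 0" using K1_pos pos by (simp add: q_def)
 define C where "C = 14 * t0 + Cs + 256 * q + 32 * k + 2 * K * b\<^sup>2 * Cs / n0"
 have C: "C \<ge> 14 * t0" "C \<ge> Cs" "C \<ge> 256 * q" "C \<ge> 32 * k + 2 * K * b\<^sup>2 * Cs / n0" "C \<ge> 0"
  using t0 Cs q k K_ge1 n0 by (auto simp: C_def)
 define h0 where "h0 = min (min hs 1) (min (b\<^sup>2) (1 / (14 * t0)))"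
 have h0: "h0 > 0" using Cs t0 pos by (simp add: h0_def)
 have "response_bound C C0 h e d \<delta>"
  if h: "0 < h" "h < h0" and e: "\<bar>e - r 0\<bar> \<le> C0 * sqrt h" and rs: "resp h e d \<delta>" for h e d \<delta>
 proof -
  have hh: "h < hs" "h \<le> 1" "h \<le> b\<^sup>2" "h * t0 \<le> 1 / 14" using h t0 by (auto simp: h0_def field_simps)
  note Sh = S[OF h(1) hh(1)]
  have \<epsilon>t: "4 * \<epsilon> C1 h \<le> t0 * h" "2 * Cs * h \<le> t0 * h" using Cs k h by (auto simp: \<epsilon>k t0_def algebra_simps)
  have \<epsilon>0: "0 \<le> \<epsilon> C1 h" using k h by (simp add: \<epsilon>k)
  have \<epsilon>h: "\<epsilon> C1 h \<le> 1 / 56" using \<epsilon>t(1) hh(4) by (simp add: mult.commute)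
  have J: "J h > 0" by (rule J_pos)
  have D: "Dinf h > 0" unfolding Dinf_def using fb_pos p_pos[of h b] h by simp
  have main: "\<delta> > 0 \<and> \<bar>\<delta> - Dinf h\<bar> \<le> C * h * Dinf h" and facts: "\<exists>wD yD wN yN. sol h e wD yD \<and> wD b = 0 \<and> yD b = - 1 \<and> sol h e wN yN \<and> wN b = 1 \<and> yN b = \<beta> h \<and> d = - yD 0 / wD 0 \<and> \<delta> = 1 / (wN 0 * wD 0) \<and>
    (\<forall>s\<in>{0..b}. \<bar>wD s - A h s\<bar> \<le> 2 * \<epsilon> C1 h * A h s \<and> \<bar>wN s\<bar> \<le> 2) \<and> 1 / 4 \<le> wN 0"
   if e: "\<bar>e - r 0\<bar> \<le> C0 * sqrt h" and rs: "resp h e d \<delta>" for e d \<delta>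
  proof -
   obtain wD yD wN yN where D1: "sol h e wD yD" "wD b = 0" "yD b = - 1"
    and N1: "sol h e wN yN" "wN b = 1" "yN b = \<beta> h" and dd: "d = - yD 0 / wD 0" "\<delta> = 1 / (wN 0 * wD 0)"
    using rs by (auto simp: resp_def)
   have er: "\<And>s. s \<in> {0..b} ==> \<bar>e - r s\<bar> \<le> C1 * (sqrt h + s)"
    unfolding C1_def using window[OF h(1) C0 e] .
   have \<epsilon>2: "\<epsilon> C1 h \<le> 1 / 2" using \<epsilon>h by linarith
   have dE: "\<bar>wD t - A h t\<bar> \<le> 2 * \<epsilon> C1 h * A h t" if "t \<in> {0..b}" for t
    by (rule dirichlet_estimate[OF h(1) D1 er C1 \<epsilon>2 that])
   have nE: "\<bar>wN t - (1 - \<beta> h * A h t)\<bar> \<le> 2 * \<epsilon> C1 h" "\<bar>wN t\<bar> \<le> 2" if "t \<in> {0..b}" for t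
    using neumann_estimate[OF h(1) N1 _ _ er C1 \<epsilon>2 that] Sh by auto
   have wD0: "\<bar>wD 0 / J h - 1\<bar> \<le> t0 * h"
   proof -
    have "\<bar>wD 0 - J h\<bar> \<le> 2 * \<epsilon> C1 h * J h" using dE[OF b_in(2)] by (simp add: J_def)
    then have "\<bar>wD 0 - J h\<bar> / J h \<le> 2 * \<epsilon> C1 h" using J by (simp add: divide_le_eq)
    moreover have "\<bar>wD 0 / J h - 1\<bar> = \<bar>wD 0 - J h\<bar> / J h" using J by (simp add: abs_if field_simps)
    ultimately show ?thesis using \<epsilon>t(1) \<epsilon>0 by linarith
   qed
   have wN0: "\<bar>2 * wN 0 - 1\<bar> \<le> t0 * h"
   proof -
    have "\<bar>wN 0 - (1 - \<beta> h * J h)\<bar> \<le> 2 * \<epsilon> C1 h" using nE(1)[OF b_in(2)] by (simp add: J_def)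
    then have "\<bar>wN 0 - 1 / 2\<bar> \<le> 2 * \<epsilon> C1 h + Cs * h" using Sh by linarith
    then have "\<bar>2 * wN 0 - 1\<bar> \<le> 4 * \<epsilon> C1 h + 2 * Cs * h" by linarith
    then show ?thesis by (simp add: \<epsilon>k t0_def algebra_simps)
   qed
   have JD: "\<bar>J h * Dinf h / 2 - 1\<bar> \<le> t0 * h"
   proof -
    have "\<bar>J h * Dinf h / 2 - 1\<bar> \<le> Cs * h" using Sh by blast
    moreover have "0 \<le> Cs * h" using Cs h by simp
    ultimately show ?thesis using \<epsilon>t(2) by linarith
   qed
   \<comment> \<open>\<open>\<delta> = Dinf / X\<close>, where \<open>X\<close> is a product of three factors that are all \<open>1 + O h\<close>\<close>
   define X where "X = (wD 0 / J h) * (2 * wN 0) * (J h * Dinf h / 2)"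
   have X: "X > 0" "\<bar>1 / X - 1\<bar> \<le> 14 * (t0 * h)"
    unfolding X_def using product_near_one[OF wD0 wN0 JD] hh(4) by (auto simp: mult.commute)
   have XX: "X = wN 0 * wD 0 * Dinf h" using J by (simp add: X_def)
   have \<delta>X: "\<delta> = Dinf h * (1 / X)" unfolding dd(2) XX using D by simp
   have "\<delta> > 0" unfolding \<delta>X using D X by simp
   moreover have "\<bar>\<delta> - Dinf h\<bar> \<le> C * h * Dinf h"
   proof -
    have "\<delta> - Dinf h = Dinf h * (1 / X - 1)" by (simp add: \<delta>X algebra_simps)
    then have "\<bar>\<delta> - Dinf h\<bar> = Dinf h * \<bar>1 / X - 1\<bar>" using D by (simp add: abs_mult)
    also have "... \<le> Dinf h * (14 * (t0 * h))" using X D by (intro mult_left_mono) auto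
    also have "... \<le> Dinf h * (C * h)"
    proof -
     have "14 * (t0 * h) \<le> C * h" using mult_right_mono[OF C(1), of h] h by simp
     then show ?thesis using D by (intro mult_left_mono) auto
    qed
    finally show ?thesis by (simp add: mult_ac)
   qed
   ultimately show "\<delta> > 0 \<and> \<bar>\<delta> - Dinf h\<bar> \<le> C * h * Dinf h" by blast
   have "1 / 4 \<le> wN 0" using wN0 hh(4) by (simp add: mult.commute abs_le_iff)
   then show "\<exists>wD yD wN yN. sol h e wD yD \<and> wD b = 0 \<and> yD b = - 1 \<and> sol h e wN yN \<and> wN b = 1 \<and> yN b = \<beta> h \<and> d = - yD 0 / wD 0 \<and> \<delta> = 1 / (wN 0 * wD 0) \<and>
    (\<forall>s\<in>{0..b}. \<bar>wD s - A h s\<bar> \<le> 2 * \<epsilon> C1 h * A h s \<and> \<bar>wN s\<bar> \<le> 2) \<and> 1 / 4 \<le> wN 0"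
    using D1 N1 dd dE nE(2) by blast
  qed
  have pair: "\<bar>\<delta> - \<delta>'\<bar> \<le> C * \<bar>e - e'\<bar> * Dinf h \<and> \<bar>d - d' + (e - e') * N h\<bar> \<le> C * h * N h * \<bar>e - e'\<bar>"
   if e': "\<bar>e' - r 0\<bar> \<le> C0 * sqrt h" and rs': "resp h e' d' \<delta>'" for e' d' \<delta>'
  proof -
   obtain wD yD wN yN where D1: "sol h e wD yD" "wD b = 0" "yD b = - 1" and N1: "sol h e wN yN" "wN b = 1" "yN b = \<beta> h"
    and dd: "d = - yD 0 / wD 0" "\<delta> = 1 / (wN 0 * wD 0)"
    and est: "\<And>s. s \<in> {0..b} ==> \<bar>wD s - A h s\<bar> \<le> 2 * \<epsilon> C1 h * A h s" "\<And>s. s \<in> {0..b} ==> \<bar>wN s\<bar> \<le> 2" "1 / 4 \<le> wN 0"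
    using facts[OF e rs] by blast
   obtain vD xD vN xN where D2: "sol h e' vD xD" "vD b = 0" "xD b = - 1" and N2: "sol h e' vN xN" "vN b = 1" "xN b = \<beta> h"
    and dd': "d' = - xD 0 / vD 0" "\<delta>' = 1 / (vN 0 * vD 0)"
    and est': "\<And>s. s \<in> {0..b} ==> \<bar>vD s - A h s\<bar> \<le> 2 * \<epsilon> C1 h * A h s" "\<And>s. s \<in> {0..b} ==> \<bar>vN s\<bar> \<le> 2" "1 / 4 \<le> vN 0"
    using facts[OF e' rs'] by blast
   have er: "\<And>s. s \<in> {0..b} ==> \<bar>e - r s\<bar> \<le> C1 * (sqrt h + s)"
    unfolding C1_def using window[OF h(1) C0 e] .
   have \<epsilon>2: "\<epsilon> C1 h \<le> 1 / 2" using \<epsilon>h by linarith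
   have near: "A h s * (1 - 2 * \<epsilon> C1 h) \<le> w \<and> w \<le> A h s * (1 + 2 * \<epsilon> C1 h) \<and> A h s / 2 \<le> w \<and> w \<le> 2 * A h s"
    if "\<bar>w - A h s\<bar> \<le> 2 * \<epsilon> C1 h * A h s" "s \<in> {0..b}" for w s
   proof -
    have A0: "0 \<le> A h s" by (rule A_nonneg[OF that(2)])
    have "2 * \<epsilon> C1 h * A h s \<le> 1 / 28 * A h s" using \<epsilon>h A0 by (intro mult_right_mono) auto
    then show ?thesis using that(1) A0 by (simp add: abs_le_iff algebra_simps)
   qed
   have wb: "\<bar>wD s\<bar> \<le> 2 * A h s" "\<bar>vD s\<bar> \<le> 2 * A h s" if "s \<in> {0..b}" for s
    using near[OF est(1)[OF that] that] near[OF est'(1)[OF that] that] A_nonneg[OF that, of h] by (auto simp: abs_le_iff)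
   have dD: "\<bar>wD 0 - vD 0\<bar> \<le> q * \<bar>e - e'\<bar> * J h"
    unfolding q_def J_def
    by (rule energy_lipschitz[OF h(1) hh(2) D1(1) D2(1) _ _ er C1 \<epsilon>2])
      (use D1 D2 wb A_antimono A_nonneg A_pos in auto)
   have dN: "\<bar>wN 0 - vN 0\<bar> \<le> q * \<bar>e - e'\<bar> * 1"
    unfolding q_def
    by (rule energy_lipschitz[OF h(1) hh(2) N1(1) N2(1) _ _ er C1 \<epsilon>2, where \<nu> = "\<lambda>_. 1"])
      (use N1 N2 est(2) est'(2) in auto)
   have D0: "J h / 2 \<le> wD 0" "wD 0 \<le> 2 * J h" "J h / 2 \<le> vD 0" "vD 0 \<le> 2 * J h"
    using near[OF est(1)[OF b_in(2)] b_in(2)] near[OF est'(1)[OF b_in(2)] b_in(2)] by (auto simp: J_def)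
   have P1: "J h / 8 \<le> wN 0 * wD 0" "J h / 8 \<le> vN 0 * vD 0"
    using mult_mono[OF est(3) D0(1)] mult_mono[OF est'(3) D0(3)] J est(3) est'(3) by auto
   have num: "\<bar>vN 0 * vD 0 - wN 0 * wD 0\<bar> \<le> 4 * q * \<bar>e - e'\<bar> * J h"
   proof -
    have "vN 0 * vD 0 - wN 0 * wD 0 = - (vN 0 * (wD 0 - vD 0) + wD 0 * (wN 0 - vN 0))" by (simp add: algebra_simps)
    then have "\<bar>vN 0 * vD 0 - wN 0 * wD 0\<bar> \<le> \<bar>vN 0\<bar> * \<bar>wD 0 - vD 0\<bar> + \<bar>wD 0\<bar> * \<bar>wN 0 - vN 0\<bar>"
     by (simp add: abs_mult[symmetric])
    also have "... \<le> 2 * (q * \<bar>e - e'\<bar> * J h) + (2 * J h) * (q * \<bar>e - e'\<bar>)"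
     using est'(2)[OF b_in(2)] dD dN D0 J q by (intro add_mono mult_mono) auto
    finally show ?thesis by (simp add: mult_ac)
   qed
   have "\<delta> - \<delta>' = (vN 0 * vD 0 - wN 0 * wD 0) / ((wN 0 * wD 0) * (vN 0 * vD 0))"
   proof -
    have nzP: "wN 0 * wD 0 \<noteq> 0" "vN 0 * vD 0 \<noteq> 0" using P1 J by auto
    show ?thesis unfolding dd dd' by (simp only: diff_frac_eq[OF nzP] mult_1)
   qed
   then have "\<bar>\<delta> - \<delta>'\<bar> = \<bar>vN 0 * vD 0 - wN 0 * wD 0\<bar> / ((wN 0 * wD 0) * (vN 0 * vD 0))"
   proof -
    have "0 \<le> wN 0 * wD 0" "0 \<le> vN 0 * vD 0" using P1 J by linarith+
    then have "0 \<le> (wN 0 * wD 0) * (vN 0 * vD 0)" by (rule mult_nonneg_nonneg)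
    then show ?thesis unfolding \<open>\<delta> - \<delta>' = _\<close> abs_divide by (simp only: abs_of_nonneg)
   qed
   also have "... \<le> (4 * q * \<bar>e - e'\<bar> * J h) / ((J h / 8) * (J h / 8))"
    using num P1 J q by (intro frac_le mult_mono) auto
   also have "... = 256 * q * \<bar>e - e'\<bar> * (1 / J h)" using J by (simp add: field_simps)
   also have "... \<le> 256 * q * \<bar>e - e'\<bar> * Dinf h" using Sh q by (intro mult_left_mono) auto
   also have "... \<le> C * \<bar>e - e'\<bar> * Dinf h" using C(3) D by (intro mult_right_mono) auto
   finally have l1: "\<bar>\<delta> - \<delta>'\<bar> \<le> C * \<bar>e - e'\<bar> * Dinf h" .
   define I where "I = integral {0..b} (\<lambda>s. p h s * (wD s * vD s))"
   define I0 where "I0 = integral {0..b} (\<lambda>s. p h s * (A h s / J h)\<^sup>2)"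
   define t where "t = 2 * \<epsilon> C1 h"
   have t: "0 \<le> t" "t \<le> 1 / 28" using \<epsilon>0 \<epsilon>h by (auto simp: t_def)
   have cA: "continuous_on {0..b} (A h)" by (rule DERIV_continuous_on[OF dA])
   have nz: "wD 0 * vD 0 > 0" using D0 J by (intro mult_pos_pos) auto
   have "vD 0 * yD 0 - wD 0 * xD 0 = (e - e') * I"
    unfolding I_def by (rule wronskian_energy[OF D1(1) D2(1) D1(2) D2(2)])
   moreover have "d - d' = - (vD 0 * yD 0 - wD 0 * xD 0) / (wD 0 * vD 0)"
   proof -
    have n0: "wD 0 \<noteq> 0" "vD 0 \<noteq> 0" using nz by auto
    have "d - d' = (- yD 0) / wD 0 - (- xD 0) / vD 0" by (simp only: dd dd')
    also have "... = ((- yD 0) * vD 0 - (- xD 0) * wD 0) / (wD 0 * vD 0)" by (rule diff_frac_eq[OF n0])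
    finally show ?thesis by (simp add: algebra_simps)
   qed
   ultimately have "d - d' = - ((e - e') * I) / (wD 0 * vD 0)" by (simp only:)
   then have ddI: "d - d' = - (e - e') * (I / (wD 0 * vD 0))" by (simp only: times_divide_eq_right mult_minus_left)
   have AJ: "A h s / J h * J h = A h s" for s using J by simp
   have I_up: "I \<le> ((1 + t) * J h)\<^sup>2 * I0" and I_lo: "((1 - t) * J h)\<^sup>2 * I0 \<le> I"
   proof -
    have i0: "(\<lambda>s. p h s * (A h s / J h)\<^sup>2) integrable_on {0..b}"
     by (intro integrable_continuous_real continuous_intros cont_p cA) (use J in auto)
    have i1: "(\<lambda>s. p h s * (wD s * vD s)) integrable_on {0..b}"
     by (intro integrable_continuous_real continuous_intros cont_p sol_cont(1)[OF D1(1)] sol_cont(1)[OF D2(1)])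
    have pt: "((1 - t) * J h)\<^sup>2 * (p h s * (A h s / J h)\<^sup>2) \<le> p h s * (wD s * vD s) \<and>
      p h s * (wD s * vD s) \<le> ((1 + t) * J h)\<^sup>2 * (p h s * (A h s / J h)\<^sup>2)" if s: "s \<in> {0..b}" for s
    proof -
     have A0: "0 \<le> A h s" by (rule A_nonneg[OF s])
     have n1: "A h s * (1 - t) \<le> wD s" "wD s \<le> A h s * (1 + t)" "A h s * (1 - t) \<le> vD s" "vD s \<le> A h s * (1 + t)"
      using near[OF est(1)[OF s] s] near[OF est'(1)[OF s] s] by (auto simp: t_def)
     have n2: "0 \<le> A h s * (1 - t)" using A0 t by simp
     have "(A h s * (1 - t)) * (A h s * (1 - t)) \<le> wD s * vD s" "wD s * vD s \<le> (A h s * (1 + t)) * (A h s * (1 + t))"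
      using n1 n2 A0 t by (intro mult_mono; linarith)+
     then have "p h s * ((A h s * (1 - t)) * (A h s * (1 - t))) \<le> p h s * (wD s * vD s)"
      "p h s * (wD s * vD s) \<le> p h s * ((A h s * (1 + t)) * (A h s * (1 + t)))"
      using p_pos[of h s] by (auto intro: mult_left_mono)
     moreover have "((1 - t) * J h)\<^sup>2 * (p h s * (A h s / J h)\<^sup>2) = p h s * ((A h s * (1 - t)) * (A h s * (1 - t)))"
      "((1 + t) * J h)\<^sup>2 * (p h s * (A h s / J h)\<^sup>2) = p h s * ((A h s * (1 + t)) * (A h s * (1 + t)))"
      using J by (simp_all add: power2_eq_square field_simps)
     ultimately show ?thesis by (simp only:)
    qed
    show "I \<le> ((1 + t) * J h)\<^sup>2 * I0" "((1 - t) * J h)\<^sup>2 * I0 \<le> I"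
     unfolding I_def I0_def integral_mult_right[symmetric]
     by (intro integral_le integrable_on_mult_right i0 i1; use pt in blast)+
   qed
   have I0_up: "I0 \<le> N h"
    unfolding I0_def N_def
   proof (rule integral_le[OF _ p_integrable])
    show "(\<lambda>s. p h s * (A h s / J h)\<^sup>2) integrable_on {0..b}"
     by (intro integrable_continuous_real continuous_intros cont_p cA) (use J in auto)
    fix s assume s: "s \<in> {0..b}"
    have "0 \<le> A h s / J h" "A h s / J h \<le> 1" using A_nonneg[OF s] A_antimono[of 0 s h] s J by (auto simp: J_def)
    then have "(A h s / J h)\<^sup>2 \<le> 1" by (simp add: power_le_one)
    then show "p h s * (A h s / J h)\<^sup>2 \<le> p h s" using mult_left_mono[of _ 1 "p h s"] p_pos[of h s] by simp
   qed
   have Nh: "n0 * sqrt h \<le> N h" by (rule n0(2)[OF h(1) hh(3)])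
   have "0 < n0 * sqrt h" using n0 h by simp
   then have N0: "N h > 0" using Nh by linarith
   have I0_lo: "N h * (1 - 2 * K * b\<^sup>2 * Cs / n0 * h) \<le> I0"
   proof -
    have "2 * K * b\<^sup>2 / J h \<le> 2 * K * b\<^sup>2 * (Cs * h\<^sup>2)"
     using Sh K_ge1 mult_left_mono[of "1 / J h" "Cs * h\<^sup>2" "2 * K * b\<^sup>2"] by simp
    also have "... = 2 * K * b\<^sup>2 * Cs / n0 * h * (n0 * (sqrt h * sqrt h))" using n0 h by (simp add: power2_eq_square)
    also have "... \<le> 2 * K * b\<^sup>2 * Cs / n0 * h * (n0 * (sqrt h * 1))"
     using K_ge1 Cs n0 h hh by (intro mult_left_mono) auto
    also have "... \<le> 2 * K * b\<^sup>2 * Cs / n0 * h * N h"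
     using K_ge1 Cs n0 h Nh by (intro mult_left_mono) auto
    finally show ?thesis using pA_lower(2)[OF h(1)] unfolding I0_def by (simp add: algebra_simps)
   qed
   have wd: "((1 - t) * J h)\<^sup>2 \<le> wD 0 * vD 0" "wD 0 * vD 0 \<le> ((1 + t) * J h)\<^sup>2"
   proof -
    have n1: "J h * (1 - t) \<le> wD 0" "wD 0 \<le> J h * (1 + t)" "J h * (1 - t) \<le> vD 0" "vD 0 \<le> J h * (1 + t)"
     using near[OF est(1)[OF b_in(2)] b_in(2)] near[OF est'(1)[OF b_in(2)] b_in(2)] by (auto simp: t_def J_def)
    have n2: "0 \<le> J h * (1 - t)" using J t by simp
    have "(J h * (1 - t)) * (J h * (1 - t)) \<le> wD 0 * vD 0" "wD 0 * vD 0 \<le> (J h * (1 + t)) * (J h * (1 + t))"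
     using n1 n2 J t by (intro mult_mono; linarith)+
    then show "((1 - t) * J h)\<^sup>2 \<le> wD 0 * vD 0" "wD 0 * vD 0 \<le> ((1 + t) * J h)\<^sup>2"
     by (simp_all add: power2_eq_square mult_ac)
   qed
   have I00: "0 \<le> I0" unfolding I0_def
    by (intro integral_nonneg integrable_continuous_real continuous_intros cont_p cA) (use J in \<open>auto simp: less_imp_le[OF p_pos]\<close>)
   have poly1: "(1 + t)\<^sup>2 \<le> (1 + 16 * t) * (1 - t)\<^sup>2"
   proof -
    have "0 \<le> 4 * t * (3 - 8 * t + 4 * t\<^sup>2)" using t by (intro mult_nonneg_nonneg) auto
    then show ?thesis by (simp add: power2_eq_square algebra_simps)
   qed
   have poly2: "(1 - 16 * t) * (1 + t)\<^sup>2 \<le> (1 - t)\<^sup>2"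
   proof -
    have "0 \<le> 4 * t * (3 + 8 * t + 4 * t\<^sup>2)" using t by (intro mult_nonneg_nonneg) auto
    then show ?thesis by (simp add: power2_eq_square algebra_simps)
   qed
   have up: "I \<le> (1 + 16 * t) * N h * (wD 0 * vD 0)"
   proof -
    have "I \<le> (1 + t)\<^sup>2 * ((J h)\<^sup>2 * I0)" using I_up by (simp add: power_mult_distrib mult_ac)
    also have "... \<le> ((1 + 16 * t) * (1 - t)\<^sup>2) * ((J h)\<^sup>2 * N h)"
     using poly1 I0_up I00 t by (intro mult_mono mult_left_mono) auto
    also have "... = (1 + 16 * t) * N h * ((1 - t) * J h)\<^sup>2" by (simp add: power_mult_distrib mult_ac)
    also have "... \<le> (1 + 16 * t) * N h * (wD 0 * vD 0)" using wd t N0 by (intro mult_left_mono) auto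
    finally show ?thesis .
   qed
   have lo: "(1 - 16 * t) * I0 * (wD 0 * vD 0) \<le> I"
   proof -
    have "(1 - 16 * t) * I0 * (wD 0 * vD 0) \<le> (1 - 16 * t) * I0 * ((1 + t) * J h)\<^sup>2"
     using wd t I00 by (intro mult_left_mono) auto
    also have "... = ((1 - 16 * t) * (1 + t)\<^sup>2) * ((J h)\<^sup>2 * I0)" by (simp add: power_mult_distrib mult_ac)
    also have "... \<le> (1 - t)\<^sup>2 * ((J h)\<^sup>2 * I0)" using poly2 I00 by (intro mult_right_mono) auto
    also have "... \<le> I" using I_lo by (simp add: power_mult_distrib mult_ac)
    finally show ?thesis .
   qed
   have q1: "I / (wD 0 * vD 0) \<le> (1 + 16 * t) * N h" using up nz by (simp add: divide_le_eq)
   have q2: "(1 - 16 * t) * I0 \<le> I / (wD 0 * vD 0)" using lo nz by (simp add: le_divide_eq)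
   have q3: "I0 - 16 * t * N h \<le> (1 - 16 * t) * I0"
    using mult_left_mono[OF I0_up, of "16 * t"] t by (simp add: algebra_simps)
   have "\<bar>I / (wD 0 * vD 0) - N h\<bar> \<le> 16 * t * N h + 2 * K * b\<^sup>2 * Cs / n0 * h * N h"
   proof -
    have "0 \<le> 2 * K * b\<^sup>2 * Cs / n0 * h * N h" using K_ge1 Cs n0 h N0 by (intro mult_nonneg_nonneg divide_nonneg_pos) auto
    then show ?thesis using q1 q2 q3 I0_lo by (simp add: abs_le_iff algebra_simps)
   qed
   also have "... = (32 * k + 2 * K * b\<^sup>2 * Cs / n0) * h * N h" by (simp add: t_def \<epsilon>k algebra_simps)
   also have "... \<le> C * h * N h" using C(4) h N0 by (intro mult_right_mono) auto
   finally have fin: "\<bar>I / (wD 0 * vD 0) - N h\<bar> \<le> C * h * N h" .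
   have "d - d' + (e - e') * N h = - (e - e') * (I / (wD 0 * vD 0) - N h)" unfolding ddI by (simp add: algebra_simps)
   then have "\<bar>d - d' + (e - e') * N h\<bar> = \<bar>e - e'\<bar> * \<bar>I / (wD 0 * vD 0) - N h\<bar>" by (simp add: abs_mult abs_minus_commute)
   also have "... \<le> \<bar>e - e'\<bar> * (C * h * N h)" using fin by (intro mult_left_mono) auto
   finally show ?thesis using l1 by (simp add: mult_ac)
  qed
  have "Dinf h \<le> C * h\<^sup>2"
  proof -
   have "Dinf h \<le> Cs * h\<^sup>2" using Sh by blast
   also have "... \<le> C * h\<^sup>2" using C(2) by (intro mult_right_mono) auto
   finally show ?thesis .
  qed
  then show ?thesis unfolding response_bound_def using main[OF e rs] pair by blast
 qed
 then show ?thesis using C(5) h0 by blast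
qed

text \<open>At distance \<open>C0 sqrt h\<close> from \<open>r 0\<close> the term \<open>(e - r 0) N\<close>, of size \<open>C0 h\<close>, beats the
contribution \<open>O h\<close> of the variation of \<open>r\<close>; so \<open>d\<close> changes sign in the window.\<close>

lemma resp_sign:
 "\<exists>Cm\<ge>0. \<forall>C0\<ge>Cm. \<exists>h0>0. \<forall>h d \<delta>. 0 < h \<and> h < h0 -->
   (resp h (r 0 + C0 * sqrt h) d \<delta> --> d \<le> - h) \<and> (resp h (r 0 - C0 * sqrt h) d \<delta> --> h \<le> d)"
proof -
 obtain Cs hs where Cs: "Cs \<ge> 1" "hs > 0" and S: "\<And>h. 0 < h ==> h < hs ==> 1 / J h \<le> Cs * h\<^sup>2"
  using scale_facts by blast
 obtain n0 where n0: "n0 > 0" "\<And>h. 0 < h ==> h \<le> b\<^sup>2 ==> n0 * sqrt h \<le> N h" using N_lower by blast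
 define Cm where "Cm = (16 + 8 * L * K1) / n0"
 have Cm0: "Cm \<ge> 0" using n0 L_nonneg K1_pos by (simp add: Cm_def)
 have "\<exists>h0>0. \<forall>h d \<delta>. 0 < h \<and> h < h0 -->
   (resp h (r 0 + C0 * sqrt h) d \<delta> --> d \<le> - h) \<and> (resp h (r 0 - C0 * sqrt h) d \<delta> --> h \<le> d)"
  if C0: "C0 \<ge> Cm" for C0
 proof -
  have C00: "C0 \<ge> 0" using C0 Cm0 by linarith
  define C1 where "C1 = C0 + L"
  have C1: "C1 \<ge> 0" using C00 L_nonneg by (simp add: C1_def)
  define k where "k = K1 * b * C1"
  have k: "k \<ge> 0" using K1_pos pos C1 by (simp add: k_def)
  have \<epsilon>k: "\<epsilon> C1 h = k * h" for h by (simp add: \<epsilon>_def k_def)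
  define h0 where "h0 = min (min hs 1) (min (min (b\<^sup>2) (1 / Cs)) (min (1 / (4 * k + 1)) (n0 / (2 * K * b\<^sup>2 * Cs))))"
  have h0: "h0 > 0" using Cs pos k n0 K_ge1 by (simp add: h0_def)
  have key: "(\<sigma> = 1 --> d \<le> - h) \<and> (\<sigma> = - 1 --> h \<le> d)"
   if h: "0 < h" "h < h0" and \<sigma>: "\<sigma> = 1 \<or> \<sigma> = - 1" and rs: "resp h (r 0 + \<sigma> * (C0 * sqrt h)) d \<delta>" for h d \<delta> \<sigma>
  proof -
   have hl: "h < hs" "h < 1" "h < b\<^sup>2" "h < 1 / Cs" "h < 1 / (4 * k + 1)" "h < n0 / (2 * K * b\<^sup>2 * Cs)"
    using h(2) by (auto simp: h0_def)
   have dp: "0 < Cs" "0 < 4 * k + 1" "0 < 2 * K * b\<^sup>2 * Cs" using Cs k K_ge1 pos by auto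
   have hh: "h < hs" "h \<le> 1" "h \<le> b\<^sup>2" "h * Cs \<le> 1" "h * (4 * k + 1) \<le> 1" "h * (2 * K * b\<^sup>2 * Cs) \<le> n0"
    using hl[unfolded pos_less_divide_eq[OF dp(1)] pos_less_divide_eq[OF dp(2)] pos_less_divide_eq[OF dp(3)]] by linarith+
   define e where "e = r 0 + \<sigma> * (C0 * sqrt h)"
   have e: "\<bar>e - r 0\<bar> \<le> C0 * sqrt h" using \<sigma> C00 h by (auto simp: e_def abs_mult)
   obtain w y where D1: "sol h e w y" "w b = 0" "y b = - 1" and d: "d = - y 0 / w 0"
    using rs unfolding resp_def e_def by blast
   have er: "\<And>s. s \<in> {0..b} ==> \<bar>e - r s\<bar> \<le> C1 * (sqrt h + s)"
    unfolding C1_def using window[OF h(1) C00 e] .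
   have \<epsilon>4: "\<epsilon> C1 h \<le> 1 / 4" using hh(5) h by (simp add: \<epsilon>k algebra_simps)
   then have \<epsilon>2: "\<epsilon> C1 h \<le> 1 / 2" by linarith
   have J: "J h > 0" by (rule J_pos)
   have wA: "A h s / 2 \<le> w s \<and> w s \<le> 3 / 2 * A h s" if s: "s \<in> {0..b}" for s
   proof -
    have "\<bar>w s - A h s\<bar> \<le> 2 * \<epsilon> C1 h * A h s" by (rule dirichlet_estimate[OF h(1) D1 er C1 \<epsilon>2 s])
    also have "... \<le> 1 / 2 * A h s" using \<epsilon>4 A_nonneg[OF s, of h] by (intro mult_right_mono) auto
    finally show ?thesis by linarith
   qed
   have cA: "continuous_on {0..b} (A h)" by (rule DERIV_continuous_on[OF dA])
   define I where "I = integral {0..b} (\<lambda>s. p h s * ((e - r s) * w s))"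
   define I1 where "I1 = integral {0..b} (\<lambda>s. p h s * (A h s / J h))"
   define I2 where "I2 = integral {0..b} (\<lambda>s. (sqrt h + s) * p h s)"
   have lower: "J h * (C0 * sqrt h / 2 * I1 - 2 * L * I2) \<le> \<sigma> * I"
   proof -
    have "J h * (C0 * sqrt h / 2 * I1 - 2 * L * I2) = integral {0..b} (\<lambda>s. J h * (C0 * sqrt h / 2 * (p h s * (A h s / J h)) - 2 * L * ((sqrt h + s) * p h s)))"
     unfolding I1_def I2_def using J
     by (subst integral_mult_right, subst hk_integral_diff)
       (auto intro!: integrable_continuous_real continuous_intros cont_p cA)
    also have "... \<le> integral {0..b} (\<lambda>s. \<sigma> * (p h s * ((e - r s) * w s)))"
    proof (rule integral_le)
     show "(\<lambda>s. J h * (C0 * sqrt h / 2 * (p h s * (A h s / J h)) - 2 * L * ((sqrt h + s) * p h s))) integrable_on {0..b}"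
      using J by (intro integrable_continuous_real continuous_intros cont_p cA) auto
     show "(\<lambda>s. \<sigma> * (p h s * ((e - r s) * w s))) integrable_on {0..b}"
      by (intro integrable_continuous_real continuous_intros cont_p cont_r sol_cont(1)[OF D1(1)])
     fix s assume s: "s \<in> {0..b}"
     have A0: "0 \<le> A h s" by (rule A_nonneg[OF s])
     have AJ: "A h s \<le> J h" using A_antimono[of 0 s h] s by (simp add: J_def)
     have "\<bar>r s - r 0\<bar> \<le> L * s" using Lip[OF s] by (simp add: r_def abs_minus_commute)
     then have "C0 * sqrt h - L * s \<le> \<sigma> * (e - r s)" using \<sigma> by (auto simp: e_def abs_le_iff)
     then have "(C0 * sqrt h - L * s) * w s \<le> \<sigma> * (e - r s) * w s" using wA[OF s] A0 by (intro mult_right_mono) auto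
     moreover have "C0 * sqrt h * (A h s / 2) \<le> C0 * sqrt h * w s" using wA[OF s] C00 h by (intro mult_left_mono) auto
     moreover have "L * s * w s \<le> 2 * L * (sqrt h + s) * J h"
     proof -
      have "L * s * w s \<le> L * s * (2 * J h)" using wA[OF s] A0 AJ L_nonneg s by (intro mult_left_mono) auto
      also have "... \<le> L * (sqrt h + s) * (2 * J h)" using L_nonneg h J by (intro mult_right_mono mult_left_mono) auto
      finally show ?thesis by (simp add: algebra_simps)
     qed
     ultimately have "C0 * sqrt h * (A h s / 2) - 2 * L * (sqrt h + s) * J h \<le> \<sigma> * (e - r s) * w s"
      by (simp add: left_diff_distrib)
     then have "p h s * (C0 * sqrt h * (A h s / 2) - 2 * L * (sqrt h + s) * J h) \<le> p h s * (\<sigma> * (e - r s) * w s)"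
      using p_pos[of h s] by (intro mult_left_mono) auto
     moreover have "p h s * (C0 * sqrt h * (A h s / 2) - 2 * L * (sqrt h + s) * J h)
      = J h * (C0 * sqrt h / 2 * (p h s * (A h s / J h)) - 2 * L * ((sqrt h + s) * p h s))"
      using J by (simp add: algebra_simps)
     ultimately show "J h * (C0 * sqrt h / 2 * (p h s * (A h s / J h)) - 2 * L * ((sqrt h + s) * p h s)) \<le> \<sigma> * (p h s * ((e - r s) * w s))"
      by (simp add: mult_ac)
    qed
    also have "... = \<sigma> * I" by (simp add: I_def)
    finally show ?thesis .
   qed
   have I1: "n0 / 2 * sqrt h \<le> I1"
   proof -
    have "K * b\<^sup>2 / J h \<le> K * b\<^sup>2 * (Cs * h\<^sup>2)"
     using S[OF h(1) hh(1)] K_ge1 mult_left_mono[of "1 / J h" "Cs * h\<^sup>2" "K * b\<^sup>2"] by simp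
    also have "... = h * (2 * K * b\<^sup>2 * Cs) * (h / 2)" by (simp add: power2_eq_square)
    also have "... \<le> n0 * (h / 2)" using hh(6) h by (intro mult_right_mono) auto
    also have "... \<le> n0 * (sqrt h / 2)"
    proof -
     have "sqrt h * sqrt h \<le> sqrt h * 1" using h hh by (intro mult_left_mono) auto
     then show ?thesis using n0 h by (intro mult_left_mono) auto
    qed
    finally show ?thesis using pA_lower(1)[OF h(1)] n0(2)[OF h(1) hh(3)] unfolding I1_def by linarith
   qed
   have I2: "I2 \<le> K1 * h" unfolding I2_def by (rule kernel_integral[OF h(1)])
   have "4 * h \<le> C0 * sqrt h / 2 * I1 - 2 * L * I2"
   proof -
    have "C0 * sqrt h / 2 * (n0 / 2 * sqrt h) \<le> C0 * sqrt h / 2 * I1" using I1 C00 h by (intro mult_left_mono) auto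
    moreover have "C0 * sqrt h / 2 * (n0 / 2 * sqrt h) = C0 * n0 / 4 * h" using h by simp
    moreover have "2 * L * I2 \<le> 2 * L * (K1 * h)" using I2 L_nonneg by (intro mult_left_mono) auto
    moreover have "(16 + 8 * L * K1) / 4 * h \<le> C0 * n0 / 4 * h"
    proof -
     have "16 + 8 * L * K1 = Cm * n0" using n0 by (simp add: Cm_def)
     also have "... \<le> C0 * n0" using C0 n0 by (intro mult_right_mono) auto
     finally show ?thesis using h by (intro mult_right_mono divide_right_mono) auto
    qed
    moreover have "(16 + 8 * L * K1) / 4 * h = 4 * h + 2 * L * (K1 * h)" by (simp add: algebra_simps)
    ultimately show ?thesis by linarith
   qed
   then have "J h * (4 * h) \<le> J h * (C0 * sqrt h / 2 * I1 - 2 * L * I2)" using J by (intro mult_left_mono) auto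
   then have \<sigma>I: "4 * h * J h \<le> \<sigma> * I" using lower by (simp add: mult_ac)
   have hJ: "1 \<le> h * J h"
   proof -
    have "1 \<le> Cs * h\<^sup>2 * J h" using S[OF h(1) hh(1)] J by (simp add: divide_le_eq)
    also have "... = (h * Cs) * (h * J h)" by (simp add: power2_eq_square)
    also have "... \<le> 1 * (h * J h)" using hh(4) h J by (intro mult_right_mono) auto
    finally show ?thesis by simp
   qed
   have w0: "J h / 2 \<le> w 0" "w 0 \<le> 3 / 2 * J h" using wA[OF b_in(2)] by (auto simp: J_def)
   have w0p: "w 0 > 0" using w0 J by linarith
   have y0: "y 0 = - 1 + I" unfolding I_def using y_at_0[OF D1(1)] D1(3) by simp
   have hw: "h * w 0 \<le> 3 / 2 * (h * J h)" using mult_left_mono[OF w0(2), of h] h by simp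
   have "\<sigma> = 1 --> d \<le> - h"
   proof
    assume "\<sigma> = 1"
    then have "h * w 0 \<le> y 0" using \<sigma>I y0 hw hJ by (simp add: mult.assoc)
    then have "h \<le> y 0 / w 0" using w0p by (simp add: le_divide_eq)
    then show "d \<le> - h" unfolding d by simp
   qed
   moreover have "\<sigma> = - 1 --> h \<le> d"
   proof
    assume "\<sigma> = - 1"
    then have "h * w 0 \<le> - y 0" using \<sigma>I y0 hw hJ by (simp add: mult.assoc)
    then have "h \<le> (- y 0) / w 0" using w0p by (simp only: pos_le_divide_eq)
    then show "h \<le> d" unfolding d .
   qed
   ultimately show ?thesis by blast
  qed
  have "(resp h (r 0 + C0 * sqrt h) d \<delta> --> d \<le> - h) \<and> (resp h (r 0 - C0 * sqrt h) d \<delta> --> h \<le> d)"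
   if "0 < h" "h < h0" for h d \<delta>
   using key[OF that, of 1 d \<delta>] key[OF that, of "- 1" d \<delta>] by auto
  then show ?thesis using h0 by blast
 qed
 then show ?thesis using Cm0 by blast
qed

end

section \<open>Laplace asymptotics of the mass and solutions of the original equation\<close>

text \<open>Half of the Gaussian absorbs the powers of \<open>x\<^sup>2 / h\<close>.\<close>

lemma gaussian_moment:
 fixes a h x :: real
 assumes a: "a > 0" and h: "h > 0" and x: "x \<ge> 0"
 shows "(x\<^sup>2 + x ^ 4 / h + x ^ 6 / h\<^sup>2) * exp (- a * x\<^sup>2 / h) \<le> (2 / a + 8 / a\<^sup>2 + 48 / a ^ 3) * h * exp (- (a / 2) * x\<^sup>2 / h)"
proof -
 define u where "u = x\<^sup>2 / h"
 define v where "v = a / 2 * u"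
 have u: "u \<ge> 0" using h by (simp add: u_def)
 have v: "v \<ge> 0" using u a by (simp add: v_def)
 have e: "v \<le> exp v" "v\<^sup>2 \<le> 2 * exp v" "v ^ 3 \<le> 6 * exp v"
 proof -
  have s: "(\<Sum>k<4. v ^ k / fact k) \<le> exp v"
  proof -
   have "(\<lambda>n. v ^ n / fact n) sums exp v" using exp_converges[of v] by (simp add: divide_inverse mult.commute scaleR_conv_of_real)
   then show ?thesis using v sum_le_suminf[of "\<lambda>n. v ^ n / fact n" "{..<4}"] by (auto simp: sums_iff)
  qed
  have "(\<Sum>k<4. v ^ k / fact k) = 1 + v + v\<^sup>2 / 2 + v ^ 3 / 6"
   by (simp add: eval_nat_numeral fact_Suc)
  moreover have "0 \<le> v\<^sup>2" "0 \<le> v ^ 3" using v by auto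
  ultimately show "v \<le> exp v" "v\<^sup>2 \<le> 2 * exp v" "v ^ 3 \<le> 6 * exp v" using s v by linarith+
 qed
 have uv: "u = 2 / a * v" using a by (simp add: v_def)
 have "u + u\<^sup>2 + u ^ 3 = 2 / a * v + 4 / a\<^sup>2 * v\<^sup>2 + 8 / a ^ 3 * v ^ 3"
  by (simp add: uv power_mult_distrib power_divide)
 also have "... \<le> 2 / a * exp v + 4 / a\<^sup>2 * (2 * exp v) + 8 / a ^ 3 * (6 * exp v)"
  using e a by (intro add_mono mult_left_mono) auto
 also have "... = (2 / a + 8 / a\<^sup>2 + 48 / a ^ 3) * exp v" by (simp add: algebra_simps)
 finally have m: "u + u\<^sup>2 + u ^ 3 \<le> (2 / a + 8 / a\<^sup>2 + 48 / a ^ 3) * exp v" .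
 have "x\<^sup>2 + x ^ 4 / h + x ^ 6 / h\<^sup>2 = h * (u + u\<^sup>2 + u ^ 3)"
  using h by (simp add: u_def power_divide field_simps eval_nat_numeral)
 moreover have "exp (- a * x\<^sup>2 / h) = exp (- 2 * v)" by (simp add: v_def u_def)
 moreover have "exp (- (a / 2) * x\<^sup>2 / h) = exp (- v)" by (simp add: v_def u_def)
 moreover have "h * (u + u\<^sup>2 + u ^ 3) * exp (- 2 * v) \<le> h * ((2 / a + 8 / a\<^sup>2 + 48 / a ^ 3) * exp v) * exp (- 2 * v)"
  using m h by (intro mult_right_mono mult_left_mono) auto
 moreover have "h * ((2 / a + 8 / a\<^sup>2 + 48 / a ^ 3) * exp v) * exp (- 2 * v) = (2 / a + 8 / a\<^sup>2 + 48 / a ^ 3) * h * (exp v * exp (- 2 * v))"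
  by (simp add: mult_ac)
 moreover have "exp v * exp (- 2 * v) = exp (- v)" by (simp add: exp_add[symmetric])
 ultimately show ?thesis by (simp only:)
qed

lemma gaussian_integral_bound:
 fixes a h b :: real
 assumes a: "a > 0" and h: "h > 0" and b: "b \<ge> 0"
 shows "integral {0..b} (\<lambda>x. exp (- a * x\<^sup>2 / h)) \<le> (3 / sqrt a) * sqrt h"
proof -
 define k where "k = sqrt (a / h)"
 have k: "k > 0" using a h by (simp add: k_def)
 have "integral {0..b} (\<lambda>x. exp (- a * x\<^sup>2 / h)) \<le> integral {0..b} (\<lambda>x. exp (1 - k * x))"
 proof (rule integral_le)
  show "(\<lambda>x. exp (- a * x\<^sup>2 / h)) integrable_on {0..b}" "(\<lambda>x. exp (1 - k * x)) integrable_on {0..b}"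
   using h by (auto intro!: integrable_continuous_real continuous_intros)
  fix x assume "x \<in> {0..b}"
  have "0 \<le> (k * x - 1 / 2)\<^sup>2" by simp
  then have "k * x - 1 \<le> (k * x)\<^sup>2" by (simp add: power2_eq_square algebra_simps)
  also have "(k * x)\<^sup>2 = a * x\<^sup>2 / h" using a h by (simp add: k_def power_mult_distrib)
  finally show "exp (- a * x\<^sup>2 / h) \<le> exp (1 - k * x)" by simp
 qed
 also have "integral {0..b} (\<lambda>x. exp (1 - k * x)) = - (1 / k) * exp (1 - k * b) - - (1 / k) * exp (1 - k * 0)"
 proof (rule integral_unique, rule fundamental_theorem_of_calculus[OF b])
  fix x
  have "((\<lambda>x. - (1 / k) * exp (1 - k * x)) has_real_derivative - (1 / k) * (exp (1 - k * x) * (0 - k * 1))) (at x)"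
   by (intro DERIV_cmult DERIV_fun_exp DERIV_diff DERIV_const DERIV_ident)
  then show "((\<lambda>x. - (1 / k) * exp (1 - k * x)) has_vector_derivative exp (1 - k * x)) (at x within {0..b})"
   using k by (simp add: has_real_derivative_iff_has_vector_derivative has_vector_derivative_at_within)
 qed
 also have "... \<le> 1 / k * exp 1" using k by simp
 also have "... \<le> 1 / k * 3" using k exp_le by (intro mult_left_mono) auto
 also have "... = (3 / sqrt a) * sqrt h" using a h by (simp add: k_def real_sqrt_divide)
 finally show ?thesis .
qed

text \<open>The tail beyond \<open>b\<close> is compared with \<open>\<integral>x / b exp (- a x\<^sup>2 / h)\<close>, which is elementary and exponentially
small.\<close>

lemma half_gaussian_integral:
 fixes a b :: real
 assumes a: "a > 0" and b: "b > 0"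
 shows "\<exists>C. C \<ge> 0 \<and> (\<forall>h. 0 < h \<and> h \<le> 1 --> \<bar>2 * integral {0..b} (\<lambda>x. exp (- a * x\<^sup>2 / h)) - sqrt (pi * h / a)\<bar> \<le> C * h * sqrt h)"
proof -
 define C where "C = 1 / (a * b) * (1 / (a * b\<^sup>2))"
 have C: "C \<ge> 0" using a b by (simp add: C_def)
 have "\<bar>2 * integral {0..b} (\<lambda>x. exp (- a * x\<^sup>2 / h)) - sqrt (pi * h / a)\<bar> \<le> C * h * sqrt h" if h: "0 < h" "h \<le> 1" for h
 proof -
  define k where "k = sqrt (a / h)"
  have k: "k > 0" using a h by (simp add: k_def)
  have kk: "k\<^sup>2 = a / h" using a h by (simp add: k_def)
  let ?f = "\<lambda>x. exp (- a * x\<^sup>2 / h)"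
  have fk: "?f x = exp (- (k * x)\<^sup>2)" for x by (simp add: power_mult_distrib kk)
  have "has_bochner_integral lborel (\<lambda>x. indicator {0..} x *\<^sub>R exp (- x\<^sup>2)) (sqrt pi / 2)" by (rule gaussian_moment_0)
  then have hb0: "has_bochner_integral lborel (\<lambda>x. indicator {0..} (0 + k * x) *\<^sub>R exp (- (0 + k * x)\<^sup>2)) ((sqrt pi / 2) /\<^sub>R \<bar>k\<bar>)"
   by (subst (asm) lborel_has_bochner_integral_real_affine_iff[of k _ _ 0]) (use k in auto)
  have ind: "indicator {0..} (0 + k * x) = (indicator {0..} x :: real)" for x
   using k by (simp add: indicator_def zero_le_mult_iff)
  have fk0: "exp (- (0 + k * x)\<^sup>2) = ?f x" for x by (simp only: fk add_0_left)
  have vk: "(sqrt pi / 2) /\<^sub>R \<bar>k\<bar> = sqrt pi / (2 * k)" using k by (simp add: field_simps)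
  have hb: "has_bochner_integral lborel (\<lambda>x. indicator {0..} x *\<^sub>R ?f x) (sqrt pi / (2 * k))"
   using hb0 unfolding ind fk0 vk .
  have si: "set_integrable lborel {0..} ?f" and sv: "set_lebesgue_integral lborel {0..} ?f = sqrt pi / (2 * k)"
   using hb unfolding set_integrable_def set_lebesgue_integral_def by (auto simp: has_bochner_integral_iff)
  have lim: "((\<lambda>B. set_lebesgue_integral lborel {0..B} ?f) \<longlongrightarrow> sqrt pi / (2 * k)) at_top"
   unfolding sv[symmetric] by (rule tendsto_set_lebesgue_integral_at_top[OF _ si]) auto
  have eq: "set_lebesgue_integral lborel {0..B} ?f = integral {0..B} ?f" for B
   by (rule set_borel_integral_eq_integral(2)[OF set_integrable_subset[OF si]]) auto
  have ic: "?f integrable_on {u..v}" for u v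
   using h by (intro integrable_continuous_real continuous_intros) auto
  define \<tau> where "\<tau> = h / (2 * a * b) * exp (- a * b\<^sup>2 / h)"
  have tail: "integral {b..B} ?f \<le> \<tau>" if B: "B \<ge> b" for B
  proof -
   have "((\<lambda>x. x / b * ?f x) has_integral (- (h / (2 * a * b)) * ?f B) - (- (h / (2 * a * b)) * ?f b)) {b..B}"
   proof (rule fundamental_theorem_of_calculus[OF B])
    fix x
    have "((\<lambda>x. - a * x\<^sup>2 / h) has_real_derivative - a * (2 * x) / h) (at x)"
     using h by (auto intro!: derivative_eq_intros)
    from DERIV_cmult[OF DERIV_fun_exp[OF this], of "- (h / (2 * a * b))"]
    have "((\<lambda>x. - (h / (2 * a * b)) * ?f x) has_real_derivative x / b * ?f x) (at x)"
     using a b h by (simp add: field_simps)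
    then show "((\<lambda>x. - (h / (2 * a * b)) * ?f x) has_vector_derivative x / b * ?f x) (at x within {b..B})"
     by (simp add: has_real_derivative_iff_has_vector_derivative has_vector_derivative_at_within)
   qed
   then have "integral {b..B} ?f \<le> (- (h / (2 * a * b)) * ?f B) - (- (h / (2 * a * b)) * ?f b)"
   proof (rule has_integral_le[OF integrable_integral[OF ic]])
    fix x assume "x \<in> {b..B}"
    then have "1 * ?f x \<le> x / b * ?f x" using b by (intro mult_right_mono) auto
    then show "?f x \<le> x / b * ?f x" by simp
   qed
   also have "... \<le> \<tau>" using a b h by (simp add: \<tau>_def)
   finally show ?thesis .
  qed
  have up: "integral {0..b} ?f \<le> sqrt pi / (2 * k)"
  proof (rule tendsto_lowerbound[OF lim])
   show "\<forall>\<^sub>F B in at_top. integral {0..b} ?f \<le> set_lebesgue_integral lborel {0..B} ?f"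
    using eventually_ge_at_top[of b] unfolding eq
    by eventually_elim (intro integral_subset_le ic, auto)
  qed simp
  have lo: "sqrt pi / (2 * k) \<le> integral {0..b} ?f + \<tau>"
  proof (rule tendsto_upperbound[OF lim])
   show "\<forall>\<^sub>F B in at_top. set_lebesgue_integral lborel {0..B} ?f \<le> integral {0..b} ?f + \<tau>"
    using eventually_ge_at_top[of b] unfolding eq
   proof eventually_elim
    case (elim B)
    have "integral {0..b} ?f + integral {b..B} ?f = integral {0..B} ?f"
     using b elim by (intro hk_integral_combine ic) auto
    then show ?case using tail[OF elim] by linarith
   qed
  qed simp
  have val: "2 * (sqrt pi / (2 * k)) = sqrt (pi * h / a)"
   using a h by (simp add: k_def real_sqrt_divide real_sqrt_mult)
  have "2 * \<tau> \<le> C * h * sqrt h"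
  proof -
   have "a * b\<^sup>2 / h \<le> exp (a * b\<^sup>2 / h)" using exp_ge_add_one_self[of "a * b\<^sup>2 / h"] by linarith
   then have "exp (- a * b\<^sup>2 / h) \<le> 1 / (a * b\<^sup>2 / h)"
    using frac_le[of 1 1 "a * b\<^sup>2 / h" "exp (a * b\<^sup>2 / h)"] a b h by (simp add: exp_minus inverse_eq_divide)
   also have "... = 1 / (a * b\<^sup>2) * h" using a b h by simp
   also have "... \<le> 1 / (a * b\<^sup>2) * sqrt h"
   proof -
    have "sqrt h * sqrt h \<le> sqrt h * 1" using h by (intro mult_left_mono) auto
    then show ?thesis using a h by (intro mult_left_mono) auto
   qed
   finally have "h / (a * b) * exp (- a * b\<^sup>2 / h) \<le> h / (a * b) * (1 / (a * b\<^sup>2) * sqrt h)"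
    using a b h by (intro mult_left_mono) auto
   then show ?thesis by (simp add: \<tau>_def C_def mult_ac)
  qed
  then show ?thesis using up lo val by (simp add: abs_le_iff)
 qed
 then show ?thesis using C by blast
qed

text \<open>Bounding by \<open>1 + exp x\<close> keeps the estimate global: in the application \<open>exp x\<close> times the Gaussian is \<open>p\<close> itself, whose
decay is known.\<close>

lemma exp_second_order: "\<bar>exp x - 1 - x\<bar> \<le> x\<^sup>2 * (1 + exp x)" for x :: real
proof -
 have l: "1 + x \<le> exp x" by (rule exp_ge_add_one_self)
 have "1 - x \<le> exp (- x)" using exp_ge_add_one_self[of "- x"] by simp
 then have "(1 - x) * exp x \<le> exp (- x) * exp x" by (intro mult_right_mono) auto
 also have "... = 1" by (simp add: exp_minus)
 finally have u: "exp x - 1 \<le> x * exp x" by (simp add: algebra_simps)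
 have "x * (exp x - 1) \<le> x\<^sup>2 * (1 + exp x)"
 proof (cases "x \<ge> 0")
  case True
  have "x * (exp x - 1) \<le> x * (x * exp x)" by (rule mult_left_mono[OF u True])
  moreover have "x\<^sup>2 * (1 + exp x) = x * x + x * (x * exp x)" by (simp add: power2_eq_square algebra_simps)
  ultimately show ?thesis using zero_le_square[of x] by linarith
 next
  case False
  have "x * (exp x - 1) \<le> x * x" by (rule mult_left_mono_neg) (use l False in linarith)+
  moreover have "0 \<le> x\<^sup>2 * exp x" by simp
  ultimately show ?thesis by (simp add: power2_eq_square algebra_simps)
 qed
 moreover have "exp x - 1 - x \<le> x * (exp x - 1)" using u by (simp add: algebra_simps)
 ultimately show ?thesis using l by linarith
qed

lemma small_increment:
 fixes u :: "real \<Rightarrow> real"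
 assumes du: "\<And>s. s \<in> {0..b} ==> (u has_real_derivative u' s) (at s within {0..b})"
  and u0: "u 0 = 0" and B: "\<And>s. s \<in> {0..b} ==> \<bar>u' s\<bar> \<le> B * s ^ n" "B \<ge> 0" and s: "s \<in> {0..b}"
 shows "\<bar>u s\<bar> \<le> B * s ^ Suc n"
proof -
 have "\<bar>u s - u 0\<bar> \<le> B * s ^ Suc n - B * 0 ^ Suc n"
 proof (rule deriv_compare)
  show "continuous_on {0..s} u" using s by (intro continuous_on_subset[OF DERIV_continuous_on[OF du]]) auto
  show "continuous_on {0..s} (\<lambda>s. B * s ^ Suc n)" by (intro continuous_intros)
  fix x assume x: "0 < x" "x < s"
  then have x': "x \<in> {0..b}" "x < b" using s by auto
  show "(u has_real_derivative u' x) (at x)" by (rule within_Icc_interior[OF du[OF x'(1)] x(1) x'(2)])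
  show "((\<lambda>s. B * s ^ Suc n) has_real_derivative B * (real (Suc n) * x ^ n)) (at x)"
   using DERIV_cmult[OF DERIV_pow[of "Suc n" x UNIV], of B] by simp
  have "B * x ^ n \<le> B * (real (Suc n) * x ^ n)" using B(2) x by (intro mult_left_mono) (auto simp: mult_le_cancel_right1)
  then show "\<bar>u' x\<bar> \<le> B * (real (Suc n) * x ^ n)" using B(1)[OF x'(1)] by linarith
 qed (use s in auto)
 then show ?thesis using u0 by simp
qed

lemma continuous_Icc_bound:
 fixes u :: "real \<Rightarrow> real"
 assumes "continuous_on {a..b} u"
 shows "\<exists>B\<ge>0. \<forall>s\<in>{a..b}. \<bar>u s\<bar> \<le> B"
proof -
 have "bounded (u ` {a..b})" using assms by (intro compact_imp_bounded compact_continuous_image) auto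
 then obtain B where "\<forall>x\<in>u ` {a..b}. norm x \<le> B" unfolding bounded_iff by blast
 then show ?thesis by (intro exI[of _ "\<bar>B\<bar>"]) force
qed

context half_well
begin

lemma f_quadratic: "\<exists>B\<ge>0. \<forall>s\<in>{0..b}. \<bar>f s - \<kappa> * s\<bar> \<le> B * s\<^sup>2"
proof -
 obtain Bg where Bg: "Bg \<ge> 0" "\<And>s. s \<in> {0..b} ==> \<bar>g s\<bar> \<le> Bg" using continuous_Icc_bound[OF cont_g] by blast
 obtain Bf where Bf: "Bf > 0" "\<And>s. s \<in> {0..b} ==> f s \<le> Bf * s" using f_upper by blast
 have f_abs: "\<bar>f s\<bar> \<le> Bf * s" if "s \<in> {0..b}" for s
 proof -
  have "0 \<le> c * s" using that pos by simp
  then show ?thesis using fc[OF that] Bf(2)[OF that] by linarith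
 qed
 have f2: "\<bar>f s - \<kappa> * s\<bar> \<le> (2 * Bf * Bg) * s\<^sup>2" if s: "s \<in> {0..b}" for s
 proof -
  have "\<bar>f s - \<kappa> * s\<bar> \<le> (2 * Bf * Bg) * s ^ Suc 1"
  proof (rule small_increment[OF _ _ _ _ s])
   fix x assume x: "x \<in> {0..b}"
   show "((\<lambda>s. f s - \<kappa> * s) has_real_derivative - 2 * (f x * g x)) (at x within {0..b})"
    using x by (auto intro!: derivative_eq_intros df)
   have "\<bar>f x\<bar> * \<bar>g x\<bar> \<le> (Bf * x) * Bg" using f_abs[OF x] Bg(2)[OF x] by (intro mult_mono) auto
   then show "\<bar>- 2 * (f x * g x)\<bar> \<le> (2 * Bf * Bg) * x ^ 1" by (simp add: abs_mult mult_ac)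
  qed (use f0 Bf Bg in auto)
  then show ?thesis by (simp add: numeral_2_eq_2)
 qed
 show ?thesis using f2 Bf Bg by (intro exI[of _ "2 * Bf * Bg"]) auto
qed

lemma phase_expansion:
 "\<exists>B\<ge>0. \<forall>s\<in>{0..b}. \<bar>F s - \<kappa> * s\<^sup>2 / 2 + \<kappa> * g 0 * s ^ 3 / 3\<bar> \<le> B * s ^ 4 \<and> \<bar>G s - g 0 * s\<bar> \<le> B * s\<^sup>2"
proof -
 obtain Bg where Bg: "Bg \<ge> 0" "\<And>s. s \<in> {0..b} ==> \<bar>g s\<bar> \<le> Bg" using continuous_Icc_bound[OF cont_g] by blast
 obtain Bd where Bd: "Bd \<ge> 0" "\<And>s. s \<in> {0..b} ==> \<bar>g' s\<bar> \<le> Bd" using continuous_Icc_bound[OF cg'] by blast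
 have g1: "\<bar>g s - g 0\<bar> \<le> Bd * s" if s: "s \<in> {0..b}" for s
 proof -
  have "\<bar>g s - g 0\<bar> \<le> Bd * s ^ Suc 0"
  proof (rule small_increment[OF _ _ _ Bd(1) s])
   fix x assume x: "x \<in> {0..b}"
   show "((\<lambda>s. g s - g 0) has_real_derivative g' x) (at x within {0..b})"
    using DERIV_diff[OF dg[OF x] DERIV_const[of "g 0"]] by simp
   show "\<bar>g' x\<bar> \<le> Bd * x ^ 0" using Bd(2)[OF x] by simp
  qed simp
  then show ?thesis by simp
 qed
 obtain B2 where B2: "B2 \<ge> 0" and f2: "\<And>s. s \<in> {0..b} ==> \<bar>f s - \<kappa> * s\<bar> \<le> B2 * s\<^sup>2" using f_quadratic by blast
 define B3 where "B3 = 2 * (B2 * Bg + \<kappa> * Bd)"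
 have B3: "B3 \<ge> 0" using B2 Bg Bd pos by (simp add: B3_def)
 have f3: "\<bar>f s - \<kappa> * s + \<kappa> * g 0 * s\<^sup>2\<bar> \<le> B3 * s ^ 3" if s: "s \<in> {0..b}" for s
 proof -
  have "\<bar>f s - \<kappa> * s + \<kappa> * g 0 * s\<^sup>2\<bar> \<le> B3 * s ^ Suc 2"
  proof (rule small_increment[OF _ _ _ B3 s])
   fix x assume x: "x \<in> {0..b}"
   show "((\<lambda>s. f s - \<kappa> * s + \<kappa> * g 0 * s\<^sup>2) has_real_derivative - 2 * ((f x - \<kappa> * x) * g x + \<kappa> * x * (g x - g 0))) (at x within {0..b})"
    using x by (auto intro!: derivative_eq_intros df simp: algebra_simps)
   have "\<bar>f x - \<kappa> * x\<bar> * \<bar>g x\<bar> \<le> (B2 * x\<^sup>2) * Bg" using f2[OF x] Bg(2)[OF x] by (intro mult_mono) auto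
   moreover have "\<kappa> * x * \<bar>g x - g 0\<bar> \<le> \<kappa> * x * (Bd * x)" using g1[OF x] pos x by (intro mult_left_mono) auto
   moreover have "\<bar>(f x - \<kappa> * x) * g x + \<kappa> * x * (g x - g 0)\<bar> \<le> \<bar>f x - \<kappa> * x\<bar> * \<bar>g x\<bar> + \<kappa> * x * \<bar>g x - g 0\<bar>"
    using pos x by (intro order_trans[OF abs_triangle_ineq]) (simp add: abs_mult)
   ultimately show "\<bar>- 2 * ((f x - \<kappa> * x) * g x + \<kappa> * x * (g x - g 0))\<bar> \<le> B3 * x\<^sup>2"
    by (simp add: B3_def abs_mult power2_eq_square algebra_simps)
  qed (use f0 in auto)
  then show ?thesis by (simp add: numeral_3_eq_3 numeral_2_eq_2)
 qed
 have F4: "\<bar>F s - \<kappa> * s\<^sup>2 / 2 + \<kappa> * g 0 * s ^ 3 / 3\<bar> \<le> B3 * s ^ 4" if s: "s \<in> {0..b}" for s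
 proof -
  have "\<bar>F s - \<kappa> * s\<^sup>2 / 2 + \<kappa> * g 0 * s ^ 3 / 3\<bar> \<le> B3 * s ^ Suc 3"
  proof (rule small_increment[OF _ _ f3 B3 s])
   fix x assume x: "x \<in> {0..b}"
   show "((\<lambda>s. F s - \<kappa> * s\<^sup>2 / 2 + \<kappa> * g 0 * s ^ 3 / 3) has_real_derivative f x - \<kappa> * x + \<kappa> * g 0 * x\<^sup>2) (at x within {0..b})"
    using x by (auto intro!: derivative_eq_intros dF)
  qed auto
  then show ?thesis by (simp add: eval_nat_numeral)
 qed
 have G2: "\<bar>G s - g 0 * s\<bar> \<le> Bd * s\<^sup>2" if s: "s \<in> {0..b}" for s
 proof -
  have "\<bar>G s - g 0 * s\<bar> \<le> Bd * s ^ Suc 1"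
  proof (rule small_increment[OF _ _ _ Bd(1) s])
   fix x assume x: "x \<in> {0..b}"
   show "((\<lambda>s. G s - g 0 * s) has_real_derivative g x - g 0) (at x within {0..b})"
    using x by (auto intro!: derivative_eq_intros dG)
   show "\<bar>g x - g 0\<bar> \<le> Bd * x ^ 1" using g1[OF x] by simp
  qed auto
  then show ?thesis by (simp add: numeral_2_eq_2)
 qed
 show ?thesis
 proof (intro exI[of _ "B3 + Bd"] conjI ballI)
  fix s assume s: "s \<in> {0..b}"
  have "0 \<le> Bd * s ^ 4" "0 \<le> B3 * s\<^sup>2" using s B3 Bd by auto
  then show "\<bar>F s - \<kappa> * s\<^sup>2 / 2 + \<kappa> * g 0 * s ^ 3 / 3\<bar> \<le> (B3 + Bd) * s ^ 4" "\<bar>G s - g 0 * s\<bar> \<le> (B3 + Bd) * s\<^sup>2"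
   using F4[OF s] G2[OF s] by (simp_all add: distrib_right)
 qed (use B3 Bd in auto)
qed

text \<open>The cubic term of \<open>F / h\<close> and the linear term of \<open>G\<close> are both of size \<open>sqrt h\<close> on the scale
\<open>s = sqrt h\<close>, and both carry the factor \<open>g 0\<close>; everything else is \<open>O h\<close> there.\<close>

lemma p_expansion:
 "\<exists>M\<ge>0. \<forall>h s. 0 < h \<and> s \<in> {0..b} -->
   \<bar>p h s - exp (- \<kappa> * s\<^sup>2 / h) * (1 + g 0 * (2 * s + 2 * \<kappa> * s ^ 3 / (3 * h)))\<bar>
    \<le> M * ((s\<^sup>2 + s ^ 4 / h + s ^ 6 / h\<^sup>2) * exp (- min c \<kappa> * s\<^sup>2 / h))"
proof -
 obtain B where B: "B \<ge> 0" "\<And>s. s \<in> {0..b} ==> \<bar>F s - \<kappa> * s\<^sup>2 / 2 + \<kappa> * g 0 * s ^ 3 / 3\<bar> \<le> B * s ^ 4"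
  "\<And>s. s \<in> {0..b} ==> \<bar>G s - g 0 * s\<bar> \<le> B * s\<^sup>2" using phase_expansion by blast
 define A1 where "A1 = \<bar>g 0\<bar> * (2 + 2 * \<kappa>) + 2 * B * b"
 have A1: "A1 \<ge> 0" using B pos by (simp add: A1_def)
 define M where "M = 2 * A1\<^sup>2 * (1 + K) + 2 * B"
 have M: "M \<ge> 0" using B K_ge1 by (simp add: M_def)
 have "\<bar>p h s - exp (- \<kappa> * s\<^sup>2 / h) * (1 + g 0 * (2 * s + 2 * \<kappa> * s ^ 3 / (3 * h)))\<bar>
    \<le> M * ((s\<^sup>2 + s ^ 4 / h + s ^ 6 / h\<^sup>2) * exp (- min c \<kappa> * s\<^sup>2 / h))" if h: "0 < h" and s: "s \<in> {0..b}" for h s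
 proof -
  define m where "m = s\<^sup>2 + s ^ 4 / h + s ^ 6 / h\<^sup>2"
  define T where "T = g 0 * (2 * s + 2 * \<kappa> * s ^ 3 / (3 * h))"
  define E where "E = 2 * G s - 2 * F s / h + \<kappa> * s\<^sup>2 / h"
  define R where "R = E - T"
  define q where "q = exp (- \<kappa> * s\<^sup>2 / h)"
  define w where "w = exp (- min c \<kappa> * s\<^sup>2 / h)"
  have nn: "0 \<le> s" "0 \<le> s ^ 3" "0 \<le> s\<^sup>2" "0 \<le> s ^ 4" "0 \<le> s ^ 6" "0 \<le> s ^ 3 / h" "0 \<le> s ^ 4 / h" "0 \<le> s ^ 6 / h\<^sup>2" using s h by auto
  have m0: "0 \<le> m" using nn by (simp add: m_def)
  have "R = 2 * (G s - g 0 * s) - 2 / h * (F s - \<kappa> * s\<^sup>2 / 2 + \<kappa> * g 0 * s ^ 3 / 3)"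
   using h by (simp add: R_def E_def T_def field_simps)
  then have "\<bar>R\<bar> \<le> 2 * \<bar>G s - g 0 * s\<bar> + 2 / h * \<bar>F s - \<kappa> * s\<^sup>2 / 2 + \<kappa> * g 0 * s ^ 3 / 3\<bar>"
  proof -
   have t: "\<bar>2 * X - 2 / h * Y\<bar> \<le> 2 * \<bar>X\<bar> + 2 / h * \<bar>Y\<bar>" for X Y :: real
    using abs_triangle_ineq4[of "2 * X" "2 / h * Y"] h by (simp only: abs_mult abs_divide abs_numeral abs_of_pos)
   assume "R = 2 * (G s - g 0 * s) - 2 / h * (F s - \<kappa> * s\<^sup>2 / 2 + \<kappa> * g 0 * s ^ 3 / 3)"
   then show ?thesis using t by (simp only:)
  qed
  also have "... \<le> 2 * (B * s\<^sup>2) + 2 / h * (B * s ^ 4)"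
   using B(2,3)[OF s] h by (intro add_mono mult_left_mono) auto
  also have "... = 2 * B * (s\<^sup>2 + s ^ 4 / h)" by (simp add: algebra_simps)
  finally have R: "\<bar>R\<bar> \<le> 2 * B * (s\<^sup>2 + s ^ 4 / h)" .
  have Rm: "\<bar>R\<bar> \<le> 2 * B * m"
   using R mult_left_mono[of "s\<^sup>2 + s ^ 4 / h" m "2 * B"] B nn by (simp add: m_def)
  have R': "2 * B * (s\<^sup>2 + s ^ 4 / h) \<le> 2 * B * b * (s + s ^ 3 / h)"
  proof -
   have "s\<^sup>2 + s ^ 4 / h = s * (s + s ^ 3 / h)" by (simp add: eval_nat_numeral algebra_simps)
   also have "... \<le> b * (s + s ^ 3 / h)" using s nn by (intro mult_right_mono) auto
   finally show ?thesis using B by (simp add: mult_left_mono mult.assoc)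
  qed
  have "\<bar>T\<bar> \<le> \<bar>g 0\<bar> * ((2 + 2 * \<kappa>) * (s + s ^ 3 / h))"
  proof -
   have "2 * \<kappa> * s ^ 3 / (3 * h) = 2 * \<kappa> / 3 * (s ^ 3 / h)" by simp
   moreover have "0 \<le> \<kappa> * s" "0 \<le> \<kappa> * (s ^ 3 / h)" using pos nn by (intro mult_nonneg_nonneg; simp)+
   ultimately have "0 \<le> 2 * s + 2 * \<kappa> * s ^ 3 / (3 * h)" "2 * s + 2 * \<kappa> * s ^ 3 / (3 * h) \<le> (2 + 2 * \<kappa>) * (s + s ^ 3 / h)"
    using nn by (auto simp: algebra_simps)
   then show ?thesis unfolding T_def abs_mult by (intro mult_left_mono) auto
  qed
  then have "\<bar>T\<bar> + 2 * B * b * (s + s ^ 3 / h) \<le> A1 * (s + s ^ 3 / h)" by (simp add: A1_def algebra_simps)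
  then have "\<bar>E\<bar> \<le> A1 * (s + s ^ 3 / h)" using R R' unfolding R_def by linarith
  then have "E\<^sup>2 \<le> (A1 * (s + s ^ 3 / h))\<^sup>2" using abs_le_square_iff[of E "A1 * (s + s ^ 3 / h)"] A1 nn by simp
  also have "... = A1\<^sup>2 * (s\<^sup>2 + 2 * (s ^ 4 / h) + s ^ 6 / h\<^sup>2)"
   by (simp add: power_mult_distrib power2_sum power_divide eval_nat_numeral algebra_simps)
  also have "... \<le> A1\<^sup>2 * (2 * m)"
  proof (rule mult_left_mono)
   have k: "x + 2 * y + w \<le> 2 * (x + y + w)" if "0 \<le> x" "0 \<le> w" for x y w :: real using that by simp
   show "s\<^sup>2 + 2 * (s ^ 4 / h) + s ^ 6 / h\<^sup>2 \<le> 2 * m" unfolding m_def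
    using nn(3,8) by (rule k)
  qed simp
  finally have E2: "E\<^sup>2 \<le> 2 * A1\<^sup>2 * m" by simp
  have pq: "p h s = q * exp E" by (simp add: p_def q_def E_def exp_add[symmetric])
  have mc: "min c \<kappa> * s\<^sup>2 / h \<le> c * s\<^sup>2 / h" "min c \<kappa> * s\<^sup>2 / h \<le> \<kappa> * s\<^sup>2 / h"
   using h nn by (auto intro!: divide_right_mono mult_right_mono)
  have qw: "0 \<le> q" "q \<le> w" using mc by (auto simp: q_def w_def)
  have pw: "p h s \<le> K * w"
  proof -
   have "p h s \<le> K * exp (- c * s\<^sup>2 / h)" using p_decay[of 0 s h] s h by simp
   also have "... \<le> K * w" using mc K_ge1 by (intro mult_left_mono) (auto simp: w_def)
   finally show ?thesis .
  qed
  have "p h s - q * (1 + T) = q * (exp E - 1 - E) + q * R" by (simp add: pq R_def algebra_simps)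
  then have "\<bar>p h s - q * (1 + T)\<bar> \<le> q * \<bar>exp E - 1 - E\<bar> + q * \<bar>R\<bar>"
   using qw by (simp only:) (intro order_trans[OF abs_triangle_ineq], simp add: abs_mult)
  also have "... \<le> q * (E\<^sup>2 * (1 + exp E)) + w * (2 * B * m)"
   using qw exp_second_order[of E] Rm by (intro add_mono mult_left_mono mult_mono) auto
  also have "q * (E\<^sup>2 * (1 + exp E)) = E\<^sup>2 * (q + p h s)" by (simp add: pq algebra_simps)
  also have "... \<le> (2 * A1\<^sup>2 * m) * (w + K * w)"
   using E2 qw pw p_pos[of h s] m0 by (intro mult_mono add_mono) (auto intro: add_nonneg_nonneg less_imp_le)
  also have "(2 * A1\<^sup>2 * m) * (w + K * w) + w * (2 * B * m) = M * (m * w)" by (simp add: M_def algebra_simps)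
  finally show ?thesis by (simp add: q_def T_def m_def w_def)
 qed
 then show ?thesis using M by blast
qed

text \<open>Only the sign of \<open>g 0\<close> distinguishes the two sides of a well to this order.\<close>

lemma N_expansion:
 "\<exists>C\<ge>0. \<forall>h>0. \<bar>N h - (integral {0..b} (\<lambda>s. exp (- \<kappa> * s\<^sup>2 / h)) +
   g 0 * integral {0..b} (\<lambda>s. exp (- \<kappa> * s\<^sup>2 / h) * (2 * s + 2 * \<kappa> * s ^ 3 / (3 * h))))\<bar> \<le> C * h * sqrt h"
proof -
 obtain M where M: "M \<ge> 0" "\<And>h s. 0 < h ==> s \<in> {0..b} ==>
   \<bar>p h s - exp (- \<kappa> * s\<^sup>2 / h) * (1 + g 0 * (2 * s + 2 * \<kappa> * s ^ 3 / (3 * h)))\<bar>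
    \<le> M * ((s\<^sup>2 + s ^ 4 / h + s ^ 6 / h\<^sup>2) * exp (- min c \<kappa> * s\<^sup>2 / h))" using p_expansion by blast
 define a where "a = min c \<kappa>"
 have a: "a > 0" using pos by (simp add: a_def)
 define D where "D = M * (2 / a + 8 / a\<^sup>2 + 48 / a ^ 3)"
 have D: "D \<ge> 0" using M a by (simp add: D_def)
 show ?thesis
 proof (intro exI[of _ "D * (3 / sqrt (a / 2))"] conjI allI impI)
  show "0 \<le> D * (3 / sqrt (a / 2))" using D a by simp
  fix h :: real assume h: "h > 0"
  let ?q = "\<lambda>s. exp (- \<kappa> * s\<^sup>2 / h)" and ?t = "\<lambda>s. 2 * s + 2 * \<kappa> * s ^ 3 / (3 * h)"
  have iq: "?q integrable_on {0..b}" "(\<lambda>s. ?q s * ?t s) integrable_on {0..b}"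
   using h by (auto intro!: integrable_continuous_real continuous_intros)
  have iq2: "(\<lambda>s. ?q s + g 0 * (?q s * ?t s)) integrable_on {0..b}"
   by (intro integrable_add integrable_on_mult_right iq)
  have "N h - (integral {0..b} ?q + g 0 * integral {0..b} (\<lambda>s. ?q s * ?t s)) = integral {0..b} (\<lambda>s. p h s - (?q s + g 0 * (?q s * ?t s)))"
   unfolding N_def
   by (simp only: hk_integral_diff[OF p_integrable iq2]
     hk_integral_add[OF iq(1) integrable_on_mult_right[OF iq(2)]] integral_mult_right)
  moreover have "norm (integral {0..b} (\<lambda>s. p h s - (?q s + g 0 * (?q s * ?t s)))) \<le> integral {0..b} (\<lambda>s. D * h * exp (- (a / 2) * s\<^sup>2 / h))"
  proof (rule integral_norm_bound_integral)
   show "(\<lambda>s. p h s - (?q s + g 0 * (?q s * ?t s))) integrable_on {0..b}"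
    by (intro integrable_diff p_integrable iq2)
   show "(\<lambda>s. D * h * exp (- (a / 2) * s\<^sup>2 / h)) integrable_on {0..b}"
    using h by (auto intro!: integrable_continuous_real continuous_intros)
   fix s assume s: "s \<in> {0..b}"
   have "p h s - (?q s + g 0 * (?q s * ?t s)) = p h s - ?q s * (1 + g 0 * ?t s)" by (simp add: algebra_simps)
   then have "\<bar>p h s - (?q s + g 0 * (?q s * ?t s))\<bar> \<le> M * ((s\<^sup>2 + s ^ 4 / h + s ^ 6 / h\<^sup>2) * exp (- a * s\<^sup>2 / h))"
    using M(2)[OF h s] by (simp only: a_def)
   also have "... \<le> M * ((2 / a + 8 / a\<^sup>2 + 48 / a ^ 3) * h * exp (- (a / 2) * s\<^sup>2 / h))"
    using gaussian_moment[OF a h, of s] s M(1) by (intro mult_left_mono) auto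
   also have "... = D * h * exp (- (a / 2) * s\<^sup>2 / h)" by (simp only: D_def mult_ac)
   finally show "norm (p h s - (?q s + g 0 * (?q s * ?t s))) \<le> D * h * exp (- (a / 2) * s\<^sup>2 / h)" by simp
  qed
  moreover have "integral {0..b} (\<lambda>s. D * h * exp (- (a / 2) * s\<^sup>2 / h)) \<le> D * h * (3 / sqrt (a / 2) * sqrt h)"
   unfolding integral_mult_right using gaussian_integral_bound[of "a / 2" h b] a h pos D by (intro mult_left_mono) auto
  ultimately show "\<bar>N h - (integral {0..b} ?q + g 0 * integral {0..b} (\<lambda>s. ?q s * ?t s))\<bar> \<le> D * (3 / sqrt (a / 2)) * h * sqrt h"
   by (simp only: real_norm_def mult_ac)
 qed
qed

lemma sol_scale: "sol h e w y ==> sol h e (\<lambda>s. k * w s) (\<lambda>s. k * y s)"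
 unfolding sol_def
proof
 fix s assume a: "\<forall>s\<in>{0..b}. (w has_real_derivative y s / p h s) (at s within {0..b}) \<and> (y has_real_derivative - (p h s * ((e - r s) * w s))) (at s within {0..b})"
  and s: "s \<in> {0..b}"
 have "((\<lambda>s. k * w s) has_real_derivative k * (y s / p h s)) (at s within {0..b})"
  "((\<lambda>s. k * y s) has_real_derivative k * (- (p h s * ((e - r s) * w s)))) (at s within {0..b})"
  using DERIV_cmult[of w _ s _ k] DERIV_cmult[of y _ s _ k] a s by blast+
 then show "((\<lambda>s. k * w s) has_real_derivative k * y s / p h s) (at s within {0..b}) \<and> ((\<lambda>s. k * y s) has_real_derivative - (p h s * ((e - r s) * (k * w s)))) (at s within {0..b})"
  by (simp add: mult_ac)
qed

text \<open>The square root of \<open>p\<close>.\<close>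

definition \<Psi> :: "real \<Rightarrow> real \<Rightarrow> real" where "\<Psi> h s = exp (G s - F s / h)"

text \<open>\<open>\<Psi>'' / \<Psi> = (V - \<kappa> h) / h\<^sup>2 - r\<close>, so division by \<open>\<Psi>\<close> leaves the energy term \<open>e - r\<close>.\<close>

lemma sol_of_schroedinger:
 fixes u u' :: "real \<Rightarrow> real"
 assumes h: "h > 0" and q: "\<And>s. s \<in> {0..b} ==> q s = ((f s)\<^sup>2 - \<kappa> * h - h\<^sup>2 * e) / h\<^sup>2"
  and u: "solves_on UNIV q u u'"
 shows "sol h e (\<lambda>s. u s / \<Psi> h s) (\<lambda>s. \<Psi> h s * (u' s - (g s - f s / h) * u s))"
 unfolding sol_def
proof
 fix s assume s: "s \<in> {0..b}"
 have du: "(u has_real_derivative u' s) (at s within {0..b})" "(u' has_real_derivative q s * u s) (at s within {0..b})"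
  using u by (auto simp: solves_on_def has_real_derivative_iff_has_vector_derivative intro: has_vector_derivative_at_within)
 have d\<Psi>: "(\<Psi> h has_real_derivative \<Psi> h s * (g s - f s / h)) (at s within {0..b})"
  unfolding \<Psi>_def[abs_def] using s h by (auto intro!: derivative_eq_intros dF dG)
 have pp: "p h s = \<Psi> h s * \<Psi> h s" by (simp add: p_def \<Psi>_def exp_add[symmetric])
 have nz: "\<Psi> h s \<noteq> 0" by (simp add: \<Psi>_def)
 have "((\<lambda>s. u s / \<Psi> h s) has_real_derivative (u' s * \<Psi> h s - u s * (\<Psi> h s * (g s - f s / h))) / (\<Psi> h s * \<Psi> h s)) (at s within {0..b})"
  by (rule DERIV_divide[OF du(1) d\<Psi> nz])
 then have 1: "((\<lambda>s. u s / \<Psi> h s) has_real_derivative \<Psi> h s * (u' s - (g s - f s / h) * u s) / p h s) (at s within {0..b})"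
  unfolding pp by (simp add: algebra_simps)
 let ?k = "\<lambda>s. g s - f s / h"
 have alg: "P * k * (v' - k * v) + (x * v - (m * v + v' * k)) * P = P * v * (x - k\<^sup>2 - m)" for P k v v' x m :: real
  by (simp add: power2_eq_square algebra_simps)
 have dk: "(?k has_real_derivative g' s - (\<kappa> - 2 * f s * g s) / h) (at s within {0..b})"
  by (intro DERIV_diff DERIV_cdivide dg df s)
 have "((\<lambda>s. \<Psi> h s * (u' s - ?k s * u s)) has_real_derivative
   \<Psi> h s * ?k s * (u' s - ?k s * u s) + (q s * u s - ((g' s - (\<kappa> - 2 * f s * g s) / h) * u s + u' s * ?k s)) * \<Psi> h s) (at s within {0..b})"
  by (intro DERIV_mult DERIV_diff d\<Psi> dk du)
 also have "\<Psi> h s * ?k s * (u' s - ?k s * u s) + (q s * u s - ((g' s - (\<kappa> - 2 * f s * g s) / h) * u s + u' s * ?k s)) * \<Psi> h s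
   = \<Psi> h s * u s * (q s - (?k s)\<^sup>2 - (g' s - (\<kappa> - 2 * f s * g s) / h))" by (rule alg)
 also have "q s - (?k s)\<^sup>2 - (g' s - (\<kappa> - 2 * f s * g s) / h) = - (e - r s)"
  unfolding q[OF s] r_def using h by (simp add: power2_eq_square field_simps)
 also have "\<Psi> h s * u s * - (e - r s) = - (p h s * ((e - r s) * (u s / \<Psi> h s)))" unfolding pp using nz by (simp add: field_simps)
 finally show "((\<lambda>s. u s / \<Psi> h s) has_real_derivative \<Psi> h s * (u' s - (g s - f s / h) * u s) / p h s) (at s within {0..b}) \<and>
   ((\<lambda>s. \<Psi> h s * (u' s - (g s - f s / h) * u s)) has_real_derivative - (p h s * ((e - r s) * (u s / \<Psi> h s)))) (at s within {0..b})"
  using 1 by blast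
qed

text \<open>The shift by \<open>g 0\<close> is the logarithmic derivative of \<open>\<Psi>\<close> at the bottom, where \<open>f\<close> vanishes. The
hypothesis \<open>\<delta>\<close> guarantees that neither normalised solution vanishes at the bottom.\<close>

lemma half_response_of_resp:
 assumes b: "b = pi / 2" and h: "h > 0" and cq: "continuous_on UNIV q" and Q: "\<And>s. \<bar>q s\<bar> \<le> Q"
  and q: "\<And>s. s \<in> {0..b} ==> q s = ((f s)\<^sup>2 - \<kappa> * h - h\<^sup>2 * e) / h\<^sup>2"
  and \<delta>: "\<And>d \<delta>. resp h e d \<delta> ==> \<delta> > 0"
 shows "\<exists>d \<delta>. resp h e d \<delta> \<and> half_response q (d - g 0) \<delta>"
proof -
 obtain n n' :: "real \<Rightarrow> real" where n: "solves_on UNIV q n n'" "n b = 1" "n' b = 0" using solves_UNIV_exists[OF cq Q] by blast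
 obtain x x' :: "real \<Rightarrow> real" where x: "solves_on UNIV q x x'" "x b = 0" "x' b = 1" using solves_UNIV_exists[OF cq Q] by blast
 have W: "n 0 * x' 0 - n' 0 * x 0 = 1"
 proof -
  have "((\<lambda>s. n s * x' s - n' s * x s) has_real_derivative 0) (at s)" for s
  proof -
   have d: "(n has_real_derivative n' s) (at s)" "(n' has_real_derivative q s * n s) (at s)"
    "(x has_real_derivative x' s) (at s)" "(x' has_real_derivative q s * x s) (at s)"
    using n(1) x(1) by (auto simp: solves_on_def has_real_derivative_iff_has_vector_derivative)
   show ?thesis by (rule derivative_eq_intros d refl | simp add: algebra_simps)+
  qed
  then have "n 0 * x' 0 - n' 0 * x 0 = n b * x' b - n' b * x b" by (intro DERIV_isconst_all) blast
  then show ?thesis using n x by simp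
 qed
 define k where "k = \<Psi> h b"
 have k: "k > 0" by (simp add: k_def \<Psi>_def)
 have \<Psi>0: "\<Psi> h 0 = 1" by (simp add: \<Psi>_def)
 have pk: "p h b = k * k" by (simp add: k_def p_def \<Psi>_def exp_add[symmetric])
 define wN where "wN = (\<lambda>s. k * (n s / \<Psi> h s))"
 define yN where "yN = (\<lambda>s. k * (\<Psi> h s * (n' s - (g s - f s / h) * n s)))"
 define wD where "wD = (\<lambda>s. - (1 / k) * (x s / \<Psi> h s))"
 define yD where "yD = (\<lambda>s. - (1 / k) * (\<Psi> h s * (x' s - (g s - f s / h) * x s)))"
 have sN: "sol h e wN yN" unfolding wN_def yN_def by (rule sol_scale[OF sol_of_schroedinger[OF h q n(1)]])
 have sD: "sol h e wD yD" unfolding wD_def yD_def by (rule sol_scale[OF sol_of_schroedinger[OF h q x(1)]])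
 have bN: "wN b = 1" "yN b = \<beta> h" using n k by (simp_all add: wN_def yN_def k_def[symmetric] \<beta>_def pk algebra_simps)
 have bD: "wD b = 0" "yD b = - 1" using x k by (simp_all add: wD_def yD_def k_def[symmetric])
 have N0: "wN 0 = k * n 0" "wD 0 = - (1 / k) * x 0" "yD 0 = - (1 / k) * (x' 0 - g 0 * x 0)"
  by (simp_all add: wN_def wD_def yD_def \<Psi>0 f0)
 define d where "d = - yD 0 / wD 0"
 define \<epsilon>' where "\<epsilon>' = 1 / (wN 0 * wD 0)"
 have rs: "resp h e d \<epsilon>'" unfolding resp_def d_def \<epsilon>'_def using sN sD bN bD by blast
 have "\<epsilon>' > 0" by (rule \<delta>[OF rs])
 then have "wN 0 \<noteq> 0" "wD 0 \<noteq> 0" by (auto simp: \<epsilon>'_def)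
 then have nz: "n 0 \<noteq> 0" "x 0 \<noteq> 0" by (auto simp: N0)
 have dd: "x' 0 = - (d - g 0) * x 0" using nz k by (simp add: d_def N0 field_simps)
 have ee: "\<epsilon>' * (n 0 * x 0) = - 1" using nz k by (simp add: \<epsilon>'_def N0)
 have "n' 0 * x 0 = n 0 * x' 0 - 1" using W by linarith
 also have "... = ((\<epsilon>' - (d - g 0)) * n 0) * x 0" unfolding dd using ee by (simp add: algebra_simps)
 finally have nn: "n' 0 = (\<epsilon>' - (d - g 0)) * n 0" using nz by simp
 have "half_response q (d - g 0) \<epsilon>'" unfolding half_response_def
  using n x nz dd nn b by blast
 then show ?thesis using rs by blast
qed

end

section \<open>The secular equation\<close>

lemma Lipschitz_imp_continuous_on:
 fixes u :: "real \<Rightarrow> real"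
 assumes "\<And>x y. x \<in> S ==> y \<in> S ==> \<bar>u x - u y\<bar> \<le> K * \<bar>x - y\<bar>"
 shows "continuous_on S u"
proof (rule lipschitz_on_continuous_on)
 show "\<bar>K\<bar>-lipschitz_on S u"
 proof (rule lipschitz_onI)
  fix x y assume "x \<in> S" "y \<in> S"
  then have "\<bar>u x - u y\<bar> \<le> K * \<bar>x - y\<bar>" by (rule assms)
  also have "... \<le> \<bar>K\<bar> * \<bar>x - y\<bar>" by (intro mult_right_mono) auto
  finally show "dist (u x) (u y) \<le> \<bar>K\<bar> * dist x y" by (simp add: dist_real_def)
 qed simp
qed

text \<open>The functions \<open>R \<mp> g / 2\<close> change sign between the ends of the window, which gives \<open>e1\<close> and \<open>e2\<close>. Since
\<open>R\<close> decreases with slope close to \<open>- N\<close> and \<open>R e1 - R e2 = (g e1 + g e2) / 2\<close>, the order and the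
distance of the roots follow.\<close>

lemma secular_roots:
 fixes lo hi h N Dr Dl C :: real and d \<delta>r \<delta>l :: "real \<Rightarrow> real" and z :: complex
 defines "R \<equiv> \<lambda>e. d e - (\<delta>r e + \<delta>l e) / 2"
  and "g \<equiv> \<lambda>e. cmod (of_real (\<delta>r e) + of_real (\<delta>l e) * z)"
 assumes lh: "lo \<le> hi" and h: "0 < h" and N: "0 < N" and D: "0 \<le> Dr" "0 \<le> Dl" and C: "0 \<le> C" "C * h \<le> 1 / 8"
  and small: "2 * (Dr + Dl) \<le> h" "Dr + Dl \<le> h * N" and z: "cmod z = 1"
  and \<delta>r: "\<And>e. e \<in> {lo..hi} ==> 0 < \<delta>r e \<and> \<bar>\<delta>r e - Dr\<bar> \<le> C * h * Dr"
  and \<delta>l: "\<And>e. e \<in> {lo..hi} ==> 0 < \<delta>l e \<and> \<bar>\<delta>l e - Dl\<bar> \<le> C * h * Dl"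
  and \<delta>r': "\<And>e e'. e \<in> {lo..hi} ==> e' \<in> {lo..hi} ==> \<bar>\<delta>r e - \<delta>r e'\<bar> \<le> C * \<bar>e - e'\<bar> * Dr"
  and \<delta>l': "\<And>e e'. e \<in> {lo..hi} ==> e' \<in> {lo..hi} ==> \<bar>\<delta>l e - \<delta>l e'\<bar> \<le> C * \<bar>e - e'\<bar> * Dl"
  and d: "\<And>e e'. e \<in> {lo..hi} ==> e' \<in> {lo..hi} ==> \<bar>d e - d e' + (e - e') * N\<bar> \<le> C * h * N * \<bar>e - e'\<bar>"
  and ends: "2 * h \<le> d lo" "d hi \<le> - (2 * h)"
 shows "\<exists>e1\<in>{lo..hi}. \<exists>e2\<in>{lo..hi}. e1 \<le> e2 \<and> R e1 = g e1 / 2 \<and> R e2 = - (g e2 / 2) \<and>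
   N * (e2 - e1) \<le> 4 * (Dr + Dl) \<and> \<bar>N * (e2 - e1) - cmod (of_real Dr + of_real Dl * z)\<bar> \<le> 9 * C * h * (Dr + Dl)"
proof -
 let ?W = "{lo..hi}"
 define G0 where "G0 = cmod (of_real Dr + of_real Dl * z)"
 have mod: "\<bar>cmod (of_real x + of_real y * z) - cmod (of_real x' + of_real y' * z)\<bar> \<le> \<bar>x - x'\<bar> + \<bar>y - y'\<bar>" for x y x' y' :: real
 proof -
  have "\<bar>cmod (of_real x + of_real y * z) - cmod (of_real x' + of_real y' * z)\<bar>
   \<le> cmod ((of_real x + of_real y * z) - (of_real x' + of_real y' * z))" by (rule norm_triangle_ineq3)
  also have "(of_real x + of_real y * z) - (of_real x' + of_real y' * z) = of_real (x - x') + of_real (y - y') * z"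
   by (simp add: algebra_simps)
  also have "cmod ... \<le> cmod (of_real (x - x')) + cmod (of_real (y - y') * z)" by (rule norm_triangle_ineq)
  also have "... = \<bar>x - x'\<bar> + \<bar>y - y'\<bar>" by (simp only: norm_mult z norm_of_real mult_1_right)
  finally show ?thesis .
 qed
 have g0: "0 \<le> g e" for e by (simp add: g_def)
 have gG: "\<bar>g e - G0\<bar> \<le> C * h * (Dr + Dl)" if "e \<in> ?W" for e
  using mod[of "\<delta>r e" "\<delta>l e" Dr Dl] \<delta>r[OF that] \<delta>l[OF that] by (simp add: g_def G0_def distrib_left)
 have hD: "C * h * Dr \<le> Dr" "C * h * Dl \<le> Dl"
  using mult_right_mono[OF C(2), of Dr] mult_right_mono[OF C(2), of Dl] D by auto
 have gs: "g e \<le> \<delta>r e + \<delta>l e" and s2: "\<delta>r e + \<delta>l e \<le> 2 * (Dr + Dl)" if "e \<in> ?W" for e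
 proof -
  show "g e \<le> \<delta>r e + \<delta>l e"
   using mod[of "\<delta>r e" "\<delta>l e" 0 0] \<delta>r[OF that] \<delta>l[OF that] by (simp add: g_def)
  show "\<delta>r e + \<delta>l e \<le> 2 * (Dr + Dl)" using \<delta>r[OF that] \<delta>l[OF that] hD by (simp add: abs_le_iff)
 qed
 have c\<delta>: "continuous_on ?W \<delta>r" "continuous_on ?W \<delta>l"
  by (rule Lipschitz_imp_continuous_on[of _ _ "C * Dr"], use \<delta>r' in \<open>simp add: mult_ac\<close>)
    (rule Lipschitz_imp_continuous_on[of _ _ "C * Dl"], use \<delta>l' in \<open>simp add: mult_ac\<close>)
 have cd: "continuous_on ?W d"
 proof (rule Lipschitz_imp_continuous_on[of _ _ "N + C * h * N"])
  fix e e' assume e: "e \<in> ?W" "e' \<in> ?W"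
  have "\<bar>(e - e') * N\<bar> = N * \<bar>e - e'\<bar>" using N by (simp add: abs_mult)
  then show "\<bar>d e - d e'\<bar> \<le> (N + C * h * N) * \<bar>e - e'\<bar>" using d[OF e] by (simp add: distrib_right)
 qed
 have cont: "continuous_on ?W R" "continuous_on ?W g"
  unfolding R_def g_def by (intro continuous_intros c\<delta> cd; simp)+
 have Rlo: "R lo - g lo / 2 \<ge> 0" "R lo + g lo / 2 \<ge> 0"
 proof -
  have lo: "lo \<in> ?W" using lh by simp
  have k: "0 \<le> x - y / 2 - w / 2" if "w \<le> y" "y \<le> 2 * D" "2 * h \<le> x" "2 * D \<le> h" for x y w D :: real
   using that h by (simp add: field_simps)
  have "R lo - g lo / 2 \<ge> 0"
   unfolding R_def by (rule k[OF gs[OF lo] s2[OF lo] ends(1) small(1)])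
  then show "R lo - g lo / 2 \<ge> 0" "R lo + g lo / 2 \<ge> 0" using g0[of lo] by auto
 qed
 have Rhi: "R hi - g hi / 2 \<le> 0" "R hi + g hi / 2 \<le> 0"
 proof -
  have hi: "hi \<in> ?W" using lh by simp
  have k: "x - y / 2 + w / 2 \<le> 0" if "w \<le> y" "x \<le> - (2 * h)" for x y w :: real
   using that h by (simp add: field_simps)
  have "R hi + g hi / 2 \<le> 0"
   unfolding R_def by (rule k[OF gs[OF hi] ends(2)])
  then show "R hi - g hi / 2 \<le> 0" "R hi + g hi / 2 \<le> 0" using g0[of hi] by auto
 qed
 \<comment> \<open>at the ends of the window \<open>d\<close> exceeds the amplitudes, which are at most \<open>h\<close>\<close>
 have "\<exists>e\<ge>lo. e \<le> hi \<and> R e - g e / 2 = 0"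
  by (rule IVT2'[OF Rhi(1) Rlo(1) lh]) (intro continuous_intros cont; simp)
 then obtain e1 where e1: "e1 \<in> ?W" "R e1 = g e1 / 2" by auto
 have "\<exists>e\<ge>lo. e \<le> hi \<and> R e + g e / 2 = 0"
  by (rule IVT2'[OF Rhi(2) Rlo(2) lh]) (intro continuous_intros cont; simp)
 then obtain e2 where e2: "e2 \<in> ?W" "R e2 = - (g e2 / 2)" by (auto simp: add_eq_0_iff)
 have CD: "C * (Dr + Dl) \<le> C * h * N" using mult_left_mono[OF small(2) C(1)] by (simp add: mult.assoc)
 \<comment> \<open>\<open>R\<close> has slope \<open>- N\<close> up to a relative error \<open>2 C h \<le> 1 / 4\<close>\<close>
 have Rd: "\<bar>R e - R e' + (e - e') * N\<bar> \<le> 2 * (C * h) * (N * \<bar>e - e'\<bar>)" if e: "e \<in> ?W" "e' \<in> ?W" for e e'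
 proof -
  have "C * (Dr + Dl) * \<bar>e - e'\<bar> \<le> C * h * N * \<bar>e - e'\<bar>" by (rule mult_right_mono[OF CD]) simp
  then have "\<bar>\<delta>r e - \<delta>r e'\<bar> + \<bar>\<delta>l e - \<delta>l e'\<bar> \<le> C * h * N * \<bar>e - e'\<bar>"
   using \<delta>r'[OF e] \<delta>l'[OF e] by (simp add: algebra_simps)
  moreover have "\<bar>R e - R e' + (e - e') * N\<bar> \<le> \<bar>d e - d e' + (e - e') * N\<bar> + (\<bar>\<delta>r e - \<delta>r e'\<bar> + \<bar>\<delta>l e - \<delta>l e'\<bar>)"
   unfolding R_def by (simp add: abs_le_iff abs_if field_simps)
  ultimately show ?thesis using d[OF e] by (simp add: mult_ac)
 qed
 define x where "x = e2 - e1"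
 have "R e1 - R e2 \<ge> 0" using e1 e2 g0[of e1] g0[of e2] by simp
 have Rx: "\<bar>(g e1 + g e2) / 2 - N * x\<bar> \<le> 2 * (C * h) * (N * \<bar>x\<bar>)"
  using Rd[OF e1(1) e2(1)] e1(2) e2(2) by (simp add: x_def abs_minus_commute algebra_simps add_divide_distrib)
 have "2 * (C * h) * (N * \<bar>x\<bar>) \<le> 1 / 4 * (N * \<bar>x\<bar>)" using C(2) N by (intro mult_right_mono) auto
 then have Rx': "\<bar>(g e1 + g e2) / 2 - N * x\<bar> \<le> 1 / 4 * (N * \<bar>x\<bar>)" using Rx by linarith
 have x0: "x \<ge> 0"
 proof (rule ccontr)
  assume "\<not> x \<ge> 0"
  then have x: "N * \<bar>x\<bar> > 0" "N * x = - (N * \<bar>x\<bar>)" using N by (auto simp: mult_pos_neg)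
  then show False using Rx'[unfolded add_divide_distrib] g0[of e1] g0[of e2] by linarith
 qed
 have Nx: "N * x \<le> 4 * (Dr + Dl)"
 proof -
  have "N * \<bar>x\<bar> = N * x" using x0 by simp
  then show ?thesis
   using Rx'[unfolded add_divide_distrib] gs[OF e1(1)] gs[OF e2(1)] s2[OF e1(1)] s2[OF e2(1)] D by linarith
 qed
 have "2 * (C * h) * (N * \<bar>x\<bar>) \<le> 2 * (C * h) * (4 * (Dr + Dl))" using Nx x0 C h by (intro mult_left_mono) auto
 also have "... = 8 * (C * h * (Dr + Dl))" by simp
 finally have "\<bar>(g e1 + g e2) / 2 - N * x\<bar> \<le> 8 * (C * h * (Dr + Dl))" using Rx by (rule order_trans[rotated])
 then have "\<bar>N * x - G0\<bar> \<le> 9 * (C * h * (Dr + Dl))"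
  using gG[OF e1(1)] gG[OF e2(1)] unfolding add_divide_distrib by linarith
 then show ?thesis using e1 e2 x0 Nx unfolding x_def G0_def
  by (intro bexI[of _ e1] bexI[of _ e2]) (auto simp: mult_ac)
qed

context half_well
begin

text \<open>The family \<open>q e = (V - \<lambda>) / h\<^sup>2\<close> with \<open>\<lambda> = \<kappa> h + h\<^sup>2 e\<close>, of which only the restriction to the half-well is prescribed.\<close>

definition model_potential :: "(real \<Rightarrow> real \<Rightarrow> real) \<Rightarrow> real \<Rightarrow> bool" where
 "model_potential q h \<longleftrightarrow> (\<forall>e. continuous_on UNIV (q e) \<and> (\<exists>Q. \<forall>s. \<bar>q e s\<bar> \<le> Q) \<and>
   (\<forall>s\<in>{0..b}. q e s = ((f s)\<^sup>2 - \<kappa> * h - h\<^sup>2 * e) / h\<^sup>2))"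

definition response_family where
 "response_family q C h lo hi d \<delta> \<longleftrightarrow> h \<le> d lo \<and> d hi \<le> - h \<and>
   (\<forall>e\<in>{lo..hi}. half_response (q e) (d e - g 0) (\<delta> e) \<and> 0 < \<delta> e \<and> \<bar>\<delta> e - Dinf h\<bar> \<le> C * h * Dinf h \<and>
    (\<forall>e'\<in>{lo..hi}. \<bar>\<delta> e - \<delta> e'\<bar> \<le> C * \<bar>e - e'\<bar> * Dinf h \<and>
     \<bar>d e - d e' + (e - e') * N h\<bar> \<le> C * h * N h * \<bar>e - e'\<bar>))"

text \<open>The constant \<open>C0\<close> may be enlarged freely, so that two half-wells can share one window.\<close>

lemma response_functions:
 assumes b: "b = pi / 2"
 shows "\<exists>Cm\<ge>0. \<forall>C0\<ge>Cm. \<exists>C\<ge>0. \<exists>h0>0. \<forall>h. 0 < h \<and> h < h0 --> Dinf h \<le> C * h\<^sup>2 \<and>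
  (\<forall>q. model_potential q h -->
   (\<exists>d \<delta>. response_family q C h (r 0 - C0 * sqrt h) (r 0 + C0 * sqrt h) d \<delta>))"
proof -
 obtain Cm where Cm: "Cm \<ge> 0" and sgn: "\<forall>C0\<ge>Cm. \<exists>h0>0. \<forall>h d \<delta>. 0 < h \<and> h < h0 -->
   (resp h (r 0 + C0 * sqrt h) d \<delta> --> d \<le> - h) \<and> (resp h (r 0 - C0 * sqrt h) d \<delta> --> h \<le> d)"
  using resp_sign by blast
 show ?thesis
 proof (rule exI[of _ Cm], intro conjI allI impI Cm)
  fix C0 assume C0: "C0 \<ge> Cm"
  then have C00: "C0 \<ge> 0" using Cm by linarith
  obtain h1 where h1: "h1 > 0" and sg: "\<And>h d \<delta>. 0 < h ==> h < h1 ==>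
   (resp h (r 0 + C0 * sqrt h) d \<delta> --> d \<le> - h) \<and> (resp h (r 0 - C0 * sqrt h) d \<delta> --> h \<le> d)"
   using sgn C0 by blast
  obtain C h2 where C: "C \<ge> 0" and h2: "h2 > 0" and est0: "\<And>h e d \<delta>. 0 < h ==> h < h2 ==> \<bar>e - r 0\<bar> \<le> C0 * sqrt h ==> resp h e d \<delta> ==>
    response_bound C C0 h e d \<delta>"
   using resp_estimates[OF C00]
   apply (elim exE conjE)
   subgoal premises prems for C h2 by (rule prems(1)[OF prems(2,3)], rule prems(4)[THEN spec, THEN spec, THEN spec, THEN spec, THEN mp], intro conjI; assumption)
   done
  note est = est0[unfolded response_bound_def]
  obtain Cs h3 where h3: "h3 > 0" and Cs: "Cs \<ge> 1" "\<And>h. 0 < h ==> h < h3 ==> Dinf h \<le> Cs * h\<^sup>2"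
  proof -
   obtain Cs h3 where "Cs \<ge> 1" "h3 > 0" "\<forall>h. 0 < h \<and> h < h3 --> 0 \<le> \<beta> h \<and> \<beta> h * J h \<le> 1 \<and>
    \<bar>\<beta> h * J h - 1 / 2\<bar> \<le> Cs * h \<and> \<bar>J h * Dinf h / 2 - 1\<bar> \<le> Cs * h \<and> 1 / J h \<le> Cs * h\<^sup>2 \<and> Dinf h \<le> Cs * h\<^sup>2 \<and> 1 / J h \<le> Dinf h"
    using scale_facts by (elim exE conjE)
   then show ?thesis by (intro that[of h3 Cs]) simp_all
  qed
  show "\<exists>C\<ge>0. \<exists>h0>0. \<forall>h. 0 < h \<and> h < h0 --> Dinf h \<le> C * h\<^sup>2 \<and> (\<forall>q. model_potential q h -->
   (\<exists>d \<delta>. response_family q C h (r 0 - C0 * sqrt h) (r 0 + C0 * sqrt h) d \<delta>))"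
  proof (rule exI[of _ "C + Cs"], intro exI[of _ "min (min h1 h2) h3"] conjI allI impI)
   fix h assume h: "0 < h \<and> h < min (min h1 h2) h3"
   have D0: "0 \<le> Dinf h" using fb_pos p_pos[of h b] h by (simp add: Dinf_def)
   have N0: "0 \<le> N h" unfolding N_def by (intro integral_nonneg p_integrable) (simp add: less_imp_le[OF p_pos])
   have "Dinf h \<le> Cs * h\<^sup>2" using Cs(2)[of h] h by simp
   also have "... \<le> (C + Cs) * h\<^sup>2" using C by (intro mult_right_mono) auto
   finally show "Dinf h \<le> (C + Cs) * h\<^sup>2" .
   fix q :: "real \<Rightarrow> real \<Rightarrow> real"
   let ?W = "{r 0 - C0 * sqrt h..r 0 + C0 * sqrt h}"
   assume q: "model_potential q h"
   have W: "\<bar>e - r 0\<bar> \<le> C0 * sqrt h" if "e \<in> ?W" for e using that by (auto simp: abs_le_iff)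
   have "\<exists>d \<delta>. resp h e d \<delta> \<and> half_response (q e) (d - g 0) \<delta>" if e: "e \<in> ?W" for e
   proof -
    have cq: "continuous_on UNIV (q e)" and qf: "\<And>s. s \<in> {0..b} ==> q e s = ((f s)\<^sup>2 - \<kappa> * h - h\<^sup>2 * e) / h\<^sup>2"
     using q unfolding model_potential_def by blast+
    obtain Q where Q: "\<And>s. \<bar>q e s\<bar> \<le> Q" using q unfolding model_potential_def by blast
    have \<delta>0: "\<And>d \<delta>. resp h e d \<delta> ==> 0 < \<delta>" using est[OF _ _ W[OF e]] h by auto
    show ?thesis by (rule half_response_of_resp[OF b _ cq Q qf \<delta>0]) (use h in auto)
   qed
   then have "\<exists>d. \<forall>e\<in>?W. \<exists>\<delta>. resp h e (d e) \<delta> \<and> half_response (q e) (d e - g 0) \<delta>" by (intro bchoice) blast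
   then obtain d where "\<forall>e\<in>?W. \<exists>\<delta>. resp h e (d e) \<delta> \<and> half_response (q e) (d e - g 0) \<delta>" by (elim exE)
   from bchoice[OF this] obtain \<delta> where dd: "\<And>e. e \<in> ?W ==> resp h e (d e) (\<delta> e) \<and> half_response (q e) (d e - g 0) (\<delta> e)" by blast
   have hh: "0 < h" "h < h1" "h < h2" using h by auto
   have Wend: "r 0 - C0 * sqrt h \<in> ?W" "r 0 + C0 * sqrt h \<in> ?W" using C00 hh by auto
   have le: "C * h * Dinf h \<le> (C + Cs) * h * Dinf h" "C * t * Dinf h \<le> (C + Cs) * t * Dinf h"
    "C * h * N h * t \<le> (C + Cs) * h * N h * t" if "0 \<le> t" for t
    using Cs(1) hh D0 N0 that by (auto intro!: mult_right_mono)
   show "\<exists>d \<delta>. response_family q (C + Cs) h (r 0 - C0 * sqrt h) (r 0 + C0 * sqrt h) d \<delta>"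
    unfolding response_family_def
   proof (rule exI[of _ d], rule exI[of _ \<delta>], intro conjI ballI)
    show "h \<le> d (r 0 - C0 * sqrt h)" "d (r 0 + C0 * sqrt h) \<le> - h"
     using sg[OF hh(1,2)] dd[OF Wend(1)] dd[OF Wend(2)] by blast+
    fix e assume e: "e \<in> ?W"
    have rs: "resp h e (d e) (\<delta> e)" and hr: "half_response (q e) (d e - g 0) (\<delta> e)" using dd[OF e] by auto
    note E = est[OF hh(1,3) W[OF e] rs]
    show "half_response (q e) (d e - g 0) (\<delta> e)" by (rule hr)
    show "0 < \<delta> e" using E by blast
    show "\<bar>\<delta> e - Dinf h\<bar> \<le> (C + Cs) * h * Dinf h" using E le(1)[of 0] by linarith
    fix e' assume e': "e' \<in> ?W"
    have "\<bar>\<delta> e - \<delta> e'\<bar> \<le> C * \<bar>e - e'\<bar> * Dinf h \<and> \<bar>d e - d e' + (e - e') * N h\<bar> \<le> C * h * N h * \<bar>e - e'\<bar>"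
     using E W[OF e'] dd[OF e'] by blast
    then show "\<bar>\<delta> e - \<delta> e'\<bar> \<le> (C + Cs) * \<bar>e - e'\<bar> * Dinf h" "\<bar>d e - d e' + (e - e') * N h\<bar> \<le> (C + Cs) * h * N h * \<bar>e - e'\<bar>"
     using le(2,3)[of "\<bar>e - e'\<bar>"] by linarith+
   qed
  qed (use C Cs h1 h2 h3 in auto)
 qed
qed

definition barrier :: "real \<Rightarrow> real \<Rightarrow> bool" where
 "barrier b1 h \<longleftrightarrow>
   (\<forall>s. 0 < s \<and> s \<le> b1 --> 2 * \<kappa> * h \<le> 3 * (3 / 4 * \<kappa>) * h - 4 * (3 / 4 * \<kappa>) * h * s / b1
     - (3 / 4 * \<kappa>)\<^sup>2 * s\<^sup>2 * (1 - s / b1)\<^sup>2 + (f s)\<^sup>2) \<and>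
   (\<forall>s. b1 \<le> s \<and> s \<le> b --> 2 * \<kappa> * h \<le> (f s)\<^sup>2)"

text \<open>With \<open>a = 3 \<kappa> / 4\<close> there is room on both sides: \<open>3 a = 9 \<kappa> / 4\<close> exceeds \<open>2 \<kappa>\<close>, and \<open>f s \<ge> 7 \<kappa> s / 8\<close>
near the bottom exceeds \<open>a s\<close>, which pays for the cut-off.\<close>

lemma well_barrier:
 "\<exists>b0>0. b0 \<le> b \<and> (\<forall>b1. 0 < b1 \<and> b1 \<le> b0 --> (\<exists>h0>0. \<forall>h. 0 < h \<and> h < h0 --> barrier b1 h))"
proof -
 obtain B where B: "B \<ge> 0" "\<And>s. s \<in> {0..b} ==> \<bar>f s - \<kappa> * s\<bar> \<le> B * s\<^sup>2" using f_quadratic by blast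
 define b0 where "b0 = min b (\<kappa> / (8 * (B + 1)))"
 have b0: "b0 > 0" "b0 \<le> b" using pos B by (auto simp: b0_def)
 have steep: "7 / 8 * \<kappa> * s \<le> f s" if s: "0 \<le> s" "s \<le> b0" for s
 proof -
  have "s \<le> \<kappa> / (8 * (B + 1))" using s by (simp add: b0_def)
  then have "s * (8 * (B + 1)) \<le> \<kappa>" using B by (subst (asm) pos_le_divide_eq) auto
  then have "B * s \<le> \<kappa> / 8" using s by (simp add: algebra_simps)
  then have "B * s * s \<le> \<kappa> / 8 * s" using s by (intro mult_right_mono) auto
  then show ?thesis using B(2)[of s] s b0 by (simp add: power2_eq_square abs_le_iff)
 qed
 have "\<exists>h0>0. \<forall>h. 0 < h \<and> h < h0 --> barrier b1 h" if b1: "0 < b1" "b1 \<le> b0" for b1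
  unfolding barrier_def
 proof (intro exI[of _ "min (\<kappa> * b1\<^sup>2 / 2304) (c\<^sup>2 * b1\<^sup>2 / (2 * \<kappa>))"] conjI allI impI)
  show "0 < min (\<kappa> * b1\<^sup>2 / 2304) (c\<^sup>2 * b1\<^sup>2 / (2 * \<kappa>))" using pos b1 by simp
  fix h assume h: "0 < h \<and> h < min (\<kappa> * b1\<^sup>2 / 2304) (c\<^sup>2 * b1\<^sup>2 / (2 * \<kappa>))"
  have h1: "2304 * h \<le> \<kappa> * b1\<^sup>2" using h by simp
  have h2: "2 * \<kappa> * h \<le> c\<^sup>2 * b1\<^sup>2"
  proof -
   have "h < c\<^sup>2 * b1\<^sup>2 / (2 * \<kappa>)" using h by simp
   then have "h * (2 * \<kappa>) < c\<^sup>2 * b1\<^sup>2" using pos by (subst (asm) pos_less_divide_eq) auto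
   then show ?thesis by (simp add: mult_ac)
  qed
  { fix s assume s: "0 < s \<and> s \<le> b1"
   have "7 / 8 * \<kappa> * s \<le> f s" using steep[of s] s b1 by simp
   then have "(7 / 8 * \<kappa> * s)\<^sup>2 \<le> (f s)\<^sup>2" using pos s by (intro power_mono) auto
   then have f2: "49 / 64 * (\<kappa>\<^sup>2 * s\<^sup>2) \<le> (f s)\<^sup>2" by (simp add: power_mult_distrib power_divide)
   have sb: "0 < s / b1" "s / b1 \<le> 1" using s b1 by auto
   have "(1 - s / b1)\<^sup>2 \<le> 1\<^sup>2" using sb by (intro power_mono) auto
   then have "(3 / 4 * \<kappa>)\<^sup>2 * s\<^sup>2 * (1 - s / b1)\<^sup>2 \<le> (3 / 4 * \<kappa>)\<^sup>2 * s\<^sup>2 * 1" by (intro mult_left_mono) auto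
   then have a2: "(3 / 4 * \<kappa>)\<^sup>2 * s\<^sup>2 * (1 - s / b1)\<^sup>2 \<le> 36 / 64 * (\<kappa>\<^sup>2 * s\<^sup>2)" by (simp add: power_mult_distrib power_divide)
   have lin: "4 * (3 / 4 * \<kappa>) * h * s / b1 = 3 * (\<kappa> * h) * (s / b1)" by simp
   have \<kappa>h: "0 < \<kappa> * h" using pos h by simp
   have core: "3 * (\<kappa> * h) * (s / b1) \<le> \<kappa> * h / 4 + 13 / 64 * (\<kappa>\<^sup>2 * s\<^sup>2)"
   proof (cases "s / b1 \<le> 1 / 12")
    case True
    then have "3 * (\<kappa> * h) * (s / b1) \<le> 3 * (\<kappa> * h) * (1 / 12)" using \<kappa>h by (intro mult_left_mono) auto
    moreover have "0 \<le> \<kappa>\<^sup>2 * s\<^sup>2" by simp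
    ultimately show ?thesis by linarith
   next
    case False
    then have "(1 / 12)\<^sup>2 \<le> (s / b1)\<^sup>2" by (intro power_mono) auto
    then have "b1\<^sup>2 \<le> 144 * s\<^sup>2" using b1 by (simp add: power_divide field_simps)
    then have "\<kappa> * (\<kappa> * b1\<^sup>2) \<le> \<kappa> * (\<kappa> * (144 * s\<^sup>2))" using pos by (intro mult_left_mono) auto
    moreover have "\<kappa> * (2304 * h) \<le> \<kappa> * (\<kappa> * b1\<^sup>2)" using h1 pos by (intro mult_left_mono) auto
    ultimately have "2304 * (\<kappa> * h) \<le> 144 * (\<kappa>\<^sup>2 * s\<^sup>2)" by (simp add: power2_eq_square)
    moreover have "3 * (\<kappa> * h) * (s / b1) \<le> 3 * (\<kappa> * h) * 1" using sb \<kappa>h by (intro mult_left_mono) auto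
    ultimately show ?thesis using \<kappa>h by linarith
   qed
   have "2 * \<kappa> * h = 2 * (\<kappa> * h)" "3 * (3 / 4 * \<kappa>) * h = 9 / 4 * (\<kappa> * h)" by simp_all
   then show "2 * \<kappa> * h \<le> 3 * (3 / 4 * \<kappa>) * h - 4 * (3 / 4 * \<kappa>) * h * s / b1
     - (3 / 4 * \<kappa>)\<^sup>2 * s\<^sup>2 * (1 - s / b1)\<^sup>2 + (f s)\<^sup>2"
    unfolding lin using core a2 f2 by linarith }
  { fix s assume s: "b1 \<le> s \<and> s \<le> b"
   then have "c * b1 \<le> c * s" using pos by (intro mult_left_mono) auto
   also have "... \<le> f s" using fc[of s] s b1 by simp
   finally have "(c * b1)\<^sup>2 \<le> (f s)\<^sup>2" using pos b1 by (intro power_mono) auto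
   then show "2 * \<kappa> * h \<le> (f s)\<^sup>2" using h2 by (simp add: power_mult_distrib) }
 qed
 then show ?thesis using b0 by blast
qed

end

section \<open>Coupling the two halves of the circle\<close>

text \<open>Both half-wells at \<open>0\<close>, the left one reflected to \<open>[0, \<pi> / 2]\<close>. By the symmetry of \<open>V\<close> they describe the well at \<open>\<pi>\<close> as well.\<close>

locale well_pair =
 right: half_well "pi / 2" \<kappa> c L fr gr gr' + left: half_well "pi / 2" \<kappa> c L fl gl gl'
 for \<kappa> c L :: real and fr gr gr' fl gl gl' :: "real \<Rightarrow> real" +
 fixes V :: "real \<Rightarrow> real"
 assumes gl0: "gl 0 = - gr 0" "gl' 0 = gr' 0"
  and V_right: "\<And>s. s \<in> {0..pi / 2} ==> V s = (fr s)\<^sup>2"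
  and V_left: "\<And>s. s \<in> {0..pi / 2} ==> V (- s) = (fl s)\<^sup>2"
  and V: "continuous_on UNIV V" "periodic_2pi V" "\<And>s. V (pi - s) = V s"
begin

text \<open>The terms with \<open>gr 0\<close> and \<open>gl 0\<close> cancel, and the two Gaussian halves add up to a full Gaussian integral.\<close>

lemma N_sum:
 "\<exists>C\<ge>0. \<forall>h. 0 < h \<and> h \<le> 1 --> \<bar>right.N h + left.N h - sqrt (pi * h / \<kappa>)\<bar> \<le> C * h * sqrt h"
proof -
 define I where "I h = integral {0..pi / 2} (\<lambda>s. exp (- \<kappa> * s\<^sup>2 / h))" for h
 define I1 where "I1 h = integral {0..pi / 2} (\<lambda>s. exp (- \<kappa> * s\<^sup>2 / h) * (2 * s + 2 * \<kappa> * s ^ 3 / (3 * h)))" for h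
 obtain C1 where C1: "C1 \<ge> 0" "\<And>h. h > 0 ==> \<bar>right.N h - (I h + gr 0 * I1 h)\<bar> \<le> C1 * h * sqrt h"
  using right.N_expansion unfolding I_def I1_def by blast
 obtain C2 where C2: "C2 \<ge> 0" "\<And>h. h > 0 ==> \<bar>left.N h - (I h + gl 0 * I1 h)\<bar> \<le> C2 * h * sqrt h"
  using left.N_expansion unfolding I_def I1_def by blast
 have "\<kappa> > 0" "pi / 2 > (0::real)" using right.pos by auto
 then obtain C3 where C3: "C3 \<ge> 0" "\<And>h. 0 < h ==> h \<le> 1 ==> \<bar>2 * I h - sqrt (pi * h / \<kappa>)\<bar> \<le> C3 * h * sqrt h"
  using half_gaussian_integral[of \<kappa> "pi / 2"] unfolding I_def by blast
 have "\<bar>right.N h + left.N h - sqrt (pi * h / \<kappa>)\<bar> \<le> (C1 + C2 + C3) * h * sqrt h" if h: "0 < h" "h \<le> 1" for h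
 proof -
  have "\<bar>left.N h - (I h - gr 0 * I1 h)\<bar> \<le> C2 * h * sqrt h" using C2(2)[OF h(1)] by (simp add: gl0)
  then have "\<bar>right.N h + left.N h - sqrt (pi * h / \<kappa>)\<bar> \<le> C1 * h * sqrt h + C2 * h * sqrt h + C3 * h * sqrt h"
   using C1(2)[OF h(1)] C3(2)[OF h] by linarith
  then show ?thesis by (simp add: algebra_simps)
 qed
 then show ?thesis using C1 C2 C3 by (intro exI[of _ "C1 + C2 + C3"]) auto
qed

lemma low_energy_dependent:
 "\<exists>h0>0. \<forall>h. 0 < h \<and> h < h0 --> (\<forall>z X l. cmod z = 1 \<and> (\<forall>i<3. X i \<in> floquet (\<lambda>s. (V s - l i) / h\<^sup>2) z) \<and> (\<forall>i<3. l i < 2 * \<kappa> * h)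
   --> (\<exists>c. (\<exists>i<3::nat. c i \<noteq> 0) \<and> (\<forall>s. (\<Sum>i<3. c i * X i s) = (0::complex))))"
proof -
 obtain b0 where b0: "b0 > 0" "b0 \<le> pi / 2"
  and bar: "\<forall>b1. 0 < b1 \<and> b1 \<le> b0 --> (\<exists>h0>0. \<forall>h. 0 < h \<and> h < h0 --> right.barrier b1 h)"
  using right.well_barrier by (elim exE conjE)
 obtain b0' where b0': "b0' > 0" "b0' \<le> pi / 2"
  and bar': "\<forall>b1. 0 < b1 \<and> b1 \<le> b0' --> (\<exists>h0>0. \<forall>h. 0 < h \<and> h < h0 --> left.barrier b1 h)"
  using left.well_barrier by (elim exE conjE)
 define b1 where "b1 = min b0 b0'"
 have b1: "0 < b1" "b1 \<le> b0" "b1 \<le> b0'" "b1 \<le> pi / 2" using b0 b0' by (auto simp: b1_def)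
 obtain h1 where h1: "h1 > 0" and B: "\<forall>h. 0 < h \<and> h < h1 --> right.barrier b1 h"
  using bar[THEN spec, THEN mp, OF conjI[OF b1(1,2)]] by (elim exE conjE)
 obtain h2 where h2: "h2 > 0" and B': "\<forall>h. 0 < h \<and> h < h2 --> left.barrier b1 h"
  using bar'[THEN spec, THEN mp, OF conjI[OF b1(1,3)]] by (elim exE conjE)
 show ?thesis
 proof (intro exI[of _ "min h1 h2"] conjI allI impI)
  fix h :: real and z :: complex and X :: "nat \<Rightarrow> real \<Rightarrow> complex" and l :: "nat \<Rightarrow> real"
  assume h: "0 < h \<and> h < min h1 h2"
   and X: "cmod z = 1 \<and> (\<forall>i<3. X i \<in> floquet (\<lambda>s. (V s - l i) / h\<^sup>2) z) \<and> (\<forall>i<3. l i < 2 * \<kappa> * h)"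
  have hh: "0 < h" "h < h1" "h < h2" using h by auto
  note near = B[THEN spec, THEN mp, OF conjI[OF hh(1,2)], unfolded right.barrier_def]
   B'[THEN spec, THEN mp, OF conjI[OF hh(1,3)], unfolded left.barrier_def]
  show "\<exists>c. (\<exists>i<3::nat. c i \<noteq> 0) \<and> (\<forall>s. (\<Sum>i<3. c i * X i s) = (0::complex))"
  proof (rule three_floquet_dependent[OF V, where L = "2 * \<kappa> * h" and h = h and z = z and l = l])
   fix v v' :: "real \<Rightarrow> complex"
   assume v: "\<And>s. (v has_vector_derivative v' s) (at s)" "continuous_on UNIV v'" "v 0 = 0" "v pi = 0" "v (- pi) = 0"
   show "0 \<le> integral {- pi..pi} (\<lambda>s. h\<^sup>2 * (cmod (v' s))\<^sup>2 + (V s - 2 * \<kappa> * h) * (cmod (v s))\<^sup>2)"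
   proof (rule energy_lower_bound[OF v V b1(1,4) hh(1), where a = "3 / 4 * \<kappa>"])
    fix s U assume U: "U = V s \<or> U = V (- s)" and s: "0 < s" "s \<le> b1"
    have "U = (fr s)\<^sup>2 \<or> U = (fl s)\<^sup>2" using U V_right[of s] V_left[of s] s b1 by auto
    then show "2 * \<kappa> * h \<le> 3 * (3 / 4 * \<kappa>) * h - 4 * (3 / 4 * \<kappa>) * h * s / b1 - (3 / 4 * \<kappa>)\<^sup>2 * s\<^sup>2 * (1 - s / b1)\<^sup>2 + U"
     using near(1)[THEN conjunct1, rule_format, OF conjI[OF s]]
      near(2)[THEN conjunct1, rule_format, OF conjI[OF s]] by (elim disjE) (simp only:)+
   next
    fix s U assume U: "U = V s \<or> U = V (- s)" and s: "b1 \<le> s" "s \<le> pi / 2"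
    have "U = (fr s)\<^sup>2 \<or> U = (fl s)\<^sup>2" using U V_right[of s] V_left[of s] s b1 by auto
    then show "2 * \<kappa> * h \<le> U"
     using near(1)[THEN conjunct2, rule_format, OF conjI[OF s]]
      near(2)[THEN conjunct2, rule_format, OF conjI[OF s]] by (elim disjE) (simp only:)+
   qed
  qed (use X hh in auto)
 qed (use h1 h2 in auto)
qed

lemma r_eq: "left.r 0 = right.r 0"
 by (simp add: left.r_def right.r_def gl0)

text \<open>The shifts \<open>\<mp> g 0\<close> of the two responses cancel in the secular equation, whose solutions are therefore given by
\<open>secular_roots\<close>; \<open>N_sum\<close> replaces the slope by its leading term.\<close>

lemma eigenvalue_splitting:
 fixes \<xi> :: real
 shows "\<exists>C\<ge>0. \<exists>h0>0. \<forall>h. 0 < h \<and> h < h0 --> (\<exists>e1 e2.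
  eigenvalue_list V \<xi> h {..<2 * \<kappa> * h} [\<kappa> * h + h\<^sup>2 * e1, \<kappa> * h + h\<^sup>2 * e2] \<and> \<bar>e1\<bar> \<le> C \<and> \<bar>e2\<bar> \<le> C \<and>
  \<bar>sqrt (pi * h / \<kappa>) * (e2 - e1) - cmod (of_real (right.Dinf h) + of_real (left.Dinf h) * cis (2 * pi * \<xi> / h))\<bar>
   \<le> C * h * (right.Dinf h + left.Dinf h))"
proof -
 let ?r = "right.r 0"
 have bb: "pi / 2 = (pi / 2 :: real)" by (rule refl)
 obtain Cm where Cm: "Cm \<ge> 0" and RF: "\<forall>C0\<ge>Cm. \<exists>C\<ge>0. \<exists>h0>0. \<forall>h. 0 < h \<and> h < h0 --> right.Dinf h \<le> C * h\<^sup>2 \<and>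
  (\<forall>q. right.model_potential q h --> (\<exists>d \<delta>. right.response_family q C h (?r - C0 * sqrt h) (?r + C0 * sqrt h) d \<delta>))"
  using right.response_functions[OF bb] by (elim exE conjE)
 obtain Cm' where Cm': "Cm' \<ge> 0" and RF': "\<forall>C0\<ge>Cm'. \<exists>C\<ge>0. \<exists>h0>0. \<forall>h. 0 < h \<and> h < h0 --> left.Dinf h \<le> C * h\<^sup>2 \<and>
  (\<forall>q. left.model_potential q h --> (\<exists>d \<delta>. left.response_family q C h (?r - C0 * sqrt h) (?r + C0 * sqrt h) d \<delta>))"
  using left.response_functions[OF bb] unfolding r_eq by (elim exE conjE)
 define C0 where "C0 = max Cm Cm'"
 have C0: "C0 \<ge> Cm" "C0 \<ge> Cm'" "C0 \<ge> 0" using Cm by (auto simp: C0_def)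
 obtain C1 h1 where C1: "C1 \<ge> 0" "h1 > 0" and F: "\<And>h. 0 < h ==> h < h1 ==> right.Dinf h \<le> C1 * h\<^sup>2"
  "\<And>h q. 0 < h ==> h < h1 ==> right.model_potential q h ==> \<exists>d \<delta>. right.response_family q C1 h (?r - C0 * sqrt h) (?r + C0 * sqrt h) d \<delta>"
  using RF C0(1) by meson
 obtain C2 h2 where C2: "C2 \<ge> 0" "h2 > 0" and F': "\<And>h. 0 < h ==> h < h2 ==> left.Dinf h \<le> C2 * h\<^sup>2"
  "\<And>h q. 0 < h ==> h < h2 ==> left.model_potential q h ==> \<exists>d \<delta>. left.response_family q C2 h (?r - C0 * sqrt h) (?r + C0 * sqrt h) d \<delta>"
  using RF' C0(2) by meson
 define C where "C = C1 + C2"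
 have C: "C \<ge> 0" "C1 \<le> C" "C2 \<le> C" using C1 C2 by (auto simp: C_def)
 obtain n1 where n1: "n1 > 0" "\<And>h. 0 < h ==> h \<le> (pi / 2)\<^sup>2 ==> n1 * sqrt h \<le> right.N h" using right.N_lower by blast
 obtain n2 where n2: "n2 > 0" "\<And>h. 0 < h ==> h \<le> (pi / 2)\<^sup>2 ==> n2 * sqrt h \<le> left.N h" using left.N_lower by blast
 define n where "n = n1 + n2"
 have n: "n > 0" using n1 n2 by (simp add: n_def)
 obtain C3 where C3: "C3 \<ge> 0" "\<And>h. 0 < h ==> h \<le> 1 ==> \<bar>right.N h + left.N h - sqrt (pi * h / \<kappa>)\<bar> \<le> C3 * h * sqrt h"
  using N_sum by blast
 obtain h3 where h3: "h3 > 0" and dep: "\<forall>h. 0 < h \<and> h < h3 --> (\<forall>z X l. cmod z = 1 \<and> (\<forall>i<3. X i \<in> floquet (\<lambda>s. (V s - l i) / h\<^sup>2) z) \<and> (\<forall>i<3. l i < 2 * \<kappa> * h)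
   --> (\<exists>c. (\<exists>i<3::nat. c i \<noteq> 0) \<and> (\<forall>s. (\<Sum>i<3. c i * X i s) = (0::complex))))"
  using low_energy_dependent by (elim exE conjE)
 obtain B where B: "\<And>s. \<bar>V s\<bar> \<le> B" using periodic_bounded[OF V(1,2)] by blast
 define CC where "CC = \<bar>?r\<bar> + C0 + (9 * C + 4 * C3 / n)"
 have CC: "CC \<ge> 0" "\<bar>?r\<bar> + C0 \<le> CC" "9 * C + 4 * C3 / n \<le> CC" using C0 C C3 n by (auto simp: CC_def)
 define h0 where "h0 = min (min (min h1 h2) (min h3 1)) (min (min (1 / (8 * (C + 1))) ((n / (C + 1))\<^sup>2)) (\<kappa> / (CC + 1)))"
 have h0: "h0 > 0" using C1 C2 h3 C n right.pos CC by (simp add: h0_def)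
 have "\<exists>e1 e2.
  eigenvalue_list V \<xi> h {..<2 * \<kappa> * h} [\<kappa> * h + h\<^sup>2 * e1, \<kappa> * h + h\<^sup>2 * e2] \<and> \<bar>e1\<bar> \<le> CC \<and> \<bar>e2\<bar> \<le> CC \<and>
  \<bar>sqrt (pi * h / \<kappa>) * (e2 - e1) - cmod (of_real (right.Dinf h) + of_real (left.Dinf h) * cis (2 * pi * \<xi> / h))\<bar>
   \<le> CC * h * (right.Dinf h + left.Dinf h)" if hb: "0 < h" "h < h0" for h
 proof -
  have h: "0 < h" "h < h1" "h < h2" "0 < h \<and> h < h3" "h < 1" "h < 1 / (8 * (C + 1))" "h < (n / (C + 1))\<^sup>2" "h < \<kappa> / (CC + 1)"
   using hb by (auto simp: h0_def)
  have hC: "C * h \<le> 1 / 8"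
  proof -
   have "h * (8 * (C + 1)) < 1" using h(6) C by (subst (asm) pos_less_divide_eq) auto
   then show ?thesis using h(1) by (simp add: algebra_simps)
  qed
  have hn: "sqrt h * C \<le> n"
  proof -
   have "sqrt h \<le> n / (C + 1)" using h(7) n C by (intro real_le_lsqrt) auto
   then have "sqrt h * (C + 1) \<le> n" using C by (subst (asm) pos_le_divide_eq) auto
   moreover have "0 \<le> sqrt h" using h by simp
   moreover have "sqrt h * (C + 1) = sqrt h * C + sqrt h" by (simp add: algebra_simps)
   ultimately show ?thesis by linarith
  qed
  have h\<kappa>: "h * CC < \<kappa>"
  proof -
   have "h * (CC + 1) < \<kappa>" using h(8) CC by (subst (asm) pos_less_divide_eq) auto
   then show ?thesis using h(1) by (simp add: algebra_simps)
  qed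
  have hpi: "h \<le> (pi / 2)\<^sup>2"
  proof -
   have "1\<^sup>2 \<le> (pi / 2)\<^sup>2" using pi_gt3 by (intro power_mono) auto
   then show ?thesis using h by simp
  qed
  define z where "z = cis (2 * pi * \<xi> / h)"
  have z: "cmod z = 1" by (simp add: z_def)
  define Dr where "Dr = right.Dinf h"
  define Dl where "Dl = left.Dinf h"
  define N where "N = right.N h + left.N h"
  have D0: "0 \<le> Dr" "0 \<le> Dl"
   unfolding Dr_def Dl_def right.Dinf_def left.Dinf_def
   using right.fb_pos left.fb_pos right.p_pos[of h "pi / 2"] left.p_pos[of h "pi / 2"] h by auto
  have Dle: "Dr + Dl \<le> C * h\<^sup>2"
   using F(1)[OF h(1,2)] F'(1)[OF h(1,3)] by (simp add: Dr_def Dl_def C_def distrib_right)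
  have N12: "n1 * sqrt h \<le> right.N h" "n2 * sqrt h \<le> left.N h" using n1(2) n2(2) h(1) hpi by auto
  have Nn: "n * sqrt h \<le> N" using N12 by (simp add: N_def n_def distrib_right)
  have N0: "N > 0" "right.N h \<ge> 0" "left.N h \<ge> 0"
  proof -
   have "0 < n * sqrt h" "0 \<le> n1 * sqrt h" "0 \<le> n2 * sqrt h" using n n1 n2 h by auto
   then show "N > 0" "right.N h \<ge> 0" "left.N h \<ge> 0" using Nn N12 by linarith+
  qed
  have sm1: "2 * (Dr + Dl) \<le> h"
  proof -
   have "C * h * h \<le> 1 / 8 * h" using hC h by (intro mult_right_mono) auto
   then have "C * h\<^sup>2 \<le> h / 8" by (simp add: power2_eq_square mult.assoc)
   with Dle have "Dr + Dl \<le> h / 8" by (rule order_trans)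
   then have "2 * (Dr + Dl) \<le> 2 * (h / 8)" by (intro mult_left_mono) auto
   then show ?thesis using h(1) by simp
  qed
  have sm2: "Dr + Dl \<le> h * N"
  proof -
   have "C * h\<^sup>2 = h * (sqrt h * C * sqrt h)" using h by (simp add: power2_eq_square)
   also have "... \<le> h * (n * sqrt h)" using hn h by (intro mult_left_mono mult_right_mono) auto
   also have "... \<le> h * N" using Nn h by (intro mult_left_mono) auto
   finally show ?thesis using Dle by linarith
  qed
  define lo where "lo = ?r - C0 * sqrt h"
  define hi where "hi = ?r + C0 * sqrt h"
  have lh: "lo \<le> hi" using C0 h by (simp add: lo_def hi_def)
  define q where "q = (\<lambda>e s. (V s - (\<kappa> * h + h\<^sup>2 * e)) / h\<^sup>2)"
  have cq: "continuous_on UNIV (q e)" for e unfolding q_def using h by (intro continuous_intros V) auto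
  have cq': "continuous_on UNIV (\<lambda>s. q e (- s))" for e
   by (rule continuous_on_compose2[OF cq]) (auto intro!: continuous_intros)
  have Q: "\<bar>q e s\<bar> \<le> (B + \<bar>\<kappa> * h + h\<^sup>2 * e\<bar>) / h\<^sup>2" for e s
  proof -
   have "\<bar>V s - (\<kappa> * h + h\<^sup>2 * e)\<bar> \<le> B + \<bar>\<kappa> * h + h\<^sup>2 * e\<bar>" using B[of s] by linarith
   then show ?thesis unfolding q_def by (simp add: abs_divide divide_right_mono)
  qed
  have qV: "q e s = ((fr s)\<^sup>2 - \<kappa> * h - h\<^sup>2 * e) / h\<^sup>2" "q e (- s) = ((fl s)\<^sup>2 - \<kappa> * h - h\<^sup>2 * e) / h\<^sup>2" if "s \<in> {0..pi / 2}" for e s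
   using V_right[OF that] V_left[OF that] by (simp_all add: q_def diff_diff_eq)
  have per: "periodic_2pi (q e)" for e using V(2) by (simp add: q_def periodic_2pi_def)
  have sym: "q e (pi - s) = q e s" for e s by (simp add: q_def V(3))
  have hyp: "right.model_potential q h" unfolding right.model_potential_def using cq Q qV(1) by blast
  have hyp': "left.model_potential (\<lambda>e s. q e (- s)) h"
   unfolding left.model_potential_def using cq' Q qV(2) by blast
  obtain dr \<delta>r where "right.response_family q C1 h lo hi dr \<delta>r"
   using F(2)[OF h(1,2) hyp] unfolding lo_def hi_def by blast
  note fr = this[unfolded right.response_family_def Dr_def[symmetric]]
  obtain dl \<delta>l where "left.response_family (\<lambda>e s. q e (- s)) C2 h lo hi dl \<delta>l"
   using F'(2)[OF h(1,3) hyp'] unfolding lo_def hi_def by blast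
  note fl = this[unfolded left.response_family_def Dl_def[symmetric]]
  have dr: "h \<le> dr lo" "dr hi \<le> - h" and dl: "h \<le> dl lo" "dl hi \<le> - h" using fr fl by auto
  note Er = fr[THEN conjunct2, THEN conjunct2] and El = fl[THEN conjunct2, THEN conjunct2]
  have up: "C1 * t * D \<le> C * t * D" "C2 * t * D \<le> C * t * D" if "0 \<le> t" "0 \<le> D" for t D :: real
   using C that by (auto intro!: mult_right_mono)
  obtain e1 e2 where e12: "e1 \<in> {lo..hi}" "e2 \<in> {lo..hi}" "e1 \<le> e2"
   and R1: "dr e1 + dl e1 - (\<delta>r e1 + \<delta>l e1) / 2 = cmod (of_real (\<delta>r e1) + of_real (\<delta>l e1) * z) / 2"
   and R2: "dr e2 + dl e2 - (\<delta>r e2 + \<delta>l e2) / 2 = - (cmod (of_real (\<delta>r e2) + of_real (\<delta>l e2) * z) / 2)"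
   and Nx: "N * (e2 - e1) \<le> 4 * (Dr + Dl)"
   and gap: "\<bar>N * (e2 - e1) - cmod (of_real Dr + of_real Dl * z)\<bar> \<le> 9 * C * h * (Dr + Dl)"
  proof -
   have "\<exists>e1\<in>{lo..hi}. \<exists>e2\<in>{lo..hi}. e1 \<le> e2 \<and>
     dr e1 + dl e1 - (\<delta>r e1 + \<delta>l e1) / 2 = cmod (of_real (\<delta>r e1) + of_real (\<delta>l e1) * z) / 2 \<and>
     dr e2 + dl e2 - (\<delta>r e2 + \<delta>l e2) / 2 = - (cmod (of_real (\<delta>r e2) + of_real (\<delta>l e2) * z) / 2) \<and>
     N * (e2 - e1) \<le> 4 * (Dr + Dl) \<and> \<bar>N * (e2 - e1) - cmod (of_real Dr + of_real Dl * z)\<bar> \<le> 9 * C * h * (Dr + Dl)"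
   proof (rule secular_roots[where d = "\<lambda>e. dr e + dl e" and C = C, OF lh h(1) N0(1) D0 C(1) hC sm1 sm2 z])
    fix e assume e: "e \<in> {lo..hi}"
    show "0 < \<delta>r e \<and> \<bar>\<delta>r e - Dr\<bar> \<le> C * h * Dr" using Er[rule_format, OF e] up(1)[of h Dr] h D0 by linarith
    show "0 < \<delta>l e \<and> \<bar>\<delta>l e - Dl\<bar> \<le> C * h * Dl" using El[rule_format, OF e] up(2)[of h Dl] h D0 by linarith
    fix e' assume e': "e' \<in> {lo..hi}"
    have er: "\<bar>\<delta>r e - \<delta>r e'\<bar> \<le> C1 * \<bar>e - e'\<bar> * Dr" "\<bar>dr e - dr e' + (e - e') * right.N h\<bar> \<le> C1 * h * right.N h * \<bar>e - e'\<bar>"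
     using Er e e' by blast+
    have el: "\<bar>\<delta>l e - \<delta>l e'\<bar> \<le> C2 * \<bar>e - e'\<bar> * Dl" "\<bar>dl e - dl e' + (e - e') * left.N h\<bar> \<le> C2 * h * left.N h * \<bar>e - e'\<bar>"
     using El e e' by blast+
    show "\<bar>\<delta>r e - \<delta>r e'\<bar> \<le> C * \<bar>e - e'\<bar> * Dr" using er(1) up(1)[of "\<bar>e - e'\<bar>" Dr] D0 by linarith
    show "\<bar>\<delta>l e - \<delta>l e'\<bar> \<le> C * \<bar>e - e'\<bar> * Dl" using el(1) up(2)[of "\<bar>e - e'\<bar>" Dl] D0 by linarith
    have "C1 * h * right.N h * \<bar>e - e'\<bar> \<le> C * h * right.N h * \<bar>e - e'\<bar>" "C2 * h * left.N h * \<bar>e - e'\<bar> \<le> C * h * left.N h * \<bar>e - e'\<bar>"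
     using C h N0 by (auto intro!: mult_right_mono)
    then have "\<bar>(dr e + dl e) - (dr e' + dl e') + ((e - e') * right.N h + (e - e') * left.N h)\<bar> \<le> C * h * right.N h * \<bar>e - e'\<bar> + C * h * left.N h * \<bar>e - e'\<bar>"
     using er(2) el(2) by linarith
    then show "\<bar>dr e + dl e - (dr e' + dl e') + (e - e') * N\<bar> \<le> C * h * N * \<bar>e - e'\<bar>"
     by (simp add: N_def distrib_left distrib_right)
   next
    show "2 * h \<le> dr lo + dl lo" "dr hi + dl hi \<le> - (2 * h)" using dr dl by auto
   qed
   then show ?thesis using that by blast
  qed
  have root: "\<exists>x\<in>floquet (q e) z. x \<noteq> (\<lambda>_. 0)"
   if e: "e \<in> {lo..hi}" and R: "\<bar>dr e + dl e - (\<delta>r e + \<delta>l e) / 2\<bar> = cmod (of_real (\<delta>r e) + of_real (\<delta>l e) * z) / 2" for e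
  proof (rule floquet_root[OF Q per sym _ _ z])
   show "half_response (q e) (dr e - gr 0) (\<delta>r e)" using Er e by blast
   show "half_response (\<lambda>s. q e (- s)) (dl e - gl 0) (\<delta>l e)" using El e by blast
   show "\<delta>l e \<noteq> 0" using El e by force
   have "2 * \<bar>dr e + dl e - (\<delta>r e + \<delta>l e) / 2\<bar> = cmod (of_real (\<delta>r e) + of_real (\<delta>l e) * z)" using R by simp
   then have "(2 * \<bar>dr e + dl e - (\<delta>r e + \<delta>l e) / 2\<bar>)\<^sup>2 = (cmod (of_real (\<delta>r e) + of_real (\<delta>l e) * z))\<^sup>2" by (simp only:)
   then show "4 * (dr e - gr 0 + (dl e - gl 0) - (\<delta>r e + \<delta>l e) / 2)\<^sup>2 = (cmod (of_real (\<delta>r e) + of_real (\<delta>l e) * z))\<^sup>2"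
    by (simp add: gl0 power_mult_distrib)
  qed
  have es: "\<bar>e\<bar> \<le> CC" if "e \<in> {lo..hi}" for e
  proof -
   have "sqrt h \<le> 1" using h by simp
   then have "C0 * sqrt h \<le> C0 * 1" using C0 by (intro mult_left_mono) auto
   then have "\<bar>e\<bar> \<le> \<bar>?r\<bar> + C0" using that by (auto simp: lo_def hi_def abs_le_iff)
   then show ?thesis using CC by linarith
  qed
  have list: "eigenvalue_list V \<xi> h {..<2 * \<kappa> * h} [\<kappa> * h + h\<^sup>2 * e1, \<kappa> * h + h\<^sup>2 * e2]"
  proof (rule eigenvalue_list_of_floquet[OF h(1) V(1,2)])
   fix X :: "nat \<Rightarrow> real \<Rightarrow> complex" and l :: "nat \<Rightarrow> real"
   assume X: "\<And>i. i < 3 ==> X i \<in> floquet (\<lambda>s. (V s - l i) / h\<^sup>2) (cis (2 * pi * \<xi> / h))" and l: "\<And>i. i < 3 ==> l i < 2 * \<kappa> * h"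
   show "\<exists>c. (\<exists>i<3::nat. c i \<noteq> 0) \<and> (\<forall>s. (\<Sum>i<3. c i * X i s) = (0::complex))"
    by (rule dep[rule_format, OF h(4), of "cis (2 * pi * \<xi> / h)" X l]) (use X l in auto)
  next
   show "\<kappa> * h + h\<^sup>2 * e1 \<le> \<kappa> * h + h\<^sup>2 * e2" using e12 by (simp add: mult_left_mono)
   have "h * e2 \<le> h * CC" using es[OF e12(2)] h by (intro mult_left_mono) auto
   then have "h * e2 < \<kappa>" using h\<kappa> by linarith
   then have "h * (h * e2) < h * \<kappa>" using h(1) by (rule mult_strict_left_mono)
   then show "\<kappa> * h + h\<^sup>2 * e2 < 2 * \<kappa> * h" by (simp add: power2_eq_square mult_ac)
   show "(\<kappa> * h + h\<^sup>2 * e1 < \<kappa> * h + h\<^sup>2 * e2 \<and>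
     (\<exists>x\<in>floquet (\<lambda>s. (V s - (\<kappa> * h + h\<^sup>2 * e1)) / h\<^sup>2) (cis (2 * pi * \<xi> / h)). x \<noteq> (\<lambda>_. 0)) \<and>
     (\<exists>x\<in>floquet (\<lambda>s. (V s - (\<kappa> * h + h\<^sup>2 * e2)) / h\<^sup>2) (cis (2 * pi * \<xi> / h)). x \<noteq> (\<lambda>_. 0))) \<or>
     (\<kappa> * h + h\<^sup>2 * e1 = \<kappa> * h + h\<^sup>2 * e2 \<and>
     (\<exists>x\<in>floquet (\<lambda>s. (V s - (\<kappa> * h + h\<^sup>2 * e1)) / h\<^sup>2) (cis (2 * pi * \<xi> / h)).
      \<exists>y\<in>floquet (\<lambda>s. (V s - (\<kappa> * h + h\<^sup>2 * e1)) / h\<^sup>2) (cis (2 * pi * \<xi> / h)). \<forall>a b. (\<forall>s. a * x s + b * y s = 0) --> a = 0 \<and> b = 0))"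
   proof (cases "e1 = e2")
    case True
    have g: "cmod (of_real (\<delta>r e1) + of_real (\<delta>l e1) * z) = 0" and R: "dr e1 + dl e1 = (\<delta>r e1 + \<delta>l e1) / 2"
     using R1 R2 True by auto
    have "\<exists>x\<in>floquet (q e1) z. \<exists>y\<in>floquet (q e1) z. \<forall>a b. (\<forall>s. a * x s + b * y s = 0) --> a = 0 \<and> b = 0"
    proof (rule floquet_double_root[OF Q per sym _ _ z])
     show "half_response (q e1) (dr e1 - gr 0) (\<delta>r e1)" using Er e12 by blast
     show "half_response (\<lambda>s. q e1 (- s)) (dl e1 - gl 0) (\<delta>l e1)" using El e12 by blast
     show "\<delta>l e1 > 0" "\<delta>r e1 > 0" using El Er e12 by blast+
     show "dr e1 - gr 0 + (dl e1 - gl 0) = (\<delta>r e1 + \<delta>l e1) / 2" using R by (simp add: gl0)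
     show "of_real (\<delta>r e1) + of_real (\<delta>l e1) * z = 0" using g by simp
    qed
    then show ?thesis using True unfolding q_def z_def by blast
   next
    case False
    then have "h\<^sup>2 * e1 < h\<^sup>2 * e2" using e12 h by (intro mult_strict_left_mono) auto
    moreover have "\<exists>x\<in>floquet (q e1) z. x \<noteq> (\<lambda>_. 0)" by (rule root[OF e12(1)]) (unfold R1, simp)
    moreover have "\<exists>x\<in>floquet (q e2) z. x \<noteq> (\<lambda>_. 0)" by (rule root[OF e12(2)]) (unfold R2, simp)
    ultimately show ?thesis unfolding q_def z_def by auto
   qed
  qed
  define x where "x = e2 - e1"
  have x0: "x \<ge> 0" using e12 by (simp add: x_def)
  have sx: "sqrt h * x \<le> 4 * (Dr + Dl) / n"
  proof -
   have "n * sqrt h * x \<le> N * x" using Nn x0 by (rule mult_right_mono)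
   then have "(sqrt h * x) * n \<le> 4 * (Dr + Dl)" using Nx by (simp add: x_def mult_ac)
   then show ?thesis using n by (simp add: pos_le_divide_eq)
  qed
  have "\<bar>N - sqrt (pi * h / \<kappa>)\<bar> * x \<le> C3 * h * sqrt h * x" using C3(2)[of h] h x0 by (intro mult_right_mono) (auto simp: N_def)
  also have "... = C3 * h * (sqrt h * x)" by simp
  also have "... \<le> C3 * h * (4 * (Dr + Dl) / n)" using sx C3 h by (intro mult_left_mono) auto
  finally have "\<bar>N - sqrt (pi * h / \<kappa>)\<bar> * x \<le> 4 * C3 / n * (h * (Dr + Dl))" by (simp add: mult_ac)
  moreover have "\<bar>N * x - sqrt (pi * h / \<kappa>) * x\<bar> = \<bar>N - sqrt (pi * h / \<kappa>)\<bar> * x"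
   using x0 by (simp add: left_diff_distrib[symmetric] abs_mult)
  ultimately have "\<bar>sqrt (pi * h / \<kappa>) * x - cmod (of_real Dr + of_real Dl * z)\<bar> \<le> 9 * C * h * (Dr + Dl) + 4 * C3 / n * (h * (Dr + Dl))"
   using gap unfolding x_def by linarith
  also have "... = (9 * C + 4 * C3 / n) * (h * (Dr + Dl))" by (simp only: distrib_right mult.assoc)
  also have "... \<le> CC * (h * (Dr + Dl))" using CC h D0 by (intro mult_right_mono) auto
  finally have "\<bar>sqrt (pi * h / \<kappa>) * (e2 - e1) - cmod (of_real Dr + of_real Dl * z)\<bar> \<le> CC * h * (Dr + Dl)" by (simp only: x_def mult.assoc)
  then show ?thesis using list es[OF e12(1)] es[OF e12(2)] unfolding Dr_def Dl_def z_def by blast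
 qed
 then show ?thesis using CC(1) h0 by blast
qed

end

section \<open>The tunnelling constants and the splitting\<close>

lemma integral_sqrt_symmetric:
 fixes U :: "real \<Rightarrow> real"
 assumes U: "continuous_on UNIV U" "\<And>s. U (pi - s) = U s"
 shows "integral {0..pi} (\<lambda>s. sqrt (U s)) = 2 * integral {0..pi / 2} (\<lambda>s. sqrt (U s))"
proof -
 let ?f = "\<lambda>s. sqrt (U s)"
 have c: "continuous_on S ?f" for S by (intro continuous_intros continuous_on_subset[OF U(1)]) auto
 have "integral {pi / 2..pi} ?f = integral {- (pi / 2)..0} (?f \<circ> (\<lambda>x. x + pi))"
  using integral_shift[of "- (pi / 2)" pi 0 ?f] c by simp
 also have "?f \<circ> (\<lambda>x. x + pi) = (\<lambda>x. ?f (- x))"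
 proof
  fix x show "(?f \<circ> (\<lambda>x. x + pi)) x = ?f (- x)" using U(2)[of "- x"] by (simp add: add.commute)
 qed
 also have "integral {- (pi / 2)..0} (\<lambda>x. ?f (- x)) = integral {0..pi / 2} ?f"
  using hk_integral_reflect[of "pi / 2" 0 ?f] by simp
 finally have "integral {pi / 2..pi} ?f = integral {0..pi / 2} ?f" .
 moreover have "integral {0..pi / 2} ?f + integral {pi / 2..pi} ?f = integral {0..pi} ?f"
  by (intro hk_integral_combine integrable_continuous_real c) auto
 ultimately show ?thesis by simp
qed

text \<open>Only the relative phase of the two tunnelling paths around the circle matters.\<close>

lemma modulus_phase_difference:
 fixes X Y \<theta> :: real
 shows "cmod (of_real X * cis \<theta> + of_real Y * cis (- \<theta>)) = cmod (of_real X + of_real Y * cis (2 * \<theta>))"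
proof -
 have "cis \<theta> * cnj (of_real X + of_real Y * cis (2 * \<theta>)) = of_real X * cis \<theta> + of_real Y * (cis \<theta> * cis (- (2 * \<theta>)))"
  by (simp only: complex_cnj_add complex_cnj_mult complex_cnj_complex_of_real cis_cnj distrib_left mult_ac)
 then have "of_real X * cis \<theta> + of_real Y * cis (- \<theta>) = cis \<theta> * cnj (of_real X + of_real Y * cis (2 * \<theta>))"
  by (simp only: cis_mult) simp
 then have "cmod (of_real X * cis \<theta> + of_real Y * cis (- \<theta>)) = cmod (cis \<theta>) * cmod (cnj (of_real X + of_real Y * cis (2 * \<theta>)))"
  by (simp only: norm_mult)
 then show ?thesis by (simp only: norm_cis complex_mod_cnj mult_1_left)
qed

text \<open>On the right \<open>sqrt V = f\<close>, on the left \<open>sqrt V = - f\<close>; in both cases the integrand of the amplitude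
is \<open>- 2 g\<close> away from the well. The value of \<open>p\<close> at the midpoint is thus the amplitude times the exponential of the action.\<close>

lemma double_well_pair:
 assumes V: "double_well V"
 obtains c L fr gr gr' fl gl gl' where "well_pair (kappa V) c L fr gr gr' fl gl gl' V"
  "\<And>h. half_well.p fr gr h (pi / 2) = A_u V * exp (- S_u V / h)" "fr (pi / 2) = sqrt (V (pi / 2))"
  "\<And>h. half_well.p fl gl h (pi / 2) = A_d V * exp (- S_d V / h)" "fl (pi / 2) = sqrt (V (- (pi / 2)))"
proof -
 have sm: "smooth V" and per: "periodic_2pi V" and dd: "deriv (deriv V) 0 \<noteq> 0" and V0: "V 0 = 0"
  and sym: "\<And>s. V (pi - s) = V s" and mins: "{s. \<forall>t. V s \<le> V t} = {of_int k * pi | k. True}"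
  using V by (auto simp: double_well_def)
 have cV: "continuous_on UNIV V" by (rule smooth_continuous[OF sm])
 have "0 \<in> {of_int k * pi | k. True}" by (auto intro!: exI[of _ 0])
 then have Vge: "V t \<ge> 0" for t using V0 unfolding mins[symmetric] by auto
 have Vpos: "V s > 0" if s: "s \<in> {- pi<..<pi}" "s \<noteq> 0" for s
 proof (rule ccontr)
  assume "\<not> V s > 0"
  then have "V s = 0" using Vge[of s] by linarith
  then have "s \<in> {s. \<forall>t. V s \<le> V t}" using Vge by simp
  then obtain k :: int where k: "s = of_int k * pi" unfolding mins by auto
  have "real_of_int k * pi < 1 * pi" "(- 1) * pi < real_of_int k * pi" using s k by auto
  from this[THEN mult_right_less_imp_less] have "real_of_int k < 1" "- 1 < real_of_int k" by simp_all
  then show False using s k by auto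
 qed
 define \<kappa> where "\<kappa> = kappa V"
 have \<kappa>_eq: "sqrt (deriv (deriv V) 0 / 2) = \<kappa>" by (simp add: \<kappa>_def kappa_def)
 have "\<forall>s\<in>{- pi<..<pi} - {0}. V s > 0" using Vpos by blast
 note wkb = wkb_data[OF sm V0 this dd, unfolded \<kappa>_eq]
 obtain f g g' c L where c: "c > 0"
  and W: "\<forall>s\<in>{- pi<..<pi}. V s = (f s)\<^sup>2 \<and> (f has_real_derivative \<kappa> - 2 * f s * g s) (at s) \<and> (g has_real_derivative g' s) (at s)"
  and cg': "continuous_on {- pi<..<pi} g'" and f0: "f 0 = 0"
  and W': "\<forall>s\<in>{- (pi / 2)..pi / 2}. c * s\<^sup>2 \<le> s * f s \<and> \<bar>(g' s + (g s)\<^sup>2) - (g' 0 + (g 0)\<^sup>2)\<bar> \<le> L * \<bar>s\<bar>"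
  and fp': "\<forall>s\<in>{0<..<pi}. f s > 0" and fn': "\<forall>s\<in>{- pi<..<0}. f s < 0"
  using wkb[THEN conjunct2] by (elim exE conjE)
 have pos: "\<kappa> > 0" "c > 0" using wkb c by auto
 have Vf: "\<And>s. s \<in> {- pi<..<pi} ==> V s = (f s)\<^sup>2"
  and df: "\<And>s. s \<in> {- pi<..<pi} ==> (f has_real_derivative \<kappa> - 2 * f s * g s) (at s)"
  and dg: "\<And>s. s \<in> {- pi<..<pi} ==> (g has_real_derivative g' s) (at s)" using W by blast+
 have fc: "\<And>s. s \<in> {- (pi / 2)..pi / 2} ==> c * s\<^sup>2 \<le> s * f s"
  and Lip: "\<And>s. s \<in> {- (pi / 2)..pi / 2} ==> \<bar>(g' s + (g s)\<^sup>2) - (g' 0 + (g 0)\<^sup>2)\<bar> \<le> L * \<bar>s\<bar>" using W' by blast+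
 have fp: "\<And>s. s \<in> {0<..<pi} ==> f s > 0" and fn: "\<And>s. s \<in> {- pi<..<0} ==> f s < 0" using fp' fn' by blast+
 define fl where "fl = (\<lambda>s. - f (- s))"
 define gl where "gl = (\<lambda>s. - g (- s))"
 define gl' where "gl' = (\<lambda>s. g' (- s))"
 have neg: "((\<lambda>x. - x) has_real_derivative - 1) (at s)" for s :: real by (auto intro!: derivative_eq_intros)
 have rng: "s \<in> {- pi<..<pi}" "- s \<in> {- pi<..<pi}" "s \<in> {- (pi / 2)..pi / 2}" "- s \<in> {- (pi / 2)..pi / 2}" "0 \<le> s"
  and rng0: "s \<noteq> 0 ==> s \<in> {0<..<pi}" "s \<noteq> 0 ==> - s \<in> {- pi<..<0}" if "s \<in> {0..pi / 2}" for s :: real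
 proof -
  have "0 \<le> s" "s \<le> pi / 2" using that by auto
  then have "- pi < s" "s < pi" "- (pi / 2) \<le> s" "0 \<le> s" using pi_gt_zero by linarith+
  then show "s \<in> {- pi<..<pi}" "- s \<in> {- pi<..<pi}" "s \<in> {- (pi / 2)..pi / 2}" "- s \<in> {- (pi / 2)..pi / 2}" "0 \<le> s"
    "s \<noteq> 0 ==> s \<in> {0<..<pi}" "s \<noteq> 0 ==> - s \<in> {- pi<..<0}" using that by auto
 qed
 have cneg: "c * s \<le> u" if "c * s\<^sup>2 \<le> s * u" "0 \<le> s" "s = 0 --> u = 0" for s u :: real
 proof (cases "s = 0")
  case False
  then have "s * (c * s) \<le> s * u" using that by (simp add: power2_eq_square mult_ac)
  then show ?thesis using False that by (simp add: mult_le_cancel_left)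
 qed (use that in simp)
 interpret right: half_well "pi / 2" \<kappa> c L f g g'
 proof
  show "0 < pi / 2" "0 < \<kappa>" "0 < c" using pos by auto
  fix s assume "s \<in> {0..pi / 2}"
  then have s: "s \<in> {- pi<..<pi}" "s \<in> {- (pi / 2)..pi / 2}" "0 \<le> s" using rng by blast+
  show "(f has_real_derivative \<kappa> - 2 * f s * g s) (at s within {0..pi / 2})" by (rule has_field_derivative_at_within[OF df[OF s(1)]])
  show "(g has_real_derivative g' s) (at s within {0..pi / 2})" by (rule has_field_derivative_at_within[OF dg[OF s(1)]])
  show "c * s \<le> f s" using cneg[OF fc[OF s(2)] s(3)] f0 by auto
  show "\<bar>g' s + (g s)\<^sup>2 - (g' 0 + (g 0)\<^sup>2)\<bar> \<le> L * s" using Lip[OF s(2)] s(3) by simp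
 next
  show "continuous_on {0..pi / 2} g'" by (rule continuous_on_subset[OF cg']) (use rng in blast)
 qed (rule f0)
 interpret left: half_well "pi / 2" \<kappa> c L fl gl gl'
 proof
  show "0 < pi / 2" "0 < \<kappa>" "0 < c" using pos by auto
  fix s assume "s \<in> {0..pi / 2}"
  then have s: "- s \<in> {- pi<..<pi}" "- s \<in> {- (pi / 2)..pi / 2}" "0 \<le> s" using rng by blast+
  have "((\<lambda>x. f (- x)) has_real_derivative (\<kappa> - 2 * f (- s) * g (- s)) * - 1) (at s)" by (rule DERIV_chain2[OF df[OF s(1)] neg])
  from DERIV_minus[OF this] have "(fl has_real_derivative \<kappa> - 2 * fl s * gl s) (at s)" by (simp add: fl_def gl_def)
  then show "(fl has_real_derivative \<kappa> - 2 * fl s * gl s) (at s within {0..pi / 2})" by (rule has_field_derivative_at_within)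
  have "((\<lambda>x. g (- x)) has_real_derivative g' (- s) * - 1) (at s)" by (rule DERIV_chain2[OF dg[OF s(1)] neg])
  from DERIV_minus[OF this] have "(gl has_real_derivative gl' s) (at s)" by (simp add: gl_def gl'_def)
  then show "(gl has_real_derivative gl' s) (at s within {0..pi / 2})" by (rule has_field_derivative_at_within)
  have "c * s\<^sup>2 \<le> s * fl s" using fc[OF s(2)] by (simp add: fl_def)
  then show "c * s \<le> fl s" using cneg[of s "fl s"] s(3) f0 by (auto simp: fl_def)
  show "\<bar>gl' s + (gl s)\<^sup>2 - (gl' 0 + (gl 0)\<^sup>2)\<bar> \<le> L * s" using Lip[OF s(2)] s(3) by (simp add: gl_def gl'_def)
 next
  show "continuous_on {0..pi / 2} gl'" unfolding gl'_def
  proof (rule continuous_on_compose2[OF cg'])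
   show "uminus ` {0..pi / 2} \<subseteq> {- pi<..<pi}" using rng(2) by (simp only: image_subset_iff) blast
  qed (intro continuous_intros)
 qed (simp add: fl_def f0)
 have wp: "well_pair \<kappa> c L f g g' fl gl gl' V"
 proof
  show "gl 0 = - g 0" "gl' 0 = g' 0" by (simp_all add: gl_def gl'_def)
  show "continuous_on UNIV V" "periodic_2pi V" by (rule cV, rule per)
  show "V (pi - s) = V s" for s by (rule sym)
  fix s assume s: "s \<in> {0..pi / 2}"
  show "V s = (f s)\<^sup>2" by (rule Vf) (use rng[OF s] in blast)
  have "V (- s) = (f (- s))\<^sup>2" by (rule Vf) (use rng[OF s] in blast)
  then show "V (- s) = (fl s)\<^sup>2" by (simp add: fl_def)
 qed
 have sq: "sqrt (V s) = f s" if "s \<in> {0..pi / 2}" for s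
 proof -
  have "0 \<le> f s" using fp[OF rng0(1)[OF that]] f0 by (cases "s = 0") auto
  then show ?thesis using Vf[OF rng(1)[OF that]] by simp
 qed
 have sql: "sqrt (V (- s)) = fl s" if "s \<in> {0..pi / 2}" for s
 proof -
  have "0 \<le> fl s" using fn[OF rng0(2)[OF that]] f0 by (cases "s = 0") (auto simp: fl_def)
  moreover have "V (- s) = (fl s)\<^sup>2" using Vf[OF rng(2)[OF that]] by (simp add: fl_def)
  ultimately show ?thesis by simp
 qed
 have Su: "S_u V = 2 * right.F (pi / 2)"
  unfolding S_u_def integral_sqrt_symmetric[OF cV sym] right.F_def by (simp only: integral_cong[of "{0..pi / 2}", OF sq])
 have Sd: "S_d V = 2 * left.F (pi / 2)"
 proof -
  have sym': "V (- (pi - s)) = V (- s)" for s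
  proof -
   have "V (- (pi - s)) = V (- (pi - s) + 2 * pi)" by (rule per[unfolded periodic_2pi_def, rule_format, symmetric])
   also have "... = V (pi - (- s))" by (simp add: algebra_simps)
   finally show ?thesis by (simp only: sym)
  qed
  have cV': "continuous_on UNIV (\<lambda>s. V (- s))"
   by (rule continuous_on_compose2[OF cV]) (auto intro!: continuous_intros)
  have "S_d V = integral {0..pi} (\<lambda>s. sqrt (V (- s)))"
   unfolding S_d_def using hk_integral_reflect[of pi 0 "\<lambda>s. sqrt (V (- s))"] by simp
  also have "... = 2 * integral {0..pi / 2} (\<lambda>s. sqrt (V (- s)))" by (rule integral_sqrt_symmetric[OF cV' sym'])
  finally show ?thesis unfolding left.F_def by (simp only: integral_cong[of "{0..pi / 2}", OF sql])
 qed
 have Au: "A_u V = exp (2 * right.G (pi / 2))"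
 proof -
  have "integral {0..pi / 2} (\<lambda>\<sigma>. (deriv (\<lambda>t. sqrt (V t)) \<sigma> - kappa V) / sqrt (V \<sigma>)) = integral {0..pi / 2} (\<lambda>\<sigma>. - 2 * g \<sigma>)"
  proof (rule integral_spike[of "{0}"])
   fix \<sigma> assume "\<sigma> \<in> {0..pi / 2} - {0}"
   then have s0: "\<sigma> \<in> {0..pi / 2}" "\<sigma> \<noteq> 0" by auto
   have s: "\<sigma> \<in> {0<..<pi}" "\<sigma> \<in> {0..pi / 2}" "\<sigma> \<in> {- pi<..<pi}" using rng0(1)[OF s0] rng(1)[OF s0(1)] s0 by blast+
   have eq: "\<forall>\<^sub>F t in nhds \<sigma>. sqrt (V t) = f t"
   proof -
    have "\<forall>\<^sub>F t in nhds \<sigma>. t \<in> {0<..<pi}" using s(1) by (intro eventually_nhds_in_open) auto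
    then show ?thesis
    proof eventually_elim
     case (elim t)
     then show ?case using Vf[of t] fp[of t] by simp
    qed
   qed
   have "deriv (\<lambda>t. sqrt (V t)) \<sigma> = deriv f \<sigma>" by (rule deriv_cong_ev[OF eq refl])
   also have "... = \<kappa> - 2 * f \<sigma> * g \<sigma>" by (rule DERIV_imp_deriv[OF df[OF s(3)]])
   finally have d: "deriv (\<lambda>t. sqrt (V t)) \<sigma> = \<kappa> - 2 * f \<sigma> * g \<sigma>" .
   show "- 2 * g \<sigma> = (deriv (\<lambda>t. sqrt (V t)) \<sigma> - kappa V) / sqrt (V \<sigma>)"
    unfolding d sq[OF s(2)] \<kappa>_def[symmetric] using fp[OF s(1)] by simp
  qed auto
  also have "... = - 2 * right.G (pi / 2)" unfolding right.G_def by (rule integral_mult_right)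
  finally show ?thesis by (simp add: A_u_def)
 qed
 have Ad: "A_d V = exp (2 * left.G (pi / 2))"
 proof -
  have "integral {- (pi / 2)..0} (\<lambda>\<sigma>. (deriv (\<lambda>t. sqrt (V t)) \<sigma> + kappa V) / sqrt (V \<sigma>)) = integral {- (pi / 2)..0} (\<lambda>\<sigma>. - 2 * g \<sigma>)"
  proof (rule integral_spike[of "{0}"])
   fix \<sigma> assume "\<sigma> \<in> {- (pi / 2)..0} - {0}"
   then have s0: "- \<sigma> \<in> {0..pi / 2}" "- \<sigma> \<noteq> 0" by auto
   have s: "\<sigma> \<in> {- pi<..<0}" "- \<sigma> \<in> {0..pi / 2}" "\<sigma> \<in> {- pi<..<pi}" using rng0(2)[OF s0] rng(2)[OF s0(1)] s0(1) by simp_all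
   have eq: "\<forall>\<^sub>F t in nhds \<sigma>. sqrt (V t) = - f t"
   proof -
    have "\<forall>\<^sub>F t in nhds \<sigma>. t \<in> {- pi<..<0}" using s(1) by (intro eventually_nhds_in_open) auto
    then show ?thesis
    proof eventually_elim
     case (elim t)
     then show ?case using Vf[of t] fn[of t] by simp
    qed
   qed
   have "deriv (\<lambda>t. sqrt (V t)) \<sigma> = deriv (\<lambda>t. - f t) \<sigma>" by (rule deriv_cong_ev[OF eq refl])
   also have "... = - (\<kappa> - 2 * f \<sigma> * g \<sigma>)" by (rule DERIV_imp_deriv[OF DERIV_minus[OF df[OF s(3)]]])
   finally have d: "deriv (\<lambda>t. sqrt (V t)) \<sigma> = - (\<kappa> - 2 * f \<sigma> * g \<sigma>)" .
   have "sqrt (V \<sigma>) = - f \<sigma>" using sql[OF s(2)] by (simp add: fl_def)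
   then show "- 2 * g \<sigma> = (deriv (\<lambda>t. sqrt (V t)) \<sigma> + kappa V) / sqrt (V \<sigma>)"
    unfolding d \<kappa>_def[symmetric] using fn[OF s(1)] by simp
  qed auto
  also have "... = integral {0..pi / 2} (\<lambda>\<sigma>. 2 * gl \<sigma>)"
   using hk_integral_reflect[of "pi / 2" 0 "\<lambda>\<sigma>. 2 * gl \<sigma>"] by (simp add: gl_def)
  also have "... = 2 * left.G (pi / 2)" unfolding left.G_def by (rule integral_mult_right)
  finally show ?thesis by (simp add: A_d_def)
 qed
 have pu: "right.p h (pi / 2) = A_u V * exp (- S_u V / h)" for h
  unfolding right.p_def Au Su by (simp add: exp_add[symmetric])
 have pd: "left.p h (pi / 2) = A_d V * exp (- S_d V / h)" for h
  unfolding left.p_def Ad Sd by (simp add: exp_add[symmetric])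
 have "f (pi / 2) = sqrt (V (pi / 2))" "fl (pi / 2) = sqrt (V (- (pi / 2)))" using sq[of "pi / 2"] sql[of "pi / 2"] by auto
 with wp pu pd show ?thesis unfolding \<kappa>_def by (intro that[of c L f g g' fl gl gl'])
qed

lemma w_0_modulus:
 assumes h: "h > 0" and \<kappa>: "kappa V > 0"
 shows "2 * cmod (w_0 V \<xi> h) = h\<^sup>2 / sqrt (pi * h / kappa V) *
  cmod (of_real (4 * sqrt (V (pi / 2)) * (A_u V * exp (- S_u V / h)) / h) +
   of_real (4 * sqrt (V (- (pi / 2))) * (A_d V * exp (- S_d V / h)) / h) * cis (2 * pi * \<xi> / h))"
proof -
 define X where "X = A_u V * sqrt (V (pi / 2)) * exp (- S_u V / h)"
 define Y where "Y = A_d V * sqrt (V (- (pi / 2))) * exp (- S_d V / h)"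
 define \<theta> where "\<theta> = \<xi> * pi / h"
 have e1: "exp ((\<i> * of_real (\<xi> * pi) - of_real (S_u V)) / of_real h) = of_real (exp (- S_u V / h)) * cis \<theta>"
 proof -
  have "(\<i> * of_real (\<xi> * pi) - of_real (S_u V)) / of_real h = of_real (- S_u V / h) + \<i> * of_real \<theta>"
   by (simp add: \<theta>_def diff_divide_distrib)
  then show ?thesis by (simp only: exp_add cis_conv_exp exp_of_real)
 qed
 have e2: "exp ((- \<i> * of_real (\<xi> * pi) - of_real (S_d V)) / of_real h) = of_real (exp (- S_d V / h)) * cis (- \<theta>)"
 proof -
  have "(- \<i> * of_real (\<xi> * pi) - of_real (S_d V)) / of_real h = of_real (- S_d V / h) + \<i> * of_real (- \<theta>)"
   by (simp add: \<theta>_def diff_divide_distrib)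
  then show ?thesis by (simp only: exp_add cis_conv_exp exp_of_real)
 qed
 have "w_0 V \<xi> h = of_real (2 * h powr (1 / 2) * sqrt (kappa V / pi)) * (of_real X * cis \<theta> + of_real Y * cis (- \<theta>))"
  unfolding w_0_def e1 e2 X_def Y_def by (simp add: mult_ac)
 then have w: "cmod (w_0 V \<xi> h) = 2 * h powr (1 / 2) * sqrt (kappa V / pi) * cmod (of_real X + of_real Y * cis (2 * \<theta>))"
  using h \<kappa> by (simp add: norm_mult modulus_phase_difference[symmetric] del: of_real_mult)
 have XY: "complex_of_real (4 * sqrt (V (pi / 2)) * (A_u V * exp (- S_u V / h)) / h) = of_real (4 / h) * of_real X"
  "complex_of_real (4 * sqrt (V (- (pi / 2))) * (A_d V * exp (- S_d V / h)) / h) = of_real (4 / h) * of_real Y"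
  unfolding X_def Y_def of_real_mult[symmetric] by (simp_all add: mult_ac)
 have "of_real (4 * sqrt (V (pi / 2)) * (A_u V * exp (- S_u V / h)) / h) +
   of_real (4 * sqrt (V (- (pi / 2))) * (A_d V * exp (- S_d V / h)) / h) * cis (2 * pi * \<xi> / h)
   = of_real (4 / h) * (of_real X + of_real Y * cis (2 * \<theta>))"
  unfolding XY by (simp add: \<theta>_def distrib_left mult_ac)
 then have r: "cmod (of_real (4 * sqrt (V (pi / 2)) * (A_u V * exp (- S_u V / h)) / h) +
   of_real (4 * sqrt (V (- (pi / 2))) * (A_d V * exp (- S_d V / h)) / h) * cis (2 * pi * \<xi> / h))
   = 4 / h * cmod (of_real X + of_real Y * cis (2 * \<theta>))"
  using h by (simp only: norm_mult norm_of_real) simp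
 have "h\<^sup>2 / sqrt (pi * h / kappa V) * (4 / h) = 4 * (h powr (1 / 2) * sqrt (kappa V / pi))"
 proof -
  have "h\<^sup>2 / sqrt (pi * h / kappa V) * (4 / h) = 4 * ((h / sqrt h) * (sqrt (kappa V) / sqrt pi))"
   using h \<kappa> by (simp add: real_sqrt_divide real_sqrt_mult power2_eq_square field_simps)
  also have "h / sqrt h = h powr (1 / 2)" using h by (simp add: real_div_sqrt powr_half_sqrt)
  also have "sqrt (kappa V) / sqrt pi = sqrt (kappa V / pi)" by (simp add: real_sqrt_divide)
  finally show ?thesis .
 qed
 then have "h\<^sup>2 / sqrt (pi * h / kappa V) * (4 / h * Z) = 4 * (h powr (1 / 2) * sqrt (kappa V / pi)) * Z" for Z
  by (simp only: mult.assoc[symmetric])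
 then show ?thesis unfolding w r by simp
qed

theorem theorem1p2:
 fixes V :: "real \<Rightarrow> real" and \<xi>\<^sub>0 :: real
 assumes "double_well V"
 shows "\<exists>lam\<^sub>1 lam\<^sub>2 :: real \<Rightarrow> real.
  (\<exists>h\<^sub>0 > 0. \<forall>h. 0 < h \<and> h < h\<^sub>0 \<longrightarrow>
    eigenvalue_list V \<xi>\<^sub>0 h {..<2 * kappa V * h} [lam\<^sub>1 h, lam\<^sub>2 h]) \<and>
  (\<lambda>h. lam\<^sub>1 h - kappa V * h) \<in> o[at_right 0](\<lambda>h. h) \<and>
  (\<lambda>h. lam\<^sub>2 h - kappa V * h) \<in> o[at_right 0](\<lambda>h. h) \<and>
  (\<lambda>h. lam\<^sub>2 h - lam\<^sub>1 h - 2 * cmod (w_0 V \<xi>\<^sub>0 h))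
   \<in> O[at_right 0](\<lambda>h. h powr (3 / 2) * exp (- S_min V / h))"
proof -
 obtain c L fr gr gr' fl gl gl' where wp: "well_pair (kappa V) c L fr gr gr' fl gl gl' V"
  and pr: "\<And>h. half_well.p fr gr h (pi / 2) = A_u V * exp (- S_u V / h)" and fr: "fr (pi / 2) = sqrt (V (pi / 2))"
  and pl: "\<And>h. half_well.p fl gl h (pi / 2) = A_d V * exp (- S_d V / h)" and fl: "fl (pi / 2) = sqrt (V (- (pi / 2)))"
  using double_well_pair[OF assms] by metis
 interpret well_pair "kappa V" c L fr gr gr' fl gl gl' V by (rule wp)
 have \<kappa>: "kappa V > 0" by (rule right.pos(2))
 define Dr where "Dr h = 4 * sqrt (V (pi / 2)) * (A_u V * exp (- S_u V / h)) / h" for h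
 define Dl where "Dl h = 4 * sqrt (V (- (pi / 2))) * (A_d V * exp (- S_d V / h)) / h" for h
 have D: "right.Dinf h = Dr h" "left.Dinf h = Dl h" for h
  unfolding right.Dinf_def left.Dinf_def pr pl fr fl Dr_def Dl_def by (rule refl)+
 define good where "good C h e1 e2 \<longleftrightarrow>
  eigenvalue_list V \<xi>\<^sub>0 h {..<2 * kappa V * h} [kappa V * h + h\<^sup>2 * e1, kappa V * h + h\<^sup>2 * e2] \<and> \<bar>e1\<bar> \<le> C \<and> \<bar>e2\<bar> \<le> C \<and>
  \<bar>sqrt (pi * h / kappa V) * (e2 - e1) - cmod (of_real (Dr h) + of_real (Dl h) * cis (2 * pi * \<xi>\<^sub>0 / h))\<bar> \<le> C * h * (Dr h + Dl h)" for C h e1 e2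
 obtain C h0 where C: "C \<ge> 0" and h0: "h0 > 0" and main: "\<forall>h. 0 < h \<and> h < h0 --> (\<exists>e1 e2. good C h e1 e2)"
  using eigenvalue_splitting[of \<xi>\<^sub>0] unfolding D good_def by (elim exE conjE)
 then have "\<forall>h. \<exists>e1. 0 < h \<and> h < h0 --> (\<exists>e2. good C h e1 e2)" by blast
 then obtain e1 where "\<forall>h. 0 < h \<and> h < h0 --> (\<exists>e2. good C h (e1 h) e2)" by metis
 then obtain e2 where E0: "\<And>h. 0 < h ==> h < h0 ==> good C h (e1 h) (e2 h)" by metis
 note E = E0[unfolded good_def]
 have ev: "\<forall>\<^sub>F h in at_right 0. 0 < h \<and> h < h0" using h0 by (auto simp: eventually_at_right_field intro!: exI[of _ h0])
 have little: "(\<lambda>h. kappa V * h + h\<^sup>2 * u h - kappa V * h) \<in> o[at_right 0](\<lambda>h. h)"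
  if u: "\<And>h. 0 < h ==> h < h0 ==> \<bar>u h\<bar> \<le> C" for u :: "real \<Rightarrow> real"
 proof -
  have "(\<lambda>h. kappa V * h + h\<^sup>2 * u h - kappa V * h) \<in> O[at_right 0](\<lambda>h. h\<^sup>2)"
  proof (rule bigoI[where c = C])
   show "\<forall>\<^sub>F h in at_right 0. norm (kappa V * h + h\<^sup>2 * u h - kappa V * h) \<le> C * norm (h\<^sup>2)"
    using ev
   proof eventually_elim
    case (elim h)
    then have "h\<^sup>2 * \<bar>u h\<bar> \<le> h\<^sup>2 * C" using u by (intro mult_left_mono) auto
    then show ?case by (simp add: abs_mult mult.commute)
   qed
  qed
  also have "(\<lambda>h::real. h\<^sup>2) \<in> o[at_right 0](\<lambda>h. h)"
  proof (rule smalloI_tendsto)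
   have "((\<lambda>h::real. h) \<longlongrightarrow> 0) (at_right 0)" by (rule tendsto_ident_at)
   then show "((\<lambda>h::real. h\<^sup>2 / h) \<longlongrightarrow> 0) (at_right 0)" by (simp add: power2_eq_square)
   show "\<forall>\<^sub>F h::real in at_right 0. h \<noteq> 0" using ev by eventually_elim auto
  qed
  finally show ?thesis .
 qed
 have bound: "\<bar>(kappa V * h + h\<^sup>2 * e2 h) - (kappa V * h + h\<^sup>2 * e1 h) - 2 * cmod (w_0 V \<xi>\<^sub>0 h)\<bar>
   \<le> C * sqrt (kappa V / pi) * 4 * (sqrt (V (pi / 2)) * A_u V + sqrt (V (- (pi / 2))) * A_d V) * (h powr (3 / 2) * exp (- S_min V / h))"
  if h: "0 < h" "h < h0" for h
 proof -
  define m where "m = sqrt (pi * h / kappa V)"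
  have m: "m > 0" using \<kappa> h by (simp add: m_def)
  define Z where "Z = cmod (of_real (Dr h) + of_real (Dl h) * cis (2 * pi * \<xi>\<^sub>0 / h))"
  have w: "2 * cmod (w_0 V \<xi>\<^sub>0 h) = h\<^sup>2 / m * Z" unfolding m_def Z_def Dr_def Dl_def by (rule w_0_modulus[OF h(1) \<kappa>])
  have "(kappa V * h + h\<^sup>2 * e2 h) - (kappa V * h + h\<^sup>2 * e1 h) - 2 * cmod (w_0 V \<xi>\<^sub>0 h) = h\<^sup>2 / m * (m * (e2 h - e1 h) - Z)"
   unfolding w using m by (simp add: field_simps)
  then have "\<bar>(kappa V * h + h\<^sup>2 * e2 h) - (kappa V * h + h\<^sup>2 * e1 h) - 2 * cmod (w_0 V \<xi>\<^sub>0 h)\<bar> = h\<^sup>2 / m * \<bar>m * (e2 h - e1 h) - Z\<bar>"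
   using m by (simp add: abs_mult)
  also have "... \<le> h\<^sup>2 / m * (C * h * (Dr h + Dl h))"
   using E[OF h] m by (intro mult_left_mono) (auto simp: m_def Z_def)
  also have "C * h * (Dr h + Dl h) = C * 4 * (sqrt (V (pi / 2)) * A_u V * exp (- S_u V / h) + sqrt (V (- (pi / 2))) * A_d V * exp (- S_d V / h))"
   using h by (simp add: Dr_def Dl_def field_simps)
  also have "h\<^sup>2 / m * (C * 4 * (sqrt (V (pi / 2)) * A_u V * exp (- S_u V / h) + sqrt (V (- (pi / 2))) * A_d V * exp (- S_d V / h)))
   \<le> h\<^sup>2 / m * (C * 4 * (sqrt (V (pi / 2)) * A_u V * exp (- S_min V / h) + sqrt (V (- (pi / 2))) * A_d V * exp (- S_min V / h)))"
  proof -
   have "exp (- S_u V / h) \<le> exp (- S_min V / h)" "exp (- S_d V / h) \<le> exp (- S_min V / h)"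
    using h by (auto simp: S_min_def divide_right_mono)
   moreover have "0 \<le> sqrt (V (pi / 2)) * A_u V" "0 \<le> sqrt (V (- (pi / 2))) * A_d V"
    using right.fb_pos left.fb_pos by (auto simp: A_u_def A_d_def fr fl)
   ultimately show ?thesis using C m by (intro mult_left_mono add_mono) auto
  qed
  also have "... = (h\<^sup>2 / m) * (C * 4 * (sqrt (V (pi / 2)) * A_u V + sqrt (V (- (pi / 2))) * A_d V) * exp (- S_min V / h))"
   by (simp add: algebra_simps)
  also have "h\<^sup>2 / m = h powr (3 / 2) * sqrt (kappa V / pi)"
  proof -
   have "h powr (3 / 2) = h powr (2 - 1 / 2)" by simp
   also have "... = h powr 2 / h powr (1 / 2)" by (rule powr_diff)
   also have "... = h\<^sup>2 / sqrt h" using h by (simp add: powr_half_sqrt)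
   finally show ?thesis using h \<kappa> by (simp add: m_def real_sqrt_divide real_sqrt_mult)
  qed
  finally show ?thesis by (simp only: mult_ac)
 qed
 show ?thesis
 proof (intro exI conjI)
  show "h0 > 0" by (rule h0)
  show "\<forall>h. 0 < h \<and> h < h0 --> eigenvalue_list V \<xi>\<^sub>0 h {..<2 * kappa V * h} [kappa V * h + h\<^sup>2 * e1 h, kappa V * h + h\<^sup>2 * e2 h]"
   using E by blast
  show "(\<lambda>h. kappa V * h + h\<^sup>2 * e1 h - kappa V * h) \<in> o[at_right 0](\<lambda>h. h)" by (rule little) (use E in blast)
  show "(\<lambda>h. kappa V * h + h\<^sup>2 * e2 h - kappa V * h) \<in> o[at_right 0](\<lambda>h. h)" by (rule little) (use E in blast)
  show "(\<lambda>h. kappa V * h + h\<^sup>2 * e2 h - (kappa V * h + h\<^sup>2 * e1 h) - 2 * cmod (w_0 V \<xi>\<^sub>0 h))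
   \<in> O[at_right 0](\<lambda>h. h powr (3 / 2) * exp (- S_min V / h))"
  proof (rule bigoI)
   show "\<forall>\<^sub>F h in at_right 0. norm (kappa V * h + h\<^sup>2 * e2 h - (kappa V * h + h\<^sup>2 * e1 h) - 2 * cmod (w_0 V \<xi>\<^sub>0 h))
    \<le> C * sqrt (kappa V / pi) * 4 * (sqrt (V (pi / 2)) * A_u V + sqrt (V (- (pi / 2))) * A_d V) * norm (h powr (3 / 2) * exp (- S_min V / h))"
    using ev
   proof eventually_elim
    case (elim h)
    then show ?case using bound[of h] by simp
   qed
  qed
 qed
qed

end
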